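(* Let $H$ be a graph with chromatic number $\chi(H)=p+1\ge 3$, and suppose that for some $t\ge 1$ the $(t+1)$-star $S_{t+1}$ belongs to $\mathcal{M}(H)$. Let $\vec H$ be an orientation of $H$ such that $\mathcal{M}(\vec H)$ contains both pure orientations of $S_{t+1}$. Then for all sufficiently large $n$, $$2^{\mathrm{ex}(n,H)}\le D(n,\vec H)\le 2^{\,t(n,p)+p\,\mathrm{ex}(n,\mathcal{M}'(\vec H))}.$$
   Context: All graphs are finite and simple; directed graphs have no loops, multiple edges or pairs of opposite edges. For a directed graph $\vec H$, $H$ denotes its underlying undirected graph, and $\chi(\vec H)=\chi(H)$. A directed graph is $\vec H$-free if it contains no subgraph isomorphic to $\vec H$. For a graph $G$, $D(G,\vec H)$ is the number of orientations of the edges of $G$ that are $\vec H$-free, and $D(n,\vec H)=\max\{D(G,\vec H): |V(G)|=n\}$. For a family $\mathcal{L}$ of graphs, $\mathrm{ex}(n,\mathcal{L})$ is the maximum number of edges of an $n$-vertex graph containing no member of $\mathcal{L}$ as a subgraph. $T(n,p)$ is the Turán graph (complete balanced $p$-partite graph on $n$ vertices) and $t(n,p)=|E(T(n,p))|$. For graphs $G,F$, $G\otimes F$ is the disjoint union of $G$ and $F$ together with all edges between $V(G)$ and $V(F)$; $K_{p-1}(t)$ is the complete $(p-1)$-partite graph with $t$ vertices per part. Decomposition family: for a graph $H$ with $\chi(H)=p+1$, $\mathcal{M}(H)$ is the family of (subgraph-)minimal graphs $M$ such that for some $t$, the graph $M'\otimes K_{p-1}(t)$ contains $H$ as a subgraph,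 where $M'$ is $M$ with $t$ isolated vertices added. For a directed graph $\vec H$ with $\chi(H)=p+1$, $\mathcal{M}(\vec H)$ is the family of directed graphs $\vec M$ whose underlying graph $M$ lies in $\mathcal{M}(H)$ and such that for some $t\ge1$, with $M'$ equal to $M$ plus $t$ isolated vertices and $G_M=M'\otimes K_{p-1}(t)$, there is an orientation $\vec G_M$ of $G_M$ and a set $W$ with $V(M)\subseteq W\subseteq V(G_M)$ such that $\vec G_M[W]$ contains $\vec H$ as a subgraph and $\vec G_M[V(M)]\cong \vec M$. $\mathcal{M}'(\vec H)=\{M\in\mathcal{M}(H):\ \text{every orientation of } M \text{ lies in } \mathcal{M}(\vec H)\}$ (a family of undirected graphs). The $(t+1)$-star $S_{t+1}$ has a center vertex adjacent to $t$ leaves and no other edges. An orientation of $S_{t+1}$ is pure if all edges are directed towards the center or all edges are directed away from the center; there are exactly two pure orientations. *)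

theory Defs
  imports Main
begin

type_synonym 'a graph = "'a set \<times> 'a set set"
type_synonym 'a dgraph = "'a set \<times> ('a \<times> 'a) set"

definition wf_graph :: "'a graph \<Rightarrow> bool" where
  "wf_graph G \<longleftrightarrow> finite (fst G) \<and>
     (\<forall>e\<in>snd G. \<exists>u v. e = {u, v} \<and> u \<noteq> v \<and> u \<in> fst G \<and> v \<in> fst G)"

definition wf_dgraph :: "'a dgraph \<Rightarrow> bool" where
  "wf_dgraph D \<longleftrightarrow> finite (fst D) \<and> snd D \<subseteq> fst D \<times> fst D \<and>
     (\<forall>(u, v)\<in>snd D. u \<noteq> v \<and> (v, u) \<notin> snd D)"

definition und :: "'a dgraph \<Rightarrow> 'a graph" where
  "und D = (fst D, {{u, v} | u v. (u, v) \<in> snd D})"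

definition is_orientation :: "'a graph \<Rightarrow> 'a dgraph \<Rightarrow> bool" where
  "is_orientation G D \<longleftrightarrow> wf_dgraph D \<and> und D = G"

definition contains :: "'a graph \<Rightarrow> 'b graph \<Rightarrow> bool" where
  "contains G H \<longleftrightarrow> (\<exists>f. inj_on f (fst H) \<and> f ` fst H \<subseteq> fst G \<and>
     (\<forall>e\<in>snd H. f ` e \<in> snd G))"

definition dcontains :: "'a dgraph \<Rightarrow> 'b dgraph \<Rightarrow> bool" where
  "dcontains G H \<longleftrightarrow> (\<exists>f. inj_on f (fst H) \<and> f ` fst H \<subseteq> fst G \<and>
     (\<forall>(u, v)\<in>snd H. (f u, f v) \<in> snd G))"

definition diso :: "'a dgraph \<Rightarrow> 'b dgraph \<Rightarrow> bool" where
  "diso D1 D2 \<longleftrightarrow> (\<exists>f. bij_betw f (fst D1) (fst D2) \<and>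
     (\<forall>u\<in>fst D1. \<forall>v\<in>fst D1. (u, v) \<in> snd D1 \<longleftrightarrow> (f u, f v) \<in> snd D2))"

definition dinduced :: "'a dgraph \<Rightarrow> 'a set \<Rightarrow> 'a dgraph" where
  "dinduced D W = (W, snd D \<inter> (W \<times> W))"

definition chi :: "'a graph \<Rightarrow> nat" where
  "chi G = (LEAST k. \<exists>c :: 'a \<Rightarrow> nat. (\<forall>v\<in>fst G. c v < k) \<and>
     (\<forall>e\<in>snd G. \<forall>u\<in>e. \<forall>v\<in>e. u \<noteq> v \<longrightarrow> c u \<noteq> c v))"

definition D_graph :: "'a graph \<Rightarrow> 'b dgraph \<Rightarrow> nat" where
  "D_graph G Hd = card {D. is_orientation G D \<and> \<not> dcontains D Hd}"

definition D_num :: "nat \<Rightarrow> 'b dgraph \<Rightarrow> nat" where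
  "D_num n Hd = Max {D_graph G Hd | G :: nat graph. wf_graph G \<and> fst G = {..<n}}"

definition ex_num :: "nat \<Rightarrow> 'b graph set \<Rightarrow> nat" where
  "ex_num n L = Max {card (snd G) | G :: nat graph. wf_graph G \<and> fst G = {..<n} \<and>
      (\<forall>M\<in>L. \<not> contains G M)}"

definition turan_graph :: "nat \<Rightarrow> nat \<Rightarrow> nat graph" where
  "turan_graph n p = ({..<n}, {{u, v} | u v. u < n \<and> v < n \<and> u mod p \<noteq> v mod p})"

definition turan_num :: "nat \<Rightarrow> nat \<Rightarrow> nat" where
  "turan_num n p = card (snd (turan_graph n p))"

definition join :: "'a graph \<Rightarrow> 'b graph \<Rightarrow> ('a + 'b) graph" where
  "join G F = (Inl ` fst G \<union> Inr ` fst F,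
     (image Inl) ` snd G \<union> (image Inr) ` snd F \<union>
     {{Inl u, Inr v} | u v. u \<in> fst G \<and> v \<in> fst F})"

definition pad :: "'a graph \<Rightarrow> nat \<Rightarrow> ('a + nat) graph" where
  "pad M t = (Inl ` fst M \<union> Inr ` {..<t}, (image Inl) ` snd M)"

definition complete_multipartite :: "nat \<Rightarrow> nat \<Rightarrow> (nat \<times> nat) graph" where
  "complete_multipartite k t = ({..<k} \<times> {..<t},
     {{x, y} | x y. x \<in> {..<k} \<times> {..<t} \<and> y \<in> {..<k} \<times> {..<t} \<and> fst x \<noteq> fst y})"

definition GM :: "'a graph \<Rightarrow> nat \<Rightarrow> nat \<Rightarrow> (('a + nat) + (nat \<times> nat)) graph" where
  "GM M p t = join (pad M t) (complete_multipartite (p - 1) t)"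

definition dec_prop :: "'a graph \<Rightarrow> nat \<Rightarrow> 'a graph \<Rightarrow> bool" where
  "dec_prop H p M \<longleftrightarrow> (\<exists>t. contains (GM M p t) H)"

text \<open>Decomposition family M(H), with chi(H) = p+1; members are the subgraph-minimal
  graphs with the property (represented over the vertex type of H).\<close>
definition dec_family :: "'a graph \<Rightarrow> 'a graph set" where
  "dec_family H = {M. wf_graph M \<and> dec_prop H (chi H - 1) M \<and>
     (\<forall>M0. wf_graph M0 \<and> fst M0 \<subseteq> fst M \<and> snd M0 \<subseteq> snd M \<and> M0 \<noteq> M
        \<longrightarrow> \<not> dec_prop H (chi H - 1) M0)}"

definition dir_dec_family :: "'a dgraph \<Rightarrow> 'a dgraph set" where
  "dir_dec_family Hd = {D. wf_dgraph D \<and> und D \<in> dec_family (und Hd) \<and>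
     (\<exists>t\<ge>1. \<exists>B. is_orientation (GM (und D) (chi (und Hd) - 1) t) B \<and>
        (\<exists>W. (\<lambda>v. Inl (Inl v)) ` fst D \<subseteq> W \<and> W \<subseteq> fst B \<and>
             dcontains (dinduced B W) Hd \<and>
             diso (dinduced B ((\<lambda>v. Inl (Inl v)) ` fst D)) D))}"

definition dec_family_prime :: "'a dgraph \<Rightarrow> 'a graph set" where
  "dec_family_prime Hd = {M \<in> dec_family (und Hd).
     \<forall>D. is_orientation M D \<longrightarrow> D \<in> dir_dec_family Hd}"

text \<open>M is a (t+1)-star: center c adjacent to t leaves, no other edges.\<close>
definition is_star :: "'a graph \<Rightarrow> nat \<Rightarrow> bool" where
  "is_star M t \<longleftrightarrow> finite (fst M) \<and> card (fst M) = t + 1 \<and>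
     (\<exists>c\<in>fst M. snd M = {{c, v} | v. v \<in> fst M \<and> v \<noteq> c})"

definition is_in_star :: "'a dgraph \<Rightarrow> nat \<Rightarrow> bool" where
  "is_in_star D t \<longleftrightarrow> finite (fst D) \<and> card (fst D) = t + 1 \<and>
     (\<exists>c\<in>fst D. snd D = {(v, c) | v. v \<in> fst D \<and> v \<noteq> c})"

definition is_out_star :: "'a dgraph \<Rightarrow> nat \<Rightarrow> bool" where
  "is_out_star D t \<longleftrightarrow> finite (fst D) \<and> card (fst D) = t + 1 \<and>
     (\<exists>c\<in>fst D. snd D = {(c, v) | v. v \<in> fst D \<and> v \<noteq> c})"

end

theory Submission
  imports Defs "HOL-Real_Asymp.Real_Asymp" "HOL-Library.FuncSet"
begin

text \<open>
  A graph with more than \<open>2 ^ t(n, p)\<close> \<open>H\<close>-free orientations is analysed by Simonovits' progressive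
  induction: either some set of boundedly many vertices can be deleted so that the excess of the logarithm
  of the count over the Turan number grows, or the graph has a \<open>p\<close>-partition whose classes contain no
  member of \<open>\<M>'(H)\<close>, and then it has too few edges.

  Regularity is avoided. By induction on \<open>p\<close> and Sauer--Shelah shattering, all but a negligible part of
  the orientations contain a universal orientation of a complete \<open>p\<close>-partite graph of bounded size. With
  such a host fixed, a vertex attached to all classes, or a star inside one class, has too few admissible
  attachments, because both pure stars extend to \<open>H\<close>; hence the graph is almost \<open>p\<close>-partite. Since the
  orientation between linear-size parts is almost always rich, a vertex with large degree to every class
  and a copy of a member of \<open>\<M>'(H)\<close> inside a class are each constrained so much that they can be deleted
  with a gain linear in \<open>n\<close>.
\<close>

section \<open>Orientations as edge sets\<close>

text \<open>The quantity followed is the ratio of the number of free orientations to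
  \<open>2 ^ t(n, p)\<close>. If deleting a set \<open>Z\<close> of at most \<open>K\<close>
  vertices never doubles it, the edges at \<open>Z\<close> must carry many orientations: the count
  for \<open>G\<close> exceeds that for \<open>G - Z\<close> by a factor of about
  \<open>2 ^ ((1 - 1/p) n |Z|)\<close>. Defects fall short of this. A vertex of large degree to
  every class loses two classes, a deficit of about \<open>n / p\<close> in the exponent;
  \<open>z\<close> vertices spanning a member of the family lose about \<open>n / (p 2 ^ z)\<close>,
  since one of the \<open>2 ^ z\<close> attachment patterns is rare in some class. The obstacle is
  that such attachments are forbidden only if the other edges supply the rest of \<open>F\<close>.
  The notion \<open>ready\<close> separates the two: orientations in which the edges at
  \<open>Z\<close> leave room for \<open>F\<close> are rare by a factor
  \<open>2 ^ (- c n ^ 2)\<close>, and the rest have poor attachments at \<open>Z\<close>. No error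
  term survives because a good graph has at most \<open>t(n, p) + p ex(n, M')\<close> edges and
  trivially at most \<open>2 ^ |E|\<close> orientations. Both pure stars enter because directions
  cannot be chosen: only that \<open>t\<close> of \<open>2 t\<close> edges at a vertex point the
  same way is certain.\<close>

text \<open>The set \<open>X \<subseteq> E\<close> encodes the orientation in which exactly the edges of \<open>X\<close> point from the smaller to
  the larger endpoint.\<close>

definition arc :: "nat set set \<Rightarrow> nat set set \<Rightarrow> nat \<Rightarrow> nat \<Rightarrow> bool" where
  "arc E X u v \<longleftrightarrow> {u, v} \<in> E \<and> ({u, v} \<in> X \<longleftrightarrow> u < v)"

definition emb :: "nat set \<Rightarrow> nat set set \<Rightarrow> nat set set \<Rightarrow> 'b dgraph \<Rightarrow> bool" where
  "emb V E X F \<longleftrightarrow> (\<exists>f. inj_on f (fst F) \<and> f ` fst F \<subseteq> V \<and> (\<forall>(u, v)\<in>snd F. arc E X (f u) (f v)))"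

lemma embI:
  assumes "inj_on f (fst F)" "\<And>u. u \<in> fst F \<Longrightarrow> f u \<in> V" "\<And>u v. (u, v) \<in> snd F \<Longrightarrow> arc E X (f u) (f v)"
  shows "emb V E X F"
  using assms unfolding emb_def by (intro exI[of _ f]) auto

lemma embE:
  assumes "emb V E X F"
  obtains f where "inj_on f (fst F)" "\<And>u. u \<in> fst F \<Longrightarrow> f u \<in> V" "\<And>u v. (u, v) \<in> snd F \<Longrightarrow> arc E X (f u) (f v)"
proof -
  obtain f where f: "inj_on f (fst F) \<and> f ` fst F \<subseteq> V \<and> (\<forall>(u, v)\<in>snd F. arc E X (f u) (f v))"
    using assms unfolding emb_def by (rule exE)
  show ?thesis by (rule that[of f]) (use f in auto)
qed

definition Free :: "nat set \<Rightarrow> nat set set \<Rightarrow> 'b dgraph \<Rightarrow> nat set set set" where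
  "Free V E F = {X. X \<subseteq> E \<and> \<not> emb V E X F}"

definition inside :: "nat set set \<Rightarrow> nat set \<Rightarrow> nat set set" where
  "inside E W = {e \<in> E. e \<subseteq> W}"

definition between :: "nat set set \<Rightarrow> nat set \<Rightarrow> nat set \<Rightarrow> nat set set" where
  "between E Z Y = {e \<in> E. \<exists>z\<in>Z. \<exists>y\<in>Y. e = {z, y}}"

lemma arc_edge: "arc E X u v \<Longrightarrow> {u, v} \<in> E"
  by (simp add: arc_def)

lemma arc_asym: "u \<noteq> v \<Longrightarrow> {u, v} \<in> E \<Longrightarrow> arc E X u v \<longleftrightarrow> \<not> arc E X v u"
  by (auto simp: arc_def insert_commute)

lemma arc_mono: "arc E' (X \<inter> E') u v \<Longrightarrow> E' \<subseteq> E \<Longrightarrow> arc E X u v"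
  by (auto simp: arc_def)

lemma wf_graph_edge:
  assumes "wf_graph (V, E)" "e \<in> E"
  obtains u v where "e = {u, v}" "u \<noteq> v" "u \<in> V" "v \<in> V"
  using assms by (auto simp: wf_graph_def)

lemma wf_graph_pair:
  assumes "wf_graph (V, E)" "{u, v} \<in> E"
  shows "u \<noteq> v" "u \<in> V" "v \<in> V"
proof -
  obtain a b where "{u, v} = {a, b}" "a \<noteq> b" "a \<in> V" "b \<in> V"
    using wf_graph_edge[OF assms] by metis
  then show "u \<noteq> v" "u \<in> V" "v \<in> V" by (auto simp: doubleton_eq_iff)
qed

lemma wf_graph_finite:
  assumes "wf_graph (V, E)"
  shows "finite V" "finite E"
proof -
  show 1: "finite V" using assms by (simp add: wf_graph_def)
  have "E \<subseteq> Pow V" using assms by (auto simp: wf_graph_def)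
  then show "finite E" using 1 finite_subset by blast
qed

lemma wf_graph_inside: "wf_graph (V, E) \<Longrightarrow> W \<subseteq> V \<Longrightarrow> wf_graph (W, inside E W)"
  using finite_subset[of W V] by (fastforce simp: wf_graph_def inside_def)

lemma wf_dgraphD:
  assumes "wf_dgraph F"
  shows "finite (fst F)" "snd F \<subseteq> fst F \<times> fst F" "\<And>u v. (u, v) \<in> snd F \<Longrightarrow> u \<noteq> v \<and> (v, u) \<notin> snd F"
    "\<And>u v. (u, v) \<in> snd F \<Longrightarrow> u \<in> fst F \<and> v \<in> fst F" "finite (snd F)"
  using assms finite_subset[of "snd F" "fst F \<times> fst F"] unfolding wf_dgraph_def by fastforce+

lemma card_edges_le:
  assumes "wf_graph (V, E)"
  shows "card E \<le> card V * card V"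
proof -
  have "E \<subseteq> (\<lambda>(u, v). {u, v}) ` (V \<times> V)" using assms by (fastforce simp: wf_graph_def)
  moreover have f: "finite (V \<times> V)" using wf_graph_finite[OF assms] by auto
  ultimately have "card E \<le> card (V \<times> V)" by (meson card_image_le card_mono finite_imageI le_trans)
  then show ?thesis by (simp add: card_cartesian_product)
qed

lemma between_finite: "finite E \<Longrightarrow> finite (between E Z Y)"
  by (simp add: between_def)

lemma inside_subset: "inside E W \<subseteq> E"
  by (auto simp: inside_def)

lemma card_between_le:
  assumes "finite Z" "finite Y"
  shows "card (between E Z Y) \<le> card Z * card Y"
proof -
  have "between E Z Y \<subseteq> (\<lambda>(u, v). {u, v}) ` (Z \<times> Y)" by (auto simp: between_def)
  moreover have f: "finite (Z \<times> Y)" using assms by auto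
  ultimately have "card (between E Z Y) \<le> card (Z \<times> Y)" by (meson card_image_le card_mono finite_imageI le_trans)
  then show ?thesis by (simp add: card_cartesian_product)
qed

lemma between_disjoint:
  assumes "Z \<inter> B = {}" "A \<inter> B = {}"
  shows "between E Z A \<inter> between E Z B = {}"
  using assms by (auto simp: between_def doubleton_eq_iff)

lemma finite_Free: "finite E \<Longrightarrow> finite (Free V E F)"
  by (rule finite_subset[of _ "Pow E"]) (auto simp: Free_def)

lemma card_Free_le: "finite E \<Longrightarrow> card (Free V E F) \<le> 2 ^ card E"
  using card_mono[of "Pow E" "Free V E F"] by (auto simp: Free_def card_Pow)

lemma Free_inside:
  assumes "X \<in> Free V E F" "W \<subseteq> V"
  shows "X \<inter> inside E W \<in> Free W (inside E W) F"
proof -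
  have "emb V E X F" if "emb W (inside E W) (X \<inter> inside E W) F"
    using that
  proof (rule embE)
    fix f
    assume f: "inj_on f (fst F)" "\<And>u. u \<in> fst F \<Longrightarrow> f u \<in> W"
      "\<And>u v. (u, v) \<in> snd F \<Longrightarrow> arc (inside E W) (X \<inter> inside E W) (f u) (f v)"
    show ?thesis
      by (rule embI[of f]) (use f assms(2) arc_mono[OF _ inside_subset] in blast)+
  qed
  then show ?thesis using assms by (auto simp: Free_def)
qed

text \<open>An orientation and its code determine each other: the code collects the edges whose arc
  goes upward in the order of the naturals. From here on all counting is done on plain families of
  edge sets.\<close>

lemma D_graph_eq_card_Free:
  assumes "wf_graph (V, E)"
  shows "D_graph (V, E) F = card (Free V E F)"
proof -
  let ?o = "\<lambda>X. (V, {(u, v). arc E X u v})"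
  have inj: "inj_on ?o (Free V E F)"
  proof (rule inj_onI)
    fix X Y assume X: "X \<in> Free V E F" and Y: "Y \<in> Free V E F" and eq: "?o X = ?o Y"
    have *: "arc E X u v \<longleftrightarrow> arc E Y u v" for u v using eq by auto
    have "e \<in> X \<longleftrightarrow> e \<in> Y" if "e \<in> E" for e
      using wf_graph_edge[OF assms that] * that by (metis arc_def)
    then show "X = Y" using X Y by (auto simp: Free_def)
  qed
  have wf: "is_orientation (V, E) (?o X)" for X
  proof -
    have "{u, v} \<in> E \<Longrightarrow> u \<noteq> v \<and> u \<in> V \<and> v \<in> V" for u v using wf_graph_pair[OF assms] by blast
    then have "arc E X u v \<Longrightarrow> u \<noteq> v \<and> u \<in> V \<and> v \<in> V \<and> \<not> arc E X v u" for u v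
      using arc_asym[of u v E X] arc_edge[of E X u v] by blast
    then have 1: "wf_dgraph (?o X)" using wf_graph_finite[OF assms]
      unfolding wf_dgraph_def by auto
    have "e \<in> {{u, v} |u v. arc E X u v}" if e: "e \<in> E" for e
    proof -
      obtain a b where "e = {a, b}" "a \<noteq> b" using wf_graph_edge[OF assms e] by metis
      then show ?thesis using arc_asym[of a b E X] e by (auto simp: insert_commute)
    qed
    then show ?thesis using 1 by (auto simp: is_orientation_def und_def dest: arc_edge)
  qed
  have dc: "dcontains (?o X) F \<longleftrightarrow> emb V E X F" for X
    by (auto simp: dcontains_def emb_def)
  have "?o ` Free V E F = {D. is_orientation (V, E) D \<and> \<not> dcontains D F}"
  proof (intro equalityI subsetI)
    fix D assume "D \<in> ?o ` Free V E F"
    then show "D \<in> {D. is_orientation (V, E) D \<and> \<not> dcontains D F}"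
      using wf dc by (auto simp: Free_def)
  next
    fix D assume "D \<in> {D. is_orientation (V, E) D \<and> \<not> dcontains D F}"
    then have o: "is_orientation (V, E) D" and nd: "\<not> dcontains D F" by auto
    define X where "X = {e \<in> E. \<exists>u v. e = {u, v} \<and> u < v \<and> (u, v) \<in> snd D}"
    have fD: "fst D = V" and sD: "{{u, v} |u v. (u, v) \<in> snd D} = E" and w: "wf_dgraph D"
      using o by (auto simp: is_orientation_def und_def)
    have "arc E X u v \<longleftrightarrow> (u, v) \<in> snd D" for u v
    proof (cases "{u, v} \<in> E")
      case True
      then have ne: "u \<noteq> v" using wf_graph_pair[OF assms] by blast
      have c: "(u, v) \<in> snd D \<or> (v, u) \<in> snd D"
        using True sD by (smt (verit, best) doubleton_eq_iff mem_Collect_eq)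
      then have d: "(u, v) \<in> snd D \<longleftrightarrow> (v, u) \<notin> snd D" using wf_dgraphD(3)[OF w] by blast
      have "{u, v} \<in> X \<longleftrightarrow> (u < v \<and> (u, v) \<in> snd D) \<or> (v < u \<and> (v, u) \<in> snd D)"
        using True by (auto simp: X_def doubleton_eq_iff)
      then show ?thesis using True d ne by (auto simp: arc_def)
    next
      case False
      then show ?thesis using sD by (auto simp: arc_def)
    qed
    then have "{(u, v). arc E X u v} = snd D" by auto
    then have "D = ?o X" using fD by (metis prod.collapse)
    moreover have "\<not> emb V E X F" using calculation nd dc by metis
    then have "X \<in> Free V E F" by (auto simp: Free_def X_def)
    ultimately show "D \<in> ?o ` Free V E F" by blast
  qed
  then show ?thesis using card_image[OF inj] by (simp add: D_graph_def)
qed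

section \<open>Product bounds for families of edge sets\<close>

text \<open>Fibre counting over the trace on \<open>E1\<close>. It is applied whenever the
  orientation of some edges is fixed and the completions are bounded uniformly; \<open>A\<close> is
  typically the set of free orientations of an induced subgraph.\<close>

lemma card_subsets_split:
  assumes "finite E1" "finite E2" "E1 \<inter> E2 = {}"
    and "\<And>X. X \<in> S \<Longrightarrow> X \<subseteq> E1 \<union> E2"
    and "\<And>X. X \<in> S \<Longrightarrow> X \<inter> E1 \<in> A" and "finite A"
    and "\<And>Y. Y \<in> A \<Longrightarrow> card {Z. Z \<subseteq> E2 \<and> Y \<union> Z \<in> S} \<le> k"
  shows "card S \<le> card A * k"
proof -
  let ?T = "SIGMA Y : A. {Z. Z \<subseteq> E2 \<and> Y \<union> Z \<in> S}"
  have fin: "finite ?T" using assms(2,6) by auto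
  have "inj_on (\<lambda>X. (X \<inter> E1, X \<inter> E2)) S"
    by (rule inj_onI) (use assms(4) in blast)
  moreover have "(\<lambda>X. (X \<inter> E1, X \<inter> E2)) ` S \<subseteq> ?T"
  proof
    fix z assume "z \<in> (\<lambda>X. (X \<inter> E1, X \<inter> E2)) ` S"
    then obtain X where X: "X \<in> S" "z = (X \<inter> E1, X \<inter> E2)" by auto
    have "X \<inter> E1 \<union> X \<inter> E2 = X" using assms(4)[OF X(1)] by blast
    then show "z \<in> ?T" using X assms(5) by auto
  qed
  ultimately have "card S \<le> card ?T" using card_inj_on_le fin by blast
  also have "\<dots> = (\<Sum>Y\<in>A. card {Z. Z \<subseteq> E2 \<and> Y \<union> Z \<in> S})"
    using assms(2,6) by (subst card_SigmaI) auto
  also have "\<dots> \<le> card A * k" using sum_bounded_above[of A _ k] assms(7) by auto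
  finally show ?thesis .
qed

text \<open>A member of \<open>S\<close> is determined by its traces on \<open>E0\<close> and on the
  blocks \<open>B i\<close>, so its number is bounded by the product of the numbers of possible
  traces. Only injectivity of this map matters; the blocks may overlap.\<close>

lemma card_subsets_prod:
  assumes "finite I" "finite E0" "\<And>i. i \<in> I \<Longrightarrow> finite (T i)"
    and "\<And>X. X \<in> S \<Longrightarrow> X \<subseteq> E0 \<union> \<Union> (B ` I)"
    and "\<And>X i. X \<in> S \<Longrightarrow> i \<in> I \<Longrightarrow> X \<inter> B i \<in> T i"
  shows "card S \<le> 2 ^ card E0 * (\<Prod>i\<in>I. card (T i))"
proof -
  let ?f = "\<lambda>X. (X \<inter> E0, \<lambda>i\<in>I. X \<inter> B i)"
  let ?T = "Pow E0 \<times> PiE I T"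
  have fin: "finite ?T" using assms by (auto intro: finite_PiE)
  have "inj_on ?f S"
  proof (rule inj_onI)
    fix X Y assume X: "X \<in> S" and Y: "Y \<in> S" and eq: "?f X = ?f Y"
    have "X \<inter> B i = Y \<inter> B i" if "i \<in> I" for i
      using eq that by (metis (no_types, lifting) prod.inject restrict_apply')
    then have "e \<in> X \<longleftrightarrow> e \<in> Y" if "e \<in> E0 \<union> \<Union> (B ` I)" for e
      using that eq by (auto simp: set_eq_iff)
    then show "X = Y" using assms(4)[OF X] assms(4)[OF Y] by (meson subsetD subsetI subset_antisym)
  qed
  moreover have "?f ` S \<subseteq> ?T" using assms(5) by (auto simp: PiE_def)
  ultimately have "card S \<le> card ?T" using card_inj_on_le fin by blast
  also have "\<dots> = 2 ^ card E0 * (\<Prod>i\<in>I. card (T i))"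
    using assms by (simp add: card_cartesian_product card_Pow card_PiE)
  finally show ?thesis .
qed

section \<open>Transversal copies in nearly complete multipartite graphs\<close>

text \<open>For a uniformly random choice function the pair \<open>(f u, f v)\<close> is uniform on
  \<open>W u \<times> W v\<close> and falls into \<open>B\<close> with probability
  \<open>card B / m ^ 2\<close>. The inequality is multiplied out to stay in the naturals.\<close>

lemma card_PiE_pair_le:
  assumes I: "finite I" "u \<in> I" "v \<in> I" "u \<noteq> v" and W: "\<And>i. i \<in> I \<Longrightarrow> finite (W i) \<and> card (W i) = m"
    and B: "B \<subseteq> W u \<times> W v"
  shows "card {f \<in> PiE I W. (f u, f v) \<in> B} * m ^ 2 \<le> card B * m ^ card I"
proof -
  let ?S = "{f \<in> PiE I W. (f u, f v) \<in> B}" and ?J = "I - {u, v}"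
  let ?h = "\<lambda>f. ((f u, f v), restrict f ?J)"
  have "finite (W u \<times> W v)" using W I by auto
  then have fB: "finite B" using B by (rule rev_finite_subset)
  have "inj_on ?h ?S"
  proof (rule inj_onI)
    fix f g assume f: "f \<in> ?S" and g: "g \<in> ?S" and e: "?h f = ?h g"
    have "f i = g i" if i: "i \<in> I" for i
    proof (cases "i = u \<or> i = v")
      case False
      then have "restrict f ?J i = f i" "restrict g ?J i = g i" using i by auto
      then show ?thesis using e by (metis prod.inject)
    qed (use e in auto)
    then show "f = g" using f g by (auto intro: PiE_ext)
  qed
  moreover have "?h ` ?S \<subseteq> B \<times> PiE ?J W"
  proof
    fix z assume "z \<in> ?h ` ?S"
    then obtain f where f: "f \<in> PiE I W" "(f u, f v) \<in> B" "z = ?h f" by auto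
    have "restrict f ?J \<in> PiE ?J W" using f(1) by auto
    then show "z \<in> B \<times> PiE ?J W" using f by blast
  qed
  moreover have "finite (B \<times> PiE ?J W)" using fB I W by (auto intro: finite_PiE)
  ultimately have "card ?S \<le> card (B \<times> PiE ?J W)" using card_inj_on_le by blast
  also have "\<dots> = card B * (\<Prod>i\<in>?J. card (W i))"
    using I by (simp add: card_cartesian_product card_PiE)
  also have "(\<Prod>i\<in>?J. card (W i)) = m ^ card ?J" using W by simp
  finally have "card ?S * m^2 \<le> card B * (m ^ card ?J * m^2)" by (simp add: mult.assoc[symmetric])
  also have "m ^ card ?J * m^2 = m ^ (card ?J + 2)" by (simp only: power_add)
  also have "card ?J + 2 = card I"
  proof -
    have "card {u, v} = 2" "{u, v} \<subseteq> I" using I by auto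
    then show ?thesis using I card_Diff_subset[of "{u, v}" I] card_mono[of I "{u, v}"] by auto
  qed
  finally show ?thesis .
qed

definition missing :: "nat set set \<Rightarrow> nat set \<Rightarrow> nat set \<Rightarrow> (nat \<times> nat) set" where
  "missing E A B = {(x, y). x \<in> A \<and> y \<in> B \<and> {x, y} \<notin> E}"

lemma finite_missing: "finite A \<Longrightarrow> finite B \<Longrightarrow> finite (missing E A B)"
  by (rule finite_subset[of _ "A \<times> B"]) (auto simp: missing_def)

text \<open>Union bound over a random choice function. Each pair collides with probability at most
  \<open>1 / m\<close>, so by the bound on \<open>m\<close> some collision occurs with probability
  below 1/4; some arc lands on a missing pair with probability at most 1/2. What remains is an
  injective choice in which every arc lies on an edge.\<close>

lemma transversal_copy_exists:
  assumes F: "wf_dgraph F" and W: "\<And>u. u \<in> fst F \<Longrightarrow> finite (W u) \<and> card (W u) = m"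
    and m: "4 * (card (fst F))\<^sup>2 < m"
    and r: "card (snd F) \<le> r"
    and miss: "\<And>u v. (u, v) \<in> snd F \<Longrightarrow> 2 * r * card (missing E (W u) (W v)) \<le> m\<^sup>2"
  shows "\<exists>f. inj_on f (fst F) \<and> (\<forall>u\<in>fst F. f u \<in> W u) \<and> (\<forall>(u, v)\<in>snd F. {f u, f v} \<in> E)"
proof -
  note FD = wf_dgraphD[OF F]
  let ?I = "fst F" and ?R = "snd F"
  let ?P = "PiE ?I W"
  have cP: "card ?P = m ^ card ?I" using FD W by (simp add: card_PiE)
  have fP: "finite ?P" using FD W by (auto intro: finite_PiE)
  define D where "D = {(u, v) \<in> ?I \<times> ?I. u \<noteq> v}"
  define B1 where "B1 = (\<lambda>(u, v). {f \<in> ?P. (f u, f v) \<in> (\<lambda>x. (x, x)) ` (W u \<inter> W v)})"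
  define B2 where "B2 = (\<lambda>(u, v). {f \<in> ?P. (f u, f v) \<in> missing E (W u) (W v)})"
  have fD: "finite D" by (rule finite_subset[of _ "?I \<times> ?I"]) (use FD in \<open>auto simp: D_def\<close>)
  have cD: "card D \<le> (card ?I)\<^sup>2"
    using card_mono[of "?I \<times> ?I" D] FD by (auto simp: D_def card_cartesian_product power2_eq_square)
  have b1: "card (B1 e) * m\<^sup>2 \<le> m * m ^ card ?I" if eD: "e \<in> D" for e
  proof -
    obtain u v where e: "e = (u, v)" "u \<in> ?I" "v \<in> ?I" "u \<noteq> v" using eD by (auto simp: D_def)
    have "card ((\<lambda>x. (x, x)) ` (W u \<inter> W v)) \<le> m"
      using card_image_le[of "W u \<inter> W v" "\<lambda>x. (x, x)"] card_mono[of "W u" "W u \<inter> W v"] W e by (metis Int_lower1 finite_Int le_trans)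
    moreover have "card (B1 e) * m\<^sup>2 \<le> card ((\<lambda>x. (x, x)) ` (W u \<inter> W v)) * m ^ card ?I"
      unfolding B1_def e by simp (rule card_PiE_pair_le; use FD e W in auto)
    ultimately show ?thesis by (meson le_trans mult_le_mono1)
  qed
  have b2: "2 * r * (card (B2 e) * m\<^sup>2) \<le> m\<^sup>2 * m ^ card ?I" if eR: "e \<in> ?R" for e
  proof -
    obtain u v where e: "e = (u, v)" "(u, v) \<in> ?R" using eR by (cases e) auto
    have "card (B2 e) * m\<^sup>2 \<le> card (missing E (W u) (W v)) * m ^ card ?I"
      unfolding B2_def e by simp (rule card_PiE_pair_le; use FD e W in \<open>auto simp: missing_def\<close>)
    then have "2 * r * (card (B2 e) * m\<^sup>2) \<le> (2 * r * card (missing E (W u) (W v))) * m ^ card ?I"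
      by (simp add: mult.assoc)
    also have "\<dots> \<le> m\<^sup>2 * m ^ card ?I" using miss[OF e(2)] by (rule mult_le_mono1)
    finally show ?thesis .
  qed
  have m0: "m > 0" using m by auto
  define N where "N = m ^ card ?I"
  have N0: "N > 0" using m0 by (simp add: N_def)
  have s1: "4 * card (\<Union> (B1 ` D)) < N"  if "D \<noteq> {}"
  proof -
    have "card (\<Union> (B1 ` D)) * m\<^sup>2 \<le> (\<Sum>e\<in>D. card (B1 e)) * m\<^sup>2"
      using card_UN_le[OF fD] by (rule mult_le_mono1)
    also have "\<dots> = (\<Sum>e\<in>D. card (B1 e) * m\<^sup>2)" by (simp add: sum_distrib_right)
    also have "\<dots> \<le> card D * (m * N)" using sum_bounded_above[of D "\<lambda>e. card (B1 e) * m\<^sup>2" "m * N"] b1 by (auto simp: N_def)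
    also have "\<dots> \<le> (card ?I)\<^sup>2 * (m * N)" using cD by (rule mult_le_mono1)
    finally have "(4 * card (\<Union> (B1 ` D))) * m\<^sup>2 \<le> (4 * (card ?I)\<^sup>2) * (m * N)" by simp
    also have "\<dots> < m * (m * N)" using m m0 N0 by (intro mult_strict_right_mono) auto
    finally have "(4 * card (\<Union> (B1 ` D))) * m\<^sup>2 < N * m\<^sup>2" by (simp add: power2_eq_square ac_simps)
    then show ?thesis using mult_less_cancel2 by blast
  qed
  have s2: "2 * card (\<Union> (B2 ` ?R)) \<le> N"
  proof (cases "r = 0")
    case True
    then show ?thesis using r FD by auto
  next
    case False
    have "2 * r * (card (\<Union> (B2 ` ?R)) * m\<^sup>2) \<le> 2 * r * ((\<Sum>e\<in>?R. card (B2 e)) * m\<^sup>2)"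
      using card_UN_le[OF FD(5)] by (intro mult_le_mono mult_le_mono1) auto
    also have "\<dots> = (\<Sum>e\<in>?R. 2 * r * (card (B2 e) * m\<^sup>2))" by (simp add: sum_distrib_right sum_distrib_left)
    also have "\<dots> \<le> card ?R * (m\<^sup>2 * N)" using sum_bounded_above[of ?R "\<lambda>e. 2 * r * (card (B2 e) * m\<^sup>2)" "m\<^sup>2 * N"] b2 by (auto simp: N_def)
    also have "\<dots> \<le> r * (m\<^sup>2 * N)" using r by (rule mult_le_mono1)
    finally have "(2 * card (\<Union> (B2 ` ?R))) * (r * m\<^sup>2) \<le> N * (r * m\<^sup>2)" by (simp add: ac_simps)
    then show ?thesis using False m0 by (metis mult_le_cancel2 mult_eq_0_iff not_gr_zero power2_eq_square)
  qed
  have "\<Union> (B1 ` D) \<union> \<Union> (B2 ` ?R) \<noteq> ?P"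
  proof
    assume a: "\<Union> (B1 ` D) \<union> \<Union> (B2 ` ?R) = ?P"
    have "N \<le> card (\<Union> (B1 ` D)) + card (\<Union> (B2 ` ?R))"
      using card_Un_le[of "\<Union> (B1 ` D)" "\<Union> (B2 ` ?R)"] a cP by (simp add: N_def)
    then show False using s1 s2 N0 by (cases "D = {}") auto
  qed
  moreover have "\<Union> (B1 ` D) \<union> \<Union> (B2 ` ?R) \<subseteq> ?P" by (auto simp: B1_def B2_def)
  ultimately obtain f where f: "f \<in> ?P" "f \<notin> \<Union> (B1 ` D)" "f \<notin> \<Union> (B2 ` ?R)" by blast
  have fW: "f u \<in> W u" if "u \<in> ?I" for u using f(1) that by auto
  have "inj_on f ?I"
  proof (rule inj_onI, rule ccontr)
    fix u v assume uv: "u \<in> ?I" "v \<in> ?I" "f u = f v" "u \<noteq> v"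
    then have "f u \<in> W u \<inter> W v" using fW by (metis IntI)
    then have "(f u, f v) \<in> (\<lambda>x. (x, x)) ` (W u \<inter> W v)" using uv(3) by force
    then have "f \<in> B1 (u, v)" using f(1) by (simp add: B1_def)
    then show False using f(2) uv by (auto simp: D_def)
  qed
  moreover have "{f u, f v} \<in> E" if "(u, v) \<in> ?R" for u v
  proof (rule ccontr)
    assume "{f u, f v} \<notin> E"
    then have "f \<in> B2 (u, v)" using f(1) fW FD(4)[OF that] by (auto simp: B2_def missing_def)
    then show False using f(3) that by blast
  qed
  ultimately show ?thesis using fW by blast
qed

section \<open>Orientations without a transversal copy\<close>

definition no_transversal :: "nat set set \<Rightarrow> 'b dgraph \<Rightarrow> ('b \<Rightarrow> nat set) \<Rightarrow> nat set set set" where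
  "no_transversal E F W = {X. X \<subseteq> E \<and> \<not> (\<exists>f. inj_on f (fst F) \<and> (\<forall>u\<in>fst F. f u \<in> W u) \<and>
     (\<forall>(u, v)\<in>snd F. arc E X (f u) (f v)))}"

text \<open>Edge-disjoint copies of the underlying graph are removed one at a time, \<open>L\<close>
  of them. On each copy one orientation is excluded, which saves a factor
  \<open>1 - 2 ^ (- r)\<close>. The term \<open>2 * r * L\<close> in the hypothesis is the budget of
  missing pairs that the removed copies will create.\<close>

lemma no_transversal_count_aux:
  assumes F: "wf_dgraph F" and "finite E" and W: "\<And>u. u \<in> fst F \<Longrightarrow> finite (W u) \<and> card (W u) = m"
    and m: "4 * (card (fst F))\<^sup>2 < m"
    and r: "card (snd F) \<le> r"
    and miss: "\<And>u v. (u, v) \<in> snd F \<Longrightarrow> 2 * r * (card (missing E (W u) (W v)) + 2 * r * L) \<le> m\<^sup>2"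
  shows "card (no_transversal E F W) * 2 ^ (r * L) \<le> 2 ^ card E * (2 ^ r - 1) ^ L"
  using assms(2) miss
proof (induction L arbitrary: E)
  case 0
  have "no_transversal E F W \<subseteq> Pow E" by (auto simp: no_transversal_def)
  then have "card (no_transversal E F W) \<le> 2 ^ card E"
    using 0 card_mono[of "Pow E"] by (simp add: card_Pow)
  then show ?case by simp
next
  case (Suc L)
  note FD = wf_dgraphD[OF F]
  have "\<exists>f. inj_on f (fst F) \<and> (\<forall>u\<in>fst F. f u \<in> W u) \<and> (\<forall>(u, v)\<in>snd F. {f u, f v} \<in> E)"
  proof (rule transversal_copy_exists[OF F W m r])
    fix u v assume "(u, v) \<in> snd F"
    from Suc.prems(2)[OF this] show "2 * r * card (missing E (W u) (W v)) \<le> m\<^sup>2"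
      by (simp add: distrib_left)
  qed
  then obtain f where f: "inj_on f (fst F)" "\<And>u. u \<in> fst F \<Longrightarrow> f u \<in> W u"
    "\<And>u v. (u, v) \<in> snd F \<Longrightarrow> {f u, f v} \<in> E" by fast
  define P where "P = (\<lambda>(u, v). {f u, f v}) ` snd F"
  have PE: "P \<subseteq> E" using f by (auto simp: P_def)
  have fP: "finite P" using FD by (simp add: P_def)
  have cP: "card P \<le> r" unfolding P_def using card_image_le[OF FD(5)] r le_trans by blast
  \<comment> \<open>The single trace on \<open>P\<close> that turns \<open>f\<close> into a copy of
    \<open>F\<close>. Every member of the family differs from it, which leaves
    \<open>2 ^ card P - 1\<close> traces.\<close>
  define S where "S = {e \<in> P. \<exists>u v. (u, v) \<in> snd F \<and> e = {f u, f v} \<and> f u < f v}"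
  define E' where "E' = E - P"
  have fE': "finite E'" using Suc.prems by (simp add: E'_def)
  have good: "arc E X (f u) (f v)" if "X \<inter> P = S" "(u, v) \<in> snd F" for X u v
  proof -
    have uv: "f u \<noteq> f v" using FD(3,4)[OF that(2)] f(1) by (auto dest: inj_onD)
    have "{f u, f v} \<in> S \<longleftrightarrow> f u < f v"
    proof
      assume "{f u, f v} \<in> S"
      then obtain a b where ab: "(a, b) \<in> snd F" "{f u, f v} = {f a, f b}" "f a < f b"
        by (auto simp: S_def)
      have "a \<in> fst F \<and> b \<in> fst F \<and> u \<in> fst F \<and> v \<in> fst F" using FD(4) ab that by blast
      then have "(f a = f u \<longrightarrow> a = u) \<and> (f a = f v \<longrightarrow> a = v) \<and> (f b = f v \<longrightarrow> b = v) \<and> (f b = f u \<longrightarrow> b = u)"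
        using f(1) by (auto dest: inj_onD)
      then show "f u < f v" using ab FD(3)[OF that(2)] by (auto simp: doubleton_eq_iff)
    next
      assume "f u < f v"
      then show "{f u, f v} \<in> S" using that by (auto simp: S_def P_def)
    qed
    moreover have "{f u, f v} \<in> P" using that by (auto simp: P_def)
    ultimately show ?thesis using that(1) f(3)[OF that(2)] unfolding arc_def by blast
  qed
  have tr: "X \<inter> E' \<in> no_transversal E' F W" if "X \<in> no_transversal E F W" for X
  proof -
    have "\<not> (inj_on g (fst F) \<and> (\<forall>u\<in>fst F. g u \<in> W u) \<and> (\<forall>(u, v)\<in>snd F. arc E' (X \<inter> E') (g u) (g v)))" for g
      using that arc_mono[of E' X _ _ E] unfolding no_transversal_def E'_def by blast
    then show ?thesis by (auto simp: no_transversal_def)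
  qed
  have SP: "S \<subseteq> P" by (auto simp: S_def)
  have "card (no_transversal E F W) \<le> card (Pow P - {S}) * card (no_transversal E' F W)"
  proof (rule card_subsets_split[of P E'])
    fix X assume X: "X \<in> no_transversal E F W"
    then show "X \<subseteq> P \<union> E'" by (auto simp: no_transversal_def E'_def)
    show "X \<inter> P \<in> Pow P - {S}" using good[of X] f X by (auto simp: no_transversal_def)
  next
    fix Y assume Y: "Y \<in> Pow P - {S}"
    have "Z \<in> no_transversal E' F W" if "Z \<subseteq> E'" "Y \<union> Z \<in> no_transversal E F W" for Z
    proof -
      have "(Y \<union> Z) \<inter> E' = Z" using Y that by (auto simp: E'_def)
      then show ?thesis using tr[OF that(2)] by simp
    qed
    moreover have "finite (no_transversal E' F W)"
      by (rule finite_subset[of _ "Pow E'"]) (use fE' in \<open>auto simp: no_transversal_def\<close>)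
    ultimately show "card {Z. Z \<subseteq> E' \<and> Y \<union> Z \<in> no_transversal E F W} \<le> card (no_transversal E' F W)"
      by (intro card_mono) auto
  qed (use fP fE' in \<open>auto simp: E'_def\<close>)
  also have "card (Pow P - {S}) = 2 ^ card P - 1"
    using SP fP by (simp add: card_Diff_singleton card_Pow)
  finally have 1: "card (no_transversal E F W) \<le> (2 ^ card P - 1) * card (no_transversal E' F W)" .
  have 2: "card (no_transversal E' F W) * 2 ^ (r * L) \<le> 2 ^ card E' * (2 ^ r - 1) ^ L"
  proof (rule Suc.IH[OF fE'])
    fix u v assume uv: "(u, v) \<in> snd F"
    \<comment> \<open>A deleted edge becomes two ordered missing pairs, hence \<open>2 * r\<close>
      per round.\<close>
    let ?swap = "\<lambda>(x, y). {(f x, f y), (f y, f x)}"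
    have sub: "missing E' (W u) (W v) \<subseteq> missing E (W u) (W v) \<union> \<Union> (?swap ` snd F)"
    proof
      fix z assume z: "z \<in> missing E' (W u) (W v)"
      obtain x y where xy: "z = (x, y)" by (cases z)
      show "z \<in> missing E (W u) (W v) \<union> \<Union> (?swap ` snd F)"
      proof (cases "{x, y} \<in> E")
        case True
        then have "{x, y} \<in> P" using z xy by (auto simp: missing_def E'_def)
        then obtain a b where "(a, b) \<in> snd F" "{x, y} = {f a, f b}" by (auto simp: P_def)
        then have "(x, y) \<in> ?swap (a, b)" "?swap (a, b) \<subseteq> \<Union> (?swap ` snd F)"
          by (auto simp: doubleton_eq_iff)
        then show ?thesis using xy by blast
      qed (use z xy in \<open>simp add: missing_def\<close>)
    qed
    have sw: "card (?swap e) \<le> 2" for e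
      by (cases e) (simp add: card_insert_le_m1)
    have "card (missing E' (W u) (W v)) \<le> card (missing E (W u) (W v) \<union> \<Union> (?swap ` snd F))"
      by (rule card_mono[OF _ sub]) (use FD W FD(4)[OF uv] in \<open>auto intro!: finite_missing\<close>)
    also have "\<dots> \<le> card (missing E (W u) (W v)) + card (\<Union> (?swap ` snd F))" by (rule card_Un_le)
    also have "card (\<Union> (?swap ` snd F)) \<le> (\<Sum>e\<in>snd F. card (?swap e))" by (rule card_UN_le[OF FD(5)])
    also have "\<dots> \<le> card (snd F) * 2" using sum_bounded_above[of "snd F" "\<lambda>e. card (?swap e)" 2] sw by auto
    also have "\<dots> \<le> r * 2" using r by simp
    finally have "card (missing E' (W u) (W v)) + 2 * r * L \<le> card (missing E (W u) (W v)) + 2 * r * Suc L"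
      by simp
    then have "2 * r * (card (missing E' (W u) (W v)) + 2 * r * L) \<le> 2 * r * (card (missing E (W u) (W v)) + 2 * r * Suc L)"
      by (rule mult_le_mono2)
    then show "2 * r * (card (missing E' (W u) (W v)) + 2 * r * L) \<le> m\<^sup>2"
      using Suc.prems(2)[OF uv] by linarith
  qed
  \<comment> \<open>The copy may use fewer than \<open>r\<close> edges. The relative saving is then
    at least as large, so every round can be charged as if exactly \<open>r\<close> edges had been
    used.\<close>
  have 3: "(2 ^ card P - 1) * 2 ^ r \<le> (2 ^ r - 1) * (2::nat) ^ card P"
  proof -
    have "(2::nat) ^ card P \<le> 2 ^ r" using cP by (simp add: power_increasing)
    then have "2 ^ r * 2 ^ card P - (2::nat) ^ r \<le> 2 ^ r * 2 ^ card P - 2 ^ card P" by (rule diff_le_mono2)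
    then show ?thesis by (simp add: diff_mult_distrib diff_mult_distrib2 mult.commute)
  qed
  have cE: "card E = card P + card E'"
    using card_Diff_subset[OF fP PE] card_mono[OF Suc.prems(1) PE] by (simp add: E'_def)
  have "card (no_transversal E F W) * 2 ^ (r * Suc L) \<le> (2 ^ card P - 1) * card (no_transversal E' F W) * (2 ^ r * 2 ^ (r * L))"
    using 1 by (simp add: power_add)
  also have "\<dots> = ((2 ^ card P - 1) * 2 ^ r) * (card (no_transversal E' F W) * 2 ^ (r * L))" by (simp only: ac_simps)
  also have "\<dots> \<le> ((2 ^ r - 1) * 2 ^ card P) * (2 ^ card E' * (2 ^ r - 1) ^ L)"
    by (rule mult_le_mono[OF 3 2])
  also have "\<dots> = 2 ^ card E * (2 ^ r - 1) ^ Suc L" by (simp add: cE power_add)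
  finally show ?case .
qed

lemma missing_mono: "A \<subseteq> A' \<Longrightarrow> B \<subseteq> B' \<Longrightarrow> missing E A B \<subseteq> missing E A' B'"
  by (auto simp: missing_def)

lemma one_minus_le_powr: "0 \<le> x \<Longrightarrow> 1 - x \<le> 2 powr (- x)" for x :: real
proof -
  assume x: "0 \<le> x"
  have "1 - x \<le> exp (- x)" using exp_ge_add_one_self[of "- x"] by simp
  also have "\<dots> \<le> exp (- x * ln 2)"
    using x ln_2_less_1 by (simp add: mult_left_le)
  also have "\<dots> = 2 powr (- x)" by (simp add: powr_def)
  finally show ?thesis .
qed

text \<open>Taking the number of rounds of order \<open>m ^ 2\<close> makes the saving quadratic in
  the exponent. In the applications \<open>m\<close> is linear in the size of the ambient classes,
  so this saving beats every number of choices that is exponential in a linear quantity. The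
  constants depend on the order bound \<open>h\<close> only.\<close>

lemma no_transversal_count:
  fixes h :: nat
  obtains c \<mu> :: real and m0 :: nat where "c > 0" "\<mu> > 0"
    "\<And>m E (F :: 'b dgraph) W. m \<ge> m0 \<Longrightarrow> finite E \<Longrightarrow> wf_dgraph F \<Longrightarrow> card (fst F) \<le> h \<Longrightarrow>
     (\<And>u. u \<in> fst F \<Longrightarrow> finite (W u) \<and> m \<le> card (W u)) \<Longrightarrow>
     (\<And>u v. (u, v) \<in> snd F \<Longrightarrow> real (card (missing E (W u) (W v))) \<le> \<mu> * (real m)\<^sup>2) \<Longrightarrow>
     real (card (no_transversal E F W)) \<le> 2 powr (real (card E) - c * (real m)\<^sup>2)"
proof -
  \<comment> \<open>\<open>r\<close> bounds the number of arcs and is positive. The budget of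
    \<open>m ^ 2 / (2 r)\<close> missing pairs is halved: \<open>\<mu>\<close> allows one half at
    the start, and \<open>L = m ^ 2 div (8 r ^ 2)\<close> rounds use the other. The rounds save
    \<open>L / 2 ^ r\<close> in the exponent, and rounding \<open>L\<close> down costs at most a
    factor 2, which turns 8 into the 16 of \<open>c\<close>.\<close>
  define r where "r = h\<^sup>2 + 1"
  define c :: real where "c = 1 / (16 * real r ^ 2 * 2 ^ r)"
  define \<mu> :: real where "\<mu> = 1 / (4 * real r)"
  define m0 where "m0 = 4 * h\<^sup>2 + 16 * r\<^sup>2 + 1"
  have r1: "r \<ge> 1" by (simp add: r_def)
  have main: "real (card (no_transversal E F W)) \<le> 2 powr (real (card E) - c * (real m)\<^sup>2)"
    if m: "m \<ge> m0" and E: "finite E" and F: "wf_dgraph F" and h: "card (fst F) \<le> h"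
      and W: "\<And>u. u \<in> fst F \<Longrightarrow> finite (W u) \<and> m \<le> card (W u)"
      and miss: "\<And>u v. (u, v) \<in> snd F \<Longrightarrow> real (card (missing E (W u) (W v))) \<le> \<mu> * (real m)\<^sup>2"
    for m E W and F :: "'b dgraph"
  proof -
    note FD = wf_dgraphD[OF F]
    define L where "L = m\<^sup>2 div (8 * r\<^sup>2)"
    have "\<forall>u\<in>fst F. \<exists>A. A \<subseteq> W u \<and> card A = m" using W obtain_subset_with_card_n by metis
    then obtain W' where W': "\<And>u. u \<in> fst F \<Longrightarrow> W' u \<subseteq> W u \<and> card (W' u) = m" by metis
    have fW': "finite (W' u)" if "u \<in> fst F" for u using W' W that finite_subset by blast
    have "card (snd F) \<le> card (fst F \<times> fst F)" using FD by (intro card_mono) auto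
    also have "\<dots> \<le> h\<^sup>2" using h by (simp add: card_cartesian_product power2_eq_square mult_le_mono)
    finally have cR: "card (snd F) \<le> r" by (simp add: r_def)
    have "(card (fst F))\<^sup>2 \<le> h\<^sup>2" using h by (simp add: power_mono)
    moreover have "4 * h\<^sup>2 + 16 * r\<^sup>2 + 1 \<le> m" using m by (simp only: m0_def)
    ultimately have m4: "4 * (card (fst F))\<^sup>2 < m" by linarith
    have L8: "L * (8 * r\<^sup>2) \<le> m\<^sup>2" by (simp add: L_def)
    have miss': "2 * r * (card (missing E (W' u) (W' v)) + 2 * r * L) \<le> m\<^sup>2" if uv: "(u, v) \<in> snd F" for u v
    proof -
      have "card (missing E (W' u) (W' v)) \<le> card (missing E (W u) (W v))"
        using missing_mono W' FD(4)[OF uv] W by (intro card_mono finite_missing) auto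
      then have "real (card (missing E (W' u) (W' v))) \<le> \<mu> * (real m)\<^sup>2" using miss uv by fastforce
      then have "4 * real r * real (card (missing E (W' u) (W' v))) \<le> (real m)\<^sup>2"
        using r1 by (simp add: \<mu>_def field_simps)
      then have "4 * r * card (missing E (W' u) (W' v)) \<le> m\<^sup>2"
        by (metis (mono_tags, lifting) of_nat_le_iff of_nat_mult of_nat_numeral of_nat_power)
      moreover have "2 * (4 * r * (r * L)) \<le> m\<^sup>2"
        using L8 by (simp add: power2_eq_square ac_simps)
      moreover have "2 * r * (card (missing E (W' u) (W' v)) + 2 * r * L)
          = 2 * (r * card (missing E (W' u) (W' v))) + 4 * r * (r * L)"
        by (simp add: distrib_left)
      ultimately show ?thesis by (simp only: mult.assoc)
    qed
    have "no_transversal E F W \<subseteq> no_transversal E F W'"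
      unfolding no_transversal_def using W' by blast
    moreover have "finite (no_transversal E F W')"
      by (rule finite_subset[of _ "Pow E"]) (use E in \<open>auto simp: no_transversal_def\<close>)
    ultimately have "card (no_transversal E F W) \<le> card (no_transversal E F W')" by (rule card_mono[rotated])
    moreover have "card (no_transversal E F W') * 2 ^ (r * L) \<le> 2 ^ card E * (2 ^ r - 1) ^ L"
      by (rule no_transversal_count_aux[OF F E _ m4 cR miss']) (use fW' W' in auto)
    ultimately have "card (no_transversal E F W) * 2 ^ (r * L) \<le> 2 ^ card E * (2 ^ r - 1) ^ L"
      by (meson le_trans mult_le_mono1)
    then have "real (card (no_transversal E F W) * 2 ^ (r * L)) \<le> real (2 ^ card E * (2 ^ r - 1) ^ L)"
      using of_nat_le_iff by blast
    then have "real (card (no_transversal E F W)) * (2 ^ r) ^ L \<le> 2 ^ card E * (2 ^ r - 1) ^ L"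
      by (simp add: power_mult of_nat_diff)
    then have "real (card (no_transversal E F W)) \<le> 2 ^ card E * ((2 ^ r - 1) ^ L / (2 ^ r) ^ L)"
      by (simp add: field_simps)
    also have "(2 ^ r - 1) ^ L / (2 ^ r) ^ L = (1 - 1 / 2 ^ r :: real) ^ L"
      by (simp add: power_divide[symmetric] diff_divide_distrib)
    also have "\<dots> \<le> (2 powr (- (1 / 2 ^ r))) ^ L"
      by (intro power_mono one_minus_le_powr) (auto simp: field_simps)
    also have "\<dots> = 2 powr (- (real L / 2 ^ r))"
      by (simp add: powr_realpow[symmetric] powr_powr)
    also have "2 ^ card E * \<dots> = 2 powr (real (card E) - real L / 2 ^ r)"
      by (simp add: powr_add[symmetric] powr_realpow[symmetric])
    also have "\<dots> \<le> 2 powr (real (card E) - c * (real m)\<^sup>2)"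
    proof -
      have "16 * r\<^sup>2 \<le> m\<^sup>2"
      proof -
        have "16 * r\<^sup>2 \<le> m" "1 \<le> m" using m by (auto simp: m0_def)
        then show ?thesis by (metis le_trans power2_nat_le_imp_le power2_eq_square mult_le_mono nat_mult_1_right le_refl)
      qed
      moreover have "m\<^sup>2 < (L + 1) * (8 * r\<^sup>2)"
      proof -
        have "m\<^sup>2 = L * (8 * r\<^sup>2) + m\<^sup>2 mod (8 * r\<^sup>2)" unfolding L_def by (rule div_mult_mod_eq[symmetric])
        moreover have "m\<^sup>2 mod (8 * r\<^sup>2) < 8 * r\<^sup>2" using r1 by (intro mod_less_divisor) simp
        ultimately show ?thesis by (simp add: distrib_right)
      qed
      ultimately have "m\<^sup>2 \<le> L * (16 * r\<^sup>2)" by (simp add: distrib_right)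
      then have "(real m)\<^sup>2 \<le> real L * (16 * (real r)\<^sup>2)"
        by (metis (mono_tags, lifting) of_nat_le_iff of_nat_mult of_nat_numeral of_nat_power)
      then have "c * (real m)\<^sup>2 \<le> real L / 2 ^ r"
        using r1 by (simp add: c_def field_simps)
      then show ?thesis by simp
    qed
    finally show ?thesis by simp
  qed
  have "c > 0" "\<mu> > 0" using r1 by (auto simp: c_def \<mu>_def)
  then show thesis using main by (rule that)
qed

section \<open>Shattering and universal orientations\<close>

definition shatters :: "'a set set \<Rightarrow> 'a set \<Rightarrow> bool" where
  "shatters F Q \<longleftrightarrow> (\<forall>Y\<subseteq>Q. \<exists>X\<in>F. X \<inter> Q = Y)"

text \<open>Pajor's form of the Sauer--Shelah lemma, by induction on the ground set. Split by
  membership of \<open>e\<close> into \<open>F0\<close> and, with \<open>e\<close> removed,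
  \<open>G\<close>; then \<open>card F = card (F0 \<union> G) + card (F0 \<inter> G)\<close>. Sets
  shattered by the union are shattered by \<open>F\<close> and avoid \<open>e\<close>; for a set
  shattered by the intersection, \<open>e\<close> can be added to it. The two kinds are
  disjoint.\<close>

lemma card_le_card_shattered:
  assumes "finite E" "F \<subseteq> Pow E"
  shows "card F \<le> card {Q. Q \<subseteq> E \<and> shatters F Q}"
  using assms
proof (induction E arbitrary: F rule: finite_induct)
  case empty
  show ?case
  proof (cases "F = {}")
    case False
    then have "F = {{}}" using empty by auto
    then have "{Q. Q \<subseteq> {} \<and> shatters F Q} = {{}}" by (auto simp: shatters_def)
    then show ?thesis using \<open>F = {{}}\<close> by simp
  qed simp
next
  case (insert e E)
  define F0 where "F0 = {X \<in> F. e \<notin> X}"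
  define F1 where "F1 = {X \<in> F. e \<in> X}"
  define G where "G = (\<lambda>X. X - {e}) ` F1"
  have finF: "finite F" by (rule finite_subset[OF insert.prems]) (use insert.hyps in auto)
  then have fin: "finite F0" "finite F1" "finite G" by (auto simp: F0_def F1_def G_def)
  have inj: "inj_on (\<lambda>X. X - {e}) F1" by (rule inj_onI) (auto simp: F1_def)
  have "F = F0 \<union> F1" "F0 \<inter> F1 = {}" by (auto simp: F0_def F1_def)
  then have "card F = card F0 + card F1" using fin card_Un_disjoint by metis
  also have "\<dots> = card F0 + card G" using card_image[OF inj] by (simp add: G_def)
  also have "\<dots> = card (F0 \<union> G) + card (F0 \<inter> G)" by (rule card_Un_Int) (use fin in auto)
  finally have c: "card F = card (F0 \<union> G) + card (F0 \<inter> G)" .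
  have sub: "F0 \<subseteq> Pow E" "G \<subseteq> Pow E"
    using insert.prems by (auto simp: F0_def G_def F1_def)
  let ?S = "\<lambda>F. {Q. Q \<subseteq> E \<and> shatters F Q}"
  have eQ: "e \<notin> Q" if "Q \<subseteq> E" for Q using that insert.hyps by auto
  have s1: "shatters F Q" if Q: "Q \<subseteq> E" "shatters (F0 \<union> G) Q" for Q
    unfolding shatters_def
  proof (intro allI impI)
    fix Y assume "Y \<subseteq> Q"
    then obtain X where X: "X \<in> F0 \<union> G" "X \<inter> Q = Y" using Q(2) unfolding shatters_def by meson
    show "\<exists>X\<in>F. X \<inter> Q = Y"
    proof (cases "X \<in> F0")
      case True
      then show ?thesis using X(2) unfolding F0_def by blast
    next
      case False
      then obtain X' where X': "X' \<in> F" "X = X' - {e}" using X(1) unfolding G_def F1_def by blast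
      then have "X' \<inter> Q = Y" using X(2) eQ[OF Q(1)] by blast
      then show ?thesis using X'(1) by blast
    qed
  qed
  have s2: "shatters F (insert e Q)" if Q: "Q \<subseteq> E" "shatters (F0 \<inter> G) Q" for Q
    unfolding shatters_def
  proof (intro allI impI)
    fix Y assume Y: "Y \<subseteq> insert e Q"
    then have "Y - {e} \<subseteq> Q" by auto
    then obtain X where X: "X \<in> F0" "X \<in> G" "X \<inter> Q = Y - {e}" using Q(2) unfolding shatters_def by (metis IntE)
    obtain X' where X': "X' \<in> F" "e \<in> X'" "X = X' - {e}" using X(2) unfolding G_def F1_def by blast
    have XF: "X \<in> F" "e \<notin> X" using X(1) unfolding F0_def by blast+
    show "\<exists>X\<in>F. X \<inter> insert e Q = Y"
    proof (cases "e \<in> Y")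
      case True
      then have "X' \<inter> insert e Q = Y" using X(3) X'(2,3) Y eQ[OF Q(1)] by blast
      then show ?thesis using X'(1) by blast
    next
      case False
      then have "X \<inter> insert e Q = Y" using X(3) XF(2) Y by blast
      then show ?thesis using XF(1) by blast
    qed
  qed
  have "card (F0 \<union> G) + card (F0 \<inter> G) \<le> card (?S (F0 \<union> G)) + card (?S (F0 \<inter> G))"
    using sub by (intro add_mono insert.IH) auto
  also have "card (?S (F0 \<inter> G)) = card (Set.insert e ` ?S (F0 \<inter> G))"
    by (rule card_image[symmetric], rule inj_onI) (use eQ in \<open>auto simp: insert_ident\<close>)
  also have "card (?S (F0 \<union> G)) + \<dots> = card (?S (F0 \<union> G) \<union> Set.insert e ` ?S (F0 \<inter> G))"
    by (rule card_Un_disjoint[symmetric]) (use insert.hyps in auto)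
  also have "\<dots> \<le> card {Q. Q \<subseteq> insert e E \<and> shatters F Q}"
    by (rule card_mono) (use insert.hyps s1 s2 in auto)
  finally show ?case using c by simp
qed

section \<open>Exponential Markov bounds\<close>

lemma one_plus_le_powr: "0 \<le> x \<Longrightarrow> 1 + x \<le> 2 powr (2 * x)" for x :: real
proof -
  assume x: "0 \<le> x"
  have "ln (exp 1) \<le> ln ((2::real) ^ 2)" using exp_le by (subst ln_le_cancel_iff) auto
  then have "1 \<le> 2 * ln (2::real)" by (subst (asm) ln_realpow) auto
  then have "x * 1 \<le> x * (2 * ln 2)" using x by (intro mult_left_mono)
  then have l: "x \<le> 2 * x * ln 2" by simp
  have "1 + x \<le> exp x" by (rule exp_ge_add_one_self)
  also have "\<dots> \<le> exp (2 * x * ln 2)" using l by simp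
  also have "\<dots> = 2 powr (2 * x)" by (simp add: powr_def)
  finally show ?thesis .
qed

text \<open>Weighting each member by \<open>x ^ cnt X\<close> with \<open>x < 1\<close>, a member
  with small count weighs at least \<open>x powr (\<gamma> * M)\<close>, so few of them fit into a
  bounded total. Since \<open>a \<ge> 1\<close>,
  \<open>(a + x) ^ n \<le> a ^ n * (1 + x) ^ n\<close>; this spends one half of
  \<open>\<epsilon>\<close>, and \<open>\<gamma>\<close> is chosen so that
  \<open>x powr (\<gamma> * M) = 2 powr (- (\<epsilon> / 2 * M))\<close> spends the other.\<close>

lemma few_markov:
  fixes \<epsilon> :: real
  assumes "\<epsilon> > 0"
  shows "\<exists>x>0. \<exists>\<gamma>>0. \<forall>(S :: 'c set) (cnt :: 'c \<Rightarrow> nat) a n M. finite S \<longrightarrow> 1 \<le> a \<longrightarrow> real n \<le> M \<longrightarrow>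
      (\<Sum>X\<in>S. x ^ cnt X) \<le> (a + x) ^ n \<longrightarrow> x \<le> 1 \<and> real (card {X \<in> S. real (cnt X) < \<gamma> * M}) \<le> a ^ n * 2 powr (\<epsilon> * M)"
proof -
  define x where "x = min (\<epsilon> / 4) (1 / 2)"
  have x: "0 < x" "x < 1" "2 * x \<le> \<epsilon> / 2" using assms by (auto simp: x_def)
  define \<gamma> where "\<gamma> = \<epsilon> / (2 * log 2 (1 / x))"
  have lx: "log 2 (1 / x) > 0" using x by (simp add: zero_less_log_cancel_iff)
  have \<gamma>: "\<gamma> > 0" using assms lx by (simp add: \<gamma>_def)
  have "real (card {X \<in> S. real (cnt X) < \<gamma> * M}) \<le> a ^ n * 2 powr (\<epsilon> * M)"
    if fS: "finite S" and a: "1 \<le> a" and n: "real n \<le> M" and le: "(\<Sum>X\<in>S. x ^ cnt X) \<le> (a + x) ^ n"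
    for S :: "'c set" and cnt :: "'c \<Rightarrow> nat" and a n M
  proof -
    let ?T = "{X \<in> S. real (cnt X) < \<gamma> * M}"
    have M: "M \<ge> 0" using n by linarith
    have px: "x powr (\<gamma> * M) = 2 powr (- (\<epsilon> / 2 * M))"
    proof -
      have "log 2 x = - log 2 (1 / x)" using x by (simp add: log_divide)
      then have "log 2 x * (\<gamma> * M) = - (\<epsilon> / 2 * M)" using lx by (simp add: \<gamma>_def)
      moreover have "x powr (\<gamma> * M) = (2 powr log 2 x) powr (\<gamma> * M)" using x by simp
      ultimately show ?thesis by (simp only: powr_powr)
    qed
    have "real (card ?T) * x powr (\<gamma> * M) = (\<Sum>X\<in>?T. x powr (\<gamma> * M))" by simp
    also have "\<dots> \<le> (\<Sum>X\<in>?T. x ^ cnt X)"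
    proof (rule sum_mono)
      fix X assume "X \<in> ?T"
      then have "x powr (\<gamma> * M) \<le> x powr (real (cnt X))" using x by (intro powr_mono') auto
      then show "x powr (\<gamma> * M) \<le> x ^ cnt X" using x by (simp add: powr_realpow)
    qed
    also have "\<dots> \<le> (\<Sum>X\<in>S. x ^ cnt X)" using fS x by (intro sum_mono2) auto
    also have "\<dots> \<le> (a + x) ^ n" by (rule le)
    also have "\<dots> \<le> (a * (1 + x)) ^ n" using a x by (intro power_mono) (auto simp: algebra_simps)
    also have "\<dots> = a ^ n * (1 + x) ^ n" by (rule power_mult_distrib)
    also have "(1 + x) ^ n \<le> 2 powr (\<epsilon> / 2 * M)"
    proof -
      have "(1 + x) ^ n \<le> (2 powr (2 * x)) ^ n" using one_plus_le_powr[of x] x by (intro power_mono) auto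
      also have "\<dots> = 2 powr (2 * x * real n)" by (simp add: powr_realpow[symmetric] powr_powr)
      also have "\<dots> \<le> 2 powr (\<epsilon> / 2 * M)" using x n M assms by (intro powr_mono mult_mono) auto
      finally show ?thesis .
    qed
    finally have "real (card ?T) * 2 powr (- (\<epsilon> / 2 * M)) \<le> a ^ n * 2 powr (\<epsilon> / 2 * M)"
      using a px by (simp add: mult_left_mono)
    then have "real (card ?T) * (2 powr (- (\<epsilon> / 2 * M)) * 2 powr (\<epsilon> / 2 * M)) \<le> a ^ n * (2 powr (\<epsilon> / 2 * M) * 2 powr (\<epsilon> / 2 * M))"
      by (metis (no_types, lifting) mult.assoc mult_right_mono powr_ge_zero)
    then show ?thesis by (simp add: powr_add[symmetric] powr_minus field_simps)
  qed
  then show ?thesis using x \<gamma> by (intro exI[of _ x] conjI exI[of _ \<gamma>]) auto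
qed

lemma sum_Pow_Un:
  fixes f :: "'a set \<Rightarrow> 'b :: comm_monoid_add"
  assumes "finite A" "finite B" "A \<inter> B = {}"
  shows "(\<Sum>X\<in>Pow (A \<union> B). f X) = (\<Sum>X\<in>Pow A. \<Sum>Y\<in>Pow B. f (X \<union> Y))"
proof -
  have "(\<Sum>X\<in>Pow A. \<Sum>Y\<in>Pow B. f (X \<union> Y)) = (\<Sum>(X, Y)\<in>Pow A \<times> Pow B. f (X \<union> Y))"
    by (rule sum.cartesian_product)
  also have "\<dots> = (\<Sum>X\<in>Pow (A \<union> B). f X)"
    by (rule sum.reindex_bij_witness[where i = "\<lambda>X. (X \<inter> A, X \<inter> B)" and j = "\<lambda>(X, Y). X \<union> Y"])
      (use assms(3) in auto)
  finally show ?thesis by simp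
qed

text \<open>The binomial theorem in the shape of the generating function that
  \<open>few_markov\<close> expects, with \<open>a = 1\<close>.\<close>

lemma sum_power_card_Pow:
  fixes x :: real
  assumes "finite S"
  shows "(\<Sum>X\<in>Pow S. x ^ card X) = (1 + x) ^ card S"
  using assms
proof (induction S rule: finite_induct)
  case (insert e S)
  have "(\<Sum>X\<in>Pow (S \<union> {e}). x ^ card X) = (\<Sum>X\<in>Pow S. \<Sum>Y\<in>Pow {e}. x ^ card (X \<union> Y))"
    using insert.hyps by (intro sum_Pow_Un) auto
  also have "\<dots> = (\<Sum>X\<in>Pow S. x ^ card X * (1 + x))"
  proof (rule sum.cong[OF refl])
    fix X assume "X \<in> Pow S"
    then have "finite X" "e \<notin> X" using insert.hyps finite_subset by auto
    then show "(\<Sum>Y\<in>Pow {e}. x ^ card (X \<union> Y)) = x ^ card X * (1 + x)"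
      by (simp add: Pow_insert distrib_left)
  qed
  also have "\<dots> = (1 + x) ^ card (insert e S)"
    using insert by (simp add: sum_distrib_right[symmetric])
  finally show ?case by simp
qed simp

lemma few_subsets:
  fixes \<epsilon> :: real
  assumes "\<epsilon> > 0"
  shows "\<exists>\<gamma>>0. \<forall>(S :: 'c set) M. finite S \<longrightarrow> real (card S) \<le> M \<longrightarrow>
      real (card {X. X \<subseteq> S \<and> real (card X) < \<gamma> * M}) \<le> 2 powr (\<epsilon> * M)"
proof -
  obtain x \<gamma> :: real where x: "x > 0" "\<gamma> > 0" and *: "\<And>(S :: 'c set set) cnt a n M. finite S \<Longrightarrow> 1 \<le> a \<Longrightarrow> real n \<le> M \<Longrightarrow>
      (\<Sum>X\<in>S. x ^ cnt X) \<le> (a + x) ^ n \<Longrightarrow> x \<le> 1 \<and> real (card {X \<in> S. real (cnt X) < \<gamma> * M}) \<le> a ^ n * 2 powr (\<epsilon> * M)"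
    using few_markov[OF assms, where ?'c = "'c set"] by blast
  have "real (card {X. X \<subseteq> S \<and> real (card X) < \<gamma> * M}) \<le> 2 powr (\<epsilon> * M)"
    if "finite S" "real (card S) \<le> M" for S :: "'c set" and M
    using *[of "Pow S" 1 "card S" M card] that sum_power_card_Pow[of S x] by (simp add: Pow_def)
  then show ?thesis using x by blast
qed

section \<open>Universal orientations of complete multipartite graphs\<close>

text \<open>Class \<open>i\<close> is the set of numbers below \<open>k * s\<close> congruent to
  \<open>i\<close> modulo \<open>k\<close>, of size \<open>s\<close>. Only a part \<open>J\<close>
  of \<open>F\<close> has to be found, because the other vertices of \<open>F\<close> will be played
  by vertices outside the host. The targets \<open>W u\<close> are arbitrary subsets of density
  \<open>\<gamma>\<close> in a class, as they will be dictated by the attachments.\<close>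

definition universal :: "'b dgraph \<Rightarrow> nat \<Rightarrow> nat \<Rightarrow> real \<Rightarrow> nat dgraph \<Rightarrow> bool" where
  "universal F k s \<gamma> U \<longleftrightarrow> fst U = {..<k * s} \<and> wf_dgraph U \<and> (\<forall>(a, b)\<in>snd U. a mod k \<noteq> b mod k) \<and>
     (\<forall>J c W. J \<subseteq> fst F \<longrightarrow> (\<forall>(u, v)\<in>snd F. u \<in> J \<longrightarrow> v \<in> J \<longrightarrow> c u \<noteq> c v) \<longrightarrow>
        (\<forall>u\<in>J. W u \<subseteq> {j. j < k * s \<and> j mod k = c u} \<and> \<gamma> * real s \<le> real (card (W u))) \<longrightarrow>
        (\<exists>f. inj_on f J \<and> (\<forall>u\<in>J. f u \<in> W u) \<and> (\<forall>(u, v)\<in>snd F. u \<in> J \<longrightarrow> v \<in> J \<longrightarrow> (f u, f v) \<in> snd U)))"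

text \<open>Counting argument: the pairs \<open>(J, W)\<close> number at most
  \<open>2 ^ (h + k * s * h)\<close>, with an exponent linear in \<open>s\<close>, while each of
  them fails for at most a fraction \<open>2 powr (- c * m ^ 2)\<close> of the orientations of the
  complete \<open>k\<close>-partite graph, with \<open>m \<ge> \<gamma> * s\<close>. For large
  \<open>s\<close> some orientation fails for none.\<close>

lemma universal_exists:
  fixes F :: "'b dgraph"
  assumes F: "wf_dgraph F" and \<gamma>: "\<gamma> > 0" and k: "k > 0"
  shows "\<exists>s0. \<forall>s\<ge>s0. \<exists>U. universal F k s \<gamma> U"
proof -
  note FD = wf_dgraphD[OF F]
  define h where "h = card (fst F)"
  obtain c \<mu> :: real and m0 where c: "c > 0" "\<mu> > 0" and count: "\<And>m E (F :: 'b dgraph) W. m \<ge> m0 \<Longrightarrow> finite E \<Longrightarrow> wf_dgraph F \<Longrightarrow> card (fst F) \<le> h \<Longrightarrow>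
     (\<And>u. u \<in> fst F \<Longrightarrow> finite (W u) \<and> m \<le> card (W u)) \<Longrightarrow>
     (\<And>u v. (u, v) \<in> snd F \<Longrightarrow> real (card (missing E (W u) (W v))) \<le> \<mu> * (real m)\<^sup>2) \<Longrightarrow>
     real (card (no_transversal E F W)) \<le> 2 powr (real (card E) - c * (real m)\<^sup>2)"
    by (rule no_transversal_count[of h, where ?'b = 'b]) blast
  \<comment> \<open>The first summand ensures \<open>m \<ge> m0\<close>; the second lets
    \<open>c * (\<gamma> * s) ^ 2\<close> exceed \<open>h + k * s * h\<close>, the logarithm of the
    number of pairs \<open>(J, W)\<close>.\<close>
  define s0 where "s0 = nat \<lceil>real m0 / \<gamma>\<rceil> + nat \<lceil>real (h + k * h) / (c * \<gamma>\<^sup>2)\<rceil> + 1"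
  have "\<exists>U. universal F k s \<gamma> U" if s: "s \<ge> s0" for s
  proof -
    have s1: "real s \<ge> real m0 / \<gamma>" "real s > real (h + k * h) / (c * \<gamma>\<^sup>2)" "real s \<ge> 1"
      using s unfolding s0_def by linarith+
    define m where "m = nat \<lceil>\<gamma> * real s\<rceil>"
    have m: "m0 \<le> m" "\<gamma> * real s \<le> real m"
      using s1 \<gamma> by (auto simp: m_def field_simps) linarith+
    define E where "E = {{a, b} | a b. a < k * s \<and> b < k * s \<and> a mod k \<noteq> b mod k}"
    have wfE: "wf_graph ({..<k * s}, E)" by (force simp: wf_graph_def E_def)
    have fE: "finite E" using wf_graph_finite[OF wfE] by simp
    let ?sub = "\<lambda>J. (J, snd F \<inter> (J \<times> J))"
    have wfJ: "wf_dgraph (?sub J)" if "J \<subseteq> fst F" for J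
      using that F finite_subset[of J "fst F"] unfolding wf_dgraph_def by auto
    define \<G> where "\<G> = {(J, W). J \<in> Pow (fst F) \<and> W \<in> PiE (fst F) (\<lambda>_. Pow {..<k * s}) \<and>
      (\<forall>u\<in>J. m \<le> card (W u)) \<and> (\<forall>(u, v)\<in>snd F. u \<in> J \<longrightarrow> v \<in> J \<longrightarrow> missing E (W u) (W v) = {})}"
    let ?P = "Pow (fst F) \<times> PiE (fst F) (\<lambda>_. Pow {..<k * s})"
    have fP: "finite ?P" using FD by (auto intro!: finite_PiE)
    have cP: "card ?P = 2 ^ h * (2 ^ (k * s)) ^ h"
      using FD by (simp add: card_cartesian_product card_Pow card_PiE h_def)
    have \<G>P: "\<G> \<subseteq> ?P" by (auto simp: \<G>_def)
    have f\<G>: "finite \<G>" using \<G>P fP by (rule finite_subset)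
    define B where "B = (\<lambda>(J, W). no_transversal E (?sub J) W)"
    have B: "real (card (B z)) \<le> 2 powr (real (card E) - c * (real m)\<^sup>2)" if z: "z \<in> \<G>" for z
    proof -
      obtain J W where z: "z = (J, W)" "J \<subseteq> fst F" "W \<in> PiE (fst F) (\<lambda>_. Pow {..<k * s})"
        "\<forall>u\<in>J. m \<le> card (W u)" "\<forall>(u, v)\<in>snd F. u \<in> J \<longrightarrow> v \<in> J \<longrightarrow> missing E (W u) (W v) = {}"
        using z by (auto simp: \<G>_def)
      have "finite (W u)" if "u \<in> J" for u using z(2,3) that by (meson PiE_mem PowD finite_lessThan finite_subset subsetD)
      moreover have "card J \<le> h" using z(2) FD by (simp add: h_def card_mono)
      ultimately show ?thesis unfolding z(1) B_def case_prod_conv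
        using z c by (intro count m(1) fE wfJ) auto
    qed
    have "real (card (\<Union> (B ` \<G>))) \<le> (\<Sum>z\<in>\<G>. real (card (B z)))"
      using card_UN_le[OF f\<G>, of B] by (metis of_nat_le_iff of_nat_sum)
    also have "\<dots> \<le> real (card \<G>) * 2 powr (real (card E) - c * (real m)\<^sup>2)"
      using sum_bounded_above[of \<G> "\<lambda>z. real (card (B z))"] B by auto
    also have "\<dots> \<le> real (card ?P) * 2 powr (real (card E) - c * (real m)\<^sup>2)"
      using card_mono[OF fP \<G>P] by (intro mult_right_mono) auto
    also have "real (card ?P) = 2 powr (real (h + k * s * h))"
      by (simp add: cP powr_realpow power_add power_mult flip: powr_realpow) (simp add: powr_add powr_powr powr_realpow[symmetric])
    also have "\<dots> * 2 powr (real (card E) - c * (real m)\<^sup>2) = 2 powr (real (h + k * s * h) + real (card E) - c * (real m)\<^sup>2)"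
      by (simp only: powr_add[symmetric] add_diff_eq)
    also have "\<dots> < 2 powr (real (card E))"
    proof -
      have "real (h + k * s * h) \<le> real (h + k * h) * real s"
      proof -
        have "real h * 1 \<le> real h * real s" using s1(3) by (intro mult_left_mono) auto
        then show ?thesis by (simp add: algebra_simps)
      qed
      also have "\<dots> < (c * \<gamma>\<^sup>2 * real s) * real s"
        using s1 c \<gamma> by (intro mult_strict_right_mono) (auto simp: field_simps)
      also have "\<dots> = c * (\<gamma> * real s)\<^sup>2" by (simp add: power2_eq_square)
      also have "\<dots> \<le> c * (real m)\<^sup>2" using m \<gamma> c by (intro mult_left_mono power_mono) auto
      finally show ?thesis by simp
    qed
    also have "\<dots> = real (card (Pow E))" using fE by (simp add: card_Pow powr_realpow)
    finally have "card (\<Union> (B ` \<G>)) < card (Pow E)" by simp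
    moreover have "\<Union> (B ` \<G>) \<subseteq> Pow E" by (auto simp: B_def no_transversal_def)
    ultimately obtain X where X: "X \<subseteq> E" "X \<notin> \<Union> (B ` \<G>)"
      by (metis PowD less_irrefl subset_antisym subsetI)
    define U where "U = ({..<k * s}, {(a, b). arc E X a b})"
    have modE: "a mod k \<noteq> b mod k \<and> a < k * s \<and> b < k * s" if "{a, b} \<in> E" for a b
      using that by (auto simp: E_def doubleton_eq_iff)
    have "arc E X a b \<Longrightarrow> a \<noteq> b \<and> a < k * s \<and> b < k * s \<and> \<not> arc E X b a \<and> a mod k \<noteq> b mod k" for a b
      using arc_asym[of a b E X] arc_edge[of E X a b] modE[of a b] by blast
    then have 1: "wf_dgraph U" "\<forall>(a, b)\<in>snd U. a mod k \<noteq> b mod k"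
      unfolding wf_dgraph_def U_def by auto
    have 2: "\<exists>f. inj_on f J \<and> (\<forall>u\<in>J. f u \<in> W u) \<and> (\<forall>(u, v)\<in>snd F. u \<in> J \<longrightarrow> v \<in> J \<longrightarrow> (f u, f v) \<in> snd U)"
      if J: "J \<subseteq> fst F" and c: "\<forall>(u, v)\<in>snd F. u \<in> J \<longrightarrow> v \<in> J \<longrightarrow> c u \<noteq> c v"
        and W: "\<forall>u\<in>J. W u \<subseteq> {j. j < k * s \<and> j mod k = c u} \<and> \<gamma> * real s \<le> real (card (W u))" for J c W
    proof -
      define W' where "W' = (\<lambda>u\<in>fst F. if u \<in> J then W u else {})"
      have W'J: "W' u = W u" if "u \<in> J" for u using that J by (auto simp: W'_def)
      have "m \<le> card (W u)" if "u \<in> J" for u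
      proof -
        have "\<gamma> * real s \<le> real (card (W u))" using W that by blast
        then show ?thesis unfolding m_def by linarith
      qed
      moreover have "missing E (W u) (W v) = {}" if "(u, v) \<in> snd F" "u \<in> J" "v \<in> J" for u v
      proof -
        have "c u \<noteq> c v" using c that by blast
        moreover have "W u \<subseteq> {j. j < k * s \<and> j mod k = c u}" "W v \<subseteq> {j. j < k * s \<and> j mod k = c v}"
          using W that by blast+
        ultimately have "{a, b} \<in> E" if "a \<in> W u" "b \<in> W v" for a b
          unfolding E_def using that by (intro CollectI exI[of _ a] exI[of _ b]) fastforce
        then show ?thesis by (auto simp: missing_def)
      qed
      moreover have "W' \<in> PiE (fst F) (\<lambda>_. Pow {..<k * s})" 
      proof -
        have "W u \<subseteq> {..<k * s}" if "u \<in> J" for u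
          using W[THEN bspec, OF that] by auto
        then show ?thesis by (auto simp: W'_def PiE_iff)
      qed
      ultimately have "(J, W') \<in> \<G>" using J W'J by (auto simp: \<G>_def)
      then have "X \<notin> no_transversal E (?sub J) W'" using X by (auto simp: B_def)
      then obtain f where "inj_on f J" "\<forall>u\<in>J. f u \<in> W' u" "\<forall>(u, v)\<in>snd F \<inter> (J \<times> J). arc E X (f u) (f v)"
        using X by (auto simp: no_transversal_def)
      then show ?thesis using W'J by (intro exI[of _ f]) (auto simp: U_def)
    qed
    show ?thesis unfolding universal_def by (rule exI[of _ U]) (use 1 2 in \<open>auto simp: U_def\<close>)
  qed
  then show ?thesis by blast
qed

section \<open>The asymptotic number of orientations\<close>

definition hosting :: "nat set \<Rightarrow> nat set set \<Rightarrow> 'b dgraph \<Rightarrow> nat dgraph \<Rightarrow> (nat \<Rightarrow> nat) \<Rightarrow> nat set set set" where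
  "hosting V E F U g = {X \<in> Free V E F. \<forall>(a, b)\<in>snd U. arc E X (g a) (g b)}"

definition placements :: "nat \<Rightarrow> nat set \<Rightarrow> (nat \<Rightarrow> nat) set" where
  "placements m V = {g \<in> PiE {..<m} (\<lambda>_. V). inj_on g {..<m}}"

lemma finite_placements: "finite V \<Longrightarrow> finite (placements m V)"
  unfolding placements_def by (rule finite_subset[of _ "PiE {..<m} (\<lambda>_. V)"]) (auto intro: finite_PiE)

lemma card_placements_le: "finite V \<Longrightarrow> card (placements m V) \<le> card V ^ m"
  using card_mono[of "PiE {..<m} (\<lambda>_. V)" "placements m V"]
  by (auto simp: placements_def card_PiE intro: finite_PiE)

text \<open>A free orientation either has no copy of \<open>U\<close> or hosts it at one of at most
  \<open>card V ^ m\<close> placements, a polynomial number. The \<open>max 0 B\<close> covers the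
  case without placements, where the hypothesis says nothing about \<open>B\<close>.\<close>

lemma card_Free_le_hosting:
  assumes G: "wf_graph (V, E)" and U: "fst U = {..<m}" "wf_dgraph U"
    and B: "\<And>g. g \<in> placements m V \<Longrightarrow> real (card (hosting V E F U g)) \<le> B"
  shows "real (card (Free V E F)) \<le> real (card (Free V E U)) + real (card V) ^ m * max 0 B"
proof -
  note fin = wf_graph_finite[OF G]
  have "Free V E F \<subseteq> Free V E U \<union> (\<Union>g\<in>placements m V. hosting V E F U g)"
  proof
    fix X assume X: "X \<in> Free V E F"
    show "X \<in> Free V E U \<union> (\<Union>g\<in>placements m V. hosting V E F U g)"
    proof (cases "emb V E X U")
      case True
      then show ?thesis
      proof (rule embE)
        fix f assume f: "inj_on f (fst U)" "\<And>u. u \<in> fst U \<Longrightarrow> f u \<in> V"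
          "\<And>u v. (u, v) \<in> snd U \<Longrightarrow> arc E X (f u) (f v)"
        let ?g = "restrict f {..<m}"
        have "?g \<in> placements m V" using f U by (auto simp: placements_def inj_on_def)
        moreover have "arc E X (?g a) (?g b)" if "(a, b) \<in> snd U" for a b
          using f(3)[OF that] wf_dgraphD(4)[OF U(2) that] U(1) by simp
        ultimately have "X \<in> hosting V E F U ?g" "?g \<in> placements m V"
          using X unfolding hosting_def by blast+
        then show ?thesis by blast
      qed
    qed (use X in \<open>auto simp: Free_def\<close>)
  qed
  moreover have "finite (Free V E U \<union> (\<Union>g\<in>placements m V. hosting V E F U g))"
    using fin by (auto simp: hosting_def finite_Free finite_placements)
  ultimately have "card (Free V E F) \<le> card (Free V E U \<union> (\<Union>g\<in>placements m V. hosting V E F U g))"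
    by (rule card_mono[rotated])
  also have "\<dots> \<le> card (Free V E U) + card (\<Union>g\<in>placements m V. hosting V E F U g)" by (rule card_Un_le)
  also have "card (\<Union>g\<in>placements m V. hosting V E F U g) \<le> (\<Sum>g\<in>placements m V. card (hosting V E F U g))"
    using fin by (intro card_UN_le finite_placements)
  finally have "card (Free V E F) \<le> card (Free V E U) + (\<Sum>g\<in>placements m V. card (hosting V E F U g))"
    by simp
  then have "real (card (Free V E F)) \<le> real (card (Free V E U) + (\<Sum>g\<in>placements m V. card (hosting V E F U g)))"
    by (rule of_nat_mono)
  then have "real (card (Free V E F)) \<le> real (card (Free V E U)) + (\<Sum>g\<in>placements m V. real (card (hosting V E F U g)))"
    by simp
  also have "(\<Sum>g\<in>placements m V. real (card (hosting V E F U g))) \<le> real (card (placements m V)) * max 0 B"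
    using sum_bounded_above[of "placements m V" "\<lambda>g. real (card (hosting V E F U g))" "max 0 B"] B
    by (auto simp: le_max_iff_disj)
  also have "\<dots> \<le> real (card V) ^ m * max 0 B"
    using card_placements_le[OF fin(1), of m] by (intro mult_right_mono) (auto simp flip: of_nat_power)
  finally show ?thesis by simp
qed

lemma hosting_inside:
  assumes "X \<in> hosting V E F U g" "W \<subseteq> V"
  shows "X \<inter> inside E W \<in> Free W (inside E W) F"
proof -
  have "X \<in> Free V E F" using assms(1) by (simp add: hosting_def)
  then show ?thesis using assms(2) by (rule Free_inside)
qed

text \<open>If the vertices outside a universal host with a common neighbourhood attach to it in more than
  \<open>B\<close> ways, some set meeting all classes substantially is shattered, and the last colour class of
  \<open>F\<close> can be realised by the shattering vertices.\<close>

lemma attachments_bounded: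
  fixes F :: "'b dgraph"
  assumes G: "wf_graph (V, E)" and F: "wf_dgraph F" and k: "k > 0"
    and col: "\<And>u v. (u, v) \<in> snd F \<Longrightarrow> c u \<noteq> c v" "\<And>u. u \<in> fst F \<Longrightarrow> c u \<le> k"
    and U: "universal F k s \<gamma> U" and big: "\<gamma> * real s \<ge> 2 * real (card (fst F))"
    and B: "card {Q. Q \<subseteq> {..<k * s} \<and> (\<exists>i<k. real (card {j \<in> Q. j mod k = i}) < \<gamma> * real s)} \<le> B"
    and g: "g \<in> placements (k * s) V" and X: "X \<in> hosting V E F U g"
  shows "card ((\<lambda>v. {j. j < k * s \<and> arc E X (g j) v}) ` {v \<in> V - g ` {..<k * s}. {j. j < k * s \<and> {g j, v} \<in> E} = N}) \<le> B"
proof (rule ccontr)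
  let ?m = "k * s"
  let ?att = "\<lambda>v. {j. j < ?m \<and> arc E X (g j) v}"
  let ?VN = "{v \<in> V - g ` {..<?m}. {j. j < ?m \<and> {g j, v} \<in> E} = N}"
  define T where "T = ?att ` ?VN"
  assume "\<not> card ((\<lambda>v. {j. j < k * s \<and> arc E X (g j) v}) ` ?VN) \<le> B"
  then have TB: "B < card T" by (simp add: T_def)
  note FD = wf_dgraphD[OF F]
  let ?bad = "{Q. Q \<subseteq> {..<?m} \<and> (\<exists>i<k. real (card {j \<in> Q. j mod k = i}) < \<gamma> * real s)}"
  have TP: "T \<subseteq> Pow {..<?m}" by (auto simp: T_def)
  have fT: "finite ?bad" by (rule finite_subset[of _ "Pow {..<?m}"]) auto
  \<comment> \<open>More than \<open>B\<close> sets are shattered, but at most \<open>B\<close> sets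
    are thin in some class. So some shattered set is thick in every class.\<close>
  have "\<not> {Q. Q \<subseteq> {..<?m} \<and> shatters T Q} \<subseteq> ?bad"
  proof
    assume "{Q. Q \<subseteq> {..<?m} \<and> shatters T Q} \<subseteq> ?bad"
    then have "card {Q. Q \<subseteq> {..<?m} \<and> shatters T Q} \<le> card ?bad" by (rule card_mono[OF fT])
    then show False using card_le_card_shattered[OF _ TP] B TB by simp
  qed
  then have "\<exists>Q. (Q \<subseteq> {..<?m} \<and> shatters T Q) \<and> Q \<notin> ?bad" by (simp only: subset_iff mem_Collect_eq not_all not_imp)
  then obtain Q where Q: "Q \<subseteq> {..<?m}" "shatters T Q" and nb: "Q \<notin> ?bad" by blast
  have Qi: "\<gamma> * real s \<le> real (card {j \<in> Q. j mod k = i})" if "i < k" for i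
  proof (rule ccontr)
    assume "\<not> ?thesis"
    then have "real (card {j \<in> Q. j mod k = i}) < \<gamma> * real s" by (simp only: not_le)
    then have "Q \<in> ?bad" using Q(1) that by blast
    then show False using nb by simp
  qed
  \<comment> \<open>The whole of \<open>Q\<close> is one of the traces, so one vertex receives arcs
    from all of \<open>Q\<close>. As all vertices considered have the same neighbourhood
    \<open>N\<close>, each of them is adjacent to all of \<open>Q\<close>.\<close>
  have QN: "Q \<subseteq> N"
  proof -
    obtain Y where Y: "Y \<in> T" "Y \<inter> Q = Q" using Q(2) unfolding shatters_def by blast
    then obtain v where "v \<in> ?VN" "Y = ?att v" unfolding T_def by (elim imageE)
    then have "Y \<subseteq> N" using arc_edge by auto
    then show ?thesis using Y by blast
  qed
  define J where "J = {u \<in> fst F. c u < k}"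
  have cU: "\<And>J c W. J \<subseteq> fst F \<Longrightarrow> \<forall>(u, v)\<in>snd F. u \<in> J \<longrightarrow> v \<in> J \<longrightarrow> c u \<noteq> c v \<Longrightarrow>
        \<forall>u\<in>J. W u \<subseteq> {j. j < ?m \<and> j mod k = c u} \<and> \<gamma> * real s \<le> real (card (W u)) \<Longrightarrow>
        \<exists>f. inj_on f J \<and> (\<forall>u\<in>J. f u \<in> W u) \<and> (\<forall>(u, v)\<in>snd F. u \<in> J \<longrightarrow> v \<in> J \<longrightarrow> (f u, f v) \<in> snd U)"
    using U unfolding universal_def by blast
  have "\<exists>f. inj_on f J \<and> (\<forall>u\<in>J. f u \<in> {j \<in> Q. j mod k = c u}) \<and> (\<forall>(u, v)\<in>snd F. u \<in> J \<longrightarrow> v \<in> J \<longrightarrow> (f u, f v) \<in> snd U)"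
    by (rule cU[of J c]) (use col(1) Qi Q(1) in \<open>auto simp: J_def\<close>)
  then obtain f where f: "inj_on f J" "\<And>u. u \<in> J \<Longrightarrow> f u \<in> Q"
    "\<And>u v. (u, v) \<in> snd F \<Longrightarrow> u \<in> J \<Longrightarrow> v \<in> J \<Longrightarrow> (f u, f v) \<in> snd U" by fast
  define S where "S = fst F - J"
  have fQ: "finite Q" using Q(1) finite_subset by blast
  have "card S \<le> card (Q - f ` J)"
  proof -
    have "real (2 * card (fst F)) \<le> real (card {j \<in> Q. j mod k = 0})" using Qi[OF k] big by simp
    then have "2 * card (fst F) \<le> card Q"
      using card_mono[OF fQ, of "{j \<in> Q. j mod k = 0}"] by (metis (no_types, lifting) le_trans mem_Collect_eq of_nat_le_iff subsetI)
    moreover have "card (f ` J) \<le> card (fst F)" using FD by (intro order_trans[OF card_image_le card_mono]) (auto simp: J_def)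
    moreover have "card S \<le> card (fst F)" using FD by (intro card_mono) (auto simp: S_def)
    moreover have "card Q - card (f ` J) \<le> card (Q - f ` J)" by (rule diff_card_le_card_Diff) (use FD in \<open>auto simp: J_def\<close>)
    ultimately show ?thesis by linarith
  qed
  moreover have "finite S" using FD by (simp add: S_def)
  ultimately obtain d where d: "d ` S \<subseteq> Q - f ` J" "inj_on d S"
    using fQ by (meson card_le_inj finite_Diff)
  define pat where "pat x = {f u | u. u \<in> J \<and> (u, x) \<in> snd F} \<union> {d x}" for x
  have patQ: "pat x \<subseteq> Q" if "x \<in> S" for x using that f(2) d(1) by (auto simp: pat_def)
  have "\<exists>v. v \<in> ?VN \<and> ?att v \<inter> Q = pat x" if x: "x \<in> S" for x
  proof -
    obtain Y where Y: "Y \<in> T" "Y \<inter> Q = pat x" using Q(2) patQ[OF x] unfolding shatters_def by meson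
    then obtain v where "v \<in> ?VN" "Y = ?att v" unfolding T_def by (elim imageE)
    then show ?thesis using Y(2) by (intro exI[of _ v]) simp
  qed
  then have "\<exists>w. \<forall>x\<in>S. w x \<in> ?VN \<and> ?att (w x) \<inter> Q = pat x" by (intro bchoice ballI)
  then obtain w where w0: "\<forall>x\<in>S. w x \<in> ?VN \<and> ?att (w x) \<inter> Q = pat x" by (rule exE)
  then have w: "w x \<in> ?VN \<and> ?att (w x) \<inter> Q = pat x" if "x \<in> S" for x using that by (rule bspec)
  have gi: "inj_on g {..<?m}" and gV: "g ` {..<?m} \<subseteq> V" using g by (auto simp: placements_def)
  define \<phi> where "\<phi> u = (if u \<in> J then g (f u) else w u)" for u
  have fm: "f u < ?m" if "u \<in> J" for u using f(2)[OF that] Q(1) by auto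
  have winj: "inj_on w S"
  proof (rule inj_onI)
    fix x y assume xy: "x \<in> S" "y \<in> S" "w x = w y"
    then have "pat x = pat y" using w[OF xy(1)] w[OF xy(2)] by simp
    then have "d x \<in> pat y" by (auto simp: pat_def)
    then have "d x = d y" using d(1) xy by (auto simp: pat_def)
    then show "x = y" using d(2) xy by (auto dest: inj_onD)
  qed
  have "emb V E X F"
  proof (rule embI[of \<phi>])
    show "inj_on \<phi> (fst F)"
    proof (rule inj_onI)
      fix x y assume xy: "x \<in> fst F" "y \<in> fst F" "\<phi> x = \<phi> y"
      have gf: "g (f u) \<in> g ` {..<?m}" if "u \<in> J" for u using fm[OF that] by auto
      have wn: "w u \<notin> g ` {..<?m}" if "u \<in> S" for u using w[OF that] by auto
      show "x = y"
      proof (cases "x \<in> J"; cases "y \<in> J")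
        assume a: "x \<in> J" "y \<in> J"
        then have "f x = f y" using xy gi fm by (auto simp: \<phi>_def dest: inj_onD)
        then show ?thesis using f(1) a by (auto dest: inj_onD)
      next
        assume a: "x \<in> J" "y \<notin> J"
        then show ?thesis using xy gf[of x] wn[of y] by (simp add: \<phi>_def S_def)
      next
        assume a: "x \<notin> J" "y \<in> J"
        then show ?thesis using xy gf[of y] wn[of x] by (simp add: \<phi>_def S_def)
      next
        assume a: "x \<notin> J" "y \<notin> J"
        then show ?thesis using xy winj by (auto simp: \<phi>_def S_def dest: inj_onD)
      qed
    qed
    show "\<phi> u \<in> V" if "u \<in> fst F" for u
      using that w[of u] fm[of u] gV by (auto simp: \<phi>_def S_def)
    show "arc E X (\<phi> u) (\<phi> v)" if uv: "(u, v) \<in> snd F" for u v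
    proof -
      have uF: "u \<in> fst F" "v \<in> fst F" and ne: "c u \<noteq> c v" and anti: "(v, u) \<notin> snd F"
        using FD uv col by blast+
      show ?thesis
      proof (cases "u \<in> J"; cases "v \<in> J")
        assume a: "u \<in> J" "v \<in> J"
        then show ?thesis using f(3)[OF uv] X by (auto simp: \<phi>_def hosting_def)
      next
        assume a: "u \<in> J" "v \<notin> J"
        then have "f u \<in> pat v" using uv by (auto simp: pat_def)
        moreover have "v \<in> S" using a uF by (simp add: S_def)
        ultimately have "f u \<in> ?att (w v)" using w[of v] by blast
        then show ?thesis using a by (simp add: \<phi>_def)
      next
        assume a: "u \<notin> J" "v \<in> J"
        have uS: "u \<in> S" using a uF by (simp add: S_def)
        have "f v \<notin> pat u"
        proof
          assume "f v \<in> pat u"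
          then consider u' where "u' \<in> J" "(u', u) \<in> snd F" "f v = f u'" | "f v = d u" by (auto simp: pat_def)
          then show False
          proof cases
            case 1
            then show False using f(1) a anti by (auto dest: inj_onD)
          next
            case 2
            then show False using d(1) uS a by force
          qed
        qed
        then have "f v \<notin> ?att (w u)" using w[OF uS] f(2)[OF a(2)] by blast
        then have na: "\<not> arc E X (g (f v)) (w u)" using fm[OF a(2)] by simp
        have "f v \<in> N" using QN f(2) a by blast
        then have e: "{g (f v), w u} \<in> E" using w[OF uS] by auto
        then have "arc E X (w u) (g (f v))"
          using arc_asym[of "w u" "g (f v)" E X] na wf_graph_pair(1)[OF G e] by (metis insert_commute)
        then show ?thesis using a by (simp add: \<phi>_def)
      next
        \<comment> \<open>Both ends would have the last colour \<open>k\<close>, which spans no arc.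
          No edge among the shattering vertices is ever required.\<close>
        assume a: "u \<notin> J" "v \<notin> J"
        then have "c u = k" "c v = k" using col(2) uF by (auto simp: J_def le_less)
        then show ?thesis using ne by simp
      qed
    qed
  qed
  then show False using X by (auto simp: hosting_def Free_def)
qed

text \<open>The at most \<open>B\<close> attachments available to a neighbourhood depend on the
  orientation, so they are recorded in a table \<open>T\<close> of pairs (neighbourhood,
  attachment). There are at most \<open>2 ^ (2 ^ (2 * (k * s)))\<close> tables, a number independent
  of \<open>card V\<close>, and once the table is known every outside vertex has at most
  \<open>B\<close> attachments. The edges inside the host contribute the square in the
  exponent.\<close>

lemma hosting_count:
  fixes F :: "'b dgraph"
  assumes G: "wf_graph (V, E)" and F: "wf_dgraph F" and k: "k > 0"
    and col: "\<And>u v. (u, v) \<in> snd F \<Longrightarrow> c u \<noteq> c v" "\<And>u. u \<in> fst F \<Longrightarrow> c u \<le> k"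
    and U: "universal F k s \<gamma> U" and big: "\<gamma> * real s \<ge> 2 * real (card (fst F))"
    and B: "card {Q. Q \<subseteq> {..<k * s} \<and> (\<exists>i<k. real (card {j \<in> Q. j mod k = i}) < \<gamma> * real s)} \<le> B" "1 \<le> B"
    and g: "g \<in> placements (k * s) V"
  shows "card (hosting V E F U g) \<le> 2 ^ ((k * s)\<^sup>2 + 2 ^ (2 * (k * s))) * B ^ card V *
     card (Free (V - g ` {..<k * s}) (inside E (V - g ` {..<k * s})) F)"
proof -
  let ?m = "k * s"
  define A where "A = g ` {..<?m}"
  define E1 where "E1 = inside E (V - A)"
  define E2 where "E2 = E - E1"
  note fin = wf_graph_finite[OF G]
  have AV: "A \<subseteq> V" and gi: "inj_on g {..<?m}" using g by (auto simp: A_def placements_def)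
  have fA: "finite A" and cA: "card A = ?m" using gi by (auto simp: A_def card_image)
  have fE: "finite E1" "finite E2" using fin by (auto simp: E1_def E2_def inside_def)
  let ?nb = "\<lambda>v. {j. j < ?m \<and> {g j, v} \<in> E}"
  let ?att = "\<lambda>X v. {j. j < ?m \<and> arc E X (g j) v}"
  define \<T> where "\<T> = {T. T \<subseteq> Pow {..<?m} \<times> Pow {..<?m} \<and> (\<forall>N. card {S. (N, S) \<in> T} \<le> B)}"
  define P where "P = (\<Union>T\<in>\<T>. PiE (V - A) (\<lambda>v. {S. (?nb v, S) \<in> T}))"
  have fPP: "finite (Pow {..<?m} \<times> Pow {..<?m})" by simp
  have f\<T>: "finite \<T>" by (rule finite_subset[of _ "Pow (Pow {..<?m} \<times> Pow {..<?m})"]) (auto simp: \<T>_def)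
  have c\<T>: "card \<T> \<le> 2 ^ (2 ^ (2 * ?m))"
  proof -
    have "card \<T> \<le> card (Pow (Pow {..<?m} \<times> Pow {..<?m}))" by (rule card_mono) (auto simp: \<T>_def)
    also have "\<dots> = 2 ^ (2 ^ ?m * 2 ^ ?m)" by (simp add: card_Pow card_cartesian_product)
    also have "2 ^ ?m * 2 ^ ?m = (2::nat) ^ (2 * ?m)" by (simp add: mult_2 power_add)
    finally show ?thesis .
  qed
  have fS: "finite {S. (N, S) \<in> T}" if "T \<in> \<T>" for N T
    by (rule finite_subset[of _ "Pow {..<?m}"]) (use that in \<open>auto simp: \<T>_def\<close>)
  have fP: "finite P" unfolding P_def using f\<T> fin fS by (auto intro!: finite_PiE)
  have cP: "card P \<le> 2 ^ (2 ^ (2 * ?m)) * B ^ card V"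
  proof -
    have "card P \<le> (\<Sum>T\<in>\<T>. card (PiE (V - A) (\<lambda>v. {S. (?nb v, S) \<in> T})))"
      unfolding P_def by (rule card_UN_le[OF f\<T>])
    also have "\<dots> \<le> card \<T> * B ^ card V"
    proof -
      have "card (PiE (V - A) (\<lambda>v. {S. (?nb v, S) \<in> T})) \<le> B ^ card V" if T: "T \<in> \<T>" for T
      proof -
        have "card (PiE (V - A) (\<lambda>v. {S. (?nb v, S) \<in> T})) = (\<Prod>v\<in>V - A. card {S. (?nb v, S) \<in> T})"
          using fin by (simp add: card_PiE)
        also have "\<dots> \<le> (\<Prod>v\<in>V - A. B)" using T by (intro prod_mono) (auto simp: \<T>_def)
        also have "\<dots> = B ^ card (V - A)" by simp
        also have "\<dots> \<le> B ^ card V" using B(2) fin by (intro power_increasing card_mono) auto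
        finally show ?thesis .
      qed
      then have "(\<Sum>T\<in>\<T>. card (PiE (V - A) (\<lambda>v. {S. (?nb v, S) \<in> T}))) \<le> of_nat (card \<T>) * B ^ card V"
        by (rule sum_bounded_above)
      then show ?thesis by simp
    qed
    also have "\<dots> \<le> 2 ^ (2 ^ (2 * ?m)) * B ^ card V" using c\<T> by (rule mult_le_mono1)
    finally show ?thesis .
  qed
  have cA2: "card (inside E A) \<le> ?m\<^sup>2"
    using card_edges_le[OF wf_graph_inside[OF G AV]] cA by (simp add: power2_eq_square)
  have fiA: "finite (inside E A)" using fin by (simp add: inside_def)
  have "card (hosting V E F U g) \<le> card (Free (V - A) E1 F) * (2 ^ (?m\<^sup>2) * (2 ^ (2 ^ (2 * ?m)) * B ^ card V))"
  proof (rule card_subsets_split[of E1 E2])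
    fix X assume X: "X \<in> hosting V E F U g"
    then show "X \<subseteq> E1 \<union> E2" by (auto simp: hosting_def Free_def E2_def)
    show "X \<inter> E1 \<in> Free (V - A) E1 F" unfolding E1_def by (rule hosting_inside[OF X]) auto
  next
    fix Y assume Y: "Y \<in> Free (V - A) E1 F"
    let ?S = "{Z. Z \<subseteq> E2 \<and> Y \<union> Z \<in> hosting V E F U g}"
    let ?h = "\<lambda>Z. (Z \<inter> inside E A, \<lambda>v\<in>V - A. ?att (Y \<union> Z) v)"
    have "inj_on ?h ?S"
    proof (rule inj_onI)
      fix Z Z' assume Z: "Z \<in> ?S" and Z': "Z' \<in> ?S" and eq: "?h Z = ?h Z'"
      have att: "?att (Y \<union> Z) v = ?att (Y \<union> Z') v" if "v \<in> V - A" for v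
        using eq that by (metis (no_types, lifting) prod.inject restrict_apply')
      have "e \<in> Z \<longleftrightarrow> e \<in> Z'" if e: "e \<in> E2" for e
      proof -
        have eE: "e \<in> E" "e \<notin> E1" using e by (auto simp: E2_def)
        then have eY: "e \<notin> Y" using Y by (auto simp: Free_def)
        obtain a b where ab: "e = {a, b}" "a \<noteq> b" "a \<in> V" "b \<in> V" using wf_graph_edge[OF G eE(1)] by metis
        show ?thesis
        proof (cases "a \<in> A \<and> b \<in> A")
          case True
          then have "e \<in> inside E A" using ab eE by (auto simp: inside_def)
          then show ?thesis using eq by (metis (no_types, lifting) IntD1 IntI prod.inject)
        next
          case False
          have "\<exists>j v. j < ?m \<and> v \<in> V - A \<and> e = {g j, v}"
          proof -
            have "a \<in> A \<or> b \<in> A" using ab eE by (auto simp: E1_def inside_def)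
            then consider "a \<in> A" "b \<in> V - A" | "b \<in> A" "a \<in> V - A" using False ab by blast
            then show ?thesis using ab(1) by cases (auto simp: A_def insert_commute)
          qed
          then obtain j v where jv: "j < ?m" "v \<in> V - A" "e = {g j, v}" by blast
          have "arc E (Y \<union> Z) (g j) v \<longleftrightarrow> arc E (Y \<union> Z') (g j) v" using att[OF jv(2)] jv(1) by blast
          then show ?thesis using jv(3) eE eY by (auto simp: arc_def)
        qed
      qed
      then show "Z = Z'" using Z Z' by blast
    qed
    moreover have "?h ` ?S \<subseteq> Pow (inside E A) \<times> P"
    proof
      fix z assume "z \<in> ?h ` ?S"
      then obtain Z where Z: "Z \<subseteq> E2" "Y \<union> Z \<in> hosting V E F U g" "z = ?h Z" by auto
      let ?X = "Y \<union> Z"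
      define T where "T = (\<lambda>v. (?nb v, ?att ?X v)) ` (V - A)"
      have "card {S. (N, S) \<in> T} \<le> B" for N
      proof -
        have "{S. (N, S) \<in> T} = ?att ?X ` {v \<in> V - A. ?nb v = N}" by (auto simp: T_def)
        then show ?thesis using attachments_bounded[OF G F k col U big B(1) g Z(2), where N = N] by (simp add: A_def)
      qed
      then have "T \<in> \<T>" by (auto simp: \<T>_def T_def)
      moreover have "(\<lambda>v\<in>V - A. ?att ?X v) \<in> PiE (V - A) (\<lambda>v. {S. (?nb v, S) \<in> T})"
        by (auto simp: T_def)
      ultimately have "(\<lambda>v\<in>V - A. ?att ?X v) \<in> P" unfolding P_def by blast
      then show "z \<in> Pow (inside E A) \<times> P" using Z(3) by simp
    qed
    ultimately have "card ?S \<le> card (Pow (inside E A) \<times> P)"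
      using card_inj_on_le fP fiA by blast
    also have "\<dots> = 2 ^ card (inside E A) * card P" using fiA by (simp add: card_cartesian_product card_Pow)
    also have "\<dots> \<le> 2 ^ (?m\<^sup>2) * (2 ^ (2 ^ (2 * ?m)) * B ^ card V)"
      by (rule mult_le_mono[OF _ cP]) (use cA2 in \<open>simp add: power_increasing\<close>)
    finally show "card ?S \<le> 2 ^ (?m\<^sup>2) * (2 ^ (2 ^ (2 * ?m)) * B ^ card V)" .
  qed (use fE fin in \<open>auto simp: E2_def finite_Free\<close>)
  then show ?thesis by (simp add: A_def E1_def power_add ac_simps)
qed


lemma card_residue_class:
  assumes "i < k"
  shows "card {j. j < k * s \<and> j mod k = i} = s"
proof -
  have "bij_betw (\<lambda>q. q * k + i) {..<s} {j. j < k * s \<and> j mod k = i}"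
  proof (rule bij_betw_byWitness[where f' = "\<lambda>j. j div k"])
    show "(\<lambda>q. q * k + i) ` {..<s} \<subseteq> {j. j < k * s \<and> j mod k = i}"
    proof clarify
      fix q assume "q < s"
      then have "(q + 1) * k \<le> s * k" by (intro mult_le_mono1) simp
      then show "q * k + i < k * s \<and> (q * k + i) mod k = i" using assms by (simp add: algebra_simps)
    qed
    show "(\<lambda>j. j div k) ` {j. j < k * s \<and> j mod k = i} \<subseteq> {..<s}"
      by (auto simp: less_mult_imp_div_less mult.commute)
  qed (use assms in auto)
  then show ?thesis by (simp add: bij_betw_same_card[symmetric])
qed

lemma power_eq_powr_log: "0 < x \<Longrightarrow> x ^ m = 2 powr (real m * log 2 x)"
  by (simp add: powr_realpow[symmetric] powr_def log_def)

lemma eventually_log_le_linear: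
  fixes a b d :: real
  assumes "d > 0"
  obtains n0 :: nat where "\<And>n. n \<ge> n0 \<Longrightarrow> a * log 2 (real n) + b \<le> d * real n"
proof -
  have "eventually (\<lambda>n :: nat. \<bar>a\<bar> * log 2 (real n) + b \<le> d * real n) at_top"
    using assms by real_asymp
  then obtain n0 where n0: "\<And>n. n \<ge> n0 \<Longrightarrow> \<bar>a\<bar> * log 2 (real n) + b \<le> d * real n"
    by (auto simp: eventually_at_top_linorder)
  have "a * log 2 (real n) + b \<le> d * real n" if n: "n \<ge> max n0 1" for n
  proof -
    have "0 \<le> log 2 (real n)" using n by simp
    then have "a * log 2 (real n) \<le> \<bar>a\<bar> * log 2 (real n)" by (intro mult_right_mono) auto
    then show ?thesis using n0[of n] n by simp
  qed
  then show ?thesis by (rule that)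
qed

text \<open>A subset that is thin in one class is nearly determined by its trace on the other
  \<open>k - 1\<close> classes; choosing the class costs a factor \<open>k\<close>, absorbed for
  large \<open>s\<close>. Used as the bound \<open>B\<close> on attachments, this is where the
  density \<open>1 - 1 / k\<close> comes from: \<open>(k - 1) * s\<close> bits per outside vertex
  and host of \<open>k * s\<close> vertices.\<close>

lemma poor_subsets:
  fixes \<epsilon> :: real
  assumes "\<epsilon> > 0" "k > 0"
  obtains \<gamma> :: real and s0 where "\<gamma> > 0"
    "\<And>s. s \<ge> s0 \<Longrightarrow> real (card {Q. Q \<subseteq> {..<k * s} \<and> (\<exists>i<k. real (card {j \<in> Q. j mod k = i}) < \<gamma> * real s)})
       \<le> 2 powr ((real k - 1 + \<epsilon>) * real s)"
proof -
  have "\<epsilon> / 2 > 0" using assms by simp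
  then obtain \<gamma> :: real where \<gamma>: "\<gamma> > 0" and few: "\<And>(S :: nat set) M. finite S \<Longrightarrow> real (card S) \<le> M \<Longrightarrow>
      real (card {X. X \<subseteq> S \<and> real (card X) < \<gamma> * M}) \<le> 2 powr (\<epsilon> / 2 * M)"
    using few_subsets[where ?'c = nat] by meson
  define s0 where "s0 = nat \<lceil>2 * log 2 (real k) / \<epsilon>\<rceil>"
  have "real (card {Q. Q \<subseteq> {..<k * s} \<and> (\<exists>i<k. real (card {j \<in> Q. j mod k = i}) < \<gamma> * real s)})
       \<le> 2 powr ((real k - 1 + \<epsilon>) * real s)" (is "real (card ?S) \<le> _") if s: "s \<ge> s0" for s
  proof -
    let ?A = "\<lambda>i. {j. j < k * s \<and> j mod k = i}"
    define P where "P i = {Q. Q \<subseteq> {..<k * s} \<and> real (card {j \<in> Q. j mod k = i}) < \<gamma> * real s}" for i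
    have fP: "finite (P i)" for i by (rule finite_subset[of _ "Pow {..<k * s}"]) (auto simp: P_def)
    have cP: "real (card (P i)) \<le> 2 powr ((real k - 1 + \<epsilon> / 2) * real s)" if i: "i < k" for i
    proof -
      define R where "R = {X. X \<subseteq> ?A i \<and> real (card X) < \<gamma> * real s}"
      have fR: "finite R" by (rule finite_subset[of _ "Pow {..<k * s}"]) (auto simp: R_def)
      have "card (P i) \<le> card R * 2 ^ card ({..<k * s} - ?A i)"
      proof (rule card_subsets_split[of "?A i" "{..<k * s} - ?A i"])
        fix X assume X: "X \<in> P i"
        have "X \<inter> ?A i = {j \<in> X. j mod k = i}" using X by (auto simp: P_def)
        then show "X \<inter> ?A i \<in> R" using X by (auto simp: R_def P_def)
        show "X \<subseteq> ?A i \<union> ({..<k * s} - ?A i)" using X by (auto simp: P_def)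
      next
        fix Y
        have "card {Z. Z \<subseteq> {..<k * s} - ?A i \<and> Y \<union> Z \<in> P i} \<le> card (Pow ({..<k * s} - ?A i))"
          by (rule card_mono) auto
        then show "card {Z. Z \<subseteq> {..<k * s} - ?A i \<and> Y \<union> Z \<in> P i} \<le> 2 ^ card ({..<k * s} - ?A i)"
          by (simp add: card_Pow)
      qed (use fR in auto)
      also have "card ({..<k * s} - ?A i) = k * s - s"
        using card_residue_class[OF i, of s] by (subst card_Diff_subset) auto
      finally have "real (card (P i)) \<le> real (card R) * 2 ^ (k * s - s)"
        by (metis of_nat_le_iff of_nat_mult of_nat_numeral of_nat_power)
      also have "\<dots> \<le> 2 powr (\<epsilon> / 2 * real s) * 2 ^ (k * s - s)"
        unfolding R_def by (intro mult_right_mono few) (use card_residue_class[OF i, of s] in auto)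
      also have "2 ^ (k * s - s) = 2 powr ((real k - 1) * real s)"
      proof -
        have "s \<le> k * s" using assms(2) by simp
        then have "real (k * s - s) = (real k - 1) * real s" by (simp add: of_nat_diff left_diff_distrib)
        then show ?thesis by (metis powr_realpow zero_less_numeral)
      qed
      finally show ?thesis by (simp add: powr_add[symmetric] algebra_simps)
    qed
    have "?S = (\<Union>i\<in>{..<k}. P i)" by (auto simp: P_def)
    then have "real (card ?S) \<le> (\<Sum>i<k. real (card (P i)))"
      using card_UN_le[of "{..<k}" P] by (metis finite_lessThan of_nat_le_iff of_nat_sum)
    also have "\<dots> \<le> real k * 2 powr ((real k - 1 + \<epsilon> / 2) * real s)"
      using sum_bounded_above[of "{..<k}" "\<lambda>i. real (card (P i))"] cP by auto
    also have "\<dots> = 2 powr (log 2 (real k) + (real k - 1 + \<epsilon> / 2) * real s)" using assms by (simp add: powr_add)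
    also have "\<dots> \<le> 2 powr ((real k - 1 + \<epsilon>) * real s)"
    proof -
      have "real s \<ge> 2 * log 2 (real k) / \<epsilon>" using s unfolding s0_def by linarith
      then have "log 2 (real k) \<le> \<epsilon> / 2 * real s" using assms by (simp add: field_simps)
      then show ?thesis by (simp add: algebra_simps)
    qed
    finally show ?thesis .
  qed
  then show ?thesis using \<gamma> that by blast
qed

text \<open>The limit of \<open>turan_num n k / n ^ 2\<close>; at \<open>k = 0\<close> division by
  zero gives the value 0, which suits the base case.\<close>

definition ext_density :: "nat \<Rightarrow> real" where
  "ext_density k = (real k - 1) / (2 * real k)"

text \<open>Orientations without a universal host for \<open>F\<close> are free of a graph with one
  colour fewer and fall under the induction hypothesis; this is why \<open>F\<close> lives on the
  naturals, the vertex type of the hosts. From the others a host is deleted, and the attachments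
  cost what \<open>ext_density\<close> allows. Only the leading term is claimed, so a slack
  \<open>\<beta>\<close> absorbs the rest.\<close>

lemma orientation_count_asymptotic:
  fixes F :: "nat dgraph"
  assumes "wf_dgraph F" "\<And>u. u \<in> fst F \<Longrightarrow> c u \<le> k" "\<And>u v. (u, v) \<in> snd F \<Longrightarrow> c u \<noteq> c v" "\<beta> > 0"
  shows "\<exists>n0. \<forall>V E. wf_graph (V, E) \<longrightarrow> n0 \<le> card V \<longrightarrow>
    real (card (Free V E F)) \<le> 2 powr ((ext_density k + \<beta>) * (real (card V))\<^sup>2)"
  using assms
proof (induction k arbitrary: F c \<beta>)
  case 0
  note FD = wf_dgraphD[OF 0(1)]
  have sF: "snd F = {}"
  proof (rule equals0I)
    fix e assume "e \<in> snd F"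
    then obtain u v where uv: "(u, v) \<in> snd F" by (cases e) auto
    then have "c u = 0" "c v = 0" using FD(4)[OF uv] 0(2) by auto
    then show False using 0(3)[OF uv] by simp
  qed
  have "Free V E F = {}" if G: "wf_graph (V, E)" and n: "card (fst F) \<le> card V" for V E
  proof -
    obtain f where "f ` fst F \<subseteq> V" "inj_on f (fst F)"
      using card_le_inj[OF FD(1) wf_graph_finite(1)[OF G] n] by blast
    then have "emb V E X F" for X by (intro embI[of f]) (use sF in auto)
    then show ?thesis by (auto simp: Free_def)
  qed
  then show ?case by (intro exI[of _ "card (fst F)"]) auto
next
  case (Suc k)
  define K where "K = Suc k"
  define \<beta>1 where "\<beta>1 = \<beta> / 2"
  have K: "K > 0" and \<beta>1: "\<beta>1 > 0" using Suc by (auto simp: K_def \<beta>1_def)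
  obtain \<gamma> :: real and s1 where \<gamma>: "\<gamma> > 0" and poor: "\<And>s. s \<ge> s1 \<Longrightarrow>
     real (card {Q. Q \<subseteq> {..<K * s} \<and> (\<exists>i<K. real (card {j \<in> Q. j mod K = i}) < \<gamma> * real s)})
       \<le> 2 powr ((real K - 1 + \<beta>1) * real s)" using poor_subsets[OF \<beta>1 K] by blast
  obtain s2 where s2: "\<And>s. s \<ge> s2 \<Longrightarrow> \<exists>U. universal F K s \<gamma> U"
    using universal_exists[OF Suc.prems(1) \<gamma> K] by blast
  define s where "s = max (max s1 s2) (nat \<lceil>2 * real (card (fst F)) / \<gamma>\<rceil> + 1)"
  have s: "s \<ge> s1" "s \<ge> s2" "s \<ge> 1" by (auto simp: s_def)
  have big: "\<gamma> * real s \<ge> 2 * real (card (fst F))"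
  proof -
    have "real s \<ge> 2 * real (card (fst F)) / \<gamma>" unfolding s_def by linarith
    then show ?thesis using \<gamma> by (simp add: field_simps)
  qed
  obtain U where U: "universal F K s \<gamma> U" using s2 s by blast
  then have U': "fst U = {..<K * s}" "wf_dgraph U" "\<And>a b. (a, b) \<in> snd U \<Longrightarrow> a mod K \<noteq> b mod K"
    by (auto simp: universal_def)
  have "\<exists>n0. \<forall>V E. wf_graph (V, E) \<longrightarrow> n0 \<le> card V \<longrightarrow>
    real (card (Free V E U)) \<le> 2 powr ((ext_density k + \<beta>1 / 2) * (real (card V))\<^sup>2)"
    by (rule Suc.IH[of U "\<lambda>j. j mod K"]) (use U' \<beta>1 K_def in \<open>auto simp: less_Suc_eq_le[symmetric]\<close>)
  then obtain n1 where n1: "\<And>V E. wf_graph (V, E) \<Longrightarrow> n1 \<le> card V \<Longrightarrow>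
    real (card (Free V E U)) \<le> 2 powr ((ext_density k + \<beta>1 / 2) * (real (card V))\<^sup>2)" by blast
  define m where "m = K * s"
  \<comment> \<open>Half of the slack \<open>\<beta>\<close> is spent here, on placements and
    attachments. The other half absorbs the constant \<open>C\<close>, which covers all graphs on
    fewer than \<open>n0\<close> vertices.\<close>
  define b where "b = ext_density K + \<beta>1"
  define c0 where "c0 = m\<^sup>2 + 2 ^ (2 * m)"
  have m: "m \<ge> 1" using K s by (simp add: m_def)
  have ed: "0 \<le> ext_density K" "ext_density k \<le> ext_density K"
    by (cases "k = 0"; simp add: ext_density_def K_def field_simps)+
  have b0: "b > 0" using ed \<beta>1 by (simp add: b_def)
  obtain n2 where n2: "\<And>n. n \<ge> n2 \<Longrightarrow> real m * log 2 (real n) + (real c0 + 1 + b * (real m)\<^sup>2) \<le> (\<beta>1 * real s) * real n"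
    using eventually_log_le_linear[of "\<beta>1 * real s" "real m" "real c0 + 1 + b * (real m)\<^sup>2"] \<beta>1 s(3) by auto
  define n0 where "n0 = max (max n1 n2) (m + 1 + nat \<lceil>2 / \<beta>1\<rceil>)"
  have n0: "n0 \<ge> n1" "n0 \<ge> n2" "n0 \<ge> m + 1" by (auto simp: n0_def)
  have n0b: "real n0 \<ge> 2 / \<beta>1" unfolding n0_def by linarith
  define C where "C = (real n0)\<^sup>2"
  define B where "B = nat \<lfloor>2 powr ((real K - 1 + \<beta>1) * real s)\<rfloor>"
  have B1: "1 \<le> B"
  proof -
    have "1 \<le> 2 powr ((real K - 1 + \<beta>1) * real s)"
      using K \<beta>1 by (intro ge_one_powr_ge_zero) auto
    then show ?thesis unfolding B_def by linarith
  qed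
  have BU: "real B \<le> 2 powr ((real K - 1 + \<beta>1) * real s)" by (simp add: B_def)
  have BL: "card {Q. Q \<subseteq> {..<K * s} \<and> (\<exists>i<K. real (card {j \<in> Q. j mod K = i}) < \<gamma> * real s)} \<le> B"
    using poor[OF s(1)] unfolding B_def by linarith
  have main: "real (card (Free V E F)) \<le> 2 powr (b * (real (card V))\<^sup>2 + C)" if "wf_graph (V, E)" for V E
    using that
  proof (induction "card V" arbitrary: V E rule: less_induct)
    case less
    note G = less.prems
    note fin = wf_graph_finite[OF G]
    define n where "n = card V"
    show ?case
    proof (cases "n < n0")
      case True
      have "real (card (Free V E F)) \<le> 2 ^ card E" using card_Free_le[OF fin(2), of V F]
        by (metis of_nat_le_iff of_nat_numeral of_nat_power)
      also have "\<dots> = 2 powr (real (card E))" by (simp add: powr_realpow)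
      also have "\<dots> \<le> 2 powr (b * (real (card V))\<^sup>2 + C)"
      proof -
        have "card E \<le> n0\<^sup>2" using card_edges_le[OF G] True
          by (metis le_trans less_imp_le n_def power2_eq_square power_mono zero_le)
        then have "real (card E) \<le> C" unfolding C_def by (metis of_nat_le_iff of_nat_power)
        moreover have "0 \<le> b * (real (card V))\<^sup>2" using b0 by simp
        ultimately show ?thesis by simp
      qed
      finally show ?thesis .
    next
      case False
      then have nn: "n \<ge> n0" by simp
      have n1': "real n \<ge> 1" using nn n0 m by linarith
      define R where "R = 2 powr (real c0 + (real K - 1 + \<beta>1) * real s * real n + b * (real n - real m)\<^sup>2 + C)"
      have host: "real (card (hosting V E F U g)) \<le> R" if g: "g \<in> placements m V" for g
      proof -
        let ?A = "g ` {..<K * s}"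
        have gi: "inj_on g {..<m}" "?A \<subseteq> V" using g by (auto simp: placements_def m_def)
        have cA: "card ?A = m" using gi by (simp add: card_image m_def)
        have cVA: "card (V - ?A) = n - m" using gi cA by (simp add: card_Diff_subset n_def)
        have mn: "m \<le> n" using nn n0 by linarith
        have lt: "card (V - ?A) < card V" using cVA mn m n_def by linarith
        have "real (card (Free (V - ?A) (inside E (V - ?A)) F)) \<le> 2 powr (b * (real (card (V - ?A)))\<^sup>2 + C)"
          using less.hyps[OF lt wf_graph_inside[OF G]] by auto
        also have "real (card (V - ?A)) = real n - real m" using cVA mn by (simp add: of_nat_diff)
        finally have IH: "real (card (Free (V - ?A) (inside E (V - ?A)) F)) \<le> 2 powr (b * (real n - real m)\<^sup>2 + C)" .
        have "card (hosting V E F U g) \<le> 2 ^ c0 * B ^ n * card (Free (V - ?A) (inside E (V - ?A)) F)"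
          using hosting_count[OF G Suc.prems(1) K _ _ U big BL B1, where c = c and g = g] Suc.prems(2,3) g
          by (simp add: K_def[symmetric] m_def c0_def n_def)
        then have "real (card (hosting V E F U g)) \<le> 2 ^ c0 * real B ^ n * real (card (Free (V - ?A) (inside E (V - ?A)) F))"
          by (metis (mono_tags, lifting) of_nat_le_iff of_nat_mult of_nat_numeral of_nat_power)
        also have "\<dots> \<le> 2 ^ c0 * (2 powr ((real K - 1 + \<beta>1) * real s)) ^ n * 2 powr (b * (real n - real m)\<^sup>2 + C)"
          by (intro mult_mono power_mono BU IH) auto
        also have "\<dots> = R"
          by (simp add: R_def powr_add powr_realpow[symmetric] powr_powr)
        finally show ?thesis .
      qed
      have "real (card (Free V E F)) \<le> real (card (Free V E U)) + real (card V) ^ m * max 0 R"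
        by (rule card_Free_le_hosting[OF G _ U'(2) host]) (use U' in \<open>simp_all add: m_def\<close>)
      also have "max 0 R = R" by (simp add: R_def)
      also have "real (card (Free V E U)) \<le> 2 powr (b * (real n)\<^sup>2 + C - 1)"
      proof -
        have "real (card (Free V E U)) \<le> 2 powr ((ext_density k + \<beta>1 / 2) * (real n)\<^sup>2)"
          using n1[OF G] nn n0 by (simp add: n_def)
        also have "\<dots> \<le> 2 powr (b * (real n)\<^sup>2 + C - 1)"
        proof (rule powr_mono)
          have "real n \<ge> 2 / \<beta>1" using n0b nn by linarith
          then have "1 \<le> \<beta>1 / 2 * real n" using \<beta>1 by (simp add: field_simps)
          also have "\<dots> \<le> \<beta>1 / 2 * real n * real n" using n1' \<beta>1 by simp
          finally have "1 \<le> \<beta>1 / 2 * (real n)\<^sup>2" by (simp add: power2_eq_square)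
          moreover have "ext_density k * (real n)\<^sup>2 \<le> ext_density K * (real n)\<^sup>2" using ed by (intro mult_right_mono) auto
          moreover have "C \<ge> 0" by (simp add: C_def)
          ultimately show "(ext_density k + \<beta>1 / 2) * (real n)\<^sup>2 \<le> b * (real n)\<^sup>2 + C - 1"
            by (simp add: b_def algebra_simps)
        qed auto
        finally show ?thesis .
      qed
      also have "real (card V) ^ m * R \<le> 2 powr (b * (real n)\<^sup>2 + C - 1)"
      proof -
        have "real (card V) ^ m = 2 powr (real m * log 2 (real n))"
          using n1' by (simp add: n_def[symmetric] power_eq_powr_log)
        then have "real (card V) ^ m * R = 2 powr (real m * log 2 (real n) + (real c0 + (real K - 1 + \<beta>1) * real s * real n + b * (real n - real m)\<^sup>2 + C))"
          by (simp only: R_def powr_add)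
        also have "\<dots> \<le> 2 powr (b * (real n)\<^sup>2 + C - 1)"
        proof (rule powr_mono)
          \<comment> \<open>Passing from \<open>n\<close> to \<open>n - m\<close> lowers
            \<open>ext_density K * n ^ 2\<close> by about \<open>2 * ext_density K * m * n\<close>,
            which equals the \<open>(K - 1) * s * n\<close> spent on attachments. The surplus
            \<open>2 * \<beta>1 * m * n\<close> pays for the error in the attachments, the
            placements and the constants.\<close>
          have e1: "b * (real n - real m)\<^sup>2 = b * (real n)\<^sup>2 - 2 * b * real m * real n + b * (real m)\<^sup>2"
            by (simp add: power2_eq_square algebra_simps)
          have "2 * ext_density K * real m = (real K - 1) * real s"
            using K by (simp add: ext_density_def m_def)
          moreover have "2 * b * real m * real n = (2 * ext_density K * real m) * real n + 2 * \<beta>1 * real m * real n"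
            by (simp add: b_def algebra_simps)
          ultimately have e2: "2 * b * real m * real n = (real K - 1) * real s * real n + 2 * \<beta>1 * real K * real s * real n"
            by (simp add: m_def)
          have "real m * log 2 (real n) + (real c0 + 1 + b * (real m)\<^sup>2) \<le> (\<beta>1 * real s) * real n"
            using n2 nn n0 by simp
          moreover have "\<beta>1 * real s * real n * 1 \<le> \<beta>1 * real s * real n * real K"
            using K \<beta>1 by (intro mult_left_mono) auto
          ultimately show "real m * log 2 (real n) + (real c0 + (real K - 1 + \<beta>1) * real s * real n + b * (real n - real m)\<^sup>2 + C) \<le> b * (real n)\<^sup>2 + C - 1"
            unfolding e1 e2 by (simp add: algebra_simps)
        qed auto
        finally show ?thesis .
      qed
      also have "2 powr (b * (real n)\<^sup>2 + C - 1) + 2 powr (b * (real n)\<^sup>2 + C - 1) = 2 powr (b * (real n)\<^sup>2 + C)"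
        by (simp add: powr_diff)
      finally show ?thesis by (simp add: n_def)
    qed
  qed
  define n3 where "n3 = nat \<lceil>C / \<beta>1\<rceil> + 1"
  have "real (card (Free V E F)) \<le> 2 powr ((ext_density K + \<beta>) * (real (card V))\<^sup>2)"
    if G: "wf_graph (V, E)" and n: "card V \<ge> n3" for V E
  proof -
    have "real (card V) \<ge> C / \<beta>1" "real (card V) \<ge> 1" using n unfolding n3_def by linarith+
    then have "C \<le> \<beta>1 * real (card V)" "real (card V) \<ge> 1" using \<beta>1 by (auto simp: field_simps)
    moreover from this have "\<beta>1 * real (card V) * 1 \<le> \<beta>1 * real (card V) * real (card V)" using \<beta>1 by (intro mult_left_mono) auto
    ultimately have "C \<le> \<beta>1 * (real (card V))\<^sup>2" by (simp add: power2_eq_square)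
    then have "b * (real (card V))\<^sup>2 + C \<le> (ext_density K + \<beta>) * (real (card V))\<^sup>2"
      by (simp add: b_def \<beta>1_def algebra_simps)
    then show ?thesis using main[OF G] by (meson le_less_trans not_le one_less_numeral_iff order_trans powr_mono semiring_norm(76) less_imp_le)
  qed
  then show ?case unfolding K_def by blast
qed

section \<open>Attachments of a vertex set to the classes\<close>

text \<open>The candidates in \<open>Y\<close> for a vertex of \<open>F\<close> whose adjacencies to
  \<open>Z\<close> are prescribed: \<open>\<sigma>\<close> is the set of its in-neighbours in
  \<open>Z\<close>, and the rest of \<open>Z\<close> consists of out-neighbours.\<close>

definition matching :: "nat set set \<Rightarrow> nat set set \<Rightarrow> nat set \<Rightarrow> nat set \<Rightarrow> nat set \<Rightarrow> nat set" where
  "matching E X Z Y \<sigma> = {y \<in> Y. \<forall>z\<in>Z. {z, y} \<in> E \<and> (arc E X z y \<longleftrightarrow> z \<in> \<sigma>)}"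

lemma matching_cong:
  assumes "\<And>z y. z \<in> Z \<Longrightarrow> y \<in> Y \<Longrightarrow> {z, y} \<in> E \<Longrightarrow> {z, y} \<in> X \<longleftrightarrow> {z, y} \<in> X'"
  shows "matching E X Z Y \<sigma> = matching E X' Z Y \<sigma>"
  unfolding matching_def arc_def using assms by blast

lemma matching_Int_between: "matching E (X \<inter> between E Z Y) Z Y \<sigma> = matching E X Z Y \<sigma>"
  by (rule matching_cong) (auto simp: between_def)

text \<open>If \<open>y\<close> is joined to all of \<open>Z\<close>, exactly one of the
  \<open>2 ^ card Z\<close> orientations of these edges shows the pattern and gets weight
  \<open>x\<close>. If an edge is absent, there are at most half as many orientations, all of weight
  1, and the bound still holds.\<close>

lemma sum_power_matching_single:
  fixes x :: real
  assumes Z: "finite Z" "Z \<noteq> {}" "y \<notin> Z" and x: "0 \<le> x"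
  shows "(\<Sum>X\<in>Pow (between E Z {y}). x ^ card (matching E X Z {y} \<sigma>)) \<le> 2 ^ card Z - 1 + x"
proof -
  let ?B = "between E Z {y}"
  have inj: "inj_on (\<lambda>z. {z, y}) Z" by (rule inj_onI) (auto simp: doubleton_eq_iff)
  have Bim: "?B = (\<lambda>z. {z, y}) ` {z \<in> Z. {z, y} \<in> E}" by (auto simp: between_def)
  have cB: "card ?B = card {z \<in> Z. {z, y} \<in> E}" unfolding Bim
    by (rule card_image) (rule inj_on_subset[OF inj], auto)
  have fB: "finite ?B" using Z by (simp add: Bim)
  show ?thesis
  proof (cases "\<forall>z\<in>Z. {z, y} \<in> E")
    case True
    then have "{z \<in> Z. {z, y} \<in> E} = Z" by auto
    then have cB: "card ?B = card Z" and Bim: "?B = (\<lambda>z. {z, y}) ` Z" using cB Bim by simp_all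
    define X0 where "X0 = (\<lambda>z. {z, y}) ` {z \<in> Z. z < y \<longleftrightarrow> z \<in> \<sigma>}"
    have X0B: "X0 \<subseteq> ?B" by (auto simp: X0_def Bim)
    have m0: "matching E X Z {y} \<sigma> = {}" if X: "X \<subseteq> ?B" "X \<noteq> X0" for X
    proof (rule ccontr)
      assume "matching E X Z {y} \<sigma> \<noteq> {}"
      then have *: "\<And>z. z \<in> Z \<Longrightarrow> ({z, y} \<in> X \<longleftrightarrow> z < y) \<longleftrightarrow> z \<in> \<sigma>"
        using True by (auto simp: matching_def arc_def)
      have "{z, y} \<in> X \<longleftrightarrow> {z, y} \<in> X0" if z: "z \<in> Z" for z
      proof -
        have "{z, y} \<in> X0 \<longleftrightarrow> (z < y \<longleftrightarrow> z \<in> \<sigma>)"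
          unfolding X0_def using z inj by (auto simp: inj_on_def)
        then show ?thesis using *[OF z] by blast
      qed
      then have "X = X0" using X(1) X0B unfolding Bim by blast
      then show False using X(2) by simp
    qed
    have m1: "matching E X0 Z {y} \<sigma> = {y}"
    proof -
      have "arc E X0 z y \<longleftrightarrow> z \<in> \<sigma>" if z: "z \<in> Z" for z
      proof -
        have "{z, y} \<in> X0 \<longleftrightarrow> (z < y \<longleftrightarrow> z \<in> \<sigma>)"
          unfolding X0_def using z inj by (auto simp: inj_on_def)
        then show ?thesis using True z by (auto simp: arc_def)
      qed
      then show ?thesis using True by (auto simp: matching_def)
    qed
    have "(\<Sum>X\<in>Pow ?B. x ^ card (matching E X Z {y} \<sigma>)) =
        x ^ card (matching E X0 Z {y} \<sigma>) + (\<Sum>X\<in>Pow ?B - {X0}. x ^ card (matching E X Z {y} \<sigma>))"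
      using fB X0B by (intro sum.remove) auto
    also have "(\<Sum>X\<in>Pow ?B - {X0}. x ^ card (matching E X Z {y} \<sigma>)) = (\<Sum>X\<in>Pow ?B - {X0}. 1)"
      by (rule sum.cong) (use m0 in auto)
    also have "\<dots> = 2 ^ card Z - 1"
      using fB X0B cB by (simp add: card_Diff_singleton card_Pow of_nat_diff)
    finally show ?thesis using m1 by simp
  next
    case False
    then have "matching E X Z {y} \<sigma> = {}" for X by (auto simp: matching_def)
    then have "(\<Sum>X\<in>Pow ?B. x ^ card (matching E X Z {y} \<sigma>)) = 2 ^ card ?B"
      using fB by (simp add: card_Pow)
    moreover have "card ?B < card Z" unfolding cB
      by (rule psubset_card_mono) (use Z False in auto)
    then have "2 * 2 ^ card ?B \<le> (2::real) ^ card Z"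
      by (metis Suc_leI numeral_One one_le_numeral power_Suc power_increasing)
    moreover have "(1::real) \<le> 2 ^ card ?B" by simp
    ultimately show ?thesis using x by linarith
  qed
qed

text \<open>The edges at different \<open>y\<close> are disjoint and the number of matches is
  additive, so the generating function is the product of the single ones. This is the hypothesis of
  \<open>few_markov\<close> with \<open>a = 2 ^ card Z - 1\<close>.\<close>

lemma sum_power_matching:
  fixes x :: real
  assumes Z: "finite Z" "Z \<noteq> {}" and Y: "finite Y" "Z \<inter> Y = {}" and x: "0 \<le> x"
  shows "(\<Sum>X\<in>Pow (between E Z Y). x ^ card (matching E X Z Y \<sigma>)) \<le> (2 ^ card Z - 1 + x) ^ card Y"
  using Y
proof (induction Y rule: finite_induct)
  case empty
  have "between E Z {} = {}" "matching E X Z {} \<sigma> = {}" for X by (auto simp: between_def matching_def)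
  then show ?case by simp
next
  case (insert y Y)
  let ?A = "between E Z Y" and ?B = "between E Z {y}"
  have fin: "finite ?A" "finite ?B"
  proof -
    have "?A \<subseteq> (\<lambda>(z, y). {z, y}) ` (Z \<times> Y)" "?B \<subseteq> (\<lambda>(z, y). {z, y}) ` (Z \<times> {y})"
      by (auto simp: between_def)
    then show "finite ?A" "finite ?B" using Z insert.hyps by (meson finite_SigmaI finite_imageI finite_subset finite.emptyI finite.insertI)+
  qed
  have disj: "?A \<inter> ?B = {}" by (rule between_disjoint) (use insert in auto)
  have un: "between E Z (insert y Y) = ?A \<union> ?B" by (auto simp: between_def)
  have m: "card (matching E (X1 \<union> X2) Z (insert y Y) \<sigma>) = card (matching E X1 Z Y \<sigma>) + card (matching E X2 Z {y} \<sigma>)"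
    if X: "X1 \<subseteq> ?A" "X2 \<subseteq> ?B" for X1 X2
  proof -
    have "matching E (X1 \<union> X2) Z (insert y Y) \<sigma> = matching E (X1 \<union> X2) Z Y \<sigma> \<union> matching E (X1 \<union> X2) Z {y} \<sigma>"
      by (auto simp: matching_def)
    moreover have "matching E (X1 \<union> X2) Z Y \<sigma> = matching E X1 Z Y \<sigma>"
    proof (rule matching_cong)
      fix z a assume "z \<in> Z" "a \<in> Y" "{z, a} \<in> E"
      then have "{z, a} \<in> ?A" by (auto simp: between_def)
      then show "{z, a} \<in> X1 \<union> X2 \<longleftrightarrow> {z, a} \<in> X1" using disj X by blast
    qed
    moreover have "matching E (X1 \<union> X2) Z {y} \<sigma> = matching E X2 Z {y} \<sigma>"
    proof (rule matching_cong)
      fix z a assume "z \<in> Z" "a \<in> {y}" "{z, a} \<in> E"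
      then have "{z, a} \<in> ?B" by (auto simp: between_def)
      then show "{z, a} \<in> X1 \<union> X2 \<longleftrightarrow> {z, a} \<in> X2" using disj X by blast
    qed
    moreover have "finite (matching E X1 Z Y \<sigma>)" "finite (matching E X2 Z {y} \<sigma>)"
      "matching E X1 Z Y \<sigma> \<inter> matching E X2 Z {y} \<sigma> = {}"
      using insert.hyps by (auto simp: matching_def)
    ultimately show ?thesis by (simp add: card_Un_disjoint)
  qed
  have "(\<Sum>X\<in>Pow (?A \<union> ?B). x ^ card (matching E X Z (insert y Y) \<sigma>))
      = (\<Sum>X1\<in>Pow ?A. \<Sum>X2\<in>Pow ?B. x ^ card (matching E (X1 \<union> X2) Z (insert y Y) \<sigma>))"
    by (rule sum_Pow_Un[OF fin disj])
  also have "\<dots> = (\<Sum>X1\<in>Pow ?A. \<Sum>X2\<in>Pow ?B. x ^ card (matching E X1 Z Y \<sigma>) * x ^ card (matching E X2 Z {y} \<sigma>))"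
    by (intro sum.cong refl) (use m in \<open>simp add: power_add\<close>)
  also have "\<dots> = (\<Sum>X1\<in>Pow ?A. x ^ card (matching E X1 Z Y \<sigma>)) * (\<Sum>X2\<in>Pow ?B. x ^ card (matching E X2 Z {y} \<sigma>))"
    by (simp add: sum_product)
  also have "\<dots> \<le> (2 ^ card Z - 1 + x) ^ card Y * (2 ^ card Z - 1 + x)"
  proof (rule mult_mono)
    show "(\<Sum>X1\<in>Pow ?A. x ^ card (matching E X1 Z Y \<sigma>)) \<le> (2 ^ card Z - 1 + x) ^ card Y"
      using insert by (intro insert.IH) auto
    show "(\<Sum>X2\<in>Pow ?B. x ^ card (matching E X2 Z {y} \<sigma>)) \<le> 2 ^ card Z - 1 + x"
      using insert.prems by (intro sum_power_matching_single Z x) auto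
    show "0 \<le> (2 ^ card Z - 1 + x) ^ card Y" using x by (intro zero_le_power) (simp add: add_nonneg_nonneg)
    show "0 \<le> (\<Sum>X2\<in>Pow ?B. x ^ card (matching E X2 Z {y} \<sigma>))" using x by (intro sum_nonneg) auto
  qed
  also have "\<dots> = (2 ^ card Z - 1 + x) ^ card (insert y Y)" using insert.hyps by simp
  finally show ?case unfolding un .
qed

lemma two_power_minus_one_le: "2 ^ z - 1 \<le> 2 powr (real z - 1 / 2 ^ z)"
proof -
  have "2 ^ z - 1 = 2 ^ z * (1 - 1 / 2 ^ z :: real)" by (simp add: right_diff_distrib)
  also have "\<dots> \<le> 2 ^ z * 2 powr (- (1 / 2 ^ z))" by (intro mult_left_mono one_minus_le_powr) auto
  also have "\<dots> = 2 powr (real z - 1 / 2 ^ z)" by (simp add: powr_realpow[symmetric] powr_add[symmetric])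
  finally show ?thesis .
qed

text \<open>If a pattern occurs at few \<open>y\<close>, then nearly every \<open>y\<close> has lost
  one of its \<open>2 ^ card Z\<close> options. For a single vertex, \<open>card Z = 1\<close>, the
  base is 1 and the class contributes nothing but the error term.\<close>

lemma few_pattern:
  fixes \<epsilon> :: real
  assumes "\<epsilon> > 0"
  obtains \<gamma> :: real where "\<gamma> > 0"
    "\<And>E Z Y \<sigma> M. finite Z \<Longrightarrow> Z \<noteq> {} \<Longrightarrow> finite Y \<Longrightarrow> Z \<inter> Y = {} \<Longrightarrow> real (card Y) \<le> M \<Longrightarrow>
      real (card {X. X \<subseteq> between E Z Y \<and> real (card (matching E X Z Y \<sigma>)) < \<gamma> * M})
        \<le> (2 ^ card Z - 1) ^ card Y * 2 powr (\<epsilon> * M)"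
proof -
  obtain x \<gamma> :: real where x: "x > 0" "\<gamma> > 0" and *: "\<And>(S :: nat set set set) cnt a n M. finite S \<Longrightarrow> 1 \<le> a \<Longrightarrow> real n \<le> M \<Longrightarrow>
      (\<Sum>X\<in>S. x ^ cnt X) \<le> (a + x) ^ n \<Longrightarrow> x \<le> 1 \<and> real (card {X \<in> S. real (cnt X) < \<gamma> * M}) \<le> a ^ n * 2 powr (\<epsilon> * M)"
    using few_markov[OF assms, where ?'c = "nat set set"] by blast
  show thesis
  proof (rule that[OF x(2)])
    fix E :: "nat set set" and Z Y \<sigma> :: "nat set" and M :: real
    assume a: "finite Z" "Z \<noteq> {}" "finite Y" "Z \<inter> Y = {}" "real (card Y) \<le> M"
    have "between E Z Y \<subseteq> (\<lambda>(z, y). {z, y}) ` (Z \<times> Y)" by (auto simp: between_def)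
    then have f: "finite (Pow (between E Z Y))" using a by (meson finite_Pow_iff finite_SigmaI finite_imageI finite_subset)
    have "card Z > 0" using a by (simp add: card_gt_0_iff)
    then have "(2::real) ^ 1 \<le> 2 ^ card Z" by (intro power_increasing) auto
    then have 1: "1 \<le> (2 ^ card Z - 1 :: real)" by simp
    show "real (card {X. X \<subseteq> between E Z Y \<and> real (card (matching E X Z Y \<sigma>)) < \<gamma> * M})
        \<le> (2 ^ card Z - 1) ^ card Y * 2 powr (\<epsilon> * M)"
      using *[OF f 1 a(5), of "\<lambda>X. card (matching E X Z Y \<sigma>)"] sum_power_matching[OF a(1-4), of x E \<sigma>] x(1)
      by (simp add: Pow_def)
  qed
qed

section \<open>Readiness: the edges at a vertex set leave room for a copy\<close>

text \<open>The edges touching \<open>Z\<close> are oriented so that a suitable multicoloured pattern with prescribed large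
  sets in the classes \<open>Y i\<close>, whatever the orientation of the other edges, would complete a copy of \<open>F\<close>.\<close>

definition ready :: "nat set \<Rightarrow> nat set set \<Rightarrow> 'b dgraph \<Rightarrow> nat \<Rightarrow> nat set \<Rightarrow> (nat \<Rightarrow> nat set) \<Rightarrow> real \<Rightarrow> nat set set \<Rightarrow> bool" where
  "ready V E F p Z Y m X \<longleftrightarrow> (\<exists>J c W. J \<subseteq> fst F \<and> (\<forall>u\<in>J. c u < p \<and> W u \<subseteq> Y (c u) \<and> m \<le> real (card (W u))) \<and>
     (\<forall>(u, v)\<in>snd F. u \<in> J \<longrightarrow> v \<in> J \<longrightarrow> c u \<noteq> c v) \<and>
     (\<forall>X' f. X' \<subseteq> E \<longrightarrow> (\<forall>e\<in>E. e \<inter> Z \<noteq> {} \<longrightarrow> (e \<in> X' \<longleftrightarrow> e \<in> X)) \<longrightarrow> inj_on f J \<longrightarrow> (\<forall>u\<in>J. f u \<in> W u) \<longrightarrow>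
        (\<forall>(u, v)\<in>snd F. u \<in> J \<longrightarrow> v \<in> J \<longrightarrow> arc E X' (f u) (f v)) \<longrightarrow> emb V E X' F))"

lemma readyE:
  assumes "ready V E F p Z Y m X"
  obtains J c W where "J \<subseteq> fst F" "\<And>u. u \<in> J \<Longrightarrow> c u < p" "\<And>u. u \<in> J \<Longrightarrow> W u \<subseteq> Y (c u)"
    "\<And>u. u \<in> J \<Longrightarrow> m \<le> real (card (W u))"
    "\<And>u v. (u, v) \<in> snd F \<Longrightarrow> u \<in> J \<Longrightarrow> v \<in> J \<Longrightarrow> c u \<noteq> c v"
    "\<And>X' f. X' \<subseteq> E \<Longrightarrow> (\<And>e. e \<in> E \<Longrightarrow> e \<inter> Z \<noteq> {} \<Longrightarrow> e \<in> X' \<longleftrightarrow> e \<in> X) \<Longrightarrow> inj_on f J \<Longrightarrow> (\<And>u. u \<in> J \<Longrightarrow> f u \<in> W u) \<Longrightarrow>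
        (\<And>u v. (u, v) \<in> snd F \<Longrightarrow> u \<in> J \<Longrightarrow> v \<in> J \<Longrightarrow> arc E X' (f u) (f v)) \<Longrightarrow> emb V E X' F"
proof -
  from assms[unfolded ready_def]
  obtain J c W where *: "J \<subseteq> fst F \<and> (\<forall>u\<in>J. c u < p \<and> W u \<subseteq> Y (c u) \<and> m \<le> real (card (W u))) \<and>
     (\<forall>(u, v)\<in>snd F. u \<in> J \<longrightarrow> v \<in> J \<longrightarrow> c u \<noteq> c v) \<and>
     (\<forall>X' f. X' \<subseteq> E \<longrightarrow> (\<forall>e\<in>E. e \<inter> Z \<noteq> {} \<longrightarrow> (e \<in> X' \<longleftrightarrow> e \<in> X)) \<longrightarrow> inj_on f J \<longrightarrow> (\<forall>u\<in>J. f u \<in> W u) \<longrightarrow>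
        (\<forall>(u, v)\<in>snd F. u \<in> J \<longrightarrow> v \<in> J \<longrightarrow> arc E X' (f u) (f v)) \<longrightarrow> emb V E X' F)"
    by (elim exE)
  show ?thesis
  proof (rule that[of J c W])
    fix X' f assume a: "X' \<subseteq> E" "\<And>e. e \<in> E \<Longrightarrow> e \<inter> Z \<noteq> {} \<Longrightarrow> e \<in> X' \<longleftrightarrow> e \<in> X" "inj_on f J" "\<And>u. u \<in> J \<Longrightarrow> f u \<in> W u"
      "\<And>u v. (u, v) \<in> snd F \<Longrightarrow> u \<in> J \<Longrightarrow> v \<in> J \<Longrightarrow> arc E X' (f u) (f v)"
    have "X' \<subseteq> E \<longrightarrow> (\<forall>e\<in>E. e \<inter> Z \<noteq> {} \<longrightarrow> (e \<in> X' \<longleftrightarrow> e \<in> X)) \<longrightarrow> inj_on f J \<longrightarrow> (\<forall>u\<in>J. f u \<in> W u) \<longrightarrow>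
        (\<forall>(u, v)\<in>snd F. u \<in> J \<longrightarrow> v \<in> J \<longrightarrow> arc E X' (f u) (f v)) \<longrightarrow> emb V E X' F" using * by (elim conjE allE)
    then show "emb V E X' F" using a by auto
  qed (use * in auto)
qed

text \<open>Arcs between the part \<open>S\<close> placed in \<open>Z\<close> and the other vertices
  touch \<open>Z\<close>, so they are the same in every \<open>X'\<close> that agrees with
  \<open>X\<close> there. Once all candidates in \<open>W u\<close> are attached to \<open>Z\<close>
  correctly, only arcs among the remaining vertices are left to be found.\<close>

lemma readyI:
  assumes G: "wf_graph (V, E)" and F: "wf_dgraph F" and S: "S \<subseteq> fst F" "inj_on \<theta> S" "\<theta> ` S \<subseteq> Z" and Z: "Z \<subseteq> V"
    and Y: "\<And>i. i < p \<Longrightarrow> Y i \<subseteq> V - Z"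
    and SS: "\<And>x y. (x, y) \<in> snd F \<Longrightarrow> x \<in> S \<Longrightarrow> y \<in> S \<Longrightarrow> arc E X (\<theta> x) (\<theta> y)"
    and W: "\<And>u. u \<in> fst F - S \<Longrightarrow> c u < p \<and> W u \<subseteq> Y (c u) \<and> m \<le> real (card (W u))"
    and col: "\<And>u v. (u, v) \<in> snd F \<Longrightarrow> u \<notin> S \<Longrightarrow> v \<notin> S \<Longrightarrow> c u \<noteq> c v"
    and out: "\<And>x u y. (x, u) \<in> snd F \<Longrightarrow> x \<in> S \<Longrightarrow> u \<notin> S \<Longrightarrow> y \<in> W u \<Longrightarrow> arc E X (\<theta> x) y"
    and inn: "\<And>x u y. (u, x) \<in> snd F \<Longrightarrow> x \<in> S \<Longrightarrow> u \<notin> S \<Longrightarrow> y \<in> W u \<Longrightarrow> arc E X y (\<theta> x)"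
  shows "ready V E F p Z Y m X"
proof -
  note FD = wf_dgraphD[OF F]
  have "emb V E X' F" if X': "X' \<subseteq> E" "\<forall>e\<in>E. e \<inter> Z \<noteq> {} \<longrightarrow> (e \<in> X' \<longleftrightarrow> e \<in> X)"
    and f: "inj_on f (fst F - S)" "\<forall>u\<in>fst F - S. f u \<in> W u"
      "\<forall>(u, v)\<in>snd F. u \<in> fst F - S \<longrightarrow> v \<in> fst F - S \<longrightarrow> arc E X' (f u) (f v)" for X' f
  proof -
    have same: "arc E X' a b" if "arc E X a b" "a \<in> Z \<or> b \<in> Z" for a b
      using that X'(2) by (auto simp: arc_def)
    let ?g = "\<lambda>u. if u \<in> S then \<theta> u else f u"
    have fV: "f u \<in> V - Z" if "u \<in> fst F - S" for u using f(2) W[OF that] Y that by blast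
    have \<theta>Z: "\<theta> x \<in> Z" if "x \<in> S" for x using S(3) that by auto
    show ?thesis
    proof (rule embI[of ?g])
      show "inj_on ?g (fst F)"
      proof (rule inj_onI)
        fix x y assume xy: "x \<in> fst F" "y \<in> fst F" "?g x = ?g y"
        consider "x \<in> S" "y \<in> S" | "x \<in> S" "y \<notin> S" | "x \<notin> S" "y \<in> S" | "x \<notin> S" "y \<notin> S" by blast
        then show "x = y"
        proof cases
          case 1 then show ?thesis using xy S(2) by (auto dest: inj_onD)
        next
          case 2 then show ?thesis using xy \<theta>Z[of x] fV[of y] by simp
        next
          case 3 then show ?thesis using xy \<theta>Z[of y] fV[of x] by simp
        next
          case 4 then show ?thesis using xy f(1) by (auto dest: inj_onD)
        qed
      qed
      show "?g u \<in> V" if "u \<in> fst F" for u using that fV[of u] \<theta>Z[of u] Z by auto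
      show "arc E X' (?g u) (?g v)" if uv: "(u, v) \<in> snd F" for u v
      proof -
        have uF: "u \<in> fst F" "v \<in> fst F" using FD(4)[OF uv] by auto
        consider "u \<in> S" "v \<in> S" | "u \<in> S" "v \<notin> S" | "u \<notin> S" "v \<in> S" | "u \<notin> S" "v \<notin> S" by blast
        then show ?thesis
        proof cases
          case 1 then show ?thesis using SS[OF uv] same \<theta>Z[of u] by simp
        next
          case 2
          have "f v \<in> W v" using f(2) uF 2 by simp
          then show ?thesis using out[OF uv] 2 same \<theta>Z[of u] by simp
        next
          case 3
          have "f u \<in> W u" using f(2) uF 3 by simp
          then show ?thesis using inn[OF uv] 3 same \<theta>Z[of v] by simp
        next
          case 4 then show ?thesis using f(3) uv uF by auto
        qed
      qed
    qed
  qed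
  then show ?thesis unfolding ready_def
    by (intro exI[of _ "fst F - S"] exI[of _ c] exI[of _ W]) (use W col in auto)
qed

text \<open>When the \<open>Y i\<close> are the classes of a universal host, its universality
  supplies the missing transversal part for the orientation itself. So readiness at density
  \<open>\<gamma>\<close> would already give a copy of \<open>F\<close>.\<close>

lemma not_ready_hosting:
  assumes G: "wf_graph (V, E)" and F: "wf_dgraph F" and U: "universal F p s \<gamma> U" and g: "g \<in> placements (p * s) V"
    and X: "X \<in> hosting V E F U g" and Y: "\<And>i. i < p \<Longrightarrow> Y i = g ` {j. j < p * s \<and> j mod p = i}"
  shows "\<not> ready V E F p Z Y (\<gamma> * real s) X"
proof
  assume "ready V E F p Z Y (\<gamma> * real s) X"
  then show False
  proof (rule readyE)
    fix J c W
    assume J: "J \<subseteq> fst F" and c: "\<And>u. u \<in> J \<Longrightarrow> c u < p" and W: "\<And>u. u \<in> J \<Longrightarrow> W u \<subseteq> Y (c u)"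
      and cW: "\<And>u. u \<in> J \<Longrightarrow> \<gamma> * real s \<le> real (card (W u))"
      and col: "\<And>u v. (u, v) \<in> snd F \<Longrightarrow> u \<in> J \<Longrightarrow> v \<in> J \<Longrightarrow> c u \<noteq> c v"
      and fin: "\<And>X' f. X' \<subseteq> E \<Longrightarrow> (\<And>e. e \<in> E \<Longrightarrow> e \<inter> Z \<noteq> {} \<Longrightarrow> e \<in> X' \<longleftrightarrow> e \<in> X) \<Longrightarrow> inj_on f J \<Longrightarrow> (\<And>u. u \<in> J \<Longrightarrow> f u \<in> W u) \<Longrightarrow>
        (\<And>u v. (u, v) \<in> snd F \<Longrightarrow> u \<in> J \<Longrightarrow> v \<in> J \<Longrightarrow> arc E X' (f u) (f v)) \<Longrightarrow> emb V E X' F"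
    have gi: "inj_on g {..<p * s}" using g by (simp add: placements_def)
    define W' where "W' u = {j. j < p * s \<and> j mod p = c u \<and> g j \<in> W u}" for u
    have cW': "\<gamma> * real s \<le> real (card (W' u))" if "u \<in> J" for u
    proof -
      have "W u = g ` W' u" using W[OF that] Y[OF c[OF that]] by (auto simp: W'_def)
      then have "card (W u) \<le> card (W' u)" using card_image_le[of "W' u" g] by (simp add: W'_def)
      then show ?thesis using cW[OF that] by linarith
    qed
    have "\<exists>f. inj_on f J \<and> (\<forall>u\<in>J. f u \<in> W' u) \<and> (\<forall>(u, v)\<in>snd F. u \<in> J \<longrightarrow> v \<in> J \<longrightarrow> (f u, f v) \<in> snd U)"
    proof -
      have uni: "\<And>J c W. J \<subseteq> fst F \<Longrightarrow> (\<forall>(u, v)\<in>snd F. u \<in> J \<longrightarrow> v \<in> J \<longrightarrow> c u \<noteq> c v) \<Longrightarrow>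
        (\<forall>u\<in>J. W u \<subseteq> {j. j < p * s \<and> j mod p = c u} \<and> \<gamma> * real s \<le> real (card (W u))) \<Longrightarrow>
        (\<exists>f. inj_on f J \<and> (\<forall>u\<in>J. f u \<in> W u) \<and> (\<forall>(u, v)\<in>snd F. u \<in> J \<longrightarrow> v \<in> J \<longrightarrow> (f u, f v) \<in> snd U))"
        using U unfolding universal_def by blast
      show ?thesis by (rule uni[of J c W']) (use J col cW' in \<open>auto simp: W'_def\<close>)
    qed
    then obtain f where f: "inj_on f J" "\<forall>u\<in>J. f u \<in> W' u" "\<forall>(u, v)\<in>snd F. u \<in> J \<longrightarrow> v \<in> J \<longrightarrow> (f u, f v) \<in> snd U"
      by (elim exE conjE)
    have "emb V E X F"
    proof (rule fin[of X "\<lambda>u. g (f u)"])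
      show "X \<subseteq> E" using X by (simp add: hosting_def Free_def)
      show "inj_on (\<lambda>u. g (f u)) J"
      proof (rule inj_onI)
        fix x y assume "x \<in> J" "y \<in> J" "g (f x) = g (f y)"
        moreover have "f x < p * s" "f y < p * s" using f(2) calculation by (auto simp: W'_def)
        ultimately show "x = y" using gi f(1) by (auto dest!: inj_onD)
      qed
      show "g (f u) \<in> W u" if "u \<in> J" for u using f(2) that by (auto simp: W'_def)
      show "arc E X (g (f u)) (g (f v))" if "(u, v) \<in> snd F" "u \<in> J" "v \<in> J" for u v
        using f(3) that X by (auto simp: hosting_def)
    qed auto
    then show False using X by (simp add: hosting_def Free_def)
  qed
qed

text \<open>The counterpart without a host: between nearly completely joined classes a transversal
  copy of any fixed orientation is avoided by only a \<open>2 powr (- c * m ^ 2)\<close> fraction of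
  the orientations. The edges touching \<open>Z\<close> are fixed beforehand, and the number of ways
  to fix them is already contained in \<open>2 ^ card E\<close>.\<close>

lemma ready_count:
  fixes F :: "'b dgraph"
  assumes F: "wf_dgraph F"
  obtains c \<mu> :: real and m0 :: nat where "c > 0" "\<mu> > 0"
    "\<And>m V E p Z Y. m \<ge> m0 \<Longrightarrow> wf_graph (V, E) \<Longrightarrow> Z \<subseteq> V \<Longrightarrow> (\<And>i. i < p \<Longrightarrow> Y i \<subseteq> V - Z) \<Longrightarrow>
      (\<And>i j. i < p \<Longrightarrow> j < p \<Longrightarrow> i \<noteq> j \<Longrightarrow> real (card (missing E (Y i) (Y j))) \<le> \<mu> * (real m)\<^sup>2) \<Longrightarrow>
      real (card {X \<in> Free V E F. ready V E F p Z Y (real m) X}) \<le> 2 powr (real (card E) - c * (real m)\<^sup>2)"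
proof -
  obtain c \<mu> :: real and m0 where c: "c > 0" "\<mu> > 0" and count: "\<And>m E (F' :: 'b dgraph) W. m \<ge> m0 \<Longrightarrow> finite E \<Longrightarrow> wf_dgraph F' \<Longrightarrow> card (fst F') \<le> card (fst F) \<Longrightarrow>
     (\<And>u. u \<in> fst F' \<Longrightarrow> finite (W u) \<and> m \<le> card (W u)) \<Longrightarrow>
     (\<And>u v. (u, v) \<in> snd F' \<Longrightarrow> real (card (missing E (W u) (W v))) \<le> \<mu> * (real m)\<^sup>2) \<Longrightarrow>
     real (card (no_transversal E F' W)) \<le> 2 powr (real (card E) - c * (real m)\<^sup>2)"
    by (rule no_transversal_count[of "card (fst F)", where ?'b = 'b]) blast
  show thesis
  proof (rule that[OF c])
    fix m :: nat and V E p Z and Y :: "nat \<Rightarrow> nat set"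
    assume m: "m \<ge> m0" and G: "wf_graph (V, E)" and Z: "Z \<subseteq> V" and Y: "\<And>i. i < p \<Longrightarrow> Y i \<subseteq> V - Z"
      and miss: "\<And>i j. i < p \<Longrightarrow> j < p \<Longrightarrow> i \<noteq> j \<Longrightarrow> real (card (missing E (Y i) (Y j))) \<le> \<mu> * (real m)\<^sup>2"
    note fin = wf_graph_finite[OF G]
    let ?S = "{X \<in> Free V E F. ready V E F p Z Y (real m) X}"
    define E2 where "E2 = {e \<in> E. e \<inter> Z \<noteq> {}}"
    define E1 where "E1 = E - E2"
    have fE: "finite E1" "finite E2" using fin by (auto simp: E1_def E2_def)
    define k where "k = nat \<lfloor>2 powr (real (card E1) - c * (real m)\<^sup>2)\<rfloor>"
    have "card ?S \<le> card (Pow E2) * k"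
    proof (rule card_subsets_split[of E2 E1])
      show "X \<subseteq> E2 \<union> E1" if "X \<in> ?S" for X using that by (auto simp: Free_def E1_def E2_def)
      show "X \<inter> E2 \<in> Pow E2" for X by auto
      fix P assume P: "P \<in> Pow E2"
      let ?T = "{Q. Q \<subseteq> E1 \<and> P \<union> Q \<in> ?S}"
      have "real (card ?T) \<le> 2 powr (real (card E1) - c * (real m)\<^sup>2)"
      proof (cases "?T = {}")
        case True
        then have "card ?T = 0" by (simp only: card.empty)
        then show ?thesis by (simp only:) simp
      next
        case False
        \<comment> \<open>One completion yields \<open>J\<close>, \<open>cc\<close> and
          \<open>W\<close> that serve for all completions of \<open>P\<close>, because the last
          clause of \<open>ready\<close> quantifies over all \<open>X'\<close> that agree on the
          edges touching \<open>Z\<close>.\<close>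
        then obtain Q0 where Q0: "Q0 \<subseteq> E1" "P \<union> Q0 \<in> ?S" by auto
        then have "ready V E F p Z Y (real m) (P \<union> Q0)" by simp
        then show ?thesis
        proof (rule readyE)
          fix J cc W
          assume J: "J \<subseteq> fst F" and cc: "\<And>u. u \<in> J \<Longrightarrow> cc u < p" and W: "\<And>u. u \<in> J \<Longrightarrow> W u \<subseteq> Y (cc u)"
            and cW: "\<And>u. u \<in> J \<Longrightarrow> real m \<le> real (card (W u))"
            and col: "\<And>u v. (u, v) \<in> snd F \<Longrightarrow> u \<in> J \<Longrightarrow> v \<in> J \<Longrightarrow> cc u \<noteq> cc v"
            and emb: "\<And>X' f. X' \<subseteq> E \<Longrightarrow> (\<And>e. e \<in> E \<Longrightarrow> e \<inter> Z \<noteq> {} \<Longrightarrow> e \<in> X' \<longleftrightarrow> e \<in> P \<union> Q0) \<Longrightarrow> inj_on f J \<Longrightarrow> (\<And>u. u \<in> J \<Longrightarrow> f u \<in> W u) \<Longrightarrow>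
              (\<And>u v. (u, v) \<in> snd F \<Longrightarrow> u \<in> J \<Longrightarrow> v \<in> J \<Longrightarrow> arc E X' (f u) (f v)) \<Longrightarrow> emb V E X' F"
          let ?F = "(J, snd F \<inter> (J \<times> J))"
          have wfJ: "wf_dgraph ?F" using J F finite_subset[of J "fst F"] unfolding wf_dgraph_def by auto
          have "?T \<subseteq> no_transversal E1 ?F W"
          proof
            fix Q assume Q: "Q \<in> ?T"
            have "\<not> emb V E (P \<union> Q) F" using Q by (simp add: Free_def)
            moreover have "emb V E (P \<union> Q) F" if f: "inj_on f J" "\<forall>u\<in>J. f u \<in> W u"
              "\<forall>(u, v)\<in>snd F \<inter> (J \<times> J). arc E1 Q (f u) (f v)" for f
            proof (rule emb)
              show "P \<union> Q \<subseteq> E" using P Q by (auto simp: E1_def E2_def)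
              show "e \<in> P \<union> Q \<longleftrightarrow> e \<in> P \<union> Q0" if "e \<in> E" "e \<inter> Z \<noteq> {}" for e
                using that Q Q0 by (auto simp: E1_def E2_def)
              show "inj_on f J" "\<And>u. u \<in> J \<Longrightarrow> f u \<in> W u" using f by auto
              show "arc E (P \<union> Q) (f u) (f v)" if "(u, v) \<in> snd F" "u \<in> J" "v \<in> J" for u v
              proof -
                have "arc E1 Q (f u) (f v)" using f(3) that by auto
                moreover have "(P \<union> Q) \<inter> E1 = Q" using P Q by (auto simp: E1_def)
                ultimately show ?thesis using arc_mono[of E1 "P \<union> Q" "f u" "f v" E] by (simp add: E1_def)
              qed
            qed
            ultimately have "\<not> (\<exists>f. inj_on f J \<and> (\<forall>u\<in>J. f u \<in> W u) \<and> (\<forall>(u, v)\<in>snd F \<inter> (J \<times> J). arc E1 Q (f u) (f v)))"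
              by blast
            then show "Q \<in> no_transversal E1 ?F W" using Q unfolding no_transversal_def by simp
          qed
          moreover have "finite (no_transversal E1 ?F W)"
            by (rule finite_subset[of _ "Pow E1"]) (use fE in \<open>auto simp: no_transversal_def\<close>)
          ultimately have "real (card ?T) \<le> real (card (no_transversal E1 ?F W))" by (simp add: card_mono)
          also have "\<dots> \<le> 2 powr (real (card E1) - c * (real m)\<^sup>2)"
          proof (rule count[OF m fE(1) wfJ])
            show "card (fst ?F) \<le> card (fst F)" using J wf_dgraphD(1)[OF F] by (simp add: card_mono)
            have YV: "finite (Y i)" if "i < p" for i using Y[OF that] fin by (meson finite_Diff finite_subset)
            show "finite (W u) \<and> m \<le> card (W u)" if "u \<in> fst ?F" for u
            proof -
              have u: "u \<in> J" using that by simp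
              have "finite (W u)" using W[OF u] YV[OF cc[OF u]] by (rule finite_subset)
              then show ?thesis using cW[OF u] by simp
            qed
            show "real (card (missing E1 (W u) (W v))) \<le> \<mu> * (real m)\<^sup>2" if uv: "(u, v) \<in> snd ?F" for u v
            proof -
              have u: "u \<in> J" "v \<in> J" "(u, v) \<in> snd F" using uv by auto
              have "missing E1 (W u) (W v) \<subseteq> missing E (Y (cc u)) (Y (cc v))"
              proof
                fix z assume "z \<in> missing E1 (W u) (W v)"
                then obtain x y where xy: "z = (x, y)" "x \<in> W u" "y \<in> W v" "{x, y} \<notin> E1" by (auto simp: missing_def)
                have "x \<in> V - Z" using xy(2) W[OF u(1)] Y[OF cc[OF u(1)]] by (meson subsetD)
                moreover have "y \<in> V - Z" using xy(3) W[OF u(2)] Y[OF cc[OF u(2)]] by (meson subsetD)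
                ultimately have "{x, y} \<notin> E" using xy(4) by (auto simp: E1_def E2_def)
                moreover have "x \<in> Y (cc u)" "y \<in> Y (cc v)"
                  using xy(2,3) W[OF u(1)] W[OF u(2)] by (meson subsetD)+
                ultimately show "z \<in> missing E (Y (cc u)) (Y (cc v))" using xy(1) by (simp add: missing_def)
              qed
              then have "card (missing E1 (W u) (W v)) \<le> card (missing E (Y (cc u)) (Y (cc v)))"
                by (intro card_mono finite_missing YV cc u)
              then show ?thesis using miss[OF cc[OF u(1)] cc[OF u(2)] col[OF u(3,1,2)]] by linarith
            qed
          qed
          finally show ?thesis .
        qed
      qed
      then show "card ?T \<le> k" unfolding k_def by linarith
    qed (use fE in \<open>auto simp: E1_def\<close>)
    then have "real (card ?S) \<le> real (card (Pow E2) * k)" by (rule of_nat_mono)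
    also have "\<dots> = 2 ^ card E2 * real k" using fE by (simp add: card_Pow)
    also have "\<dots> \<le> 2 ^ card E2 * 2 powr (real (card E1) - c * (real m)\<^sup>2)"
      by (intro mult_left_mono) (auto simp: k_def)
    also have "\<dots> = 2 powr (real (card E2) + (real (card E1) - c * (real m)\<^sup>2))"
      by (simp only: powr_add) (simp add: powr_realpow)
    also have "real (card E2) + (real (card E1) - c * (real m)\<^sup>2) = real (card E) - c * (real m)\<^sup>2"
    proof -
      have "card E = card E2 + card E1" unfolding E1_def using fin fE card_mono[of E E2]
        by (subst card_Diff_subset) (auto simp: E2_def)
      then show ?thesis by simp
    qed
    finally show "real (card ?S) \<le> 2 powr (real (card E) - c * (real m)\<^sup>2)" .
  qed
qed

section \<open>Counting poor attachments\<close>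

text \<open>The edges from \<open>Z\<close> to different classes are chosen independently. Classes
  in \<open>I\<close>, where a pattern is rare, contribute as in \<open>few_pattern\<close>; all
  other edges are free.\<close>

lemma few_classes:
  fixes \<epsilon> :: real
  assumes "\<epsilon> > 0"
  obtains \<gamma> :: real where "\<gamma> > 0"
    "\<And>E Z (p :: nat) Y I \<sigma> M. finite E \<Longrightarrow> finite Z \<Longrightarrow> Z \<noteq> {} \<Longrightarrow>
      (\<And>i. i < p \<Longrightarrow> finite (Y i) \<and> Z \<inter> Y i = {} \<and> real (card (Y i)) \<le> M) \<Longrightarrow> I \<subseteq> {..<p} \<Longrightarrow>
      real (card {X. X \<subseteq> between E Z (\<Union>i<p. Y i) \<and> (\<forall>i\<in>I. real (card (matching E X Z (Y i) (\<sigma> i))) < \<gamma> * M)})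
        \<le> 2 ^ card (between E Z (\<Union>i\<in>{..<p} - I. Y i)) * (\<Prod>i\<in>I. (2 ^ card Z - 1) ^ card (Y i) * 2 powr (\<epsilon> * M))"
proof -
  obtain \<gamma> :: real where \<gamma>: "\<gamma> > 0" and few: "\<And>E Z Y \<sigma> M. finite Z \<Longrightarrow> Z \<noteq> {} \<Longrightarrow> finite Y \<Longrightarrow> Z \<inter> Y = {} \<Longrightarrow> real (card Y) \<le> M \<Longrightarrow>
      real (card {X. X \<subseteq> between E Z Y \<and> real (card (matching E X Z Y \<sigma>)) < \<gamma> * M})
        \<le> (2 ^ card Z - 1) ^ card Y * 2 powr (\<epsilon> * M)"
    by (rule few_pattern[OF assms]) blast
  show thesis
  proof (rule that[OF \<gamma>])
    fix E :: "nat set set" and Z :: "nat set" and p and Y \<sigma> :: "nat \<Rightarrow> nat set" and I :: "nat set" and M :: real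
    assume E: "finite E" and Z: "finite Z" "Z \<noteq> {}" and I: "I \<subseteq> {..<p}"
      and Y: "\<And>i. i < p \<Longrightarrow> finite (Y i) \<and> Z \<inter> Y i = {} \<and> real (card (Y i)) \<le> M"
    let ?S = "{X. X \<subseteq> between E Z (\<Union>i<p. Y i) \<and> (\<forall>i\<in>I. real (card (matching E X Z (Y i) (\<sigma> i))) < \<gamma> * M)}"
    let ?T = "\<lambda>i. {X. X \<subseteq> between E Z (Y i) \<and> real (card (matching E X Z (Y i) (\<sigma> i))) < \<gamma> * M}"
    have fI: "finite I" using I finite_subset by blast
    have "card ?S \<le> 2 ^ card (between E Z (\<Union>i\<in>{..<p} - I. Y i)) * (\<Prod>i\<in>I. card (?T i))"
    proof (rule card_subsets_prod[OF fI, of _ _ _ "\<lambda>i. between E Z (Y i)"])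
      show "finite (between E Z (\<Union>i\<in>{..<p} - I. Y i))" by (rule between_finite[OF E])
      show "finite (?T i)" for i
        by (rule finite_subset[of _ "Pow (between E Z (Y i))"]) (use between_finite[OF E] in auto)
      show "X \<subseteq> between E Z (\<Union>i\<in>{..<p} - I. Y i) \<union> (\<Union>i\<in>I. between E Z (Y i))" if "X \<in> ?S" for X
      proof -
        have "between E Z (\<Union>i<p. Y i) \<subseteq> between E Z (\<Union>i\<in>{..<p} - I. Y i) \<union> (\<Union>i\<in>I. between E Z (Y i))"
          unfolding between_def by blast
        then show ?thesis using that by blast
      qed
      show "X \<inter> between E Z (Y i) \<in> ?T i" if "X \<in> ?S" "i \<in> I" for X i
        using that by (simp add: matching_Int_between)
    qed
    then have "real (card ?S) \<le> real (2 ^ card (between E Z (\<Union>i\<in>{..<p} - I. Y i)) * (\<Prod>i\<in>I. card (?T i)))"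
      by (rule of_nat_mono)
    also have "\<dots> = 2 ^ card (between E Z (\<Union>i\<in>{..<p} - I. Y i)) * (\<Prod>i\<in>I. real (card (?T i)))" by simp
    also have "\<dots> \<le> 2 ^ card (between E Z (\<Union>i\<in>{..<p} - I. Y i)) * (\<Prod>i\<in>I. (2 ^ card Z - 1) ^ card (Y i) * 2 powr (\<epsilon> * M))"
      using I Z Y by (intro mult_left_mono prod_mono conjI few) auto
    finally show "real (card ?S) \<le> 2 ^ card (between E Z (\<Union>i\<in>{..<p} - I. Y i)) * (\<Prod>i\<in>I. (2 ^ card Z - 1) ^ card (Y i) * 2 powr (\<epsilon> * M))" .
  qed
qed

text \<open>For a single vertex one class with a scarce direction is tolerable, as it can take the
  role of colour \<open>0\<close>, which is needed in one direction only. Two such classes cannot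
  both be accommodated.\<close>

definition poor_star :: "nat set set \<Rightarrow> nat \<Rightarrow> nat \<Rightarrow> (nat \<Rightarrow> nat set) \<Rightarrow> real \<Rightarrow> nat set set \<Rightarrow> bool" where
  "poor_star E v p Y m X \<longleftrightarrow> (\<exists>i<p. \<exists>j<p. i \<noteq> j \<and> (\<exists>\<sigma>\<in>Pow {v}. \<exists>\<tau>\<in>Pow {v}.
     real (card (matching E X {v} (Y i) \<sigma>)) < m \<and> real (card (matching E X {v} (Y j) \<tau>)) < m))"

text \<open>\<open>i0\<close> stands for the class in which \<open>Z\<close> lives. Its vertices
  serve as padding and need no edges to \<open>Z\<close>, so only the other classes must show every
  pattern.\<close>

definition poor_config :: "nat set set \<Rightarrow> nat set \<Rightarrow> nat \<Rightarrow> (nat \<Rightarrow> nat set) \<Rightarrow> nat \<Rightarrow> real \<Rightarrow> nat set set \<Rightarrow> bool" where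
  "poor_config E Z p Y i0 m X \<longleftrightarrow> (\<exists>j<p. j \<noteq> i0 \<and> (\<exists>\<sigma>\<in>Pow Z. real (card (matching E X Z (Y j) \<sigma>)) < m))"

lemma card_between_single_le: "finite Y \<Longrightarrow> card (between E {v} Y) \<le> card Y"
  using card_between_le[of "{v}" Y E] by simp

text \<open>Relative to free attachments, a poor vertex loses two whole classes, hence
  \<open>2 * L\<close>; a poor set loses the fraction \<open>1 / 2 ^ card Z\<close> of one class.
  The leading factors count the choice of the classes and of the patterns.\<close>

lemma poor_counts:
  fixes \<epsilon> :: real
  assumes "\<epsilon> > 0"
  obtains \<gamma> :: real where "\<gamma> > 0"
    "\<And>E v p Y M L. finite E \<Longrightarrow> (\<And>i. i < p \<Longrightarrow> finite (Y i) \<and> v \<notin> Y i \<and> L \<le> real (card (Y i)) \<and> real (card (Y i)) \<le> M) \<Longrightarrow>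
      real (card {X. X \<subseteq> between E {v} (\<Union>i<p. Y i) \<and> poor_star E v p Y (\<gamma> * M) X})
        \<le> (2 * real p) ^ 2 * 2 powr ((\<Sum>i<p. real (card (Y i))) - 2 * L + 2 * \<epsilon> * M)"
    "\<And>E Z p Y M L i0. finite E \<Longrightarrow> finite Z \<Longrightarrow> Z \<noteq> {} \<Longrightarrow> i0 < p \<Longrightarrow>
      (\<And>i. i < p \<Longrightarrow> finite (Y i) \<and> Z \<inter> Y i = {} \<and> L \<le> real (card (Y i)) \<and> real (card (Y i)) \<le> M) \<Longrightarrow>
      real (card {X. X \<subseteq> between E Z (\<Union>i<p. Y i) \<and> poor_config E Z p Y i0 (\<gamma> * M) X})
        \<le> real p * 2 ^ card Z * 2 powr (real (card Z) * (\<Sum>i\<in>{..<p} - {i0}. real (card (Y i))) - L / 2 ^ card Z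
             + real (card (between E Z (Y i0))) + \<epsilon> * M)"
proof -
  obtain \<gamma> :: real where \<gamma>: "\<gamma> > 0" and few: "\<And>E Z (p :: nat) Y I \<sigma> M. finite E \<Longrightarrow> finite Z \<Longrightarrow> Z \<noteq> {} \<Longrightarrow>
      (\<And>i. i < p \<Longrightarrow> finite (Y i) \<and> Z \<inter> Y i = {} \<and> real (card (Y i)) \<le> M) \<Longrightarrow> I \<subseteq> {..<p} \<Longrightarrow>
      real (card {X. X \<subseteq> between E Z (\<Union>i<p. Y i) \<and> (\<forall>i\<in>I. real (card (matching E X Z (Y i) (\<sigma> i))) < \<gamma> * M)})
        \<le> 2 ^ card (between E Z (\<Union>i\<in>{..<p} - I. Y i)) * (\<Prod>i\<in>I. (2 ^ card Z - 1) ^ card (Y i) * 2 powr (\<epsilon> * M))"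
    by (rule few_classes[OF assms]) blast
  show thesis
  proof (rule that[OF \<gamma>])
    fix E :: "nat set set" and v p and Y :: "nat \<Rightarrow> nat set" and M L :: real
    assume E: "finite E" and Y: "\<And>i. i < p \<Longrightarrow> finite (Y i) \<and> v \<notin> Y i \<and> L \<le> real (card (Y i)) \<and> real (card (Y i)) \<le> M"
    let ?N = "\<Sum>i<p. real (card (Y i))"
    let ?S = "\<lambda>(i, j, \<sigma>, \<tau>). {X. X \<subseteq> between E {v} (\<Union>i<p. Y i) \<and>
        (\<forall>l\<in>{i, j}. real (card (matching E X {v} (Y l) (if l = i then \<sigma> else \<tau>))) < \<gamma> * M)}"
    let ?Q = "{(i, j, \<sigma>, \<tau>). i < p \<and> j < p \<and> i \<noteq> j \<and> \<sigma> \<in> Pow {v} \<and> \<tau> \<in> Pow {v}}"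
    have Qs: "?Q \<subseteq> {..<p} \<times> {..<p} \<times> Pow {v} \<times> Pow {v}" by auto
    have fQ: "finite ?Q" by (rule finite_subset[OF Qs]) simp
    have "card ?Q \<le> card ({..<p} \<times> {..<p} \<times> Pow {v} \<times> Pow {v})" by (rule card_mono[OF _ Qs]) simp
    also have "\<dots> = (2 * p)\<^sup>2" by (simp add: card_cartesian_product card_Pow power2_eq_square)
    finally have cQ: "card ?Q \<le> (2 * p)\<^sup>2" .
    have one: "real (card (?S q)) \<le> 2 powr (?N - 2 * L + 2 * \<epsilon> * M)" if "q \<in> ?Q" for q
    proof -
      from that obtain i j \<sigma> \<tau> where q: "q = (i, j, \<sigma>, \<tau>)" "i < p" "j < p" "i \<noteq> j" by auto
      let ?R = "{..<p} - {i, j}"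
      have "real (card (?S q)) \<le> 2 ^ card (between E {v} (\<Union>l\<in>?R. Y l)) *
          (\<Prod>l\<in>{i, j}. (2 ^ card {v} - 1) ^ card (Y l) * 2 powr (\<epsilon> * M))"
        unfolding q(1) prod.case
        by (rule few) (use E Y q in auto)
      also have "(\<Prod>l\<in>{i, j}. (2 ^ card {v} - 1) ^ card (Y l) * 2 powr (\<epsilon> * M)) = 2 powr (2 * \<epsilon> * M)"
        using q(4) by (simp add: powr_add[symmetric] mult_ac)
      also have "2 ^ card (between E {v} (\<Union>l\<in>?R. Y l)) \<le> 2 powr (?N - 2 * L)"
      proof -
        have "card (between E {v} (\<Union>l\<in>?R. Y l)) \<le> card (\<Union>l\<in>?R. Y l)"
          by (rule card_between_single_le) (use Y in auto)
        also have "\<dots> \<le> (\<Sum>l\<in>?R. card (Y l))" by (rule card_UN_le) simp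
        finally have "real (card (between E {v} (\<Union>l\<in>?R. Y l))) \<le> real (\<Sum>l\<in>?R. card (Y l))" by (rule of_nat_mono)
        also have "\<dots> = (\<Sum>l\<in>?R. real (card (Y l)))" by simp
        also have "\<dots> = ?N - (\<Sum>l\<in>{i, j}. real (card (Y l)))"
          by (rule sum_diff) (use q in auto)
        also have "\<dots> \<le> ?N - 2 * L" using q(4) Y[OF q(2)] Y[OF q(3)] by simp
        finally show ?thesis by (simp add: powr_realpow[symmetric])
      qed
      finally show ?thesis by (simp add: powr_add mult_right_mono)
    qed
    have "{X. X \<subseteq> between E {v} (\<Union>i<p. Y i) \<and> poor_star E v p Y (\<gamma> * M) X} \<subseteq> (\<Union>q\<in>?Q. ?S q)"
    proof
      fix X assume "X \<in> {X. X \<subseteq> between E {v} (\<Union>i<p. Y i) \<and> poor_star E v p Y (\<gamma> * M) X}"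
      then obtain i j \<sigma> \<tau> where *: "X \<subseteq> between E {v} (\<Union>i<p. Y i)" "i < p" "j < p" "i \<noteq> j" "\<sigma> \<in> Pow {v}" "\<tau> \<in> Pow {v}"
        "real (card (matching E X {v} (Y i) \<sigma>)) < \<gamma> * M" "real (card (matching E X {v} (Y j) \<tau>)) < \<gamma> * M"
        unfolding poor_star_def by blast
      then have "X \<in> ?S (i, j, \<sigma>, \<tau>)" "(i, j, \<sigma>, \<tau>) \<in> ?Q" by auto
      then show "X \<in> (\<Union>q\<in>?Q. ?S q)" by blast
    qed
    moreover have "finite (?S q)" for q
      by (rule finite_subset[of _ "Pow (between E {v} (\<Union>i<p. Y i))"]) (use between_finite[OF E] in \<open>auto split: prod.splits\<close>)
    ultimately have "card {X. X \<subseteq> between E {v} (\<Union>i<p. Y i) \<and> poor_star E v p Y (\<gamma> * M) X} \<le> card (\<Union>q\<in>?Q. ?S q)"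
      using fQ by (intro card_mono) auto
    also have "\<dots> \<le> (\<Sum>q\<in>?Q. card (?S q))" by (rule card_UN_le[OF fQ])
    finally have "real (card {X. X \<subseteq> between E {v} (\<Union>i<p. Y i) \<and> poor_star E v p Y (\<gamma> * M) X}) \<le> real (\<Sum>q\<in>?Q. card (?S q))"
      by (rule of_nat_mono)
    also have "\<dots> = (\<Sum>q\<in>?Q. real (card (?S q)))" by simp
    also have "\<dots> \<le> real (card ?Q) * 2 powr (?N - 2 * L + 2 * \<epsilon> * M)"
      using one by (rule sum_bounded_above)
    also have "\<dots> \<le> real ((2 * p)\<^sup>2) * 2 powr (?N - 2 * L + 2 * \<epsilon> * M)"
      using cQ by (intro mult_right_mono of_nat_mono) auto
    finally show "real (card {X. X \<subseteq> between E {v} (\<Union>i<p. Y i) \<and> poor_star E v p Y (\<gamma> * M) X})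
        \<le> (2 * real p) ^ 2 * 2 powr (?N - 2 * L + 2 * \<epsilon> * M)" by simp
  next
    fix E :: "nat set set" and Z :: "nat set" and p and Y :: "nat \<Rightarrow> nat set" and M L :: real and i0
    assume E: "finite E" and Z: "finite Z" "Z \<noteq> {}" and i0: "i0 < p"
      and Y: "\<And>i. i < p \<Longrightarrow> finite (Y i) \<and> Z \<inter> Y i = {} \<and> L \<le> real (card (Y i)) \<and> real (card (Y i)) \<le> M"
    let ?z = "real (card Z)"
    let ?N = "\<Sum>i\<in>{..<p} - {i0}. real (card (Y i))"
    let ?e = "?z * ?N - L / 2 ^ card Z + real (card (between E Z (Y i0))) + \<epsilon> * M"
    let ?S = "\<lambda>(j, \<sigma>). {X. X \<subseteq> between E Z (\<Union>i<p. Y i) \<and> (\<forall>l\<in>{j}. real (card (matching E X Z (Y l) \<sigma>)) < \<gamma> * M)}"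
    let ?Q = "{(j, \<sigma>). j < p \<and> j \<noteq> i0 \<and> \<sigma> \<in> Pow Z}"
    have Qs: "?Q \<subseteq> {..<p} \<times> Pow Z" by auto
    have fQ: "finite ?Q" by (rule finite_subset[OF Qs]) (use Z in simp)
    have "card ?Q \<le> card ({..<p} \<times> Pow Z)" by (rule card_mono[OF _ Qs]) (use Z in simp)
    also have "\<dots> = p * 2 ^ card Z" using Z by (simp add: card_cartesian_product card_Pow)
    finally have cQ: "card ?Q \<le> p * 2 ^ card Z" .
    have one: "real (card (?S q)) \<le> 2 powr ?e" if "q \<in> ?Q" for q
    proof -
      from that obtain j \<sigma> where q: "q = (j, \<sigma>)" "j < p" "j \<noteq> i0" by auto
      let ?R = "{..<p} - {j}" and ?R' = "{..<p} - {i0} - {j}"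
      have "real (card (?S q)) \<le> 2 ^ card (between E Z (\<Union>l\<in>?R. Y l)) *
          (\<Prod>l\<in>{j}. (2 ^ card Z - 1) ^ card (Y l) * 2 powr (\<epsilon> * M))"
        unfolding q(1) prod.case
        by (rule few[where \<sigma> = "\<lambda>_. \<sigma>"]) (use E Z Y q in auto)
      also have "\<dots> = 2 ^ card (between E Z (\<Union>l\<in>?R. Y l)) * (2 ^ card Z - 1) ^ card (Y j) * 2 powr (\<epsilon> * M)" by simp
      also have "\<dots> \<le> 2 powr (real (card (between E Z (Y i0))) + ?z * (\<Sum>l\<in>?R'. real (card (Y l)))) * 2 powr (?z * real (card (Y j)) - L / 2 ^ card Z) * 2 powr (\<epsilon> * M)"
      proof (intro mult_mono)
        have "between E Z (\<Union>l\<in>?R. Y l) \<subseteq> between E Z (Y i0) \<union> between E Z (\<Union>l\<in>?R'. Y l)"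
          unfolding between_def by blast
        then have "card (between E Z (\<Union>l\<in>?R. Y l)) \<le> card (between E Z (Y i0) \<union> between E Z (\<Union>l\<in>?R'. Y l))"
          using between_finite[OF E] by (intro card_mono) auto
        also have "\<dots> \<le> card (between E Z (Y i0)) + card (between E Z (\<Union>l\<in>?R'. Y l))" by (rule card_Un_le)
        also have "card (between E Z (\<Union>l\<in>?R'. Y l)) \<le> card Z * card (\<Union>l\<in>?R'. Y l)"
          by (rule card_between_le) (use Z Y in auto)
        also have "card (\<Union>l\<in>?R'. Y l) \<le> (\<Sum>l\<in>?R'. card (Y l))" by (rule card_UN_le) simp
        finally have "card (between E Z (\<Union>l\<in>?R. Y l)) \<le> card (between E Z (Y i0)) + card Z * (\<Sum>l\<in>?R'. card (Y l))" by simp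
        then have "real (card (between E Z (\<Union>l\<in>?R. Y l))) \<le> real (card (between E Z (Y i0)) + card Z * (\<Sum>l\<in>?R'. card (Y l)))" by (rule of_nat_mono)
        then show "2 ^ card (between E Z (\<Union>l\<in>?R. Y l)) \<le> 2 powr (real (card (between E Z (Y i0))) + ?z * (\<Sum>l\<in>?R'. real (card (Y l))))"
          by (simp add: powr_realpow[symmetric])
        have "(2 ^ card Z - 1) ^ card (Y j) \<le> (2 powr (?z - 1 / 2 ^ card Z)) ^ card (Y j)"
          by (intro power_mono two_power_minus_one_le) auto
        also have "\<dots> = 2 powr (?z * real (card (Y j)) - real (card (Y j)) / 2 ^ card Z)"
          by (simp add: powr_realpow[symmetric] powr_powr algebra_simps)
        also have "\<dots> \<le> 2 powr (?z * real (card (Y j)) - L / 2 ^ card Z)"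
          using Y[OF q(2)] by (simp add: divide_right_mono)
        finally show "(2 ^ card Z - 1) ^ card (Y j) \<le> 2 powr (?z * real (card (Y j)) - L / 2 ^ card Z)" .
      qed auto
      also have "\<dots> = 2 powr ?e"
      proof -
        have "?N = real (card (Y j)) + (\<Sum>l\<in>?R'. real (card (Y l)))" by (rule sum.remove) (use q in auto)
        then show ?thesis by (simp add: powr_add[symmetric] algebra_simps)
      qed
      finally show ?thesis .
    qed
    have "{X. X \<subseteq> between E Z (\<Union>i<p. Y i) \<and> poor_config E Z p Y i0 (\<gamma> * M) X} \<subseteq> (\<Union>q\<in>?Q. ?S q)"
    proof
      fix X assume "X \<in> {X. X \<subseteq> between E Z (\<Union>i<p. Y i) \<and> poor_config E Z p Y i0 (\<gamma> * M) X}"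
      then obtain j \<sigma> where *: "X \<subseteq> between E Z (\<Union>i<p. Y i)" "j < p" "j \<noteq> i0" "\<sigma> \<in> Pow Z"
        "real (card (matching E X Z (Y j) \<sigma>)) < \<gamma> * M"
        unfolding poor_config_def by blast
      then have "X \<in> ?S (j, \<sigma>)" "(j, \<sigma>) \<in> ?Q" by auto
      then show "X \<in> (\<Union>q\<in>?Q. ?S q)" by blast
    qed
    moreover have "finite (?S q)" for q
      by (rule finite_subset[of _ "Pow (between E Z (\<Union>i<p. Y i))"]) (use between_finite[OF E] in \<open>auto split: prod.splits\<close>)
    ultimately have "card {X. X \<subseteq> between E Z (\<Union>i<p. Y i) \<and> poor_config E Z p Y i0 (\<gamma> * M) X} \<le> card (\<Union>q\<in>?Q. ?S q)"
      using fQ by (intro card_mono) auto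
    also have "\<dots> \<le> (\<Sum>q\<in>?Q. card (?S q))" by (rule card_UN_le[OF fQ])
    finally have "real (card {X. X \<subseteq> between E Z (\<Union>i<p. Y i) \<and> poor_config E Z p Y i0 (\<gamma> * M) X}) \<le> real (\<Sum>q\<in>?Q. card (?S q))"
      by (rule of_nat_mono)
    also have "\<dots> = (\<Sum>q\<in>?Q. real (card (?S q)))" by simp
    also have "\<dots> \<le> real (card ?Q) * 2 powr ?e"
      using one by (rule sum_bounded_above)
    also have "\<dots> \<le> real (p * 2 ^ card Z) * 2 powr ?e"
      using cQ by (intro mult_right_mono of_nat_mono) auto
    finally show "real (card {X. X \<subseteq> between E Z (\<Union>i<p. Y i) \<and> poor_config E Z p Y i0 (\<gamma> * M) X})
        \<le> real p * 2 ^ card Z * 2 powr ?e" by simp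
  qed
qed

section \<open>Centres and configurations, and how they produce readiness\<close>

text \<open>Removing \<open>x\<close> leaves a \<open>p\<close>-colouring in which no in-neighbour
  of \<open>x\<close> has colour \<open>0\<close>. This is what remains of a configuration over an
  out-star when all its vertices except the image of the centre are merged into the padding
  class.\<close>

definition out_centre :: "'b dgraph \<Rightarrow> nat \<Rightarrow> bool" where
  "out_centre F p \<longleftrightarrow> (\<exists>x\<in>fst F. \<exists>c. (\<forall>u\<in>fst F. c u < p) \<and>
     (\<forall>(u, v)\<in>snd F. (u \<noteq> x \<and> v \<noteq> x \<longrightarrow> c u \<noteq> c v) \<and> (v = x \<longrightarrow> c u \<noteq> 0)))"

definition in_centre :: "'b dgraph \<Rightarrow> nat \<Rightarrow> bool" where
  "in_centre F p \<longleftrightarrow> (\<exists>x\<in>fst F. \<exists>c. (\<forall>u\<in>fst F. c u < p) \<and>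
     (\<forall>(u, v)\<in>snd F. (u \<noteq> x \<and> v \<noteq> x \<longrightarrow> c u \<noteq> c v) \<and> (u = x \<longrightarrow> c v \<noteq> 0)))"

text \<open>A copy of \<open>F\<close> in an orientation of the graph \<open>GM M p t\<close> extending \<open>D\<close>: the vertices in \<open>S\<close> go to \<open>M\<close> via
  \<open>\<psi>\<close>, colour \<open>0\<close> outside \<open>S\<close> stands for the padding vertices, the other colours for the classes of
  \<open>K\<^bsub>p-1\<^esub>(t)\<close>.\<close>

definition config :: "'b dgraph \<Rightarrow> nat \<Rightarrow> 'd dgraph \<Rightarrow> bool" where
  "config F p D \<longleftrightarrow> (\<exists>S \<psi> c. S \<subseteq> fst F \<and> inj_on \<psi> S \<and> \<psi> ` S \<subseteq> fst D \<and> (\<forall>u\<in>fst F. c u < p) \<and>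
     (\<forall>(u, v)\<in>snd F. (u \<in> S \<and> v \<in> S \<longrightarrow> (\<psi> u, \<psi> v) \<in> snd D) \<and> (u \<in> S \<and> v \<notin> S \<longrightarrow> c v \<noteq> (0::nat)) \<and>
        (u \<notin> S \<and> v \<in> S \<longrightarrow> c u \<noteq> 0) \<and> (u \<notin> S \<and> v \<notin> S \<longrightarrow> c u \<noteq> c v)))"

text \<open>Renames the exceptional colour \<open>0\<close> to the class where the defect sits,
  without disturbing properness.\<close>

definition swap0 :: "nat \<Rightarrow> nat \<Rightarrow> nat" where
  "swap0 i a = (if a = 0 then i else if a = i then 0 else a)"

lemma swap0: "swap0 i a = swap0 i b \<longleftrightarrow> a = b" "swap0 i a = i \<longleftrightarrow> a = 0" "i < p \<Longrightarrow> a < p \<Longrightarrow> swap0 i a < p"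
  by (auto simp: swap0_def)

text \<open>If at most one class lacks a direction, that class still offers one of the two
  directions in abundance, because its degree is at least \<open>2 * m\<close>. According to that
  direction the out-centre or the in-centre of \<open>F\<close> is placed on \<open>v\<close>, with
  colour \<open>0\<close> in the deficient class and all other classes available in both
  directions.\<close>

lemma star_ready:
  assumes G: "wf_graph (V, E)" and F: "wf_dgraph F" and o: "out_centre F p" and i: "in_centre F p"
    and v: "v \<in> V" and Y: "\<And>i. i < p \<Longrightarrow> Y i \<subseteq> V - {v}"
    and deg: "\<And>i. i < p \<Longrightarrow> 2 * m \<le> real (card {y \<in> Y i. {v, y} \<in> E})"
    and nr: "\<not> ready V E F p {v} Y m X"
  shows "poor_star E v p Y m X"
proof (rule ccontr)
  assume np: "\<not> poor_star E v p Y m X"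
  note fin = wf_graph_finite[OF G]
  let ?out = "\<lambda>i. matching E X {v} (Y i) {v}" and ?in = "\<lambda>i. matching E X {v} (Y i) {}"
  have p: "p > 0"
  proof -
    obtain x c where "x \<in> fst F" "\<forall>u\<in>fst F. c u < p" using o unfolding out_centre_def by blast
    then show ?thesis by (metis not_gr_zero not_less_zero)
  qed
  have fY: "finite (Y i)" if "i < p" for i using Y[OF that] fin by (meson finite_Diff finite_subset)
  have sum: "2 * m \<le> real (card (?out i)) + real (card (?in i))" if i: "i < p" for i
  proof -
    have "{y \<in> Y i. {v, y} \<in> E} = ?out i \<union> ?in i" by (auto simp: matching_def)
    then have "card {y \<in> Y i. {v, y} \<in> E} \<le> card (?out i) + card (?in i)" by (metis card_Un_le)
    then show ?thesis using deg[OF i] by linarith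
  qed
  define few where "few i \<longleftrightarrow> (\<exists>\<sigma>\<in>Pow {v}. real (card (matching E X {v} (Y i) \<sigma>)) < m)" for i
  have two: "i = j" if "i < p" "j < p" "few i" "few j" for i j
    using np that unfolding poor_star_def few_def by blast
  \<comment> \<open>The class with a scarce direction. If there is none, any class can play its
    part, and \<open>0\<close> is taken.\<close>
  define i0 where "i0 = (if \<exists>i<p. few i then SOME i. i < p \<and> few i else 0)"
  have i0p: "i0 < p"
  proof (cases "\<exists>i<p. few i")
    case True
    then have "(SOME i. i < p \<and> few i) < p" using someI_ex[of "\<lambda>i. i < p \<and> few i"] by blast
    then show ?thesis using True by (simp add: i0_def)
  next
    case False
    then have "i0 = 0" by (simp only: i0_def if_False)
    then show ?thesis using p by simp
  qed
  have nf: "\<not> few j" if "j < p" "j \<noteq> i0" for j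
  proof
    assume f: "few j"
    then have ex: "\<exists>i. i < p \<and> few i" using that by blast
    then have "few (SOME i. i < p \<and> few i)" "(SOME i. i < p \<and> few i) < p" using someI_ex[OF ex] by blast+
    then have "few i0" using ex by (simp add: i0_def)
    then show False using two[OF that(1) i0p f] that by simp
  qed
  have many: "m \<le> real (card (?out j))" "m \<le> real (card (?in j))" if "j < p" "j \<noteq> i0" for j
    using nf[OF that] unfolding few_def by (force simp: not_less)+
  have vE: "y \<noteq> v" if "{v, y} \<in> E" for y using wf_graph_pair(1)[OF G that] by auto
  have arc_out: "arc E X v y" if "y \<in> ?out j" for y j using that by (auto simp: matching_def)
  have arc_in: "arc E X y v" if "y \<in> ?in j" for y j
    using that arc_asym[of v y E X] vE by (auto simp: matching_def)
  have subY: "?out j \<subseteq> Y j" "?in j \<subseteq> Y j" for j by (auto simp: matching_def)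
  have "m \<le> real (card (?out i0)) \<or> m \<le> real (card (?in i0))" using sum[OF i0p] by linarith
  then show False
  proof
    assume m0: "m \<le> real (card (?out i0))"
    obtain x c where x: "x \<in> fst F" and c: "\<forall>u\<in>fst F. c u < p"
      and R: "\<forall>(u, w)\<in>snd F. (u \<noteq> x \<and> w \<noteq> x \<longrightarrow> c u \<noteq> c w) \<and> (w = x \<longrightarrow> c u \<noteq> 0)"
      using o unfolding out_centre_def by blast
    define W where "W u = (if (u, x) \<in> snd F then ?in (swap0 i0 (c u)) else ?out (swap0 i0 (c u)))" for u
    have "ready V E F p {v} Y m X"
    proof (rule readyI[where S = "{x}" and \<theta> = "\<lambda>_. v" and c = "\<lambda>u. swap0 i0 (c u)" and W = W])
      show "swap0 i0 (c u) < p \<and> W u \<subseteq> Y (swap0 i0 (c u)) \<and> m \<le> real (card (W u))" if u: "u \<in> fst F - {x}" for u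
      proof (cases "c u = 0")
        case True
        then have "(u, x) \<notin> snd F" using R by auto
        then show ?thesis using True m0 i0p subY by (simp add: W_def swap0_def)
      next
        case False
        then have "swap0 i0 (c u) < p" "swap0 i0 (c u) \<noteq> i0" using c u i0p swap0 by auto
        then show ?thesis using many subY by (auto simp: W_def)
      qed
      show "arc E X v y" if "(z, u) \<in> snd F" "z \<in> {x}" "u \<notin> {x}" "y \<in> W u" for z u y
      proof -
        have "(u, x) \<notin> snd F" using that wf_dgraphD(3)[OF F] by blast
        then show ?thesis using that arc_out by (auto simp: W_def)
      qed
      show "arc E X y v" if "(u, z) \<in> snd F" "z \<in> {x}" "u \<notin> {x}" "y \<in> W u" for z u y
        using that arc_in by (auto simp: W_def)
      show "arc E X v v" if "(a, b) \<in> snd F" "a \<in> {x}" "b \<in> {x}" for a b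
        using wf_dgraphD(3)[OF F that(1)] that by auto
    qed (use G F x v Y R swap0 in auto)
    then show False using nr by simp
  next
    assume m0: "m \<le> real (card (?in i0))"
    obtain x c where x: "x \<in> fst F" and c: "\<forall>u\<in>fst F. c u < p"
      and R: "\<forall>(u, w)\<in>snd F. (u \<noteq> x \<and> w \<noteq> x \<longrightarrow> c u \<noteq> c w) \<and> (u = x \<longrightarrow> c w \<noteq> 0)"
      using i unfolding in_centre_def by blast
    define W where "W u = (if (x, u) \<in> snd F then ?out (swap0 i0 (c u)) else ?in (swap0 i0 (c u)))" for u
    have "ready V E F p {v} Y m X"
    proof (rule readyI[where S = "{x}" and \<theta> = "\<lambda>_. v" and c = "\<lambda>u. swap0 i0 (c u)" and W = W])
      show "swap0 i0 (c u) < p \<and> W u \<subseteq> Y (swap0 i0 (c u)) \<and> m \<le> real (card (W u))" if u: "u \<in> fst F - {x}" for u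
      proof (cases "c u = 0")
        case True
        then have "(x, u) \<notin> snd F" using R by auto
        then show ?thesis using True m0 i0p subY by (simp add: W_def swap0_def)
      next
        case False
        then have "swap0 i0 (c u) < p" "swap0 i0 (c u) \<noteq> i0" using c u i0p swap0 by auto
        then show ?thesis using many subY by (auto simp: W_def)
      qed
      show "arc E X v y" if "(z, u) \<in> snd F" "z \<in> {x}" "u \<notin> {x}" "y \<in> W u" for z u y
        using that arc_out by (auto simp: W_def)
      show "arc E X y v" if "(u, z) \<in> snd F" "z \<in> {x}" "u \<notin> {x}" "y \<in> W u" for z u y
      proof -
        have "(x, u) \<notin> snd F" using that wf_dgraphD(3)[OF F] by blast
        then show ?thesis using that arc_in by (auto simp: W_def)
      qed
      show "arc E X v v" if "(a, b) \<in> snd F" "a \<in> {x}" "b \<in> {x}" for a b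
        using wf_dgraphD(3)[OF F that(1)] that by auto
    qed (use G F x v Y R swap0 in auto)
    then show False using nr by simp
  qed
qed

text \<open>The part \<open>S\<close> of the configuration goes into \<open>Z\<close>, the padding
  vertices into \<open>Y i0\<close>, where arbitrary attachment is allowed, and each remaining
  vertex into the candidates with the right pattern towards \<open>Z\<close>. A configuration thus
  fails to be ready only if a pattern is rare in some class other than \<open>i0\<close>.\<close>

lemma config_ready:
  assumes G: "wf_graph (V, E)" and F: "wf_dgraph F" and D: "config F p D"
    and \<theta>: "inj_on \<theta> (fst D)" "\<theta> ` fst D \<subseteq> Z" "\<And>a b. (a, b) \<in> snd D \<Longrightarrow> arc E X (\<theta> a) (\<theta> b)"
    and Z: "Z \<subseteq> V" and Y: "\<And>i. i < p \<Longrightarrow> Y i \<subseteq> V - Z"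
    and i0: "i0 < p" and m: "m \<le> real (card (Y i0))" and nr: "\<not> ready V E F p Z Y m X"
  shows "poor_config E Z p Y i0 m X"
proof (rule ccontr)
  assume np: "\<not> poor_config E Z p Y i0 m X"
  obtain S \<psi> c where S: "S \<subseteq> fst F" "inj_on \<psi> S" "\<psi> ` S \<subseteq> fst D" and c: "\<forall>u\<in>fst F. c u < p"
    and R: "\<forall>(u, v)\<in>snd F. (u \<in> S \<and> v \<in> S \<longrightarrow> (\<psi> u, \<psi> v) \<in> snd D) \<and> (u \<in> S \<and> v \<notin> S \<longrightarrow> c v \<noteq> (0::nat)) \<and>
        (u \<notin> S \<and> v \<in> S \<longrightarrow> c u \<noteq> 0) \<and> (u \<notin> S \<and> v \<notin> S \<longrightarrow> c u \<noteq> c v)"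
    using D unfolding config_def by (elim exE conjE)
  let ?\<theta> = "\<lambda>x. \<theta> (\<psi> x)"
  \<comment> \<open>The images of the in-neighbours of \<open>u\<close>. The pattern prescribes a
    direction on all of \<open>Z\<close>, even where \<open>F\<close> has no arc, so that a single
    matching set describes the candidates for \<open>u\<close>.\<close>
  define pat where "pat u = ?\<theta> ` {x \<in> S. (x, u) \<in> snd F}" for u
  define W where "W u = (if c u = 0 then Y i0 else matching E X Z (Y (swap0 i0 (c u))) (pat u))" for u
  have inj: "inj_on ?\<theta> S" using S \<theta>(1) by (metis comp_inj_on inj_on_subset comp_def inj_on_cong)
  have \<theta>Z: "?\<theta> x \<in> Z" if "x \<in> S" for x using that S(3) \<theta>(2) by auto
  have "ready V E F p Z Y m X"
  proof (rule readyI[where S = S and \<theta> = ?\<theta> and c = "\<lambda>u. swap0 i0 (c u)" and W = W, OF G F S(1) inj _ Z Y])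
    show "swap0 i0 (c u) < p \<and> W u \<subseteq> Y (swap0 i0 (c u)) \<and> m \<le> real (card (W u))" if u: "u \<in> fst F - S" for u
    proof (cases "c u = 0")
      case True
      then show ?thesis using m i0 by (simp add: W_def swap0_def)
    next
      case False
      then have j: "swap0 i0 (c u) < p" "swap0 i0 (c u) \<noteq> i0" using c u i0 swap0 by auto
      have "pat u \<in> Pow Z" using \<theta>Z by (auto simp: pat_def)
      then have "m \<le> real (card (matching E X Z (Y (swap0 i0 (c u))) (pat u)))"
        using np j unfolding poor_config_def by (meson not_less)
      then show ?thesis using False j by (auto simp: W_def matching_def)
    qed
    show "swap0 i0 (c u) \<noteq> swap0 i0 (c v)" if "(u, v) \<in> snd F" "u \<notin> S" "v \<notin> S" for u v
      using R that swap0 by auto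
    show "arc E X (?\<theta> x) (?\<theta> y)" if "(x, y) \<in> snd F" "x \<in> S" "y \<in> S" for x y
      using R that \<theta>(3) by auto
    show "arc E X (?\<theta> x) y" if xu: "(x, u) \<in> snd F" "x \<in> S" "u \<notin> S" "y \<in> W u" for x u y
    proof -
      have "c u \<noteq> 0" using R xu by auto
      then have "y \<in> matching E X Z (Y (swap0 i0 (c u))) (pat u)" using xu by (simp add: W_def)
      moreover have "?\<theta> x \<in> pat u" using xu by (auto simp: pat_def)
      ultimately show ?thesis using \<theta>Z[OF xu(2)] by (simp add: matching_def)
    qed
    show "arc E X y (?\<theta> x)" if xu: "(u, x) \<in> snd F" "x \<in> S" "u \<notin> S" "y \<in> W u" for x u y
    proof -
      have "c u \<noteq> 0" using R xu by auto
      then have y: "y \<in> matching E X Z (Y (swap0 i0 (c u))) (pat u)" using xu by (simp add: W_def)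
      have "?\<theta> x \<notin> pat u"
      proof
        assume "?\<theta> x \<in> pat u"
        then obtain x' where x': "x' \<in> S" "(x', u) \<in> snd F" "?\<theta> x = ?\<theta> x'" by (auto simp: pat_def)
        then have "x = x'" using inj xu(2) by (auto dest: inj_onD)
        then show False using x' xu wf_dgraphD(3)[OF F] by blast
      qed
      then have e: "{?\<theta> x, y} \<in> E" "\<not> arc E X (?\<theta> x) y" using y \<theta>Z[OF xu(2)] by (auto simp: matching_def)
      then show ?thesis using arc_asym[of "?\<theta> x" y E X] wf_graph_pair(1)[OF G e(1)] by blast
    qed
  qed (use \<theta>Z in auto)
  then show False using nr by simp
qed

section \<open>Turan numbers\<close>

text \<open>The new vertex \<open>n\<close> is joined to all smaller ones except those in its
  residue class, of which there are \<open>n div p\<close>.\<close>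

lemma turan_num_Suc:
  assumes p: "p > 0"
  shows "turan_num (Suc n) p = turan_num n p + (n - n div p)"
proof -
  let ?E = "\<lambda>n. {{u, v} | u v. u < n \<and> v < n \<and> u mod p \<noteq> v mod p}"
  let ?N = "{u. u < n \<and> u mod p \<noteq> n mod p}"
  have un: "?E (Suc n) = ?E n \<union> (\<lambda>u. {u, n}) ` ?N"
  proof (intro equalityI subsetI)
    fix e assume "e \<in> ?E (Suc n)"
    then obtain u v where uv: "e = {u, v}" "u < Suc n" "v < Suc n" "u mod p \<noteq> v mod p" by auto
    consider "u < n" "v < n" | "u = n" "v < n" | "u < n" "v = n" | "u = n" "v = n" using uv by linarith
    then show "e \<in> ?E n \<union> (\<lambda>u. {u, n}) ` ?N"
    proof cases
      case 1 then show ?thesis using uv by blast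
    next
      case 2 then have "v \<in> ?N" "e = {v, n}" using uv by auto
      then show ?thesis by blast
    next
      case 3 then have "u \<in> ?N" "e = {u, n}" using uv by auto
      then show ?thesis by blast
    qed (use uv in simp)
  next
    fix e assume "e \<in> ?E n \<union> (\<lambda>u. {u, n}) ` ?N"
    then show "e \<in> ?E (Suc n)"
    proof
      assume "e \<in> ?E n"
      then show ?thesis using less_SucI by blast
    next
      assume "e \<in> (\<lambda>u. {u, n}) ` ?N"
      then obtain u where "u \<in> ?N" "e = {u, n}" by (elim imageE)
      then have "e = {u, n} \<and> u < Suc n \<and> n < Suc n \<and> u mod p \<noteq> n mod p" by simp
      then show ?thesis by blast
    qed
  qed
  have fE: "finite (?E n)" by (rule finite_subset[of _ "Pow {..<n}"]) auto
  have "inj_on (\<lambda>u. {u, n}) ?N" by (rule inj_onI) (auto simp: doubleton_eq_iff)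
  then have "card ((\<lambda>u. {u, n}) ` ?N) = card ?N" by (rule card_image)
  moreover have "?E n \<inter> (\<lambda>u. {u, n}) ` ?N = {}" by (auto simp: doubleton_eq_iff)
  ultimately have "card (?E (Suc n)) = card (?E n) + card ?N"
    unfolding un using fE by (subst card_Un_disjoint) auto
  moreover have "card ?N = n - n div p"
  proof -
    let ?M = "{u. u < n \<and> u mod p = n mod p}"
    have "?M = (\<lambda>q. q * p + n mod p) ` {..<n div p}"
    proof (intro equalityI subsetI)
      fix u assume u: "u \<in> ?M"
      have "u div p < n div p"
      proof (rule ccontr)
        assume "\<not> u div p < n div p"
        then have "n div p * p \<le> u div p * p" by (intro mult_le_mono1) simp
        moreover have "n div p * p + n mod p = n" by (rule div_mult_mod_eq)
        moreover have "u div p * p + n mod p = u" using u div_mult_mod_eq[of u p] by simp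
        ultimately have "n \<le> u" by linarith
        then show False using u by simp
      qed
      moreover have "u = u div p * p + n mod p" using u div_mult_mod_eq[of u p] by simp
      ultimately show "u \<in> (\<lambda>q. q * p + n mod p) ` {..<n div p}" by blast
    next
      fix u assume "u \<in> (\<lambda>q. q * p + n mod p) ` {..<n div p}"
      then obtain q where q: "q < n div p" "u = q * p + n mod p" by auto
      have "q * p < n div p * p" using q p by simp
      then have "u < n" using q div_mult_mod_eq[of n p] by linarith
      then show "u \<in> ?M" using q by simp
    qed
    moreover have "inj_on (\<lambda>q. q * p + n mod p) {..<n div p}" by (rule inj_onI) (use p in auto)
    ultimately have "card ?M = n div p" by (simp add: card_image)
    moreover have "?N = {..<n} - ?M" by auto
    ultimately show ?thesis by (simp add: card_Diff_subset subset_iff)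
  qed
  ultimately show ?thesis by (simp add: turan_num_def turan_graph_def)
qed

lemma turan_num_step_ge:
  assumes p: "p > 0"
  shows "(1 - 1 / real p) * real n \<le> real (n - n div p)"
proof -
  have "real (n div p) \<le> real n / real p" by (rule of_nat_div_le_of_nat)
  moreover have "n div p \<le> n" by simp
  ultimately show ?thesis by (simp add: of_nat_diff algebra_simps)
qed

text \<open>Each of the \<open>b\<close> new vertices meets at least \<open>a\<close> older ones and
  is joined to at least a fraction \<open>1 - 1 / p\<close> of them. This increment is what deleted
  vertices are charged against.\<close>

lemma turan_num_diff_ge:
  assumes p: "p > 0"
  shows "real (turan_num a p) + (1 - 1 / real p) * real a * real b \<le> real (turan_num (a + b) p)"
proof (induction b)
  case (Suc b)
  define q where "q = 1 - 1 / real p"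
  have q: "0 \<le> q" using p by (simp add: q_def)
  have "q * real a \<le> q * real (a + b)" using q by (intro mult_left_mono) auto
  also have "\<dots> \<le> real (a + b - (a + b) div p)" unfolding q_def by (rule turan_num_step_ge[OF p])
  finally have 1: "q * real a \<le> real (a + b - (a + b) div p)" .
  have "real (turan_num (a + Suc b) p) = real (turan_num (a + b) p) + real (a + b - (a + b) div p)"
    by (simp only: add_Suc_right turan_num_Suc[OF p] of_nat_add)
  moreover have "q * real a * real (Suc b) = q * real a * real b + q * real a" by (simp add: algebra_simps)
  ultimately show ?case using Suc 1 by (simp only: q_def[symmetric])
qed simp

lemma turan_num_ge:
  assumes p: "p > 0"
  shows "(1 - 1 / real p) * ((real n)\<^sup>2 - real n) / 2 \<le> real (turan_num n p)"
proof (induction n)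
  case (Suc n)
  define q where "q = 1 - 1 / real p"
  have "q * ((real (Suc n))\<^sup>2 - real (Suc n)) / 2 = q * ((real n)\<^sup>2 - real n) / 2 + q * real n"
    by (simp add: power2_eq_square algebra_simps add_divide_distrib diff_divide_distrib)
  also have "\<dots> \<le> real (turan_num n p) + real (n - n div p)"
    using Suc turan_num_step_ge[OF p] unfolding q_def by (rule add_mono)
  finally show ?case by (simp only: turan_num_Suc[OF p] of_nat_add q_def)
qed (simp add: turan_num_def turan_graph_def)

section \<open>Partitions and their cross edges\<close>

definition cross :: "nat set \<Rightarrow> (nat \<Rightarrow> nat) \<Rightarrow> nat set set" where
  "cross V c = {{u, v} | u v. u \<in> V \<and> v \<in> V \<and> c u \<noteq> c v}"

lemma wf_graph_cross: "finite V \<Longrightarrow> wf_graph (V, cross V c)"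
  by (force simp: wf_graph_def cross_def)

text \<open>With \<open>n + 1\<close> vertices some class has more than \<open>n div p\<close> of
  them. Removing a vertex of that class destroys at most \<open>n - n div p\<close> cross edges,
  which is the increment of the Turan number.\<close>

lemma card_cross_le_turan:
  assumes "finite V" "p > 0" "\<And>v. v \<in> V \<Longrightarrow> c v < p"
  shows "card (cross V c) \<le> turan_num (card V) p"
  using assms
proof (induction "card V" arbitrary: V)
  case 0
  then show ?case by (simp add: cross_def)
next
  case (Suc n)
  let ?C = "\<lambda>i. {v \<in> V. c v = i}"
  have "\<exists>i<p. n div p < card (?C i)"
  proof (rule ccontr)
    assume "\<not> (\<exists>i<p. n div p < card (?C i))"
    then have le: "card (?C i) \<le> n div p" if "i < p" for i using that by (meson not_less)
    have "V = (\<Union>i<p. ?C i)" using Suc.prems by auto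
    then have "card V \<le> (\<Sum>i<p. card (?C i))" using card_UN_le[of "{..<p}" ?C] by simp
    also have "\<dots> \<le> p * (n div p)" using sum_bounded_above[of "{..<p}" "\<lambda>i. card (?C i)" "n div p"] le by simp
    also have "\<dots> \<le> n" by simp
    finally show False using Suc.hyps by simp
  qed
  then obtain i where i: "i < p" "n div p < card (?C i)" by blast
  then obtain v where v: "v \<in> V" "c v = i" by (metis (mono_tags, lifting) card.empty empty_Collect_eq not_less_zero)
  let ?V = "V - {v}"
  have cV: "card ?V = n" using Suc.hyps(2) v Suc.prems(1) by simp
  have "cross V c \<subseteq> cross ?V c \<union> (\<lambda>w. {v, w}) ` (V - ?C i)"
  proof
    fix e assume "e \<in> cross V c"
    then obtain a b where ab: "e = {a, b}" "a \<in> V" "b \<in> V" "c a \<noteq> c b" by (auto simp: cross_def)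
    consider "a = v" | "b = v" | "a \<noteq> v" "b \<noteq> v" by blast
    then show "e \<in> cross ?V c \<union> (\<lambda>w. {v, w}) ` (V - ?C i)"
    proof cases
      case 1 then have "b \<in> V - ?C i" "e = {v, b}" using ab v by auto
      then show ?thesis by blast
    next
      case 2 then have "a \<in> V - ?C i" "e = {v, a}" using ab v by auto
      then show ?thesis by blast
    next
      case 3 then show ?thesis using ab by (auto simp: cross_def)
    qed
  qed
  moreover have "finite (cross ?V c \<union> (\<lambda>w. {v, w}) ` (V - ?C i))"
    using Suc.prems(1) wf_graph_finite(2)[OF wf_graph_cross, of ?V c] by auto
  ultimately have "card (cross V c) \<le> card (cross ?V c \<union> (\<lambda>w. {v, w}) ` (V - ?C i))" by (rule card_mono[rotated])
  also have "\<dots> \<le> card (cross ?V c) + card ((\<lambda>w. {v, w}) ` (V - ?C i))" by (rule card_Un_le)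
  also have "card ((\<lambda>w. {v, w}) ` (V - ?C i)) \<le> card (V - ?C i)" using Suc.prems by (intro card_image_le) auto
  also have "card (V - ?C i) = Suc n - card (?C i)" using Suc by (subst card_Diff_subset) auto
  also have "\<dots> \<le> n - n div p" using i by linarith
  also have "card (cross ?V c) \<le> turan_num n p" using Suc.hyps(1)[of ?V] cV Suc.prems by auto
  finally have "card (cross V c) \<le> turan_num n p + (n - n div p)" by simp
  then show ?case using Suc.hyps(2) turan_num_Suc[OF Suc.prems(2), of n] by simp
qed

lemma card_ordered_pairs:
  fixes V :: "nat set"
  assumes "wf_graph (V, E)"
  shows "card {(u, v). {u, v} \<in> E} = 2 * card E"
proof -
  have fE: "finite E" using wf_graph_finite[OF assms] by simp
  have aux: "finite E \<Longrightarrow> (\<forall>e\<in>E. \<exists>u v. e = {u, v} \<and> u \<noteq> v) \<Longrightarrow> card {(u :: nat, v). {u, v} \<in> E} = 2 * card E \<and> finite {(u :: nat, v). {u, v} \<in> E}"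
    for E :: "nat set set"
  proof (induction E rule: finite_induct)
    case (insert e E)
    obtain a b where ab: "e = {a, b}" "a \<noteq> b" using insert.prems by auto
    let ?P = "{(u, v). {u, v} \<in> E}"
    have "{(u, v). {u, v} \<in> insert e E} = {(a, b), (b, a)} \<union> ?P"
      using ab by (auto simp: doubleton_eq_iff)
    moreover have "(a, b) \<notin> ?P" "(b, a) \<notin> ?P" using insert.hyps ab by (auto simp: insert_commute)
    moreover have "card ?P = 2 * card E \<and> finite ?P" using insert by auto
    ultimately show ?case using ab insert.hyps by simp
  qed simp
  have "\<forall>e\<in>E. \<exists>u v. e = {u, v} \<and> u \<noteq> v" using wf_graph_edge[OF assms] by metis
  then show ?thesis using aux[OF fE] by simp
qed

text \<open>With class sizes \<open>a i\<close>, twice the number of cross edges is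
  \<open>n ^ 2\<close> minus the sum of the \<open>(a i) ^ 2\<close>, and the sum of the
  \<open>(a i - n / p) ^ 2\<close> is the sum of the \<open>(a i) ^ 2\<close> minus
  \<open>n ^ 2 / p\<close>. Almost as many cross edges as the Turan number therefore force every
  class close to \<open>n / p\<close>.\<close>

lemma class_size_ge:
  assumes V: "finite V" and p: "p > 0" and c: "\<And>v. v \<in> V \<Longrightarrow> c v < p" and i: "i < p"
    and x: "real (turan_num (card V) p) - x \<le> real (card (cross V c))"
  shows "(real (card {v \<in> V. c v = i}) - real (card V) / real p)\<^sup>2 \<le> 2 * x + real (card V)"
proof -
  let ?C = "\<lambda>i. {v \<in> V. c v = i}"
  define n where "n = real (card V)"
  define a where "a i = real (card (?C i))" for i
  have sa: "(\<Sum>i<p. a i) = n"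
  proof -
    have "card (\<Union>i<p. ?C i) = (\<Sum>i<p. card (?C i))"
      by (rule card_UN_disjoint) (use V in auto)
    moreover have "(\<Union>i<p. ?C i) = V" using c by auto
    ultimately show ?thesis by (simp add: a_def n_def flip: of_nat_sum)
  qed
  have "2 * card (cross V c) = card {(u, v). {u, v} \<in> cross V c}"
    using card_ordered_pairs[OF wf_graph_cross[OF V]] by simp
  also have "{(u, v). {u, v} \<in> cross V c} = V \<times> V - (\<Union>i<p. ?C i \<times> ?C i)"
    using c by (auto simp: cross_def doubleton_eq_iff)
  also have "card \<dots> = card (V \<times> V) - card (\<Union>i<p. ?C i \<times> ?C i)"
    by (rule card_Diff_subset) (use V in auto)
  also have "card (\<Union>i<p. ?C i \<times> ?C i) = (\<Sum>i<p. card (?C i \<times> ?C i))"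
    by (rule card_UN_disjoint) (use V in auto)
  finally have "2 * card (cross V c) = card V * card V - (\<Sum>i<p. card (?C i) * card (?C i))"
    by (simp add: card_cartesian_product)
  moreover have "(\<Sum>i<p. card (?C i) * card (?C i)) \<le> card V * card V"
  proof -
    have "card (\<Union>i<p. ?C i \<times> ?C i) \<le> card (V \<times> V)" by (rule card_mono) (use V in auto)
    moreover have "card (\<Union>i<p. ?C i \<times> ?C i) = (\<Sum>i<p. card (?C i \<times> ?C i))"
      by (rule card_UN_disjoint) (use V in auto)
    ultimately show ?thesis by (simp add: card_cartesian_product)
  qed
  ultimately have "real (2 * card (cross V c)) = real (card V * card V) - real (\<Sum>i<p. card (?C i) * card (?C i))"
    by (simp only: of_nat_diff)
  then have cr: "2 * real (card (cross V c)) = n\<^sup>2 - (\<Sum>i<p. (a i)\<^sup>2)"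
    by (simp add: n_def a_def power2_eq_square)
  have "(a i - n / real p)\<^sup>2 \<le> (\<Sum>j<p. (a j - n / real p)\<^sup>2)"
    by (rule member_le_sum) (use i in auto)
  also have "\<dots> = (\<Sum>j<p. (a j)\<^sup>2 - 2 * (n / real p) * a j + (n / real p)\<^sup>2)"
    by (intro sum.cong refl) (simp add: power2_eq_square algebra_simps)
  also have "\<dots> = (\<Sum>j<p. (a j)\<^sup>2) - 2 * (n / real p) * n + real p * (n / real p)\<^sup>2"
    by (simp only: sum.distrib sum_subtractf sum_distrib_left[symmetric] sa sum_constant card_lessThan)
  also have "\<dots> = (\<Sum>j<p. (a j)\<^sup>2) - n\<^sup>2 / real p"
    using p by (simp add: power2_eq_square field_simps)
  also have "\<dots> = (1 - 1 / real p) * n\<^sup>2 - 2 * real (card (cross V c))"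
    using cr by (simp add: algebra_simps)
  also have "\<dots> \<le> (1 - 1 / real p) * n\<^sup>2 - 2 * (real (turan_num (card V) p) - x)" using x by simp
  also have "\<dots> \<le> (1 - 1 / real p) * n + 2 * x"
    using turan_num_ge[OF p, of "card V"] by (simp add: n_def algebra_simps)
  also have "\<dots> \<le> n + 2 * x" using p by (simp add: n_def mult_left_le_one_le)
  finally show ?thesis by (simp add: a_def n_def)
qed

section \<open>Approximate structure\<close>

text \<open>Deleting \<open>Z\<close> at least doubles the quotient of the number of free
  orientations by \<open>2 ^ turan_num\<close>; written without division.\<close>

definition gains :: "nat set \<Rightarrow> nat set set \<Rightarrow> 'b dgraph \<Rightarrow> nat \<Rightarrow> nat \<Rightarrow> bool" where
  "gains V E F p K \<longleftrightarrow> (\<exists>Z\<subseteq>V. Z \<noteq> {} \<and> card Z \<le> K \<and>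
     2 * card (Free V E F) * 2 ^ turan_num (card V - card Z) p \<le> card (Free (V - Z) (inside E (V - Z)) F) * 2 ^ turan_num (card V) p)"

text \<open>The form in which the failure of \<open>gains\<close> is used: the edges at
  \<open>Z\<close> must on average admit almost \<open>2 ^ ((1 - 1 / p) * n * card Z)\<close>
  orientations for each orientation of the rest. An upper bound below this on the attachments of
  \<open>Z\<close> is a contradiction.\<close>

lemma not_gains_bound:
  assumes p: "p > 0" and V: "finite V" and ng: "\<not> gains V E F p K" and Z: "Z \<subseteq> V" "Z \<noteq> {}" "card Z \<le> K"
  shows "real (card (Free (V - Z) (inside E (V - Z)) F)) \<le>
    real (card (Free V E F)) * 2 powr (1 - (1 - 1 / real p) * (real (card V) - real (card Z)) * real (card Z))"
proof -
  define n where "n = card V"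
  define z where "z = card Z"
  define a where "a = card (Free (V - Z) (inside E (V - Z)) F)"
  define b where "b = card (Free V E F)"
  have zn: "z \<le> n" using Z V by (simp add: z_def n_def card_mono)
  have "\<not> 2 * b * 2 ^ turan_num (n - z) p \<le> a * 2 ^ turan_num n p"
    using ng Z unfolding gains_def a_def b_def n_def z_def by blast
  then have "a * 2 ^ turan_num n p \<le> 2 * b * 2 ^ turan_num (n - z) p" by simp
  then have "real (a * 2 ^ turan_num n p) \<le> real (2 * b * 2 ^ turan_num (n - z) p)" by (rule of_nat_mono)
  then have 1: "real a * 2 powr real (turan_num n p) \<le> 2 * real b * 2 powr real (turan_num (n - z) p)"
    by (simp add: powr_realpow)
  have "real (turan_num (n - z) p) + (1 - 1 / real p) * real (n - z) * real z \<le> real (turan_num n p)"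
    using turan_num_diff_ge[OF p, of "n - z" z] zn by simp
  then have t: "real (turan_num (n - z) p) - real (turan_num n p) \<le> - ((1 - 1 / real p) * (real n - real z) * real z)"
    using zn by (simp add: of_nat_diff)
  have "real a = real a * 2 powr real (turan_num n p) * 2 powr (- real (turan_num n p))"
    by (simp add: powr_minus)
  also have "\<dots> \<le> 2 * real b * 2 powr real (turan_num (n - z) p) * 2 powr (- real (turan_num n p))"
    by (rule mult_right_mono[OF 1]) simp
  also have "\<dots> = real b * 2 powr (1 + (real (turan_num (n - z) p) - real (turan_num n p)))"
    by (simp add: powr_add powr_diff powr_minus divide_inverse)
  also have "\<dots> \<le> real b * 2 powr (1 - (1 - 1 / real p) * (real n - real z) * real z)"
    using t by (intro mult_left_mono) auto
  finally show ?thesis by (simp add: a_def b_def n_def z_def)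
qed

lemma poor_star_cong:
  assumes "\<And>i \<sigma>. i < p \<Longrightarrow> matching E X {v} (Y i) \<sigma> = matching E X' {v} (Y i) \<sigma>"
  shows "poor_star E v p Y m X \<longleftrightarrow> poor_star E v p Y m X'"
  unfolding poor_star_def using assms by (metis (no_types, lifting))

lemma poor_config_cong:
  assumes "\<And>i \<sigma>. i < p \<Longrightarrow> matching E X Z (Y i) \<sigma> = matching E X' Z (Y i) \<sigma>"
  shows "poor_config E Z p Y i0 m X \<longleftrightarrow> poor_config E Z p Y i0 m X'"
  unfolding poor_config_def using assms by (metis (no_types, lifting))

lemma star_bij:
  assumes "finite A" "card A = t + 1" "a \<in> A" "finite L" "card L = t" "v \<notin> L"
  obtains \<theta> where "bij_betw \<theta> A (insert v L)" "\<theta> a = v"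
proof -
  have "card (A - {a}) = card L" using assms by simp
  then obtain f where f: "bij_betw f (A - {a}) L"
    using assms by (meson finite_Diff finite_same_card_bij)
  let ?\<theta> = "\<lambda>x. if x = a then v else f x"
  have "bij_betw ?\<theta> (A - {a}) L" using f by (subst bij_betw_cong[of _ _ f]) auto
  then have "bij_betw ?\<theta> (A - {a} \<union> {a}) (L \<union> {?\<theta> a})"
    using assms by (intro notIn_Un_bij_betw) auto
  moreover have "A - {a} \<union> {a} = A" using assms by auto
  ultimately show ?thesis using that[of ?\<theta>] by simp
qed

text \<open>Each bad piece (a vertex with many neighbours in every class of the host, or a star of \<open>2 t\<close> edges
  inside one class, which always contains a pure star) costs a factor \<open>2 powr (\<delta> s)\<close>, while deleting a maximal
  disjoint family of bad pieces leaves an almost \<open>p\<close>-partite graph.\<close>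

lemma host_dichotomy:
  fixes F DO DI :: "'b dgraph" and p s t N :: nat and \<gamma> \<delta> :: real
  assumes G: "wf_graph (V, E)" and F: "wf_dgraph F" and p: "p > 0" and o: "out_centre F p" and i: "in_centre F p"
    and DO: "is_out_star DO t" "config F p DO" and DI: "is_in_star DI t" "config F p DI"
    and U: "universal F p s \<gamma> U" and g: "g \<in> placements (p * s) V" and \<gamma>: "0 < \<gamma>" "\<gamma> \<le> 1" and \<delta>: "0 \<le> \<delta>"
    and HS: "\<And>E v Y. finite E \<Longrightarrow> (\<And>i. i < p \<Longrightarrow> finite (Y i) \<and> v \<notin> Y i \<and> card (Y i) = s) \<Longrightarrow>
      real (card {X. X \<subseteq> between E {v} (\<Union>i<p. Y i) \<and> poor_star E v p Y (\<gamma> * real s) X}) \<le> 2 powr ((real p - 1 - \<delta>) * real s)"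
    and HC: "\<And>E Z Y i0. finite E \<Longrightarrow> card Z = t + 1 \<Longrightarrow> i0 < p \<Longrightarrow>
      (\<And>i. i < p \<Longrightarrow> finite (Y i) \<and> Z \<inter> Y i = {} \<and> card (Y i) = s) \<Longrightarrow>
      real (card {X. X \<subseteq> between E Z (\<Union>i<p. Y i) \<and> poor_config E Z p Y i0 (\<gamma> * real s) X})
        \<le> 2 powr (real (t + 1) * (real p - 1) * real s + real (card (between E Z (Y i0))) - \<delta> * real s)"
    and nocol: "\<not> (\<exists>c. (\<forall>v\<in>V. c v < p) \<and> card {e \<in> E. e \<notin> cross V c} \<le> (p * s + (2 * t + 1) * N + 2 * t) * card V)"
  shows "real (card (hosting V E F U g)) \<le> real (card (Free (V - g ` {..<p * s}) (inside E (V - g ` {..<p * s})) F)) *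
    2 powr (real ((p * s)\<^sup>2) + real (card V) * ((real p - 1) * real s + 2 * \<gamma> * real s) - \<delta> * real s * real N)"
    (is "_ \<le> _ * 2 powr ?bound")
proof -
  define m where "m = p * s"
  define A where "A = g ` {..<m}"
  define Y where "Y i = g ` {j. j < p * s \<and> j mod p = i}" for i
  \<comment> \<open>An upper bound for the number of edges from a vertex that is not bad to the
    host: all of \<open>p - 1\<close> classes and fewer than \<open>2 * \<gamma> * s\<close> edges
    to the sparse one.\<close>
  define r where "r = (real p - 1) * real s + 2 * \<gamma> * real s"
  define n where "n = card V"
  note fin = wf_graph_finite[OF G]
  have gi: "inj_on g {..<m}" and AV: "A \<subseteq> V" using g by (auto simp: placements_def m_def A_def)
  have cA: "card A = m" and fA: "finite A" using gi by (simp_all add: A_def card_image)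
  have UY: "(\<Union>i<p. Y i) = A"
  proof (intro equalityI subsetI)
    fix y assume "y \<in> A"
    then obtain j where "j < p * s" "y = g j" by (auto simp: A_def m_def)
    then have "y \<in> Y (j mod p)" "j mod p < p" using p by (auto simp: Y_def)
    then show "y \<in> (\<Union>i<p. Y i)" by blast
  qed (auto simp: Y_def A_def m_def)
  have YA: "Y i \<subseteq> A" for i by (auto simp: Y_def A_def m_def)
  have fY: "finite (Y i)" for i using YA fA finite_subset by blast
  have cY: "card (Y i) = s" if "i < p" for i
    unfolding Y_def using card_residue_class[OF that, of s] gi
    by (subst card_image) (auto simp: m_def intro: inj_on_subset)
  define nb where "nb v i = {y \<in> Y i. {v, y} \<in> E}" for v i
  define bad where "bad v \<longleftrightarrow> (\<forall>i<p. 2 * (\<gamma> * real s) \<le> real (card (nb v i)))" for v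
  \<comment> \<open>A vertex that is not bad is assigned to a class of the host to which it sends
    few edges, as if it belonged to that class.\<close>
  define cls where "cls v = (SOME i. i < p \<and> real (card (nb v i)) < 2 * (\<gamma> * real s))" for v
  have cls: "cls v < p \<and> real (card (nb v (cls v))) < 2 * (\<gamma> * real s)" if "\<not> bad v" for v
  proof -
    have "\<exists>i. i < p \<and> real (card (nb v i)) < 2 * (\<gamma> * real s)" using that by (auto simp: bad_def not_le)
    then show ?thesis unfolding cls_def by (rule someI_ex)
  qed
  have btw_nb: "card (between E {v} (Y i)) \<le> card (nb v i)" for v i
  proof -
    have "between E {v} (Y i) \<subseteq> (\<lambda>y. {v, y}) ` nb v i" by (auto simp: between_def nb_def)
    then show ?thesis using fY[of i] by (intro surj_card_le) (auto simp: nb_def)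
  qed
  have btw1: "real (card (between E {v} A)) \<le> r" if "\<not> bad v" for v
  proof -
    let ?i = "cls v"
    have i: "?i < p" using cls[OF that] by simp
    have "between E {v} A = (\<Union>i<p. between E {v} (Y i))" unfolding UY[symmetric] by (auto simp: between_def)
    then have "card (between E {v} A) \<le> (\<Sum>i<p. card (between E {v} (Y i)))" using card_UN_le[of "{..<p}"] by simp
    also have "\<dots> = card (between E {v} (Y ?i)) + (\<Sum>i\<in>{..<p} - {?i}. card (between E {v} (Y i)))"
      using i by (intro sum.remove) auto
    also have "(\<Sum>i\<in>{..<p} - {?i}. card (between E {v} (Y i))) \<le> (\<Sum>i\<in>{..<p} - {?i}. s)"
      using card_between_single_le[OF fY] cY by (intro sum_mono) (metis DiffD1 lessThan_iff)
    also have "\<dots> = (p - 1) * s" using i by simp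
    finally have "real (card (between E {v} A)) \<le> real (card (between E {v} (Y ?i)) + (p - 1) * s)"
      by (intro of_nat_mono) simp
    also have "\<dots> \<le> 2 * (\<gamma> * real s) + (real p - 1) * real s"
      using cls[OF that] btw_nb[of v ?i] p by (simp add: of_nat_diff)
    finally show ?thesis by (simp add: r_def)
  qed
  have btwP: "real (card (between E P A)) \<le> real (card P) * r" if "finite P" "\<And>v. v \<in> P \<Longrightarrow> \<not> bad v" for P
  proof -
    have "between E P A = (\<Union>v\<in>P. between E {v} A)" by (auto simp: between_def)
    then have "card (between E P A) \<le> (\<Sum>v\<in>P. card (between E {v} A))" using card_UN_le[OF that(1)] by simp
    then have "real (card (between E P A)) \<le> real (\<Sum>v\<in>P. card (between E {v} A))" by (rule of_nat_mono)
    also have "\<dots> = (\<Sum>v\<in>P. real (card (between E {v} A)))" by simp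
    also have "\<dots> \<le> real (card P) * r" using btw1 that by (intro sum_bounded_above) auto
    finally show ?thesis .
  qed
  define single where "single P \<longleftrightarrow> (\<exists>v. P = {v} \<and> bad v)" for P
  \<comment> \<open>With \<open>2 * t\<close> edges, \<open>t\<close> of them leave \<open>v\<close>
    or \<open>t\<close> of them enter it. The common value of \<open>cls\<close> makes one class of
    the host sparse for the whole star, and this class will serve as \<open>i0\<close>.\<close>
  define block where "block P \<longleftrightarrow> (\<exists>v L. P = insert v L \<and> v \<notin> L \<and> card L = 2 * t \<and>
      (\<forall>w\<in>P. \<not> bad w \<and> cls w = cls v) \<and> (\<forall>w\<in>L. {v, w} \<in> E))" for P
  define \<P> where "\<P> = {P. P \<subseteq> V - A \<and> (single P \<or> block P)}"
  have f\<P>: "finite \<P>" by (rule finite_subset[of _ "Pow V"]) (use fin in \<open>auto simp: \<P>_def\<close>)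
  define Fam where "Fam = {\<B>. \<B> \<subseteq> \<P> \<and> (\<forall>P\<in>\<B>. \<forall>Q\<in>\<B>. P \<noteq> Q \<longrightarrow> P \<inter> Q = {})}"
  have "finite Fam" by (rule finite_subset[of _ "Pow \<P>"]) (use f\<P> in \<open>auto simp: Fam_def\<close>)
  moreover have "Fam \<noteq> {}" by (auto simp: Fam_def)
  ultimately obtain \<B> where \<B>: "\<B> \<in> Fam" and max: "\<And>\<B>'. \<B>' \<in> Fam \<Longrightarrow> \<B> \<subseteq> \<B>' \<Longrightarrow> \<B> = \<B>'"
    using finite_has_maximal[of Fam] by metis
  have \<B>P: "\<B> \<subseteq> \<P>" and disj: "\<And>P Q. P \<in> \<B> \<Longrightarrow> Q \<in> \<B> \<Longrightarrow> P \<noteq> Q \<Longrightarrow> P \<inter> Q = {}" using \<B> by (auto simp: Fam_def)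
  have f\<B>: "finite \<B>" using \<B>P f\<P> finite_subset by blast
  have \<P>ne: "P \<noteq> {}" "P \<subseteq> V - A" "card P \<le> 2 * t + 1" if "P \<in> \<P>" for P
  proof -
    show "P \<noteq> {}" "P \<subseteq> V - A" using that by (auto simp: \<P>_def single_def block_def)
    then have fP: "finite P" using fin by (meson finite_Diff finite_subset)
    show "card P \<le> 2 * t + 1"
    proof (cases "single P")
      case False
      then have "block P" using that by (simp add: \<P>_def)
      then obtain v L where vL: "P = insert v L" "v \<notin> L" "card L = 2 * t" unfolding block_def by (elim exE conjE)
      then have "finite L" using fP by simp
      then show ?thesis using vL by simp
    next
      case True
      then obtain v where "P = {v}" unfolding single_def by (elim exE conjE)
      then show ?thesis by simp
    qed
  qed
  define R where "R = V - A - \<Union> \<B>"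
  have no_piece: "P \<notin> \<P>" if "P \<subseteq> R" for P
  proof
    assume P: "P \<in> \<P>"
    have "P \<inter> Q = {}" if "Q \<in> \<B>" for Q using that \<open>P \<subseteq> R\<close> by (auto simp: R_def)
    then have "insert P \<B> \<in> Fam" using \<B> P unfolding Fam_def by auto
    then have "P \<in> \<B>" using max[of "insert P \<B>"] by blast
    then have "P \<subseteq> \<Union> \<B>" by blast
    then show False using \<P>ne(1)[OF P] that by (auto simp: R_def)
  qed
  have Rnb: "\<not> bad v" if "v \<in> R" for v
    using no_piece[of "{v}"] that by (auto simp: \<P>_def single_def R_def)
  \<comment> \<open>A smaller maximal family would contradict \<open>nocol\<close>: the classes are
    given by \<open>cls\<close>, and edges inside a class either touch the host or a piece,
    altogether at most \<open>m + (2 * t + 1) * N\<close> vertices, or join vertices of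
    \<open>R\<close>, where degrees into the own class are at most \<open>2 * t\<close>.\<close>
  have cB: "N < card \<B> \<or> N = card \<B>"
  proof (rule ccontr)
    assume "\<not> (N < card \<B> \<or> N = card \<B>)"
    then have lt: "card \<B> \<le> N" by simp
    define c where "c v = (if v \<in> R then cls v else 0)" for v
    have cp: "\<forall>v\<in>V. c v < p" using cls Rnb p by (auto simp: c_def)
    define Bad where "Bad = A \<union> \<Union> \<B>"
    have BadV: "Bad \<subseteq> V" using AV \<B>P \<P>ne(2) unfolding Bad_def by blast
    have "card (\<Union> \<B>) \<le> (\<Sum>P\<in>\<B>. card P)" using card_Union_le_sum_card[of \<B>] by simp
    also have "\<dots> \<le> card \<B> * (2 * t + 1)" using sum_bounded_above[of \<B> card "2 * t + 1"] \<P>ne(3) \<B>P by auto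
    also have "\<dots> \<le> N * (2 * t + 1)" using lt by (rule mult_le_mono1)
    finally have cBad: "card Bad \<le> m + (2 * t + 1) * N"
      using card_Un_le[of A "\<Union> \<B>"] cA unfolding Bad_def by (simp add: mult.commute)
    let ?D = "\<lambda>v. {w \<in> R. {v, w} \<in> E \<and> cls w = cls v}"
    have fR: "finite R" using fin by (simp add: R_def)
    have deg: "card (?D v) \<le> 2 * t" if v: "v \<in> R" for v
    proof (rule ccontr)
      assume "\<not> card (?D v) \<le> 2 * t"
      then have "2 * t \<le> card (?D v)" by simp
      then obtain L where L: "L \<subseteq> ?D v" "card L = 2 * t" "finite L" by (rule obtain_subset_with_card_n)
      have vL: "v \<notin> L" using L(1) wf_graph_pair(1)[OF G, of v v] by blast
      have sub: "insert v L \<subseteq> R" using v L(1) by blast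
      then have RV: "insert v L \<subseteq> V - A" unfolding R_def by blast
      have "\<forall>w\<in>insert v L. \<not> bad w \<and> cls w = cls v" using sub L(1) Rnb by blast
      moreover have "\<forall>w\<in>L. {v, w} \<in> E" using L(1) by blast
      ultimately have "block (insert v L)" unfolding block_def using vL L(2) by blast
      then have "insert v L \<in> \<P>" using RV unfolding \<P>_def by blast
      then show False using no_piece[OF sub] by simp
    qed
    have "{e \<in> E. e \<notin> cross V c} \<subseteq> between E Bad V \<union> (\<Union>v\<in>R. (\<lambda>w. {v, w}) ` ?D v)"
    proof
      fix e assume e: "e \<in> {e \<in> E. e \<notin> cross V c}"
      then obtain u w where uw: "e = {u, w}" "u \<noteq> w" "u \<in> V" "w \<in> V" using wf_graph_edge[OF G, of e] by blast
      show "e \<in> between E Bad V \<union> (\<Union>v\<in>R. (\<lambda>w. {v, w}) ` ?D v)"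
      proof (cases "u \<in> Bad \<or> w \<in> Bad")
        case True
        then have "e \<in> between E Bad V"
        proof
          assume "u \<in> Bad" then show ?thesis using e uw by (auto simp: between_def)
        next
          assume "w \<in> Bad"
          moreover have "e = {w, u}" using uw by auto
          ultimately show ?thesis using e uw(3) unfolding between_def by blast
        qed
        then show ?thesis by blast
      next
        case False
        then have R: "u \<in> R" "w \<in> R" using uw by (auto simp: R_def Bad_def)
        have "c u = c w" using e uw by (auto simp: cross_def)
        then have "cls w = cls u" using R by (simp add: c_def)
        then have "w \<in> ?D u" using R e uw by auto
        then show ?thesis using R uw(1) by blast
      qed
    qed
    moreover have f2: "finite (\<Union>v\<in>R. (\<lambda>w. {v, w}) ` ?D v)" using fR by auto
    ultimately have "card {e \<in> E. e \<notin> cross V c} \<le> card (between E Bad V \<union> (\<Union>v\<in>R. (\<lambda>w. {v, w}) ` ?D v))"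
      using between_finite[OF fin(2)] by (intro card_mono) auto
    also have "\<dots> \<le> card (between E Bad V) + card (\<Union>v\<in>R. (\<lambda>w. {v, w}) ` ?D v)" by (rule card_Un_le)
    also have "card (between E Bad V) \<le> card Bad * n"
      unfolding n_def using BadV fin finite_subset by (intro card_between_le) auto
    also have "card Bad * n \<le> (m + (2 * t + 1) * N) * n" using cBad by (rule mult_le_mono1)
    also have "card (\<Union>v\<in>R. (\<lambda>w. {v, w}) ` ?D v) \<le> (\<Sum>v\<in>R. card ((\<lambda>w. {v, w}) ` ?D v))" by (rule card_UN_le[OF fR])
    also have "\<dots> \<le> (\<Sum>v\<in>R. 2 * t)"
    proof (rule sum_mono)
      fix v assume "v \<in> R"
      have "card ((\<lambda>w. {v, w}) ` ?D v) \<le> card (?D v)" using fR by (intro card_image_le) auto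
      then show "card ((\<lambda>w. {v, w}) ` ?D v) \<le> 2 * t" using deg[OF \<open>v \<in> R\<close>] by linarith
    qed
    also have "\<dots> = 2 * t * card R" by simp
    also have "\<dots> \<le> 2 * t * n" unfolding n_def using fin by (intro mult_le_mono2 card_mono) (auto simp: R_def)
    finally have "card {e \<in> E. e \<notin> cross V c} \<le> (m + (2 * t + 1) * N + 2 * t) * n" by (simp add: distrib_right)
    then show False using nocol cp unfolding m_def n_def by blast
  qed
  define E1 where "E1 = inside E (V - A)"
  define E2 where "E2 = E - E1"
  have fE: "finite E1" "finite E2" using fin by (auto simp: E1_def E2_def inside_def)
  have E1A: "{v, y} \<notin> E1" if "y \<in> A" for v y using that by (auto simp: E1_def inside_def)
  have piece: "\<exists>T. finite T \<and> real (card T) \<le> 2 powr (real (card P) * r - \<delta> * real s) \<and>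
      (\<forall>Q. Q \<subseteq> E2 \<and> Y0 \<union> Q \<in> hosting V E F U g \<longrightarrow> Q \<inter> between E P A \<in> T)"
    if Y0: "Y0 \<in> Free (V - A) E1 F" and P: "P \<in> \<B>" for Y0 P
  proof -
    have PP: "P \<in> \<P>" using P \<B>P by blast
    have PV: "P \<subseteq> V - A" using \<P>ne(2)[OF PP] .
    have Y01: "Y0 \<subseteq> E1" using Y0 by (simp add: Free_def)
    \<comment> \<open>Edges from a piece to the host are not decided by \<open>Y0\<close>, so
      poorness of a piece is a condition on \<open>Q\<close> restricted to
      \<open>between E P A\<close> alone.\<close>
    have mcong: "matching E (Y0 \<union> Q) Z (Y i) \<sigma> = matching E (Q \<inter> between E P A) Z (Y i) \<sigma>" if "Z \<subseteq> P" for Q Z i \<sigma>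
    proof (rule matching_cong)
      fix z y assume zy: "z \<in> Z" "y \<in> Y i" "{z, y} \<in> E"
      have zyP: "z \<in> P" "y \<in> A" using zy that YA by blast+
      then have "{z, y} \<in> between E P A" using zy(3) unfolding between_def by blast
      moreover have "{z, y} \<notin> Y0" using E1A[OF zyP(2), of z] Y01 by blast
      ultimately show "{z, y} \<in> Y0 \<union> Q \<longleftrightarrow> {z, y} \<in> Q \<inter> between E P A" by blast
    qed
    have YZ: "Y i \<subseteq> V - Z" if "Z \<subseteq> P" for i Z using YA AV PV that by blast
    show ?thesis
    proof (cases "single P")
      case True
      then obtain v where v: "P = {v}" "bad v" unfolding single_def by blast
      let ?T = "{X. X \<subseteq> between E {v} (\<Union>i<p. Y i) \<and> poor_star E v p Y (\<gamma> * real s) X}"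
      have vA: "v \<notin> A" "v \<in> V" using PV v by auto
      have "finite ?T" by (rule finite_subset[of _ "Pow (between E {v} (\<Union>i<p. Y i))"]) (use between_finite[OF fin(2)] in auto)
      moreover have "real (card ?T) \<le> 2 powr (real (card P) * r - \<delta> * real s)"
      proof -
        have "real (card ?T) \<le> 2 powr ((real p - 1 - \<delta>) * real s)"
          by (rule HS[OF fin(2)]) (use fY cY YA vA in auto)
        also have "\<dots> \<le> 2 powr (real (card P) * r - \<delta> * real s)"
          using v \<gamma> by (simp add: r_def algebra_simps)
        finally show ?thesis .
      qed
      moreover have "Q \<inter> between E P A \<in> ?T" if Q: "Q \<subseteq> E2" "Y0 \<union> Q \<in> hosting V E F U g" for Q
      proof -
        have "\<not> ready V E F p {v} Y (\<gamma> * real s) (Y0 \<union> Q)"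
          by (rule not_ready_hosting[OF G F U g Q(2)]) (simp add: Y_def)
        then have "poor_star E v p Y (\<gamma> * real s) (Y0 \<union> Q)"
          using v(2) YZ[of "{v}"] v(1) vA(2)
          by (intro star_ready[OF G F o i vA(2)]) (auto simp: bad_def nb_def)
        then have "poor_star E v p Y (\<gamma> * real s) (Q \<inter> between E P A)"
          using poor_star_cong[of p E "Y0 \<union> Q" v Y "Q \<inter> between E P A" "\<gamma> * real s"] mcong[of "{v}"] v(1) by simp
        then show ?thesis using UY v(1) by simp
      qed
      ultimately show ?thesis by blast
    next
      case False
      then have "block P" using PP by (simp add: \<P>_def)
      then obtain v L where P: "P = insert v L" "v \<notin> L" "card L = 2 * t" "\<forall>w\<in>P. \<not> bad w \<and> cls w = cls v" "\<forall>w\<in>L. {v, w} \<in> E"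
        unfolding block_def by (elim exE conjE)
      have fP: "finite P" using PV fin by (meson finite_Diff finite_subset)
      then have fL: "finite L" using P by simp
      let ?O = "{w \<in> L. arc E Y0 v w}" and ?I = "{w \<in> L. \<not> arc E Y0 v w}"
      have i0: "cls v < p" using cls P by auto
      \<comment> \<open>The star lies outside the host, so its directions are already fixed by
        \<open>Y0\<close>. The pure substar \<open>Z\<close> can therefore be chosen before the
        completion \<open>Q\<close>, and all completions are poor at the same
        \<open>Z\<close>.\<close>
      have inst: "\<exists>Z. Z \<subseteq> P \<and> card Z = t + 1 \<and> (\<forall>Q. Q \<subseteq> E2 \<and> Y0 \<union> Q \<in> hosting V E F U g \<longrightarrow>
          poor_config E Z p Y (cls v) (\<gamma> * real s) (Y0 \<union> Q))"
      proof -
        have arcQ: "arc E (Y0 \<union> Q) a b \<longleftrightarrow> arc E Y0 a b" if "Q \<subseteq> E2" "a \<in> P" "b \<in> P" for Q a b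
        proof -
          have "{a, b} \<subseteq> V - A" using that PV by auto
          then have "{a, b} \<in> E \<Longrightarrow> {a, b} \<in> E1" by (simp add: E1_def inside_def)
          then show ?thesis using that(1) by (auto simp: arc_def E2_def)
        qed
        have common: "poor_config E Z p Y (cls v) (\<gamma> * real s) (Y0 \<union> Q)"
          if Z: "Z = insert v L'" "L' \<subseteq> L" and D: "config F p D" "inj_on \<theta> (fst D)" "\<theta> ` fst D \<subseteq> Z"
            "\<And>a b. (a, b) \<in> snd D \<Longrightarrow> arc E Y0 (\<theta> a) (\<theta> b) \<and> \<theta> a \<in> P \<and> \<theta> b \<in> P"
            and Q: "Q \<subseteq> E2" "Y0 \<union> Q \<in> hosting V E F U g" for Z L' Q and D :: "'b dgraph" and \<theta>
        proof (rule config_ready[OF G F D(1,2,3)])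
          show "arc E (Y0 \<union> Q) (\<theta> a) (\<theta> b)" if "(a, b) \<in> snd D" for a b
            using D(4)[OF that] arcQ[OF Q(1)] by blast
          have ZP: "Z \<subseteq> P" using Z P(1) by auto
          then show "Z \<subseteq> V" using PV by blast
          show "Y i \<subseteq> V - Z" for i by (rule YZ[OF ZP])
          show "cls v < p" by (rule i0)
          show "\<gamma> * real s \<le> real (card (Y (cls v)))" using cY[OF i0] \<gamma> by (simp add: mult_left_le_one_le)
          show "\<not> ready V E F p Z Y (\<gamma> * real s) (Y0 \<union> Q)"
            by (rule not_ready_hosting[OF G F U g Q(2)]) (simp add: Y_def)
        qed
        have "L = ?O \<union> ?I" by auto
        moreover have "?O \<inter> ?I = {}" by auto
        ultimately have "card L = card ?O + card ?I" using fL card_Un_disjoint[of ?O ?I] by simp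
        then have "t \<le> card ?O \<or> t \<le> card ?I" using P(3) by linarith
        then show ?thesis
        proof
          assume "t \<le> card ?O"
          then obtain L' where L': "L' \<subseteq> ?O" "card L' = t" "finite L'" by (rule obtain_subset_with_card_n)
          have fL': "finite L'" "v \<notin> L'" "L' \<subseteq> L" using L' fL P(2) finite_subset[of L' L] by auto
          obtain a where a: "finite (fst DO)" "card (fst DO) = t + 1" "a \<in> fst DO" "snd DO = {(a, w) | w. w \<in> fst DO \<and> w \<noteq> a}"
            using DO(1) unfolding is_out_star_def by blast
          obtain \<theta> where \<theta>: "bij_betw \<theta> (fst DO) (insert v L')" "\<theta> a = v"
            using star_bij[OF a(1-3) fL'(1) L'(2) fL'(2)] by blast
          have arcs: "arc E Y0 (\<theta> x) (\<theta> y) \<and> \<theta> x \<in> P \<and> \<theta> y \<in> P" if xy: "(x, y) \<in> snd DO" for x y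
          proof -
            have x: "x = a" "y \<in> fst DO" "y \<noteq> a" using xy a(4) by auto
            then have "\<theta> y \<in> insert v L'" "\<theta> y \<noteq> v"
              using \<theta> a(3) by (auto simp: bij_betw_def dest: inj_onD)
            then have "\<theta> y \<in> L'" by simp
            then show ?thesis using L'(1) x(1) \<theta>(2) P(1) by auto
          qed
          show ?thesis
            by (rule exI[of _ "insert v L'"]) (use fL' L' P(1) common[OF refl fL'(3) DO(2) _ _ arcs] \<theta>(1) in \<open>auto simp: bij_betw_def\<close>)
        next
          assume "t \<le> card ?I"
          then obtain L' where L': "L' \<subseteq> ?I" "card L' = t" "finite L'" by (rule obtain_subset_with_card_n)
          have fL': "finite L'" "v \<notin> L'" "L' \<subseteq> L" using L' fL P(2) finite_subset[of L' L] by auto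
          obtain a where a: "finite (fst DI)" "card (fst DI) = t + 1" "a \<in> fst DI" "snd DI = {(w, a) | w. w \<in> fst DI \<and> w \<noteq> a}"
            using DI(1) unfolding is_in_star_def by blast
          obtain \<theta> where \<theta>: "bij_betw \<theta> (fst DI) (insert v L')" "\<theta> a = v"
            using star_bij[OF a(1-3) fL'(1) L'(2) fL'(2)] by blast
          have arcs: "arc E Y0 (\<theta> x) (\<theta> y) \<and> \<theta> x \<in> P \<and> \<theta> y \<in> P" if xy: "(x, y) \<in> snd DI" for x y
          proof -
            have x: "y = a" "x \<in> fst DI" "x \<noteq> a" using xy a(4) by auto
            then have "\<theta> x \<in> insert v L'" "\<theta> x \<noteq> v"
              using \<theta> a(3) by (auto simp: bij_betw_def dest: inj_onD)
            then have xL: "\<theta> x \<in> L'" by simp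
            then have "\<not> arc E Y0 v (\<theta> x)" "{v, \<theta> x} \<in> E" using L'(1) P(5) by auto
            then have "arc E Y0 (\<theta> x) v" using arc_asym[of v "\<theta> x" E Y0] wf_graph_pair(1)[OF G] by blast
            then show ?thesis using xL L'(1) x(1) \<theta>(2) P(1) by auto
          qed
          show ?thesis
            by (rule exI[of _ "insert v L'"]) (use fL' L' P(1) common[OF refl fL'(3) DI(2) _ _ arcs] \<theta>(1) in \<open>auto simp: bij_betw_def\<close>)
        qed
      qed
      then obtain Z where Z: "Z \<subseteq> P" "card Z = t + 1" and poor: "\<And>Q. Q \<subseteq> E2 \<Longrightarrow> Y0 \<union> Q \<in> hosting V E F U g \<Longrightarrow>
          poor_config E Z p Y (cls v) (\<gamma> * real s) (Y0 \<union> Q)" by blast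
      have fZ: "finite Z" using Z fP finite_subset by blast
      let ?pc = "poor_config E Z p Y (cls v) (\<gamma> * real s)"
      let ?T = "{X. X \<subseteq> between E P A \<and> ?pc X}"
      let ?TZ = "{X. X \<subseteq> between E Z A \<and> ?pc X}"
      have fT: "finite ?T" by (rule finite_subset[of _ "Pow (between E P A)"]) (use between_finite[OF fin(2)] in auto)
      have fTZ: "finite ?TZ" by (rule finite_subset[of _ "Pow (between E Z A)"]) (use between_finite[OF fin(2)] in auto)
      \<comment> \<open>Only \<open>t + 1\<close> of the \<open>2 * t + 1\<close> vertices of the
        block carry the pure star. The other \<open>t\<close> are not bad and contribute at most
        \<open>r\<close> edges each.\<close>
      have "card ?T \<le> card ?TZ * 2 ^ card (between E (P - Z) A)"
      proof (rule card_subsets_split[of "between E Z A" "between E (P - Z) A"])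
        show "finite (between E Z A)" "finite (between E (P - Z) A)" using between_finite[OF fin(2)] by auto
        show "between E Z A \<inter> between E (P - Z) A = {}"
          using PV Z(1) by (auto simp: between_def doubleton_eq_iff)
        show "X \<subseteq> between E Z A \<union> between E (P - Z) A" if "X \<in> ?T" for X
        proof -
          have "between E P A \<subseteq> between E Z A \<union> between E (P - Z) A" unfolding between_def by blast
          then show ?thesis using that by blast
        qed
        show "X \<inter> between E Z A \<in> ?TZ" if "X \<in> ?T" for X
        proof -
          have "matching E X Z (Y i) \<sigma> = matching E (X \<inter> between E Z A) Z (Y i) \<sigma>" for i \<sigma>
            by (rule matching_cong) (use YA in \<open>auto simp: between_def\<close>)
          then show ?thesis using that poor_config_cong[of p E X Z Y "X \<inter> between E Z A"] by simp
        qed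
        show "card {Q. Q \<subseteq> between E (P - Z) A \<and> W \<union> Q \<in> ?T} \<le> 2 ^ card (between E (P - Z) A)" for W
        proof -
          have "card {Q. Q \<subseteq> between E (P - Z) A \<and> W \<union> Q \<in> ?T} \<le> card (Pow (between E (P - Z) A))"
            using between_finite[OF fin(2)] by (intro card_mono) auto
          then show ?thesis using between_finite[OF fin(2)] by (simp add: card_Pow)
        qed
      qed (rule fTZ)
      then have "real (card ?T) \<le> real (card ?TZ * 2 ^ card (between E (P - Z) A))" by (rule of_nat_mono)
      also have "\<dots> = real (card ?TZ) * 2 powr real (card (between E (P - Z) A))" by (simp add: powr_realpow)
      also have "\<dots> \<le> 2 powr (real (t + 1) * (real p - 1) * real s + real (card (between E Z (Y (cls v)))) - \<delta> * real s)
          * 2 powr (real t * r)"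
      proof (intro mult_mono powr_mono)
        show "real (card ?TZ) \<le> 2 powr (real (t + 1) * (real p - 1) * real s + real (card (between E Z (Y (cls v)))) - \<delta> * real s)"
        proof -
          have "Z \<inter> Y i = {}" for i using YA[of i] PV Z(1) by blast
          then show ?thesis unfolding UY[symmetric] by (intro HC[OF fin(2) Z(2) i0]) (use fY cY in auto)
        qed
        have "card (P - Z) = t"
        proof -
          have "card P = 2 * t + 1" using P fL by simp
          then show ?thesis using Z fZ by (simp add: card_Diff_subset)
        qed
        then show "real (card (between E (P - Z) A)) \<le> real t * r" using btwP[of "P - Z"] fP P(4) by simp
      qed auto
      also have "\<dots> \<le> 2 powr (real (card P) * r - \<delta> * real s)"
      proof -
        have "between E Z (Y (cls v)) = (\<Union>z\<in>Z. between E {z} (Y (cls v)))" by (auto simp: between_def)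
        then have "card (between E Z (Y (cls v))) \<le> (\<Sum>z\<in>Z. card (between E {z} (Y (cls v))))" using card_UN_le[OF fZ] by simp
        then have "real (card (between E Z (Y (cls v)))) \<le> real (\<Sum>z\<in>Z. card (between E {z} (Y (cls v))))" by (rule of_nat_mono)
        also have "\<dots> = (\<Sum>z\<in>Z. real (card (between E {z} (Y (cls v)))))" by simp
        also have "\<dots> \<le> real (card Z) * (2 * (\<gamma> * real s))"
        proof (rule sum_bounded_above)
          fix z assume "z \<in> Z"
          then have z: "\<not> bad z" "cls z = cls v" using P(4) Z(1) by auto
          show "real (card (between E {z} (Y (cls v)))) \<le> 2 * (\<gamma> * real s)"
            using cls[OF z(1)] btw_nb[of z "cls v"] unfolding z(2) by linarith
        qed
        finally have e0: "real (card (between E Z (Y (cls v)))) \<le> real (t + 1) * (2 * (\<gamma> * real s))" by (simp only: Z(2))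
        have "card P = 2 * t + 1" using P fL by simp
        then have "real (card P) * r = real (t + 1) * r + real t * r" by (simp add: algebra_simps)
        moreover have "real (t + 1) * r = real (t + 1) * (real p - 1) * real s + real (t + 1) * (2 * (\<gamma> * real s))"
          unfolding r_def by (simp only: distrib_left mult.assoc)
        ultimately show ?thesis using e0 by (simp add: powr_add[symmetric])
      qed
      finally have "real (card ?T) \<le> 2 powr (real (card P) * r - \<delta> * real s)" .
      moreover have "Q \<inter> between E P A \<in> ?T" if "Q \<subseteq> E2" "Y0 \<union> Q \<in> hosting V E F U g" for Q
        using poor[OF that] poor_config_cong[of p E "Y0 \<union> Q" Z Y "Q \<inter> between E P A"] mcong[OF Z(1)] by simp
      ultimately show ?thesis using fT by blast
    qed
  qed
  define b where "b = real (m\<^sup>2) + real n * r - \<delta> * real s * real (card \<B>)"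
  have cH: "card (hosting V E F U g) \<le> card (Free (V - A) E1 F) * nat \<lfloor>2 powr b\<rfloor>"
  proof (rule card_subsets_split[of E1 E2])
    fix X assume X: "X \<in> hosting V E F U g"
    then show "X \<subseteq> E1 \<union> E2" by (auto simp: hosting_def Free_def E2_def)
    show "X \<inter> E1 \<in> Free (V - A) E1 F" unfolding E1_def by (rule hosting_inside[OF X]) auto
  next
    fix Y0 assume Y0: "Y0 \<in> Free (V - A) E1 F"
    let ?S = "{Q. Q \<subseteq> E2 \<and> Y0 \<union> Q \<in> hosting V E F U g}"
    have "\<exists>T. \<forall>P\<in>\<B>. finite (T P) \<and> real (card (T P)) \<le> 2 powr (real (card P) * r - \<delta> * real s) \<and>
      (\<forall>Q. Q \<subseteq> E2 \<and> Y0 \<union> Q \<in> hosting V E F U g \<longrightarrow> Q \<inter> between E P A \<in> T P)"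
      by (rule bchoice) (use piece[OF Y0] in blast)
    then obtain T where T: "\<forall>P\<in>\<B>. finite (T P) \<and> real (card (T P)) \<le> 2 powr (real (card P) * r - \<delta> * real s) \<and>
      (\<forall>Q. Q \<subseteq> E2 \<and> Y0 \<union> Q \<in> hosting V E F U g \<longrightarrow> Q \<inter> between E P A \<in> T P)" by (rule exE)
    \<comment> \<open>The edges at the host that no piece controls: those inside it and those from
      the left-over vertices, the latter at most \<open>r\<close> for each vertex since none of them
      is bad.\<close>
    define E0 where "E0 = inside E A \<union> between E R A"
    have fE0: "finite E0" using fin between_finite[OF fin(2)] by (auto simp: E0_def inside_def)
    have "card ?S \<le> 2 ^ card E0 * (\<Prod>P\<in>\<B>. card (T P))"
    proof (rule card_subsets_prod[OF f\<B> fE0, of T ?S "\<lambda>P. between E P A"])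
      show "finite (T P)" if "P \<in> \<B>" for P using T that by blast
      show "X \<inter> between E P A \<in> T P" if "X \<in> ?S" "P \<in> \<B>" for X P using T that by blast
      show "X \<subseteq> E0 \<union> (\<Union>P\<in>\<B>. between E P A)" if "X \<in> ?S" for X
      proof
        fix e assume "e \<in> X"
        then have e: "e \<in> E" "e \<notin> E1" using that by (auto simp: E2_def)
        obtain a b where ab: "e = {a, b}" "a \<in> V" "b \<in> V" using wf_graph_edge[OF G e(1)] by metis
        have key: "e \<in> E0 \<union> (\<Union>P\<in>\<B>. between E P A)" if xy: "e = {x, y}" "x \<in> V" "y \<in> A" for x y
        proof -
          consider "x \<in> A" | "x \<in> R" | P where "P \<in> \<B>" "x \<in> P" using xy(2) by (auto simp: R_def)
          then show ?thesis
          proof cases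
            case 1 then show ?thesis using xy e by (auto simp: E0_def inside_def)
          next
            case 2 then show ?thesis using xy e by (auto simp: E0_def between_def)
          next
            case 3
            then have "e \<in> between E P A" using xy e by (auto simp: between_def)
            then show ?thesis using 3 by blast
          qed
        qed
        have "a \<in> A \<or> b \<in> A" using ab e by (auto simp: E1_def inside_def)
        then show "e \<in> E0 \<union> (\<Union>P\<in>\<B>. between E P A)"
        proof
          assume "a \<in> A"
          moreover have "e = {b, a}" using ab by auto
          ultimately show ?thesis using key[of b a] ab by simp
        next
          assume "b \<in> A" then show ?thesis using key[of a b] ab by simp
        qed
      qed
    qed
    then have "real (card ?S) \<le> real (2 ^ card E0 * (\<Prod>P\<in>\<B>. card (T P)))" by (rule of_nat_mono)
    also have "\<dots> = 2 powr real (card E0) * (\<Prod>P\<in>\<B>. real (card (T P)))" by (simp add: powr_realpow)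
    also have "\<dots> \<le> 2 powr real (card E0) * (\<Prod>P\<in>\<B>. 2 powr (real (card P) * r - \<delta> * real s))"
      using T by (intro mult_left_mono prod_mono) auto
    also have "(\<Prod>P\<in>\<B>. 2 powr (real (card P) * r - \<delta> * real s)) = 2 powr (\<Sum>P\<in>\<B>. (real (card P) * r - \<delta> * real s))"
      by (rule powr_sum[symmetric]) (use f\<B> in auto)
    also have "(\<Sum>P\<in>\<B>. (real (card P) * r - \<delta> * real s)) = real (card (\<Union> \<B>)) * r - \<delta> * real s * real (card \<B>)"
    proof -
      have "finite P" if "P \<in> \<B>" for P
        by (rule finite_subset[OF _ fin(1)]) (use that \<B>P \<P>ne(2) in blast)
      then have "card (\<Union> \<B>) = (\<Sum>P\<in>\<B>. card P)"
        by (intro card_Union_disjoint) (use disj in \<open>auto simp: pairwise_def disjnt_def\<close>)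
      then have "(\<Sum>P\<in>\<B>. real (card P)) = real (card (\<Union> \<B>))" by simp
      then show ?thesis by (simp only: sum_subtractf sum_distrib_right[symmetric] sum_constant) simp
    qed
    also have "2 powr real (card E0) * 2 powr (real (card (\<Union> \<B>)) * r - \<delta> * real s * real (card \<B>)) \<le> 2 powr b"
    proof -
      have "card E0 \<le> card (inside E A) + card (between E R A)" unfolding E0_def by (rule card_Un_le)
      also have "card (inside E A) \<le> m\<^sup>2" using card_edges_le[OF wf_graph_inside[OF G AV]] cA by (simp add: power2_eq_square)
      finally have "real (card E0) \<le> real (m\<^sup>2 + card (between E R A))" by (intro of_nat_mono) simp
      moreover have "real (card (between E R A)) \<le> real (card R) * r" using btwP[of R] Rnb fin by (simp add: R_def)
      moreover have "real (card R) * r + real (card (\<Union> \<B>)) * r \<le> real n * r"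
      proof -
        have sub: "\<Union> \<B> \<subseteq> V" "R \<inter> \<Union> \<B> = {}" "R \<subseteq> V" using \<B>P \<P>ne(2) by (auto simp: R_def)
        then have "finite R" "finite (\<Union> \<B>)" using fin finite_subset by blast+
        then have "card R + card (\<Union> \<B>) = card (R \<union> \<Union> \<B>)" using sub by (simp add: card_Un_disjoint)
        also have "\<dots> \<le> n" unfolding n_def using sub fin by (intro card_mono) auto
        finally have "real (card R) + real (card (\<Union> \<B>)) \<le> real n" by linarith
        moreover have "0 \<le> r" using p \<gamma> by (simp add: r_def)
        ultimately show ?thesis by (metis distrib_right mult_right_mono)
      qed
      ultimately have "real (card E0) + (real (card (\<Union> \<B>)) * r - \<delta> * real s * real (card \<B>)) \<le> b"
        by (simp add: b_def)
      then show ?thesis by (simp add: powr_add[symmetric])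
    qed
    finally have "real (card ?S) \<le> 2 powr b" by simp
    then show "card ?S \<le> nat \<lfloor>2 powr b\<rfloor>" by linarith
  qed (use fE in \<open>auto simp: E2_def finite_Free\<close>)
  have "real (card (hosting V E F U g)) \<le> real (card (Free (V - A) E1 F) * nat \<lfloor>2 powr b\<rfloor>)"
    using cH by (rule of_nat_mono)
  also have "\<dots> = real (card (Free (V - A) E1 F)) * real (nat \<lfloor>2 powr b\<rfloor>)" by simp
  also have "\<dots> \<le> real (card (Free (V - A) E1 F)) * 2 powr b" by (intro mult_left_mono) auto
  also have "\<dots> \<le> real (card (Free (V - A) E1 F)) * 2 powr (real (m\<^sup>2) + real n * r - \<delta> * real s * real N)"
  proof (intro mult_left_mono powr_mono)
    have "\<delta> * real s * real N \<le> \<delta> * real s * real (card \<B>)"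
      using cB \<delta> by (intro mult_left_mono) auto
    then show "b \<le> real (m\<^sup>2) + real n * r - \<delta> * real s * real N" by (simp add: b_def)
  qed auto
  finally show ?thesis by (simp add: A_def E1_def m_def r_def n_def)
qed

lemma poor_star_mono: "poor_star E v p Y m X \<Longrightarrow> m \<le> m' \<Longrightarrow> poor_star E v p Y m' X"
  unfolding poor_star_def by (meson less_le_trans)

lemma poor_config_mono: "poor_config E Z p Y i0 m X \<Longrightarrow> m \<le> m' \<Longrightarrow> poor_config E Z p Y i0 m' X"
  unfolding poor_config_def by (meson less_le_trans)

text \<open>If the graph is far from \<open>p\<close>-partite, every host is accompanied by linearly
  many bad pieces, each saving \<open>\<delta> * s\<close>. Without a gain the host of
  \<open>m\<close> vertices must carry almost the full Turan increment, which these savings rule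
  out. Orientations without a host are negligible by the asymptotic count with \<open>p - 1\<close>
  in place of \<open>p\<close>.\<close>

lemma structure_or_gain:
  fixes F DO DI :: "'b dgraph" and p t :: nat and \<eta> :: real
  assumes F: "wf_dgraph F" and p: "p \<ge> 2" and t: "t \<ge> 1" and o: "out_centre F p" and i: "in_centre F p"
    and DO: "is_out_star DO t" "config F p DO" and DI: "is_in_star DI t" "config F p DI" and \<eta>: "\<eta> > 0"
  obtains K n0 where "\<And>V E. wf_graph (V, E) \<Longrightarrow> n0 \<le> card V \<Longrightarrow> 2 ^ turan_num (card V) p < card (Free V E F) \<Longrightarrow> \<not> gains V E F p K \<Longrightarrow>
     \<exists>c. (\<forall>v\<in>V. c v < p) \<and> real (card {e \<in> E. e \<notin> cross V c}) \<le> \<eta> * (real (card V))\<^sup>2"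
proof -
  have p0: "p > 0" using p by simp
  \<comment> \<open>A pattern on \<open>t + 1\<close> vertices that is rare in a class of size
    \<open>s\<close> saves \<open>s / 2 ^ (t + 1)\<close>. Half of this is kept as
    \<open>\<delta> * s\<close>; the remaining half pays for the error \<open>\<epsilon>\<close> and
    the numbers of choices. Poor vertices save far more. \<open>\<eta>'\<close> is set so that
    \<open>N\<close>, about \<open>\<eta>' * n\<close> pieces, leaves about
    \<open>\<eta> / 2 * n ^ 2\<close> edges inside classes.\<close>
  define \<delta> :: real where "\<delta> = 1 / (2 * 2 ^ (t + 1))"
  define \<epsilon> :: real where "\<epsilon> = 1 / (8 * 2 ^ (t + 1))"
  define \<eta>' where "\<eta>' = \<eta> / (2 * (2 * real t + 1))"
  have pw: "(2::real) ^ 2 \<le> 2 ^ (t + 1)" using t by (intro power_increasing) auto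
  have \<delta>: "0 < \<delta>" "\<delta> \<le> 1 / 8" and \<epsilon>: "0 < \<epsilon>" "\<epsilon> \<le> 1 / 32"
    using pw by (auto simp: \<delta>_def \<epsilon>_def field_simps)
  have \<eta>': "\<eta>' > 0" using \<eta> by (simp add: \<eta>'_def)
  obtain \<gamma>0 :: real where \<gamma>0: "\<gamma>0 > 0" and
    S0: "\<And>E v p Y M L. finite E \<Longrightarrow> (\<And>i. i < p \<Longrightarrow> finite (Y i) \<and> v \<notin> Y i \<and> L \<le> real (card (Y i)) \<and> real (card (Y i)) \<le> M) \<Longrightarrow>
      real (card {X. X \<subseteq> between E {v} (\<Union>i<p. Y i) \<and> poor_star E v p Y (\<gamma>0 * M) X})
        \<le> (2 * real p) ^ 2 * 2 powr ((\<Sum>i<p. real (card (Y i))) - 2 * L + 2 * \<epsilon> * M)" and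
    C0: "\<And>E Z p Y M L i0. finite E \<Longrightarrow> finite Z \<Longrightarrow> Z \<noteq> {} \<Longrightarrow> i0 < p \<Longrightarrow>
      (\<And>i. i < p \<Longrightarrow> finite (Y i) \<and> Z \<inter> Y i = {} \<and> L \<le> real (card (Y i)) \<and> real (card (Y i)) \<le> M) \<Longrightarrow>
      real (card {X. X \<subseteq> between E Z (\<Union>i<p. Y i) \<and> poor_config E Z p Y i0 (\<gamma>0 * M) X})
        \<le> real p * 2 ^ card Z * 2 powr (real (card Z) * (\<Sum>i\<in>{..<p} - {i0}. real (card (Y i))) - L / 2 ^ card Z
             + real (card (between E Z (Y i0))) + \<epsilon> * M)"
    by (rule poor_counts[OF \<epsilon>(1)]) blast
  \<comment> \<open>The edges to sparse classes may add \<open>2 * \<gamma> * s\<close> for each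
    vertex. The last bound keeps this total below half of the saving
    \<open>\<delta> * s * \<eta>' * n\<close> of the pieces, and \<open>d\<close> is the half that
    remains.\<close>
  define \<gamma> where "\<gamma> = min \<gamma>0 (min 1 (\<delta> * \<eta>' / 4))"
  have \<gamma>: "0 < \<gamma>" "\<gamma> \<le> 1" "\<gamma> \<le> \<gamma>0" "\<gamma> \<le> \<delta> * \<eta>' / 4" using \<gamma>0 \<delta> \<eta>' by (auto simp: \<gamma>_def)
  obtain s1 where s1: "\<And>s. s \<ge> s1 \<Longrightarrow> \<exists>U. universal F p s \<gamma> U"
    using universal_exists[OF F \<gamma>(1) p0] by blast
  define s where "s = max s1 (1 + nat \<lceil>4 * log 2 (2 * real p)\<rceil> + nat \<lceil>(log 2 (real p) + real (t + 1)) * 2 ^ (t + 1) * 3\<rceil>)"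
  have s: "s \<ge> s1" "s \<ge> 1" "real s \<ge> 4 * log 2 (2 * real p)" "real s \<ge> (log 2 (real p) + real (t + 1)) * 2 ^ (t + 1) * 3"
    unfolding s_def by linarith+
  obtain U where U: "universal F p s \<gamma> U" using s1 s by blast
  then have U': "fst U = {..<p * s}" "wf_dgraph U" "\<And>a b. (a, b) \<in> snd U \<Longrightarrow> a mod p \<noteq> b mod p"
    by (auto simp: universal_def)
  have HS: "real (card {X. X \<subseteq> between E {v} (\<Union>i<p. Y i) \<and> poor_star E v p Y (\<gamma> * real s) X}) \<le> 2 powr ((real p - 1 - \<delta>) * real s)"
    if E: "finite E" and Y: "\<And>i. i < p \<Longrightarrow> finite (Y i) \<and> v \<notin> Y i \<and> card (Y i) = s" for E v Y
  proof -
    let ?B = "{X. X \<subseteq> between E {v} (\<Union>i<p. Y i) \<and> poor_star E v p Y (\<gamma>0 * real s) X}"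
    have "finite ?B" by (rule finite_subset[of _ "Pow (between E {v} (\<Union>i<p. Y i))"]) (use between_finite[OF E] in auto)
    moreover have "{X. X \<subseteq> between E {v} (\<Union>i<p. Y i) \<and> poor_star E v p Y (\<gamma> * real s) X} \<subseteq> ?B"
      using poor_star_mono[of E v p Y "\<gamma> * real s" _ "\<gamma>0 * real s"] \<gamma>(3) by (auto simp: mult_right_mono)
    ultimately have "real (card {X. X \<subseteq> between E {v} (\<Union>i<p. Y i) \<and> poor_star E v p Y (\<gamma> * real s) X}) \<le> real (card ?B)"
      by (intro of_nat_mono card_mono)
    also have "\<dots> \<le> (2 * real p) ^ 2 * 2 powr ((\<Sum>i<p. real (card (Y i))) - 2 * real s + 2 * \<epsilon> * real s)"
      by (rule S0[OF E]) (use Y in auto)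
    also have "(\<Sum>i<p. real (card (Y i))) = real p * real s" using Y by simp
    also have "(2 * real p) ^ 2 = 2 powr (2 * log 2 (2 * real p))"
      using p power_eq_powr_log[of "2 * real p" 2] by simp
    also have "2 powr (2 * log 2 (2 * real p)) * 2 powr (real p * real s - 2 * real s + 2 * \<epsilon> * real s)
        = 2 powr (2 * log 2 (2 * real p) + (real p * real s - 2 * real s + 2 * \<epsilon> * real s))" by (simp only: powr_add)
    also have "\<dots> \<le> 2 powr ((real p - 1 - \<delta>) * real s)"
    proof (rule powr_mono)
      have "2 * \<epsilon> * real s \<le> 1 / 16 * real s" "\<delta> * real s \<le> 1 / 8 * real s"
        using \<epsilon> \<delta> by (intro mult_right_mono; simp)+
      then show "2 * log 2 (2 * real p) + (real p * real s - 2 * real s + 2 * \<epsilon> * real s) \<le> (real p - 1 - \<delta>) * real s"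
        using s(2,3) unfolding left_diff_distrib by linarith
    qed simp
    finally show ?thesis .
  qed
  have HC: "real (card {X. X \<subseteq> between E Z (\<Union>i<p. Y i) \<and> poor_config E Z p Y i0 (\<gamma> * real s) X})
        \<le> 2 powr (real (t + 1) * (real p - 1) * real s + real (card (between E Z (Y i0))) - \<delta> * real s)"
    if E: "finite E" and Z: "card Z = t + 1" and i0: "i0 < p"
      and Y: "\<And>i. i < p \<Longrightarrow> finite (Y i) \<and> Z \<inter> Y i = {} \<and> card (Y i) = s" for E Z Y i0
  proof -
    let ?B = "{X. X \<subseteq> between E Z (\<Union>i<p. Y i) \<and> poor_config E Z p Y i0 (\<gamma>0 * real s) X}"
    have fZ: "finite Z" "Z \<noteq> {}" using Z by (auto intro: card_ge_0_finite)
    have "finite ?B" by (rule finite_subset[of _ "Pow (between E Z (\<Union>i<p. Y i))"]) (use between_finite[OF E] in auto)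
    moreover have "{X. X \<subseteq> between E Z (\<Union>i<p. Y i) \<and> poor_config E Z p Y i0 (\<gamma> * real s) X} \<subseteq> ?B"
      using poor_config_mono[of E Z p Y i0 "\<gamma> * real s" _ "\<gamma>0 * real s"] \<gamma>(3) by (auto simp: mult_right_mono)
    ultimately have "real (card {X. X \<subseteq> between E Z (\<Union>i<p. Y i) \<and> poor_config E Z p Y i0 (\<gamma> * real s) X}) \<le> real (card ?B)"
      by (intro of_nat_mono card_mono)
    also have "\<dots> \<le> real p * 2 ^ card Z * 2 powr (real (card Z) * (\<Sum>i\<in>{..<p} - {i0}. real (card (Y i))) - real s / 2 ^ card Z
             + real (card (between E Z (Y i0))) + \<epsilon> * real s)"
      by (rule C0[OF E fZ i0]) (use Y in auto)
    also have "(\<Sum>i\<in>{..<p} - {i0}. real (card (Y i))) = (real p - 1) * real s" using Y i0 p by (simp add: of_nat_diff)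
    also have "real p * 2 ^ card Z = 2 powr (log 2 (real p) + real (t + 1))"
      unfolding Z using p by (simp only: powr_add powr_realpow zero_less_numeral) simp
    also have "2 powr (log 2 (real p) + real (t + 1)) * 2 powr (real (card Z) * ((real p - 1) * real s) - real s / 2 ^ card Z
             + real (card (between E Z (Y i0))) + \<epsilon> * real s)
        = 2 powr (log 2 (real p) + real (t + 1) + (real (card Z) * ((real p - 1) * real s) - real s / 2 ^ card Z
             + real (card (between E Z (Y i0))) + \<epsilon> * real s))" by (simp only: powr_add)
    also have "\<dots> \<le> 2 powr (real (t + 1) * (real p - 1) * real s + real (card (between E Z (Y i0))) - \<delta> * real s)"
    proof (rule powr_mono)
      define w where "w = real s / 2 ^ (t + 1)"
      have gen: "a + (b - w + e + w / 8) \<le> b + e - w / 2" if "a * 3 \<le> w" "0 \<le> w" for a b e w :: real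
        using that by linarith
      have e: "\<epsilon> * real s = w / 8" "\<delta> * real s = w / 2" by (simp_all add: \<epsilon>_def \<delta>_def w_def)
      have "(log 2 (real p) + real (t + 1)) * 3 \<le> w"
      proof -
        have "(log 2 (real p) + real (t + 1)) * 3 * 2 ^ (t + 1) \<le> real s" using s(4) by (simp only: mult_ac)
        then show ?thesis unfolding w_def by (rule pos_le_divide_eq[THEN iffD2, rotated]) simp
      qed
      moreover have "0 \<le> w" by (simp add: w_def)
      ultimately show "log 2 (real p) + real (t + 1) + (real (card Z) * ((real p - 1) * real s) - real s / 2 ^ card Z
             + real (card (between E Z (Y i0))) + \<epsilon> * real s)
          \<le> real (t + 1) * (real p - 1) * real s + real (card (between E Z (Y i0))) - \<delta> * real s"
        unfolding e Z w_def[symmetric] by (simp only: mult.assoc) (rule gen)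
    qed simp
    finally show ?thesis .
  qed
  define m where "m = p * s"
  have m1: "m \<ge> 1" using p s by (simp add: m_def)
  define d where "d = \<delta> * \<eta>' / 2"
  have d: "d > 0" using \<delta> \<eta>' by (simp add: d_def)
  define C1 where "C1 = 1 + real (m\<^sup>2) + (real p - 1) * real s * real m"
  obtain n1 where n1: "\<And>n. n \<ge> n1 \<Longrightarrow> real m * log 2 (real n) + (C1 + 2) \<le> d * real n"
    by (rule eventually_log_le_linear[OF d, of "real m" "C1 + 2"]) blast
  define \<Delta> where "\<Delta> = ext_density p - ext_density (p - 1)"
  have \<Delta>: "\<Delta> > 0" using p by (simp add: \<Delta>_def ext_density_def of_nat_diff field_simps)
  have "\<exists>n0. \<forall>V E. wf_graph (V, E) \<longrightarrow> n0 \<le> card V \<longrightarrow>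
    real (card (Free V E U)) \<le> 2 powr ((ext_density (p - 1) + \<Delta> / 2) * (real (card V))\<^sup>2)"
  proof (rule orientation_count_asymptotic[OF U'(2), of "\<lambda>j. j mod p"])
    show "a mod p \<le> p - 1" for a using p0 mod_less_divisor[OF p0, of a] by linarith
  qed (use U' \<Delta> in auto)
  then obtain n2 where n2: "\<And>V E. wf_graph (V, E) \<Longrightarrow> n2 \<le> card V \<Longrightarrow>
    real (card (Free V E U)) \<le> 2 powr ((ext_density (p - 1) + \<Delta> / 2) * (real (card V))\<^sup>2)" by blast
  define C2 where "C2 = real m + 2 * (2 * real t + 1)"
  define n0 where "n0 = max (max n1 n2) (m + 1 + nat \<lceil>2 * C2 / \<eta>\<rceil> + nat \<lceil>2 * (ext_density p + 2) / \<Delta>\<rceil>)"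
  show thesis
  \<comment> \<open>The only vertex sets deleted here are hosts, so \<open>K = m\<close>.\<close>
  proof (rule that[of n0 m])
    fix V E
    assume G: "wf_graph (V, E)" and n0: "n0 \<le> card V" and D: "2 ^ turan_num (card V) p < card (Free V E F)"
      and ng: "\<not> gains V E F p m"
    define n where "n = card V"
    note fin = wf_graph_finite[OF G]
    have nn: "n1 \<le> n" "n2 \<le> n" "m + 1 \<le> n" using n0 by (auto simp: n0_def n_def)
    have nr: "real n \<ge> 2 * C2 / \<eta>" "real n \<ge> 2 * (ext_density p + 2) / \<Delta>" "real n \<ge> 1"
      using n0 m1 unfolding n0_def n_def by linarith+
    define N where "N = nat \<lceil>\<eta>' * real n\<rceil>"
    have N: "\<eta>' * real n \<le> real N" "real N \<le> \<eta>' * real n + 1"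
      using \<eta>' by (auto simp: N_def)
    show "\<exists>c. (\<forall>v\<in>V. c v < p) \<and> real (card {e \<in> E. e \<notin> cross V c}) \<le> \<eta> * (real (card V))\<^sup>2"
    proof (cases "\<exists>c. (\<forall>v\<in>V. c v < p) \<and> card {e \<in> E. e \<notin> cross V c} \<le> (p * s + (2 * t + 1) * N + 2 * t) * card V")
      case True
      then obtain c where c: "\<forall>v\<in>V. c v < p" "card {e \<in> E. e \<notin> cross V c} \<le> (p * s + (2 * t + 1) * N + 2 * t) * card V" by blast
      have "real (card {e \<in> E. e \<notin> cross V c}) \<le> real ((p * s + (2 * t + 1) * N + 2 * t) * card V)"
        using c(2) by (rule of_nat_mono)
      also have "\<dots> = (real m + (2 * real t + 1) * real N + 2 * real t) * real n" by (simp add: m_def n_def algebra_simps)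
      also have "\<dots> \<le> (\<eta> * real n) * real n"
      proof (rule mult_right_mono)
        have "(2 * real t + 1) * real N \<le> (2 * real t + 1) * (\<eta>' * real n + 1)" using N by (intro mult_left_mono) auto
        also have "\<dots> = \<eta> / 2 * real n + (2 * real t + 1)" by (simp add: \<eta>'_def field_simps)
        finally have "(2 * real t + 1) * real N \<le> \<eta> / 2 * real n + (2 * real t + 1)" .
        moreover have "C2 \<le> \<eta> / 2 * real n" using nr(1) \<eta> by (simp add: field_simps)
        ultimately show "real m + (2 * real t + 1) * real N + 2 * real t \<le> \<eta> * real n" by (simp add: C2_def)
      qed simp
      finally show ?thesis using c(1) by (auto simp: n_def power2_eq_square mult.assoc)
    next
      case False
      define Dn where "Dn = real (card (Free V E F))"
      have Dn: "2 powr real (turan_num n p) < Dn" 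
      proof -
        have "real (2 ^ turan_num (card V) p) < Dn" using D unfolding Dn_def by (rule of_nat_less_iff[THEN iffD2])
        then show ?thesis by (simp add: powr_realpow n_def)
      qed
      then have Dn0: "Dn > 0" using powr_ge_zero[of 2 "real (turan_num n p)"] by linarith
      have host: "real (card (hosting V E F U g)) \<le> Dn * 2 powr (C1 - d * real n)" if g: "g \<in> placements m V" for g
      proof -
        let ?A = "g ` {..<p * s}"
        have gi: "inj_on g {..<p * s}" "?A \<subseteq> V" using g by (auto simp: placements_def m_def)
        have cA: "card ?A = m" using gi by (simp add: card_image m_def)
        have "?A \<noteq> {}" using cA m1 by auto
        then have FA: "real (card (Free (V - ?A) (inside E (V - ?A)) F)) \<le> Dn * 2 powr (1 - (1 - 1 / real p) * (real n - real m) * real m)"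
          using not_gains_bound[OF p0 fin(1) ng gi(2)] cA unfolding Dn_def n_def by simp
        have "real (card (hosting V E F U g)) \<le> real (card (Free (V - ?A) (inside E (V - ?A)) F)) *
          2 powr (real ((p * s)\<^sup>2) + real (card V) * ((real p - 1) * real s + 2 * \<gamma> * real s) - \<delta> * real s * real N)"
          by (rule host_dichotomy[OF G F p0 o i DO DI U _ \<gamma>(1,2) _ HS HC False]) (use g \<delta> m_def in auto)
        also have "\<dots> \<le> (Dn * 2 powr (1 - (1 - 1 / real p) * (real n - real m) * real m)) *
          2 powr (real ((p * s)\<^sup>2) + real (card V) * ((real p - 1) * real s + 2 * \<gamma> * real s) - \<delta> * real s * real N)"
          using FA by (rule mult_right_mono) simp
        also have "\<dots> = Dn * 2 powr (1 - (1 - 1 / real p) * (real n - real m) * real m +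
          (real (m\<^sup>2) + real n * ((real p - 1) * real s + 2 * \<gamma> * real s) - \<delta> * real s * real N))"
          by (simp only: powr_add m_def n_def mult.assoc)
        also have "\<dots> \<le> Dn * 2 powr (C1 - d * real n)"
        proof (intro mult_left_mono powr_mono)
          have "(1 - 1 / real p) * real m = (real p - 1) * real s" using p by (simp add: m_def field_simps)
          then have e1: "(1 - 1 / real p) * (real n - real m) * real m = (real p - 1) * real s * (real n - real m)"
            by (metis mult.assoc mult.commute)
          have "2 * \<gamma> * real s * real n \<le> 2 * (\<delta> * \<eta>' / 4) * real s * real n" using \<gamma> by (intro mult_right_mono) auto
          moreover have "\<delta> * real s * (\<eta>' * real n) \<le> \<delta> * real s * real N" using N \<delta> by (intro mult_left_mono) auto
          moreover have "d * real n * 1 \<le> d * real n * real s" using d s(2) by (intro mult_left_mono) auto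
          ultimately show "1 - (1 - 1 / real p) * (real n - real m) * real m +
              (real (m\<^sup>2) + real n * ((real p - 1) * real s + 2 * \<gamma> * real s) - \<delta> * real s * real N) \<le> C1 - d * real n"
            unfolding e1 C1_def d_def by (simp add: algebra_simps)
        qed (use Dn0 in auto)
        finally show ?thesis .
      qed
      \<comment> \<open>Orientations without a host make up at most a quarter of
        \<open>2 ^ t(n, p)\<close> because of the density gap \<open>\<Delta>\<close>, and those
        with a host at most a quarter of \<open>Dn\<close>, since \<open>2 powr (- d * n)\<close>
        beats the polynomial number of placements.\<close>
      have "Dn \<le> real (card (Free V E U)) + real (card V) ^ m * max 0 (Dn * 2 powr (C1 - d * real n))"
        unfolding Dn_def by (rule card_Free_le_hosting[OF G _ U'(2)]) (use U' host in \<open>simp_all add: m_def Dn_def\<close>)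
      also have "max 0 (Dn * 2 powr (C1 - d * real n)) = Dn * 2 powr (C1 - d * real n)" using Dn0 by simp
      also have "real (card V) ^ m * (Dn * 2 powr (C1 - d * real n)) \<le> Dn / 4"
      proof -
        have "real (card V) ^ m * 2 powr (C1 - d * real n) = 2 powr (real m * log 2 (real n) + (C1 - d * real n))"
          using nr(3) power_eq_powr_log[of "real n" m] by (simp add: powr_add n_def)
        also have "\<dots> \<le> 2 powr (- 2)" using n1[OF nn(1)] by (intro powr_mono) auto
        also have "\<dots> = 1 / 4" by (simp add: powr_minus powr_realpow[of 2 2, simplified])
        finally have "Dn * (real (card V) ^ m * 2 powr (C1 - d * real n)) \<le> Dn * (1 / 4)" using Dn0 by (intro mult_left_mono) auto
        then show ?thesis by (simp add: mult_ac)
      qed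
      also have "real (card (Free V E U)) \<le> Dn / 4"
      proof -
        have "real (card (Free V E U)) \<le> 2 powr ((ext_density (p - 1) + \<Delta> / 2) * (real n)\<^sup>2)"
          using n2[OF G] nn(2) by (simp add: n_def)
        also have "\<dots> \<le> 2 powr (real (turan_num n p) - 2)"
        proof (rule powr_mono)
          have "ext_density p + 2 \<le> \<Delta> / 2 * real n" using nr(2) \<Delta> by (simp add: field_simps)
          then have "(ext_density p + 2) * real n \<le> \<Delta> / 2 * real n * real n" by (rule mult_right_mono) simp
          moreover have "2 \<le> 2 * real n" using nr(3) by simp
          ultimately have "ext_density p * real n + 2 \<le> \<Delta> / 2 * (real n)\<^sup>2"
            by (simp add: power2_eq_square algebra_simps)
          moreover have "ext_density p * ((real n)\<^sup>2 - real n) \<le> real (turan_num n p)"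
          proof -
            have e: "1 - 1 / real p = 2 * ext_density p" using p by (simp add: ext_density_def field_simps)
            show ?thesis using turan_num_ge[OF p0, of n] unfolding e by simp
          qed
          moreover have "(ext_density (p - 1) + \<Delta> / 2) * (real n)\<^sup>2 = ext_density p * (real n)\<^sup>2 - \<Delta> / 2 * (real n)\<^sup>2"
            by (simp add: \<Delta>_def algebra_simps)
          ultimately show "(ext_density (p - 1) + \<Delta> / 2) * (real n)\<^sup>2 \<le> real (turan_num n p) - 2"
            by (simp add: right_diff_distrib)
        qed simp
        also have "\<dots> = 2 powr real (turan_num n p) / 4" by (simp add: powr_diff powr_realpow[of 2 2, simplified])
        finally show ?thesis using Dn by simp
      qed
      finally have False using Dn0 by simp
      then show ?thesis ..
    qed
  qed
qed

section \<open>Removing the remaining defects\<close>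

lemma powr_gather:
  fixes a b c d :: real
  shows "(2 powr a * 2 powr b) * (x * 2 powr c) = x * 2 powr (a + b + c)"
    and "((2 powr a * 2 powr b) * 2 powr d) * (x * 2 powr c) = x * 2 powr (a + b + d + c)"
  by (simp_all add: powr_add)

text \<open>The cross pairs number at most the Turan number, which is at most \<open>card E\<close>.
  So no more cross pairs are absent than there are edges inside classes, and the cross edges present
  come within \<open>x\<close> of the Turan number.\<close>

lemma near_turan:
  fixes V :: "nat set"
  assumes G: "wf_graph (V, E)" and p: "p > 0" and c: "\<forall>v\<in>V. c v < p"
    and x: "real (card {e \<in> E. e \<notin> cross V c}) \<le> x" and E: "turan_num (card V) p \<le> card E"
  shows "real (card E) \<le> real (turan_num (card V) p) + x"
    "\<And>i j. i \<noteq> j \<Longrightarrow> real (card (missing E {v \<in> V. c v = i} {v \<in> V. c v = j})) \<le> x"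
    "\<And>i. i < p \<Longrightarrow> (real (card {v \<in> V. c v = i}) - real (card V) / real p)\<^sup>2 \<le> 2 * x + real (card V)"
proof -
  note fin = wf_graph_finite[OF G]
  note fC = wf_graph_finite(2)[OF wf_graph_cross[OF fin(1), of c]]
  let ?in = "{e \<in> E. e \<notin> cross V c}" and ?C = "cross V c"
  have un: "E = ?in \<union> (?C \<inter> E)" by auto
  have "card (?in \<union> (?C \<inter> E)) = card ?in + card (?C \<inter> E)"
    by (rule card_Un_disjoint) (use fin fC in auto)
  then have cE: "card E = card ?in + card (?C \<inter> E)" using un by simp
  have le: "card (?C \<inter> E) \<le> card ?C" by (rule card_mono) (use fC in auto)
  have CT: "card ?C \<le> turan_num (card V) p" by (rule card_cross_le_turan) (use fin p c in auto)
  show "real (card E) \<le> real (turan_num (card V) p) + x" using cE le CT x by linarith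
  have cd: "card (?C - E) \<le> card ?in"
  proof -
    have "card (?C - E) = card ?C - card (?C \<inter> E)" using card_Diff_subset_Int[of ?C E] fC by simp
    then show ?thesis using cE CT E by linarith
  qed
  show "real (card (missing E {v \<in> V. c v = i} {v \<in> V. c v = j})) \<le> x" if ij: "i \<noteq> j" for i j
  proof -
    let ?M = "missing E {v \<in> V. c v = i} {v \<in> V. c v = j}"
    have "inj_on (\<lambda>(a, b). {a, b}) ?M"
      by (rule inj_onI) (use ij in \<open>auto simp: missing_def doubleton_eq_iff\<close>)
    moreover have "(\<lambda>(a, b). {a, b}) ` ?M \<subseteq> ?C - E" using ij by (auto simp: missing_def cross_def)
    ultimately have "card ?M \<le> card (?C - E)" using fC by (intro card_inj_on_le) auto
    then show ?thesis using cd x by linarith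
  qed
  show "(real (card {v \<in> V. c v = i}) - real (card V) / real p)\<^sup>2 \<le> 2 * x + real (card V)" if i: "i < p" for i
  proof (rule class_size_ge[OF fin(1) p bspec[OF c] i])
    show "real (turan_num (card V) p) - x \<le> real (card ?C)" using cE le E x by linarith
  qed
qed

text \<open>An orientation that is not ready splits into its trace at \<open>Z\<close>, confined to
  \<open>T\<close>, and a free orientation of the rest, which is compared with the whole through
  \<open>not_gains_bound\<close>.\<close>

lemma split_ready:
  assumes G: "wf_graph (V, E)" and Z: "Z \<subseteq> V" and T: "finite T"
    and nr: "\<And>X. X \<in> Free V E F \<Longrightarrow> \<not> ready V E F p Z Y m X \<Longrightarrow> X \<inter> {e \<in> E. e \<inter> Z \<noteq> {}} \<in> T"
  shows "card (Free V E F) \<le> card {X \<in> Free V E F. ready V E F p Z Y m X} + card T * card (Free (V - Z) (inside E (V - Z)) F)"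
proof -
  note fin = wf_graph_finite[OF G]
  let ?E2 = "{e \<in> E. e \<inter> Z \<noteq> {}}" and ?E1 = "inside E (V - Z)"
  let ?R = "{X \<in> Free V E F. ready V E F p Z Y m X}" and ?N = "{X \<in> Free V E F. \<not> ready V E F p Z Y m X}"
  have EE: "E = ?E2 \<union> ?E1"
  proof
    show "E \<subseteq> ?E2 \<union> ?E1"
    proof
      fix e assume e: "e \<in> E"
      then obtain a b where "e = {a, b}" "a \<in> V" "b \<in> V" using wf_graph_edge[OF G] by metis
      then show "e \<in> ?E2 \<union> ?E1" using e by (auto simp: inside_def)
    qed
  qed (auto simp: inside_def)
  have "card ?N \<le> card (T \<inter> Pow ?E2) * card (Free (V - Z) ?E1 F)"
  proof (rule card_subsets_split[of ?E2 ?E1])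
    show "finite ?E2" "finite ?E1" using fin by (auto simp: inside_def)
    show "?E2 \<inter> ?E1 = {}" by (auto simp: inside_def)
    show "X \<subseteq> ?E2 \<union> ?E1" if "X \<in> ?N" for X using that EE by (auto simp: Free_def)
    show "X \<inter> ?E2 \<in> T \<inter> Pow ?E2" if "X \<in> ?N" for X using nr that by blast
    show "card {Q. Q \<subseteq> ?E1 \<and> P \<union> Q \<in> ?N} \<le> card (Free (V - Z) ?E1 F)" if "P \<in> T \<inter> Pow ?E2" for P
    proof -
      have PE: "P \<inter> ?E1 = {}" using that by (auto simp: inside_def)
      have "{Q. Q \<subseteq> ?E1 \<and> P \<union> Q \<in> ?N} \<subseteq> Free (V - Z) ?E1 F"
      proof
        fix Q assume Q: "Q \<in> {Q. Q \<subseteq> ?E1 \<and> P \<union> Q \<in> ?N}"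
        then have "(P \<union> Q) \<inter> ?E1 = Q" using PE by blast
        then show "Q \<in> Free (V - Z) ?E1 F" using Q Free_inside[of "P \<union> Q" V E F "V - Z"] by auto
      qed
      then show ?thesis using fin by (intro card_mono finite_Free) (auto simp: inside_def)
    qed
  qed (use T in simp)
  also have "\<dots> \<le> card T * card (Free (V - Z) ?E1 F)" using T by (intro mult_le_mono1 card_mono) auto
  finally have "card ?N \<le> card T * card (Free (V - Z) ?E1 F)" .
  moreover have "card (Free V E F) \<le> card ?R + card ?N"
  proof -
    have "Free V E F = ?R \<union> ?N" by auto
    then show ?thesis by (metis card_Un_le)
  qed
  ultimately show ?thesis by linarith
qed


text \<open>What the deletion argument uses of a member of the family. The order bound limits the
  deleted sets; every vertex lies on an edge, so that a copy whose edges lie in a class has its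
  vertices there as well.\<close>

definition forcing :: "'b dgraph \<Rightarrow> nat \<Rightarrow> nat \<Rightarrow> 'b graph \<Rightarrow> bool" where
  "forcing F p h M \<longleftrightarrow> wf_graph M \<and> fst M \<noteq> {} \<and> card (fst M) \<le> h \<and> fst M \<subseteq> \<Union> (snd M) \<and>
     (\<forall>D. is_orientation M D \<longrightarrow> config F p D)"

text \<open>A copy of \<open>M\<close> found in the graph inherits an orientation from
  \<open>X\<close>. Which one cannot be chosen, hence the demand that every orientation of
  \<open>M\<close> be a configuration.\<close>

lemma pulled_back_orientation:
  assumes G: "wf_graph (V, E)" and M: "wf_graph M" and f: "inj_on f (fst M)" and e: "\<And>e. e \<in> snd M \<Longrightarrow> f ` e \<in> E"
  shows "is_orientation M (fst M, {(a, b). {a, b} \<in> snd M \<and> arc E X (f a) (f b)})" (is "is_orientation M ?D")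
proof -
  have pr: "a \<noteq> b \<and> a \<in> fst M \<and> b \<in> fst M \<and> f a \<noteq> f b \<and> {f a, f b} \<in> E" if ab: "{a, b} \<in> snd M" for a b
  proof -
    have "a \<noteq> b" "a \<in> fst M" "b \<in> fst M" using wf_graph_pair[of "fst M" "snd M" a b] M ab by auto
    moreover have "f ` {a, b} \<in> E" using e[OF ab] .
    ultimately show ?thesis using f by (auto dest: inj_onD)
  qed
  have one: "arc E X (f a) (f b) \<longleftrightarrow> \<not> arc E X (f b) (f a)" if "{a, b} \<in> snd M" for a b
    using arc_asym[of "f a" "f b" E X] pr[OF that] by blast
  have "wf_dgraph ?D" unfolding wf_dgraph_def
  proof (intro conjI ballI)
    show "finite (fst ?D)" using M by (simp add: wf_graph_def)
    show "snd ?D \<subseteq> fst ?D \<times> fst ?D" using pr by auto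
    fix z assume "z \<in> snd ?D"
    then obtain a b where ab: "z = (a, b)" "{a, b} \<in> snd M" "arc E X (f a) (f b)" by auto
    then show "case z of (u, v) \<Rightarrow> u \<noteq> v \<and> (v, u) \<notin> snd ?D" using pr[OF ab(2)] one[OF ab(2)] by auto
  qed
  moreover have "und ?D = M"
  proof -
    have "{{u, v} | u v. (u, v) \<in> snd ?D} = snd M"
    proof (intro equalityI subsetI)
      fix x assume x: "x \<in> snd M"
      have "wf_graph (fst M, snd M)" using M by simp
      then obtain a b where ab: "x = {a, b}" using wf_graph_edge[OF _ x] by metis
      have ba: "{b, a} \<in> snd M" "{a, b} \<in> snd M" using x ab by (auto simp: insert_commute)
      show "x \<in> {{u, v} | u v. (u, v) \<in> snd ?D}"
      proof (cases "arc E X (f a) (f b)")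
        case True
        then have "(a, b) \<in> snd ?D" using ba by simp
        then show ?thesis using ab by blast
      next
        case False
        then have "(b, a) \<in> snd ?D" using ba one[OF ba(2)] by simp
        moreover have "x = {b, a}" using ab by auto
        ultimately show ?thesis by blast
      qed
    qed auto
    then show ?thesis by (simp add: und_def)
  qed
  ultimately show ?thesis by (simp add: is_orientation_def)
qed

text \<open>The approximate partition is used in place of a host: its classes have linear size and
  are almost completely joined, so \<open>ready_count\<close> applies with a saving of order
  \<open>n ^ 2\<close>. Single vertices are treated before copies of \<open>M\<close>, since the
  argument for a copy needs every vertex to have small degree inside its own class.\<close>

lemma final_structure:
  fixes F DO DI :: "'b dgraph" and p t h :: nat
  assumes F: "wf_dgraph F" and p: "p \<ge> 2" and t: "t \<ge> 1" and o: "out_centre F p" and i: "in_centre F p"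
    and DO: "is_out_star DO t" "config F p DO" and DI: "is_in_star DI t" "config F p DI"
    and fam: "\<And>M. M \<in> fam \<Longrightarrow> forcing F p h M"
  obtains K n0 where "\<And>V E. wf_graph (V, E) \<Longrightarrow> n0 \<le> card V \<Longrightarrow> 2 ^ turan_num (card V) p < card (Free V E F) \<Longrightarrow> \<not> gains V E F p K \<Longrightarrow>
     \<exists>c. (\<forall>v\<in>V. c v < p) \<and> (\<forall>i<p. \<forall>M\<in>fam. \<not> (\<exists>f. inj_on f (fst M) \<and> (\<forall>e\<in>snd M. f ` e \<in> inside E {v \<in> V. c v = i})))"
proof -
  have p0: "p > 0" using p by simp
  \<comment> \<open>A rare pattern on at most \<open>h\<close> vertices in a class of about
    \<open>n / p\<close> saves at least about \<open>n / (p * 2 ^ h) = 2 * \<omega> * n\<close>. The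
    other errors are kept to small fractions of \<open>\<omega> * n\<close>:
    \<open>\<epsilon>\<close> in the count of patterns, \<open>\<zeta>\<close> in the class sizes,
    \<open>\<gamma>\<close> in the degrees inside classes.\<close>
  define \<omega> :: real where "\<omega> = 1 / (real p * 2 ^ (h + 1))"
  have \<omega>: "0 < \<omega>" "\<omega> \<le> 1 / (2 * real p)"
  proof -
    have "(2::real) ^ 1 \<le> 2 ^ (h + 1)" by (intro power_increasing) auto
    then show "0 < \<omega>" "\<omega> \<le> 1 / (2 * real p)" using p by (auto simp: \<omega>_def field_simps)
  qed
  define \<epsilon> where "\<epsilon> = \<omega> / 16"
  define \<zeta> where "\<zeta> = \<omega> / (16 * (real h + 1))"
  have \<epsilon>: "0 < \<epsilon>" using \<omega> by (simp add: \<epsilon>_def)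
  have \<zeta>: "0 < \<zeta>" "\<zeta> \<le> \<omega> / 16" "(real h + 1) * \<zeta> = \<omega> / 16" using \<omega> by (auto simp: \<zeta>_def field_simps)
  obtain \<gamma>0 :: real where \<gamma>0: "\<gamma>0 > 0" and
    S0: "\<And>E v p Y M L. finite E \<Longrightarrow> (\<And>i. i < p \<Longrightarrow> finite (Y i) \<and> v \<notin> Y i \<and> L \<le> real (card (Y i)) \<and> real (card (Y i)) \<le> M) \<Longrightarrow>
      real (card {X. X \<subseteq> between E {v} (\<Union>i<p. Y i) \<and> poor_star E v p Y (\<gamma>0 * M) X})
        \<le> (2 * real p) ^ 2 * 2 powr ((\<Sum>i<p. real (card (Y i))) - 2 * L + 2 * \<epsilon> * M)" and
    C0: "\<And>E Z p Y M L i0. finite E \<Longrightarrow> finite Z \<Longrightarrow> Z \<noteq> {} \<Longrightarrow> i0 < p \<Longrightarrow>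
      (\<And>i. i < p \<Longrightarrow> finite (Y i) \<and> Z \<inter> Y i = {} \<and> L \<le> real (card (Y i)) \<and> real (card (Y i)) \<le> M) \<Longrightarrow>
      real (card {X. X \<subseteq> between E Z (\<Union>i<p. Y i) \<and> poor_config E Z p Y i0 (\<gamma>0 * M) X})
        \<le> real p * 2 ^ card Z * 2 powr (real (card Z) * (\<Sum>i\<in>{..<p} - {i0}. real (card (Y i))) - L / 2 ^ card Z
             + real (card (between E Z (Y i0))) + \<epsilon> * M)"
    by (rule poor_counts[OF \<epsilon>]) blast
  define \<gamma> where "\<gamma> = min (\<gamma>0 / 2) (min (1 / (16 * real p)) (\<omega> / (64 * (real h + 1))))"
  have \<gamma>: "0 < \<gamma>" "2 * \<gamma> \<le> \<gamma>0" "\<gamma> \<le> 1 / (16 * real p)" "4 * real h * \<gamma> \<le> \<omega> / 16" "\<gamma> \<le> 1"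
  proof -
    show "0 < \<gamma>" using \<gamma>0 \<omega> p by (simp add: \<gamma>_def)
    show "2 * \<gamma> \<le> \<gamma>0" "\<gamma> \<le> 1 / (16 * real p)" by (auto simp: \<gamma>_def)
    have "\<gamma> \<le> \<omega> / (64 * (real h + 1))" by (simp add: \<gamma>_def)
    then have "4 * real h * \<gamma> \<le> 4 * real h * (\<omega> / (64 * (real h + 1)))" by (intro mult_left_mono) auto
    also have "\<dots> \<le> \<omega> / 16" using \<omega> by (simp add: field_simps)
    finally show "4 * real h * \<gamma> \<le> \<omega> / 16" .
    have "1 / (16 * real p) \<le> 1" using p by simp
    then show "\<gamma> \<le> 1" using \<open>\<gamma> \<le> 1 / (16 * real p)\<close> by linarith
  qed
  obtain c\<^sub>r \<mu> :: real and m0 :: nat where cr: "c\<^sub>r > 0" "\<mu> > 0" and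
    RC: "\<And>m V E p Z Y. m \<ge> m0 \<Longrightarrow> wf_graph (V, E) \<Longrightarrow> Z \<subseteq> V \<Longrightarrow> (\<And>i. i < p \<Longrightarrow> Y i \<subseteq> V - Z) \<Longrightarrow>
      (\<And>i j. i < p \<Longrightarrow> j < p \<Longrightarrow> i \<noteq> j \<Longrightarrow> real (card (missing E (Y i) (Y j))) \<le> \<mu> * (real m)\<^sup>2) \<Longrightarrow>
      real (card {X \<in> Free V E F. ready V E F p Z Y (real m) X}) \<le> 2 powr (real (card E) - c\<^sub>r * (real m)\<^sup>2)"
    by (rule ready_count[OF F]) blast
  \<comment> \<open>The number of edges inside classes that is tolerated, relative to
    \<open>n ^ 2\<close>. The bounds give, in this order, balanced classes, few missing cross pairs
    for \<open>ready_count\<close>, a number of edges exceeding the Turan number by less than the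
    saving of \<open>ready_count\<close>, and few relocated vertices.\<close>
  define \<eta>2 where "\<eta>2 = min (min (\<zeta>\<^sup>2 / 3) (\<mu> * \<gamma>\<^sup>2)) (min (c\<^sub>r * \<gamma>\<^sup>2 / 2) (2 * \<gamma>))"
  have \<eta>2: "0 < \<eta>2" "\<eta>2 \<le> \<zeta>\<^sup>2 / 3" "\<eta>2 \<le> \<mu> * \<gamma>\<^sup>2" "\<eta>2 \<le> c\<^sub>r * \<gamma>\<^sup>2 / 2" "\<eta>2 \<le> 2 * \<gamma>"
    using \<zeta> cr \<gamma> by (auto simp: \<eta>2_def)
  \<comment> \<open>Relocating up to \<open>\<eta> / \<gamma> * n\<close> vertices can add
    \<open>\<eta> / \<gamma> * n ^ 2\<close> edges inside classes; this choice keeps the total below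
    \<open>\<eta>2 * n ^ 2\<close>.\<close>
  define \<eta> where "\<eta> = \<gamma> * \<eta>2 / 2"
  have \<eta>: "0 < \<eta>" using \<gamma> \<eta>2 by (simp add: \<eta>_def)
  have \<eta>le: "\<eta> + \<eta> / \<gamma> \<le> \<eta>2" "\<eta> / \<gamma> \<le> \<gamma>" "\<eta> \<le> \<eta>2"
  proof -
    have e: "\<eta> / \<gamma> = \<eta>2 / 2" using \<gamma> by (simp add: \<eta>_def)
    have "\<gamma> * \<eta>2 \<le> 1 * \<eta>2" using \<gamma> \<eta>2 by (intro mult_right_mono) auto
    then have "\<eta> \<le> \<eta>2 / 2" by (simp add: \<eta>_def)
    then show "\<eta> + \<eta> / \<gamma> \<le> \<eta>2" "\<eta> / \<gamma> \<le> \<gamma>" "\<eta> \<le> \<eta>2"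
      unfolding e using \<eta>2(1,5) by linarith+
  qed
  obtain K1 n1 where st: "\<And>V E. wf_graph (V, E) \<Longrightarrow> n1 \<le> card V \<Longrightarrow> 2 ^ turan_num (card V) p < card (Free V E F) \<Longrightarrow> \<not> gains V E F p K1 \<Longrightarrow>
     \<exists>c. (\<forall>v\<in>V. c v < p) \<and> real (card {e \<in> E. e \<notin> cross V c}) \<le> \<eta> * (real (card V))\<^sup>2"
    by (rule structure_or_gain[OF F p t o i DO DI \<eta>]) blast
  define K where "K = max K1 (max 1 h)"
  define CB where "CB = 10 + 2 * log 2 (2 * real p)"
  define CC where "CC = 10 + (real h)\<^sup>2 + log 2 (real p) + real h + real h + (real h)\<^sup>2"
  define n0 where "n0 = max n1 (m0 + nat \<lceil>real m0 / \<gamma>\<rceil> + nat \<lceil>2 / \<gamma>\<rceil> + nat \<lceil>3 / \<zeta>\<^sup>2\<rceil> + nat \<lceil>4 / (c\<^sub>r * \<gamma>\<^sup>2)\<rceil> + nat \<lceil>4 * real p * (real h + 3)\<rceil>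
     + nat \<lceil>2 * real p * CB\<rceil> + nat \<lceil>4 * CC / \<omega>\<rceil> + 1)"
  show thesis
  proof (rule that[of n0 K])
    fix V E
    assume G: "wf_graph (V, E)" and n0: "n0 \<le> card V" and D: "2 ^ turan_num (card V) p < card (Free V E F)"
      and ng: "\<not> gains V E F p K"
    define n where "n = card V"
    define T where "T = turan_num n p"
    define Dn where "Dn = real (card (Free V E F))"
    note fin = wf_graph_finite[OF G]
    have nr: "real n \<ge> real m0 / \<gamma>" "real n \<ge> 2 / \<gamma>" "real n \<ge> 3 / \<zeta>\<^sup>2" "real n \<ge> 4 / (c\<^sub>r * \<gamma>\<^sup>2)"
      "real n \<ge> 4 * real p * (real h + 3)" "real n \<ge> 2 * real p * CB" "real n \<ge> 4 * CC / \<omega>" "real n \<ge> 1" "n \<ge> n1"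
    proof -
      define a where "a x = nat \<lceil>x\<rceil>" for x :: real
      have "n1 \<le> n" "m0 + a (real m0 / \<gamma>) + a (2 / \<gamma>) + a (3 / \<zeta>\<^sup>2) + a (4 / (c\<^sub>r * \<gamma>\<^sup>2)) + a (4 * real p * (real h + 3))
         + a (2 * real p * CB) + a (4 * CC / \<omega>) + 1 \<le> n"
        using n0 unfolding n0_def n_def a_def by simp_all
      moreover have "x \<le> real n" if "a x \<le> n" for x using that unfolding a_def by (simp only: nat_ceiling_le_eq)
      ultimately show "real n \<ge> real m0 / \<gamma>" "real n \<ge> 2 / \<gamma>" "real n \<ge> 3 / \<zeta>\<^sup>2" "real n \<ge> 4 / (c\<^sub>r * \<gamma>\<^sup>2)"
        "real n \<ge> 4 * real p * (real h + 3)" "real n \<ge> 2 * real p * CB" "real n \<ge> 4 * CC / \<omega>" "real n \<ge> 1" "n \<ge> n1"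
        by simp_all
    qed
    have Dn: "2 powr real T < Dn"
    proof -
      have "real (2 ^ T) < Dn" using D unfolding Dn_def T_def n_def by (rule of_nat_less_iff[THEN iffD2])
      then show ?thesis by (simp add: powr_realpow)
    qed
    then have Dn0: "Dn > 0" using powr_ge_zero[of 2 "real T"] by linarith
    have TE: "T \<le> card E"
    proof (rule ccontr)
      assume "\<not> T \<le> card E"
      then have "(2::nat) ^ card E \<le> 2 ^ T" by (intro power_increasing) auto
      then show False using card_Free_le[OF fin(2), of V F] D unfolding T_def n_def by linarith
    qed
    have FZ: "real (card (Free (V - Z) (inside E (V - Z)) F)) \<le> Dn * 2 powr (1 - (1 - 1 / real p) * (real n - real (card Z)) * real (card Z))"
      if "Z \<subseteq> V" "Z \<noteq> {}" "card Z \<le> max 1 h" for Z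
      using not_gains_bound[OF p0 fin(1) ng that(1,2)] that(3) by (simp add: Dn_def n_def K_def)
    define m where "m = nat \<lceil>\<gamma> * real n\<rceil>"
    have m: "\<gamma> * real n \<le> real m" "real m \<le> \<gamma> * real n + 1" using \<gamma> by (auto simp: m_def)
    have m2: "real m \<le> 2 * \<gamma> * real n" "real m \<le> \<gamma>0 * real n" "m0 \<le> m"
    proof -
      have "2 \<le> \<gamma> * real n" using nr(2) \<gamma> by (simp add: field_simps)
      then show 1: "real m \<le> 2 * \<gamma> * real n" using m by linarith
      have "2 * \<gamma> * real n \<le> \<gamma>0 * real n" using \<gamma> by (intro mult_right_mono) auto
      then show "real m \<le> \<gamma>0 * real n" using 1 by linarith
      have "real m0 \<le> \<gamma> * real n" using nr(1) \<gamma> by (simp add: field_simps)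
      then show "m0 \<le> m" using m by linarith
    qed
    have mm: "\<gamma>\<^sup>2 * (real n)\<^sup>2 \<le> (real m)\<^sup>2"
      using power_mono[OF m(1), of 2] \<gamma> by (simp add: power_mult_distrib)
    have sizes: "real n / real p - \<zeta> * real n \<le> real (card {v \<in> V. c v = i})"
      and missing: "\<And>a b. a \<noteq> b \<Longrightarrow> real (card (missing E {v \<in> V. c v = a} {v \<in> V. c v = b})) \<le> \<mu> * (real m)\<^sup>2"
      and Ecard: "real (card E) - c\<^sub>r * (real m)\<^sup>2 \<le> real T - 2"
      if c: "\<forall>v\<in>V. c v < p" and inn: "real (card {e \<in> E. e \<notin> cross V c}) \<le> \<eta>2 * (real n)\<^sup>2" and i: "i < p" for c i
    proof -
      note nt = near_turan[OF G p0 c inn TE[unfolded T_def n_def]]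
      have "real (card (missing E {v \<in> V. c v = a} {v \<in> V. c v = b})) \<le> \<mu> * (real m)\<^sup>2" if "a \<noteq> b" for a b
      proof -
        have "\<eta>2 * (real n)\<^sup>2 \<le> \<mu> * \<gamma>\<^sup>2 * (real n)\<^sup>2" using \<eta>2 by (intro mult_right_mono) auto
        also have "\<dots> \<le> \<mu> * (real m)\<^sup>2" using mm cr by (simp add: mult.assoc)
        finally show ?thesis using nt(2)[OF that] by linarith
      qed
      then show "\<And>a b. a \<noteq> b \<Longrightarrow> real (card (missing E {v \<in> V. c v = a} {v \<in> V. c v = b})) \<le> \<mu> * (real m)\<^sup>2" .
      show "real (card E) - c\<^sub>r * (real m)\<^sup>2 \<le> real T - 2"
      proof -
        have "\<eta>2 * (real n)\<^sup>2 \<le> c\<^sub>r * \<gamma>\<^sup>2 / 2 * (real n)\<^sup>2" using \<eta>2 by (intro mult_right_mono) auto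
        moreover have "c\<^sub>r * (\<gamma>\<^sup>2 * (real n)\<^sup>2) \<le> c\<^sub>r * (real m)\<^sup>2" using mm cr by (intro mult_left_mono) auto
        moreover have "2 \<le> c\<^sub>r * \<gamma>\<^sup>2 / 2 * (real n)\<^sup>2"
        proof -
          have "2 \<le> c\<^sub>r * \<gamma>\<^sup>2 / 2 * real n" using nr(4) cr \<gamma> by (simp add: field_simps)
          also have "\<dots> \<le> c\<^sub>r * \<gamma>\<^sup>2 / 2 * real n * real n" using nr(8) cr \<gamma> by simp
          finally show ?thesis by (simp add: power2_eq_square)
        qed
        ultimately show ?thesis using nt(1) by (simp add: T_def n_def)
      qed
      show "real n / real p - \<zeta> * real n \<le> real (card {v \<in> V. c v = i})"
      proof (rule ccontr)
        assume "\<not> ?thesis"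
        then have "\<zeta> * real n < real n / real p - real (card {v \<in> V. c v = i})" by simp
        then have "(\<zeta> * real n)\<^sup>2 < (real n / real p - real (card {v \<in> V. c v = i}))\<^sup>2"
          using \<zeta> by (intro power_strict_mono) auto
        also have "\<dots> = (real (card {v \<in> V. c v = i}) - real n / real p)\<^sup>2" by (rule power2_commute)
        also have "\<dots> \<le> 2 * (\<eta>2 * (real n)\<^sup>2) + real n" using nt(3)[OF i] by (simp add: n_def)
        finally have big: "\<zeta>\<^sup>2 * (real n)\<^sup>2 < 2 * (\<eta>2 * (real n)\<^sup>2) + real n" by (simp add: power_mult_distrib)
        have "\<eta>2 * (real n)\<^sup>2 \<le> \<zeta>\<^sup>2 / 3 * (real n)\<^sup>2" using \<eta>2 by (intro mult_right_mono) auto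
        moreover have "real n \<le> \<zeta>\<^sup>2 / 3 * (real n)\<^sup>2"
        proof -
          have "1 \<le> \<zeta>\<^sup>2 / 3 * real n" using nr(3) \<zeta> by (simp add: field_simps)
          then have "1 * real n \<le> \<zeta>\<^sup>2 / 3 * real n * real n" by (rule mult_right_mono) simp
          then show ?thesis by (simp add: power2_eq_square)
        qed
        ultimately show False using big by simp
      qed
    qed
    \<comment> \<open>Common end of both deletion arguments: the ready orientations number at most a
      quarter of \<open>2 ^ T < Dn\<close>, the others at most a quarter of \<open>Dn\<close>, yet
      together they are all.\<close>
    have contra: False if Z: "Z \<subseteq> V" and TT: "finite TT"
      and nrd: "\<And>X. X \<in> Free V E F \<Longrightarrow> \<not> ready V E F p Z Y (real m) X \<Longrightarrow> X \<inter> {e \<in> E. e \<inter> Z \<noteq> {}} \<in> TT"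
      and rd: "real (card {X \<in> Free V E F. ready V E F p Z Y (real m) X}) \<le> 2 powr (real T - 2)"
      and cT: "real (card TT) * real (card (Free (V - Z) (inside E (V - Z)) F)) \<le> Dn * 2 powr (- 2)" for Z Y TT
    proof -
      have "card (Free V E F) \<le> card {X \<in> Free V E F. ready V E F p Z Y (real m) X} + card TT * card (Free (V - Z) (inside E (V - Z)) F)"
        by (rule split_ready[OF G Z TT nrd])
      then have "Dn \<le> real (card {X \<in> Free V E F. ready V E F p Z Y (real m) X} + card TT * card (Free (V - Z) (inside E (V - Z)) F))"
        unfolding Dn_def by (rule of_nat_mono)
      also have "\<dots> \<le> 2 powr (real T - 2) + Dn * 2 powr (- 2)" using rd cT by simp
      also have "\<dots> = 2 powr real T / 4 + Dn / 4" by (simp add: powr_diff powr_minus powr_realpow[of 2 2, simplified])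
      finally show False using Dn Dn0 by linarith
    qed
    obtain c where c: "\<And>v. v \<in> V \<Longrightarrow> c v < p" and inn: "real (card {e \<in> E. e \<notin> cross V c}) \<le> \<eta> * (real n)\<^sup>2"
    proof -
      have "\<not> gains V E F p K1"
        using ng unfolding gains_def K_def by (meson le_trans max.cobounded1)
      then show ?thesis using st[OF G nr(9)[unfolded n_def] D] that unfolding n_def by blast
    qed
    have cb: "\<forall>v\<in>V. c v < p" using c by blast
    have inn2: "real (card {e \<in> E. e \<notin> cross V c}) \<le> \<eta>2 * (real n)\<^sup>2"
      using inn mult_right_mono[OF \<eta>le(3), of "(real n)\<^sup>2"] by simp
    define C where "C i = {v \<in> V. c v = i}" for i
    define nb where "nb c v i = {y \<in> V. c y = i \<and> {v, y} \<in> E}" for c :: "nat \<Rightarrow> nat" and v i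
    \<comment> \<open>A vertex with \<open>2 * m\<close> neighbours in every class has poor
      attachments in every orientation that is not ready. Its exponent is then about
      \<open>n - 2 * n / p\<close>, whereas the Turan increment is about
      \<open>n - n / p\<close>.\<close>
    have placed: "\<exists>i<p. card (nb c v i) < 2 * m" if v: "v \<in> V" for v
    proof (rule ccontr)
      assume "\<not> (\<exists>i<p. card (nb c v i) < 2 * m)"
      then have deg: "2 * m \<le> card (nb c v i)" if "i < p" for i using that by (meson not_less)
      define Y where "Y i = C i - {v}" for i
      define L where "L = real n / real p - \<zeta> * real n - 1"
      have YV: "Y i \<subseteq> V - {v}" for i by (auto simp: Y_def C_def)
      have fY: "finite (Y i)" for i using YV fin by (meson finite_Diff finite_subset)
      have cY: "L \<le> real (card (Y i))" "real (card (Y i)) \<le> real n" if "i < p" for i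
      proof -
        have "card (C i) - card {v} \<le> card (Y i)" unfolding Y_def by (rule diff_card_le_card_Diff) simp
        then have "card (C i) \<le> card (Y i) + 1" by simp
        then show "L \<le> real (card (Y i))" using sizes[OF cb inn2 that, folded C_def] unfolding L_def by linarith
        have "card (Y i) \<le> n" unfolding n_def using YV fin by (intro card_mono) auto
        then show "real (card (Y i)) \<le> real n" by simp
      qed
      have UY: "(\<Union>i<p. Y i) = V - {v}" using c by (auto simp: Y_def C_def)
      let ?TT = "{X. X \<subseteq> between E {v} (\<Union>i<p. Y i) \<and> poor_star E v p Y (\<gamma>0 * real n) X}"
      show False
      proof (rule contra[of "{v}" ?TT Y])
        show "{v} \<subseteq> V" using v by simp
        show "finite ?TT" by (rule finite_subset[of _ "Pow (between E {v} (\<Union>i<p. Y i))"]) (use between_finite[OF fin(2)] in auto)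
        show "X \<inter> {e \<in> E. e \<inter> {v} \<noteq> {}} \<in> ?TT" if X: "X \<in> Free V E F" "\<not> ready V E F p {v} Y (real m) X" for X
        proof -
          have "poor_star E v p Y (real m) X"
          proof (rule star_ready[OF G F o i v YV])
            show "2 * real m \<le> real (card {y \<in> Y i. {v, y} \<in> E})" if "i < p" for i
            proof -
              have "{y \<in> Y i. {v, y} \<in> E} = nb c v i"
                using wf_graph_pair(1)[OF G] by (auto simp: Y_def C_def nb_def)
              then show ?thesis using deg[OF that] by simp
            qed
          qed (rule X(2))
          then have ps: "poor_star E v p Y (\<gamma>0 * real n) X" using m2(2) by (rule poor_star_mono)
          have "matching E X {v} (Y i) \<sigma> = matching E (X \<inter> {e \<in> E. e \<inter> {v} \<noteq> {}}) {v} (Y i) \<sigma>" for i \<sigma>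
            by (rule matching_cong) auto
          then have "poor_star E v p Y (\<gamma>0 * real n) (X \<inter> {e \<in> E. e \<inter> {v} \<noteq> {}})"
            using ps poor_star_cong[of p E X v Y "X \<inter> {e \<in> E. e \<inter> {v} \<noteq> {}}"] by simp
          moreover have "{e \<in> E. e \<inter> {v} \<noteq> {}} \<subseteq> between E {v} (\<Union>i<p. Y i)"
          proof
            fix e assume e: "e \<in> {e \<in> E. e \<inter> {v} \<noteq> {}}"
            then obtain a b where ab: "e = {a, b}" "a \<noteq> b" "a \<in> V" "b \<in> V" using wf_graph_edge[OF G] by blast
            then consider "a = v" | "b = v" using e by auto
            then show "e \<in> between E {v} (\<Union>i<p. Y i)"
            proof cases
              case 1 then show ?thesis using ab e unfolding UY between_def by blast
            next
              case 2
              then have "e = {v, a}" "a \<in> V - {v}" using ab by auto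
              then show ?thesis using e unfolding UY between_def by blast
            qed
          qed
          ultimately show ?thesis by blast
        qed
        show "real (card {X \<in> Free V E F. ready V E F p {v} Y (real m) X}) \<le> 2 powr (real T - 2)"
        proof -
          have "real (card {X \<in> Free V E F. ready V E F p {v} Y (real m) X}) \<le> 2 powr (real (card E) - c\<^sub>r * (real m)\<^sup>2)"
          proof (rule RC[OF m2(3) G])
            show "{v} \<subseteq> V" using v by simp
            show "real (card (missing E (Y a) (Y b))) \<le> \<mu> * (real m)\<^sup>2" if "a \<noteq> b" for a b
            proof -
              have "card (missing E (Y a) (Y b)) \<le> card (missing E (C a) (C b))"
                using fin by (intro card_mono finite_missing missing_mono) (auto simp: Y_def C_def)
              then show ?thesis using missing[OF cb inn2 p0 that] by (simp add: C_def)
            qed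
          qed (rule YV)
          also have "\<dots> \<le> 2 powr (real T - 2)" using Ecard[OF cb inn2 p0] by (intro powr_mono) auto
          finally show ?thesis .
        qed
        have "real (card ?TT) \<le> (2 * real p) ^ 2 * 2 powr ((\<Sum>i<p. real (card (Y i))) - 2 * L + 2 * \<epsilon> * real n)"
        proof -
          have "v \<notin> Y i" for i using YV[of i] by blast
          then show ?thesis by (intro S0[OF fin(2)]) (use fY cY in auto)
        qed
        also have "(\<Sum>i<p. real (card (Y i))) = real n - 1"
        proof -
          have "card (\<Union>i<p. Y i) = (\<Sum>i<p. card (Y i))" by (rule card_UN_disjoint) (use fY in \<open>auto simp: Y_def C_def\<close>)
          then have "(\<Sum>i<p. card (Y i)) = n - 1" using v fin by (simp add: UY n_def)
          then have "real (\<Sum>i<p. card (Y i)) = real n - 1" using nr(8) by (simp add: of_nat_diff)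
          then show ?thesis by simp
        qed
        also have "(2 * real p) ^ 2 = 2 powr (2 * log 2 (2 * real p))"
          using p power_eq_powr_log[of "2 * real p" 2] by simp
        finally have cTT: "real (card ?TT) \<le> 2 powr (2 * log 2 (2 * real p)) * 2 powr (real n - 1 - 2 * L + 2 * \<epsilon> * real n)" .
        have "real (card ?TT) * real (card (Free (V - {v}) (inside E (V - {v})) F)) \<le>
          (2 powr (2 * log 2 (2 * real p)) * 2 powr (real n - 1 - 2 * L + 2 * \<epsilon> * real n)) *
          (Dn * 2 powr (1 - (1 - 1 / real p) * (real n - real (card {v})) * real (card {v})))"
          by (rule mult_mono[OF cTT FZ]) (use v in auto)
        also have "\<dots> = Dn * 2 powr (2 * log 2 (2 * real p) + (real n - 1 - 2 * L + 2 * \<epsilon> * real n) + (1 - (1 - 1 / real p) * (real n - 1)))"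
          unfolding powr_gather by simp
        also have "\<dots> \<le> Dn * 2 powr (- 2)"
        proof (intro mult_left_mono powr_mono)
          define q where "q = real n / real p"
          define ip where "ip = 1 / real p"
          have ip: "0 \<le> ip" by (simp add: ip_def)
          have qn: "(1 - 1 / real p) * (real n - 1) = real n - 1 - q + ip" by (simp add: ip_def q_def algebra_simps diff_divide_distrib)
          have "CB \<le> q / 2" using nr(6) p by (simp add: q_def field_simps)
          moreover have "\<omega> * real n \<le> 1 / (2 * real p) * real n" using \<omega> by (intro mult_right_mono) auto
          then have "\<omega> * real n \<le> q / 2" by (simp add: q_def)
          moreover have "\<zeta> * real n \<le> \<omega> / 16 * real n" using \<zeta> by (intro mult_right_mono) auto
          moreover note ip
          moreover have "0 \<le> q" by (simp add: q_def)
          ultimately show "2 * log 2 (2 * real p) + (real n - 1 - 2 * L + 2 * \<epsilon> * real n) + (1 - (1 - 1 / real p) * (real n - 1)) \<le> - 2"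
            unfolding qn L_def q_def[symmetric] \<epsilon>_def CB_def by simp
        qed (use Dn0 in auto)
        finally show "real (card ?TT) * real (card (Free (V - {v}) (inside E (V - {v})) F)) \<le> Dn * 2 powr (- 2)" .
      qed
    qed
    define moved where "moved = {v \<in> V. 2 * m \<le> card (nb c v (c v))}"
    \<comment> \<open>Vertices with many neighbours in their own class are moved to a class where
      they have few, which exists by \<open>placed\<close>. The choice refers to the old classes;
      the shift caused by the moves is at most \<open>card moved\<close>.\<close>
    define c' where "c' v = (if v \<in> moved then SOME i. i < p \<and> card (nb c v i) < 2 * m else c v)" for v
    have mv: "c' v < p \<and> card (nb c v (c' v)) < 2 * m" if v: "v \<in> V" for v
    proof (cases "v \<in> moved")
      case True
      have "\<exists>i. i < p \<and> card (nb c v i) < 2 * m" using placed[OF v] by blast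
      then have "(SOME i. i < p \<and> card (nb c v i) < 2 * m) < p \<and> card (nb c v (SOME i. i < p \<and> card (nb c v i) < 2 * m)) < 2 * m"
        by (rule someI_ex)
      then show ?thesis using True by (simp add: c'_def)
    next
      case False
      then show ?thesis using v c by (auto simp: c'_def moved_def)
    qed
    have fm: "finite moved" using fin by (simp add: moved_def)
    \<comment> \<open>Each moved vertex accounts for \<open>2 * m\<close> ordered pairs of adjacent
      vertices in a common class of \<open>c\<close>, and there are at most
      \<open>2 * \<eta> * n ^ 2\<close> such pairs.\<close>
    have cm: "real (card moved) \<le> \<eta> / \<gamma> * real n"
    proof -
      let ?in = "{e \<in> E. e \<notin> cross V c}"
      have Gin: "wf_graph (V, ?in)" using G by (auto simp: wf_graph_def)
      have fpairs: "finite {(u, w). {u, w} \<in> ?in}"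
        by (rule finite_subset[of _ "V \<times> V"]) (use fin wf_graph_pair[OF G] in auto)
      have "(SIGMA v : moved. nb c v (c v)) \<subseteq> {(u, w). {u, w} \<in> ?in}"
      proof clarify
        fix v w assume "v \<in> moved" "w \<in> nb c v (c v)"
        then have "{v, w} \<in> E" "c w = c v" by (auto simp: nb_def)
        moreover from this have "{v, w} \<notin> cross V c" by (auto simp: cross_def doubleton_eq_iff)
        ultimately show "{v, w} \<in> E \<and> {v, w} \<notin> cross V c" by simp
      qed
      then have "card (SIGMA v : moved. nb c v (c v)) \<le> card {(u, w). {u, w} \<in> ?in}" by (rule card_mono[OF fpairs])
      also have "\<dots> = 2 * card ?in" by (rule card_ordered_pairs[OF Gin])
      also have "card (SIGMA v : moved. nb c v (c v)) = (\<Sum>v\<in>moved. card (nb c v (c v)))"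
        using fm fin by (intro card_SigmaI) (auto simp: nb_def)
      finally have "(\<Sum>v\<in>moved. card (nb c v (c v))) \<le> 2 * card ?in" .
      moreover have "card moved * (2 * m) \<le> (\<Sum>v\<in>moved. card (nb c v (c v)))"
        using sum_bounded_below[of moved "2 * m" "\<lambda>v. card (nb c v (c v))"] by (auto simp: moved_def)
      ultimately have "card moved * m \<le> card ?in" by linarith
      then have "real (card moved * m) \<le> real (card ?in)" by (rule of_nat_mono)
      then have "real (card moved) * real m \<le> \<eta> * (real n)\<^sup>2" using inn by simp
      moreover have "real (card moved) * (\<gamma> * real n) \<le> real (card moved) * real m" using m by (intro mult_left_mono) auto
      ultimately have "real (card moved) * (\<gamma> * real n) \<le> \<eta> * (real n)\<^sup>2" by linarith
      then show ?thesis using \<gamma> nr(8) by (simp add: field_simps power2_eq_square)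
    qed
    have inn': "real (card {e \<in> E. e \<notin> cross V c'}) \<le> \<eta>2 * (real n)\<^sup>2"
    proof -
      have "{e \<in> E. e \<notin> cross V c'} \<subseteq> {e \<in> E. e \<notin> cross V c} \<union> between E moved V"
      proof
        fix e assume e: "e \<in> {e \<in> E. e \<notin> cross V c'}"
        then obtain a b where ab: "e = {a, b}" "a \<noteq> b" "a \<in> V" "b \<in> V" using wf_graph_edge[OF G] by blast
        consider "a \<in> moved" | "b \<in> moved" | "a \<notin> moved" "b \<notin> moved" by blast
        then show "e \<in> {e \<in> E. e \<notin> cross V c} \<union> between E moved V"
        proof cases
          case 1
          then have "e \<in> between E moved V" using ab(1,4) e unfolding between_def by blast
          then show ?thesis by (rule UnI2)
        next
          case 2
          moreover have "e = {b, a}" using ab by auto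
          ultimately have "e \<in> between E moved V" using ab(3) e unfolding between_def by blast
          then show ?thesis by (rule UnI2)
        next
          case 3
          have "c' a = c' b"
          proof (rule ccontr)
            assume "c' a \<noteq> c' b"
            then have "e \<in> cross V c'" using ab unfolding cross_def by blast
            then show False using e by simp
          qed
          then have "c a = c b" using 3 by (simp add: c'_def)
          then have "e \<notin> cross V c" using ab(1) by (auto simp: cross_def doubleton_eq_iff)
          then show ?thesis using e by simp
        qed
      qed
      then have "card {e \<in> E. e \<notin> cross V c'} \<le> card ({e \<in> E. e \<notin> cross V c} \<union> between E moved V)"
        using fin between_finite[OF fin(2)] by (intro card_mono) auto
      also have "\<dots> \<le> card {e \<in> E. e \<notin> cross V c} + card (between E moved V)" by (rule card_Un_le)
      also have "card (between E moved V) \<le> card moved * n" unfolding n_def by (rule card_between_le[OF fm fin(1)])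
      finally have "real (card {e \<in> E. e \<notin> cross V c'}) \<le> real (card {e \<in> E. e \<notin> cross V c} + card moved * n)"
        by (intro of_nat_mono) simp
      also have "\<dots> \<le> \<eta> * (real n)\<^sup>2 + (\<eta> / \<gamma> * real n) * real n"
        using inn mult_right_mono[OF cm, of "real n"] by simp
      also have "\<dots> = (\<eta> + \<eta> / \<gamma>) * (real n)\<^sup>2" by (simp add: power2_eq_square algebra_simps)
      also have "\<dots> \<le> \<eta>2 * (real n)\<^sup>2" using \<eta>le(1) by (rule mult_right_mono) simp
      finally show ?thesis .
    qed
    have c'p: "\<And>v. v \<in> V \<Longrightarrow> c' v < p" using mv by blast
    have c'b: "\<forall>v\<in>V. c' v < p" using c'p by blast
    define C' where "C' i = {v \<in> V. c' v = i}" for i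
    have deg': "real (card (nb c' v (c' v))) \<le> 5 * \<gamma> * real n" if v: "v \<in> V" for v
    proof -
      have "nb c' v (c' v) \<subseteq> nb c v (c' v) \<union> moved"
        by (auto simp: nb_def c'_def split: if_splits)
      then have "card (nb c' v (c' v)) \<le> card (nb c v (c' v) \<union> moved)"
        using fin fm by (intro card_mono) (auto simp: nb_def)
      also have "\<dots> \<le> card (nb c v (c' v)) + card moved" by (rule card_Un_le)
      finally have "real (card (nb c' v (c' v))) \<le> 2 * real m + real (card moved)" using mv[OF v] by linarith
      also have "\<dots> \<le> 4 * \<gamma> * real n + \<gamma> * real n"
        using m2(1) cm mult_right_mono[OF \<eta>le(2), of "real n"] by simp
      finally show ?thesis by simp
    qed
    have "\<not> (\<exists>f. inj_on f (fst M) \<and> (\<forall>e\<in>snd M. f ` e \<in> inside E (C' i0)))" if i0: "i0 < p" and M: "M \<in> fam" for i0 M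
    proof
      assume "\<exists>f. inj_on f (fst M) \<and> (\<forall>e\<in>snd M. f ` e \<in> inside E (C' i0))"
      then obtain f where f: "inj_on f (fst M)" "\<And>e. e \<in> snd M \<Longrightarrow> f ` e \<in> inside E (C' i0)" by blast
      have wM: "wf_graph M" "fst M \<noteq> {}" "card (fst M) \<le> h" "fst M \<subseteq> \<Union> (snd M)"
        and cfg: "\<And>D. is_orientation M D \<Longrightarrow> config F p D" using fam[OF M] by (auto simp: forcing_def)
      define Z where "Z = f ` fst M"
      define z where "z = card Z"
      have fZ: "finite Z" using wM(1) by (simp add: Z_def wf_graph_def)
      have zh: "z \<le> h" "z \<ge> 1" "Z \<noteq> {}"
      proof -
        have "z = card (fst M)" unfolding z_def Z_def by (rule card_image[OF f(1)])
        then show "z \<le> h" using wM by simp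
        show "Z \<noteq> {}" using wM by (simp add: Z_def)
        then show "z \<ge> 1" using fZ by (simp add: z_def Suc_leI card_gt_0_iff)
      qed
      \<comment> \<open>Only the edges of the copy are known to lie in the class. The vertices
        follow because \<open>M\<close> has no isolated vertex.\<close>
      have ZC: "Z \<subseteq> C' i0"
      proof
        fix y assume "y \<in> Z"
        then obtain x where x: "x \<in> fst M" "y = f x" by (auto simp: Z_def)
        then obtain e where e: "e \<in> snd M" "x \<in> e" using wM(4) by blast
        then have "f ` e \<subseteq> C' i0" using f(2)[OF e(1)] by (simp add: inside_def)
        then show "y \<in> C' i0" using x e by blast
      qed
      then have ZV: "Z \<subseteq> V" by (auto simp: C'_def)
      define Y where "Y i = C' i - Z" for i
      define L where "L = real n / real p - \<zeta> * real n - real h"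
      have YV: "Y i \<subseteq> V - Z" for i by (auto simp: Y_def C'_def)
      have fY: "finite (Y i)" for i using YV fin by (meson finite_Diff finite_subset)
      have cY: "L \<le> real (card (Y i))" "real (card (Y i)) \<le> real n" if "i < p" for i
      proof -
        have "card (C' i) - card Z \<le> card (Y i)" unfolding Y_def by (rule diff_card_le_card_Diff[OF fZ])
        then have "card (C' i) \<le> card (Y i) + h" using zh by (simp add: z_def)
        then show "L \<le> real (card (Y i))" using sizes[OF c'b inn' that, folded C'_def] unfolding L_def by linarith
        have "card (Y i) \<le> n" unfolding n_def using YV fin by (intro card_mono) auto
        then show "real (card (Y i)) \<le> real n" by simp
      qed
      have UY: "(\<Union>i<p. Y i) = V - Z" using c'p by (auto simp: Y_def C'_def)
      define q where "q = real n / real p"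
      have \<omega>q: "\<omega> * real n \<le> q / 2"
        using mult_right_mono[OF \<omega>(2), of "real n"] by (simp add: q_def)
      have \<zeta>q: "\<zeta> * real n \<le> q / 32"
        using mult_right_mono[OF \<zeta>(2), of "real n"] \<omega>q by simp
      have hq: "real h + 3 \<le> q / 4" using nr(5) p by (simp add: q_def field_simps)
      have L0: "0 \<le> L" using \<zeta>q hq unfolding L_def q_def[symmetric] by linarith
      have mL: "real m \<le> L"
      proof -
        have "\<gamma> * real n \<le> 1 / (16 * real p) * real n" using \<gamma>(3) by (rule mult_right_mono) simp
        then have "\<gamma> * real n \<le> q / 16" by (simp add: q_def)
        then have "real m \<le> q / 16 + 1" using m(2) by linarith
        then show ?thesis using \<zeta>q hq unfolding L_def q_def[symmetric] by linarith
      qed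
      let ?E2 = "{e \<in> E. e \<inter> Z \<noteq> {}}"
      let ?B = "between E Z (\<Union>i<p. Y i)"
      let ?P = "{X. X \<subseteq> ?B \<and> poor_config E Z p Y i0 (\<gamma>0 * real n) X}"
      let ?TT = "{X. X \<subseteq> ?E2 \<and> poor_config E Z p Y i0 (\<gamma>0 * real n) X}"
      have E2: "?E2 = ?B \<union> inside E Z"
      proof (intro equalityI subsetI)
        fix e assume e: "e \<in> ?E2"
        then obtain a b where ab: "e = {a, b}" "a \<in> V" "b \<in> V" using wf_graph_edge[OF G] by blast
        consider "a \<in> Z" "b \<in> Z" | "a \<in> Z" "b \<in> V - Z" | "b \<in> Z" "a \<in> V - Z" using ab e by blast
        then show "e \<in> ?B \<union> inside E Z"
        proof cases
          case 1 then show ?thesis using ab e by (auto simp: inside_def)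
        next
          case 2 then show ?thesis using ab e unfolding UY between_def by blast
        next
          case 3
          moreover have "e = {b, a}" using ab by auto
          ultimately show ?thesis using e unfolding UY between_def by blast
        qed
      next
        fix e assume e: "e \<in> ?B \<union> inside E Z"
        have "e \<noteq> {}" if "e \<in> E" using wf_graph_edge[OF G that] by (metis insert_not_empty)
        then show "e \<in> ?E2" using e by (auto simp: between_def inside_def)
      qed
      have fB: "finite ?B" "finite (inside E Z)" using between_finite[OF fin(2)] fin by (auto simp: inside_def)
      have fP: "finite ?P" by (rule finite_subset[of _ "Pow ?B"]) (use fB in auto)
      show False
      proof (rule contra[of Z ?TT Y])
        show "Z \<subseteq> V" by (rule ZV)
        show "finite ?TT" by (rule finite_subset[of _ "Pow ?E2"]) (use fin in auto)
        show "X \<inter> ?E2 \<in> ?TT" if X: "X \<in> Free V E F" "\<not> ready V E F p Z Y (real m) X" for X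
        proof -
          let ?D = "(fst M, {(a, b). {a, b} \<in> snd M \<and> arc E X (f a) (f b)})"
          have fE: "f ` e \<in> E" if "e \<in> snd M" for e using f(2)[OF that] by (simp add: inside_def)
          have "config F p ?D" by (rule cfg[OF pulled_back_orientation[OF G wM(1) f(1) fE]])
          then have "poor_config E Z p Y i0 (real m) X"
          proof (rule config_ready[OF G F])
            show "real m \<le> real (card (Y i0))" using mL cY(1)[OF i0] by linarith
          qed (use f(1) ZV YV i0 X(2) in \<open>auto simp: Z_def\<close>)
          then have ps: "poor_config E Z p Y i0 (\<gamma>0 * real n) X" using m2(2) by (rule poor_config_mono)
          have "matching E X Z (Y i) \<sigma> = matching E (X \<inter> ?E2) Z (Y i) \<sigma>" for i \<sigma>
            by (rule matching_cong) auto
          then have "poor_config E Z p Y i0 (\<gamma>0 * real n) (X \<inter> ?E2)"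
            using ps poor_config_cong[of p E X Z Y "X \<inter> ?E2"] by simp
          then show ?thesis by blast
        qed
        show "real (card {X \<in> Free V E F. ready V E F p Z Y (real m) X}) \<le> 2 powr (real T - 2)"
        proof -
          have "real (card {X \<in> Free V E F. ready V E F p Z Y (real m) X}) \<le> 2 powr (real (card E) - c\<^sub>r * (real m)\<^sup>2)"
          proof (rule RC[OF m2(3) G ZV])
            show "real (card (missing E (Y a) (Y b))) \<le> \<mu> * (real m)\<^sup>2" if "a \<noteq> b" for a b
            proof -
              have "card (missing E (Y a) (Y b)) \<le> card (missing E (C' a) (C' b))"
                using fin by (intro card_mono finite_missing missing_mono) (auto simp: Y_def C'_def)
              then show ?thesis using missing[OF c'b inn' p0 that] by (simp add: C'_def)
            qed
          qed (rule YV)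
          also have "\<dots> \<le> 2 powr (real T - 2)" using Ecard[OF c'b inn' p0] by (intro powr_mono) auto
          finally show ?thesis .
        qed
        \<comment> \<open>The edges inside \<open>Z\<close> are counted as free; there are at most
          \<open>h ^ 2\<close> of them.\<close>
        have "card ?TT \<le> card ?P * 2 ^ card (inside E Z)"
        proof (rule card_subsets_split[of ?B "inside E Z"])
          show "?B \<inter> inside E Z = {}" unfolding UY by (auto simp: between_def inside_def)
          show "X \<subseteq> ?B \<union> inside E Z" if "X \<in> ?TT" for X using that E2 by simp
          show "X \<inter> ?B \<in> ?P" if "X \<in> ?TT" for X
          proof -
            have "matching E X Z (Y i) \<sigma> = matching E (X \<inter> ?B) Z (Y i) \<sigma>" if "i < p" for i \<sigma>
              by (rule matching_cong) (use that in \<open>auto simp: between_def\<close>)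
            then show ?thesis using that poor_config_cong[of p E X Z Y "X \<inter> ?B"] by simp
          qed
          show "card {Q. Q \<subseteq> inside E Z \<and> W \<union> Q \<in> ?TT} \<le> 2 ^ card (inside E Z)" for W
            using card_mono[of "Pow (inside E Z)" "{Q. Q \<subseteq> inside E Z \<and> W \<union> Q \<in> ?TT}"] fB by (auto simp: card_Pow)
        qed (use fB fP in auto)
        then have "real (card ?TT) \<le> real (card ?P * 2 ^ card (inside E Z))" by (rule of_nat_mono)
        also have "\<dots> = real (card ?P) * 2 powr real (card (inside E Z))" by (simp add: powr_realpow)
        also have "\<dots> \<le> (2 powr (log 2 (real p) + real h) * 2 powr (real z * (real n - q + \<zeta> * real n) - L / 2 ^ h + real z * (5 * \<gamma> * real n) + \<epsilon> * real n)) * 2 powr ((real h)\<^sup>2)"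
        proof (intro mult_mono)
          have "card (inside E Z) \<le> z * z"
            using card_edges_le[OF wf_graph_inside[OF G ZV]] by (simp add: z_def)
          also have "\<dots> \<le> h * h" using zh by (intro mult_le_mono)
          finally have "real (card (inside E Z)) \<le> real (h * h)" by (rule of_nat_mono)
          then show "2 powr real (card (inside E Z)) \<le> 2 powr ((real h)\<^sup>2)" by (simp add: power2_eq_square)
          have "real (card ?P) \<le> real p * 2 ^ card Z * 2 powr (real (card Z) * (\<Sum>i\<in>{..<p} - {i0}. real (card (Y i))) - L / 2 ^ card Z
             + real (card (between E Z (Y i0))) + \<epsilon> * real n)"
          proof -
            have "Z \<inter> Y i = {}" for i using YV[of i] by blast
            then show ?thesis by (intro C0[OF fin(2) fZ zh(3) i0]) (use fY cY in auto)
          qed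
          also have "\<dots> \<le> 2 powr (log 2 (real p) + real h) * 2 powr (real z * (real n - q + \<zeta> * real n) - L / 2 ^ h + real z * (5 * \<gamma> * real n) + \<epsilon> * real n)"
          proof -
            have "2 ^ card Z \<le> (2::real) ^ h" using zh by (intro power_increasing) (auto simp: z_def)
            then have b1: "real p * 2 ^ card Z \<le> 2 powr (log 2 (real p) + real h)"
              using p by (simp add: powr_add powr_realpow)
            have "(\<Sum>i\<in>{..<p} - {i0}. real (card (Y i))) \<le> real n - q + \<zeta> * real n"
            proof -
              let ?I = "{..<p} - {i0}"
              have "card (\<Union>i\<in>?I. Y i) = (\<Sum>i\<in>?I. card (Y i))"
                by (rule card_UN_disjoint) (use fY in \<open>auto simp: Y_def C'_def\<close>)
              moreover have "card (\<Union>i\<in>?I. Y i) \<le> card (V - C' i0)"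
                using fin by (intro card_mono) (auto simp: Y_def C'_def)
              moreover have "card (V - C' i0) = n - card (C' i0)"
                using fin by (simp add: card_Diff_subset C'_def n_def)
              moreover have "card (C' i0) \<le> n" using fin by (auto simp: C'_def n_def intro: card_mono)
              ultimately have "real (\<Sum>i\<in>?I. card (Y i)) \<le> real n - real (card (C' i0))" by linarith
              then show ?thesis using sizes[OF c'b inn' i0, folded C'_def] unfolding q_def by simp
            qed
            then have b2: "real (card Z) * (\<Sum>i\<in>{..<p} - {i0}. real (card (Y i))) \<le> real z * (real n - q + \<zeta> * real n)"
              unfolding z_def by (rule mult_left_mono) simp
            have b3: "L / 2 ^ h \<le> L / 2 ^ card Z"
              using L0 zh by (intro divide_left_mono power_increasing) (auto simp: z_def)
            have "between E Z (Y i0) = (\<Union>y\<in>Z. between E {y} (Y i0))" by (auto simp: between_def)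
            then have "card (between E Z (Y i0)) \<le> (\<Sum>y\<in>Z. card (between E {y} (Y i0)))" using card_UN_le[OF fZ] by simp
            then have "real (card (between E Z (Y i0))) \<le> real (\<Sum>y\<in>Z. card (between E {y} (Y i0)))" by (rule of_nat_mono)
            also have "\<dots> = (\<Sum>y\<in>Z. real (card (between E {y} (Y i0))))" by simp
            also have "\<dots> \<le> real (card Z) * (5 * \<gamma> * real n)"
            proof (rule sum_bounded_above)
              fix y assume y: "y \<in> Z"
              then have yV: "y \<in> V" "c' y = i0" using ZC by (auto simp: C'_def)
              have "between E {y} (Y i0) \<subseteq> (\<lambda>w. {y, w}) ` nb c' y (c' y)"
                using yV by (auto simp: between_def nb_def Y_def C'_def)
              then have "card (between E {y} (Y i0)) \<le> card (nb c' y (c' y))"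
                using fin by (intro surj_card_le) (auto simp: nb_def)
              then show "real (card (between E {y} (Y i0))) \<le> 5 * \<gamma> * real n" using deg'[OF yV(1)] by linarith
            qed
            finally have b4: "real (card (between E Z (Y i0))) \<le> real z * (5 * \<gamma> * real n)" by (simp add: z_def)
            have "real (card Z) * (\<Sum>i\<in>{..<p} - {i0}. real (card (Y i))) - L / 2 ^ card Z + real (card (between E Z (Y i0))) + \<epsilon> * real n
               \<le> real z * (real n - q + \<zeta> * real n) - L / 2 ^ h + real z * (5 * \<gamma> * real n) + \<epsilon> * real n"
              by (intro add_mono diff_mono b2 b3 b4 order_refl)
            then show ?thesis by (intro mult_mono[OF b1] powr_mono) auto
          qed
          finally show "real (card ?P) \<le> 2 powr (log 2 (real p) + real h) * 2 powr (real z * (real n - q + \<zeta> * real n) - L / 2 ^ h + real z * (5 * \<gamma> * real n) + \<epsilon> * real n)" .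
        qed auto
        finally have cTT: "real (card ?TT) \<le> (2 powr (log 2 (real p) + real h) * 2 powr (real z * (real n - q + \<zeta> * real n) - L / 2 ^ h + real z * (5 * \<gamma> * real n) + \<epsilon> * real n)) * 2 powr ((real h)\<^sup>2)" .
        have "real (card ?TT) * real (card (Free (V - Z) (inside E (V - Z)) F)) \<le>
          ((2 powr (log 2 (real p) + real h) * 2 powr (real z * (real n - q + \<zeta> * real n) - L / 2 ^ h + real z * (5 * \<gamma> * real n) + \<epsilon> * real n)) * 2 powr ((real h)\<^sup>2)) *
          (Dn * 2 powr (1 - (1 - 1 / real p) * (real n - real (card Z)) * real (card Z)))"
          by (rule mult_mono[OF cTT FZ]) (use ZV zh z_def in auto)
        also have "\<dots> = Dn * 2 powr (log 2 (real p) + real h + (real z * (real n - q + \<zeta> * real n) - L / 2 ^ h + real z * (5 * \<gamma> * real n) + \<epsilon> * real n)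
            + (real h)\<^sup>2 + (1 - (1 - 1 / real p) * (real n - real z) * real z))"
          unfolding powr_gather z_def ..
        also have "\<dots> \<le> Dn * 2 powr (- 2)"
        proof (intro mult_left_mono powr_mono)
          \<comment> \<open>The main term \<open>z * (n - q)\<close> of the attachments cancels
            against the Turan increment. What decides is \<open>- L / 2 ^ h\<close>, about
            \<open>- 2 * \<omega> * n\<close>, while the remaining terms stay below it in absolute
            value.\<close>
          have qn: "(1 - 1 / real p) * (real n - real z) * real z = real z * (real n - q) - (1 - 1 / real p) * (real z * real z)"
            by (simp add: q_def algebra_simps diff_divide_distrib add_divide_distrib)
          have zz: "(1 - 1 / real p) * (real z * real z) \<le> (real h)\<^sup>2"
          proof -
            have "(1 - 1 / real p) * (real z * real z) \<le> 1 * (real z * real z)" by (intro mult_right_mono) auto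
            also have "\<dots> \<le> (real h)\<^sup>2" using zh by (simp add: power2_eq_square mult_mono)
            finally show ?thesis .
          qed
          have Lh: "2 * \<omega> * real n - \<zeta> * real n - real h \<le> L / 2 ^ h"
          proof -
            have "q / 2 ^ h = 2 * \<omega> * real n" using p by (simp add: q_def \<omega>_def)
            moreover have "(\<zeta> * real n + real h) / 2 ^ h \<le> \<zeta> * real n + real h"
            proof -
              have "0 \<le> \<zeta> * real n + real h" using \<zeta> by simp
              then have "(\<zeta> * real n + real h) / 2 ^ h \<le> (\<zeta> * real n + real h) / 1" by (intro divide_left_mono) auto
              then show ?thesis by simp
            qed
            moreover have "L / 2 ^ h = q / 2 ^ h - (\<zeta> * real n + real h) / 2 ^ h"
              by (simp add: L_def q_def diff_divide_distrib add_divide_distrib)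
            ultimately show ?thesis by linarith
          qed
          have z1: "real z * (\<zeta> * real n) + \<zeta> * real n \<le> \<omega> / 16 * real n"
          proof -
            have "real z * (\<zeta> * real n) \<le> real h * (\<zeta> * real n)" using zh \<zeta> by (intro mult_right_mono) auto
            then have "real z * (\<zeta> * real n) + \<zeta> * real n \<le> ((real h + 1) * \<zeta>) * real n" by (simp add: algebra_simps)
            then show ?thesis using \<zeta>(3) by simp
          qed
          have z2: "real z * (5 * \<gamma> * real n) \<le> \<omega> / 8 * real n"
          proof -
            have "real z * (5 * \<gamma> * real n) \<le> real h * (5 * \<gamma> * real n)" using zh \<gamma> by (intro mult_right_mono) auto
            also have "\<dots> \<le> (2 * (4 * real h * \<gamma>)) * real n" using \<gamma>(1) by (simp add: mult_right_mono)
            also have "\<dots> \<le> (2 * (\<omega> / 16)) * real n" using \<gamma>(4) by (intro mult_right_mono) auto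
            finally show ?thesis by simp
          qed
          have "CC \<le> \<omega> / 4 * real n" using nr(7) \<omega> by (simp add: field_simps)
          moreover have "0 \<le> \<omega> * real n" using \<omega> by simp
          moreover have "real z * (real n - q + \<zeta> * real n) = real z * (real n - q) + real z * (\<zeta> * real n)" by (simp add: algebra_simps)
          ultimately show "log 2 (real p) + real h + (real z * (real n - q + \<zeta> * real n) - L / 2 ^ h + real z * (5 * \<gamma> * real n) + \<epsilon> * real n)
            + (real h)\<^sup>2 + (1 - (1 - 1 / real p) * (real n - real z) * real z) \<le> - 2"
            unfolding qn \<epsilon>_def using zz Lh z1 z2 unfolding CC_def by simp
        qed (use Dn0 in auto)
        finally show "real (card ?TT) * real (card (Free (V - Z) (inside E (V - Z)) F)) \<le> Dn * 2 powr (- 2)" .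
      qed
    qed
    then show "\<exists>c. (\<forall>v\<in>V. c v < p) \<and> (\<forall>i<p. \<forall>M\<in>fam. \<not> (\<exists>f. inj_on f (fst M) \<and> (\<forall>e\<in>snd M. f ` e \<in> inside E {v \<in> V. c v = i})))"
      using c'p unfolding C'_def by blast
  qed
qed

section \<open>Decomposition families\<close>

lemma GM_edge_cases:
  assumes "{x, y} \<in> snd (GM M p t)"
  obtains a b where "x = Inl (Inl a)" "y = Inl (Inl b)" "{a, b} \<in> snd M"
  | z w where "x = Inl z" "y = Inr w"
  | z w where "x = Inr w" "y = Inl z"
  | w w' where "x = Inr w" "y = Inr w'" "fst w \<noteq> fst w'"
proof -
  have "{x, y} \<in> (image Inl) ` snd (pad M t) \<or> {x, y} \<in> (image Inr) ` snd (complete_multipartite (p - 1) t) \<or>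
    (\<exists>u v. {x, y} = {Inl u, Inr v})"
    using assms unfolding GM_def join_def snd_conv by blast
  then consider e where "e \<in> snd M" "{x, y} = Inl ` Inl ` e"
    | e where "e \<in> snd (complete_multipartite (p - 1) t)" "{x, y} = Inr ` e" | u v where "{x, y} = {Inl u, Inr v}"
    unfolding pad_def snd_conv by blast
  then show ?thesis
  proof cases
    case 1
    have "x \<in> Inl ` Inl ` e" "y \<in> Inl ` Inl ` e" unfolding 1(2)[symmetric] by simp_all
    then obtain a b where ab: "x = Inl (Inl a)" "y = Inl (Inl b)" by (elim imageE) simp
    have "z \<in> e \<longleftrightarrow> Inl (Inl z) \<in> {x, y}" for z unfolding 1(2) by (simp add: image_iff)
    then have "e = {a, b}" using ab by auto
    then show ?thesis using that(1) ab 1(1) by blast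
  next
    case 2
    then obtain w w' where w: "e = {w, w'}" "fst w \<noteq> fst w'"
      unfolding complete_multipartite_def snd_conv by blast
    have "{x, y} = {Inr w, Inr w'}" using 2(2) w(1) by simp
    then have "(x = Inr w \<and> y = Inr w') \<or> (x = Inr w' \<and> y = Inr w)" by (simp only: doubleton_eq_iff)
    then show ?thesis using that(4)[of w w'] that(4)[of w' w] w(2) by auto
  next
    case 3
    then have "(x = Inl u \<and> y = Inr v) \<or> (x = Inr v \<and> y = Inl u)" by (simp only: doubleton_eq_iff)
    then show ?thesis using that(2)[of u v] that(3)[of v u] by blast
  qed
qed

lemma GM_edgeI:
  shows "{a, b} \<in> snd M \<Longrightarrow> {Inl (Inl a), Inl (Inl b)} \<in> snd (GM M p t)"
    and "Inl z \<in> fst (GM M p t) \<Longrightarrow> Inr w \<in> fst (GM M p t) \<Longrightarrow> {Inl z, Inr w} \<in> snd (GM M p t)"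
    and "Inr w \<in> fst (GM M p t) \<Longrightarrow> Inr w' \<in> fst (GM M p t) \<Longrightarrow> fst w \<noteq> fst w' \<Longrightarrow> {Inr w, Inr w'} \<in> snd (GM M p t)"
proof -
  show "{Inl (Inl a), Inl (Inl b)} \<in> snd (GM M p t)" if "{a, b} \<in> snd M"
  proof -
    have 1: "{Inl a, Inl b} \<in> snd (pad M t)"
      unfolding pad_def snd_conv by (intro image_eqI[OF _ that]) simp
    show ?thesis unfolding GM_def join_def snd_conv by (intro UnI1 image_eqI[OF _ 1]) simp
  qed
  show "{Inl z, Inr w} \<in> snd (GM M p t)" if "Inl z \<in> fst (GM M p t)" "Inr w \<in> fst (GM M p t)"
    using that by (auto simp: GM_def join_def)
  show "{Inr w, Inr w'} \<in> snd (GM M p t)" if "Inr w \<in> fst (GM M p t)" "Inr w' \<in> fst (GM M p t)" "fst w \<noteq> fst w'"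
  proof -
    have "w \<in> {..<p - 1} \<times> {..<t}" "w' \<in> {..<p - 1} \<times> {..<t}"
      using that by (auto simp: GM_def join_def complete_multipartite_def)
    then have 1: "{w, w'} \<in> snd (complete_multipartite (p - 1) t)"
      using that(3) unfolding complete_multipartite_def snd_conv by blast
    show ?thesis unfolding GM_def join_def snd_conv by (rule UnI1, rule UnI2, rule image_eqI[OF _ 1]) simp
  qed
qed

lemma GM_vertices:
  "Inl (Inl a) \<in> fst (GM M p t) \<longleftrightarrow> a \<in> fst M"
  "Inl (Inr j) \<in> fst (GM M p t) \<longleftrightarrow> j < t"
  "Inr w \<in> fst (GM M p t) \<longleftrightarrow> fst w < p - 1 \<and> snd w < t"
  by (cases w; auto simp: GM_def join_def pad_def complete_multipartite_def)+

text \<open>Vertices of \<open>H\<close> embedded in \<open>M\<close> form \<open>S\<close>, those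
  on padding vertices get colour \<open>0\<close>, and those in part \<open>i\<close> of the
  multipartite graph get colour \<open>i + 1\<close>. Padding vertices are joined neither to
  \<open>M\<close> nor to each other, which gives the colour conditions. The isomorphism onto
  \<open>D\<close> is composed into \<open>\<psi>\<close>.\<close>

lemma dir_dec_config:
  assumes Hd: "wf_dgraph Hd" and chi: "chi (und Hd) = p + 1" and p: "p > 0" and D: "D \<in> dir_dec_family Hd"
  shows "config Hd p D"
proof -
  obtain t B W where B: "is_orientation (GM (und D) p t) B"
    and W: "W \<subseteq> fst B" "dcontains (dinduced B W) Hd" "diso (dinduced B ((\<lambda>v. Inl (Inl v)) ` fst D)) D"
    using D chi unfolding dir_dec_family_def by auto
  obtain f where f: "inj_on f (fst Hd)" "f ` fst Hd \<subseteq> W" "\<forall>(u, v)\<in>snd Hd. (f u, f v) \<in> snd B"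
    using W(2) unfolding dcontains_def dinduced_def by fastforce
  let ?I = "(\<lambda>v. Inl (Inl v)) ` fst D"
  obtain \<phi> where \<phi>: "bij_betw \<phi> ?I (fst D)"
    "\<And>x y. x \<in> ?I \<Longrightarrow> y \<in> ?I \<Longrightarrow> (x, y) \<in> snd (dinduced B ?I) \<longleftrightarrow> (\<phi> x, \<phi> y) \<in> snd D"
    using W(3) unfolding diso_def dinduced_def by auto
  have e: "und B = GM (und D) p t" using B by (simp add: is_orientation_def)
  have fB: "fst B = fst (GM (und D) p t)" and sB: "{{u, v} | u v. (u, v) \<in> snd B} = snd (GM (und D) p t)"
    using arg_cong[OF e, of fst] arg_cong[OF e, of snd] by (simp_all add: und_def[of B])
  define S where "S = {u \<in> fst Hd. f u \<in> ?I}"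
  define c where "c u = (case f u of Inl _ \<Rightarrow> 0 | Inr w \<Rightarrow> fst w + 1)" for u
  show ?thesis unfolding config_def
  proof (intro exI conjI)
    show "S \<subseteq> fst Hd" by (auto simp: S_def)
    have "inj_on f S" by (rule inj_on_subset[OF f(1)]) (auto simp: S_def)
    moreover have "inj_on \<phi> (f ` S)" using \<phi>(1) by (auto simp: bij_betw_def S_def intro: inj_on_subset)
    ultimately show "inj_on (\<lambda>u. \<phi> (f u)) S" by (auto simp: inj_on_def)
    show "(\<lambda>u. \<phi> (f u)) ` S \<subseteq> fst D" using \<phi>(1) by (auto simp: bij_betw_def S_def)
    show "\<forall>u\<in>fst Hd. c u < p"
    proof
      fix u assume "u \<in> fst Hd"
      then have "f u \<in> fst (GM (und D) p t)" using f(2) W(1) fB by blast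
      then show "c u < p" using p by (cases "f u") (auto simp: c_def GM_vertices)
    qed
    show "\<forall>(u, v)\<in>snd Hd. (u \<in> S \<and> v \<in> S \<longrightarrow> (\<phi> (f u), \<phi> (f v)) \<in> snd D) \<and> (u \<in> S \<and> v \<notin> S \<longrightarrow> c v \<noteq> 0) \<and>
        (u \<notin> S \<and> v \<in> S \<longrightarrow> c u \<noteq> 0) \<and> (u \<notin> S \<and> v \<notin> S \<longrightarrow> c u \<noteq> c v)"
    proof clarify
      fix u v assume uv: "(u, v) \<in> snd Hd"
      then have a: "(f u, f v) \<in> snd B" using f(3) by auto
      then have e: "{f u, f v} \<in> snd (GM (und D) p t)" using sB by blast
      have sD: "snd D \<subseteq> fst D \<times> fst D" using D by (auto simp: dir_dec_family_def wf_dgraph_def)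
      have uvF: "u \<in> fst Hd" "v \<in> fst Hd" using wf_dgraphD(4)[OF Hd uv] by auto
      have 1: "(\<phi> (f u), \<phi> (f v)) \<in> snd D" if "u \<in> S" "v \<in> S"
        using \<phi>(2)[of "f u" "f v"] that a by (auto simp: S_def dinduced_def)
      from e show "(u \<in> S \<and> v \<in> S \<longrightarrow> (\<phi> (f u), \<phi> (f v)) \<in> snd D) \<and> (u \<in> S \<and> v \<notin> S \<longrightarrow> c v \<noteq> 0) \<and>
        (u \<notin> S \<and> v \<in> S \<longrightarrow> c u \<noteq> 0) \<and> (u \<notin> S \<and> v \<notin> S \<longrightarrow> c u \<noteq> c v)"
      proof (cases rule: GM_edge_cases)
        case (1 a b)
        then have "a \<in> fst D" "b \<in> fst D" using sD by (auto simp: und_def doubleton_eq_iff)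
        then have "u \<in> S" "v \<in> S" using 1 uvF by (auto simp: S_def)
        then show ?thesis using \<open>u \<in> S \<Longrightarrow> v \<in> S \<Longrightarrow> (\<phi> (f u), \<phi> (f v)) \<in> snd D\<close> by blast
      next
        case (2 z w)
        then have "v \<notin> S" "c u = 0" "c v \<noteq> 0" by (auto simp: S_def c_def)
        then show ?thesis by auto
      next
        case (3 z w)
        then have "u \<notin> S" "c v = 0" "c u \<noteq> 0" by (auto simp: S_def c_def)
        then show ?thesis by auto
      next
        case (4 w w')
        then have "u \<notin> S" "v \<notin> S" "c u \<noteq> c v" by (auto simp: S_def c_def)
        then show ?thesis by auto
      qed
    qed
  qed
qed

section \<open>Consequences of the chromatic number\<close>

lemma chi_not_colourable:
  assumes "chi (und F) = p + 1"
  shows "\<not> (\<exists>c. (\<forall>u\<in>fst F. c u < p) \<and> (\<forall>(u, v)\<in>snd F. c u \<noteq> c v))"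
proof
  assume "\<exists>c. (\<forall>u\<in>fst F. c u < p) \<and> (\<forall>(u, v)\<in>snd F. c u \<noteq> c v)"
  then obtain c where c: "\<forall>u\<in>fst F. c u < p" "\<forall>(u, v)\<in>snd F. c u \<noteq> c v" by blast
  have "chi (und F) \<le> p" unfolding chi_def
  proof (rule Least_le, intro exI conjI)
    show "\<forall>v\<in>fst (und F). c v < p" using c by (simp add: und_def)
    show "\<forall>e\<in>snd (und F). \<forall>u\<in>e. \<forall>v\<in>e. u \<noteq> v \<longrightarrow> c u \<noteq> c v"
      using c(2) by (fastforce simp: und_def)
  qed
  then show False using assms by simp
qed

text \<open>With nothing in \<open>S\<close> the colours of a configuration would be a proper
  colouring with \<open>p\<close> colours.\<close>

lemma config_nonempty:
  assumes "config F p D" "chi (und F) = p + 1"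
  shows "fst D \<noteq> {}"
proof
  assume e: "fst D = {}"
  obtain S \<psi> c where S: "\<psi> ` S \<subseteq> fst D" and c: "\<forall>u\<in>fst F. c u < p"
    and R: "\<forall>(u, v)\<in>snd F. (u \<in> S \<and> v \<in> S \<longrightarrow> (\<psi> u, \<psi> v) \<in> snd D) \<and> (u \<in> S \<and> v \<notin> S \<longrightarrow> c v \<noteq> (0::nat)) \<and>
        (u \<notin> S \<and> v \<in> S \<longrightarrow> c u \<noteq> 0) \<and> (u \<notin> S \<and> v \<notin> S \<longrightarrow> c u \<noteq> c v)"
    using assms(1) unfolding config_def by (elim exE conjE)
  have "S = {}" using S e by simp
  then have "\<forall>(u, v)\<in>snd F. c u \<noteq> c v" using R by simp
  then show False using chi_not_colourable[OF assms(2)] c by blast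
qed

text \<open>Recolouring all of \<open>S\<close> with \<open>0\<close> leaves as monochromatic arcs
  only those that start at the vertex mapped to the centre. That vertex exists, for otherwise the
  colouring would be proper with \<open>p\<close> colours, against the chromatic number.\<close>

lemma config_out_centre:
  assumes D: "config F p D" "is_out_star D t" and chi: "chi (und F) = p + 1" and p: "p > 0"
  shows "out_centre F p"
proof -
  obtain S \<psi> c where S: "S \<subseteq> fst F" "inj_on \<psi> S" and c: "\<forall>u\<in>fst F. c u < p"
    and R: "\<forall>(u, v)\<in>snd F. (u \<in> S \<and> v \<in> S \<longrightarrow> (\<psi> u, \<psi> v) \<in> snd D) \<and> (u \<in> S \<and> v \<notin> S \<longrightarrow> c v \<noteq> (0::nat)) \<and>
        (u \<notin> S \<and> v \<in> S \<longrightarrow> c u \<noteq> 0) \<and> (u \<notin> S \<and> v \<notin> S \<longrightarrow> c u \<noteq> c v)"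
    using D(1) unfolding config_def by (elim exE conjE)
  obtain a where a: "snd D = {(a, w) | w. w \<in> fst D \<and> w \<noteq> a}" using D(2) unfolding is_out_star_def by blast
  define d where "d u = (if u \<in> S then 0 else c u)" for u
  have d: "\<forall>u\<in>fst F. d u < p" using c p by (simp add: d_def)
  have key: "d u \<noteq> d v \<or> (u \<in> S \<and> v \<in> S \<and> \<psi> u = a \<and> \<psi> v \<noteq> a)" if "(u, v) \<in> snd F" for u v
  proof -
    have r: "(u \<in> S \<and> v \<in> S \<longrightarrow> (\<psi> u, \<psi> v) \<in> snd D) \<and> (u \<in> S \<and> v \<notin> S \<longrightarrow> c v \<noteq> 0) \<and>
        (u \<notin> S \<and> v \<in> S \<longrightarrow> c u \<noteq> 0) \<and> (u \<notin> S \<and> v \<notin> S \<longrightarrow> c u \<noteq> c v)"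
      using bspec[OF R that] by simp
    show ?thesis by (cases "u \<in> S"; cases "v \<in> S") (use r a in \<open>auto simp: d_def\<close>)
  qed
  show ?thesis
  proof (cases "\<exists>x\<in>S. \<psi> x = a")
    case True
    then obtain x where x: "x \<in> S" "\<psi> x = a" by blast
    have eq: "u = x" if "u \<in> S" "\<psi> u = a" for u using S(2) x that by (auto dest: inj_onD)
    have "(u \<noteq> x \<and> v \<noteq> x \<longrightarrow> d u \<noteq> d v) \<and> (v = x \<longrightarrow> d u \<noteq> 0)" if "(u, v) \<in> snd F" for u v
    proof -
      have "d x = 0" using x by (simp add: d_def)
      from key[OF that] show ?thesis
      proof
        assume "d u \<noteq> d v"
        then show ?thesis using \<open>d x = 0\<close> by metis
      next
        assume uv: "u \<in> S \<and> v \<in> S \<and> \<psi> u = a \<and> \<psi> v \<noteq> a"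
        then have "u = x" using eq by simp
        moreover have "v \<noteq> x" using uv x(2) by metis
        ultimately show ?thesis by simp
      qed
    qed
    then show ?thesis unfolding out_centre_def using x S d by blast
  next
    case False
    then have "\<forall>(u, v)\<in>snd F. d u \<noteq> d v" using key by blast
    then show ?thesis using chi_not_colourable[OF chi] d by blast
  qed
qed

lemma config_in_centre:
  assumes D: "config F p D" "is_in_star D t" and chi: "chi (und F) = p + 1" and p: "p > 0"
  shows "in_centre F p"
proof -
  obtain S \<psi> c where S: "S \<subseteq> fst F" "inj_on \<psi> S" and c: "\<forall>u\<in>fst F. c u < p"
    and R: "\<forall>(u, v)\<in>snd F. (u \<in> S \<and> v \<in> S \<longrightarrow> (\<psi> u, \<psi> v) \<in> snd D) \<and> (u \<in> S \<and> v \<notin> S \<longrightarrow> c v \<noteq> (0::nat)) \<and>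
        (u \<notin> S \<and> v \<in> S \<longrightarrow> c u \<noteq> 0) \<and> (u \<notin> S \<and> v \<notin> S \<longrightarrow> c u \<noteq> c v)"
    using D(1) unfolding config_def by (elim exE conjE)
  obtain a where a: "snd D = {(w, a) | w. w \<in> fst D \<and> w \<noteq> a}" using D(2) unfolding is_in_star_def by blast
  define d where "d u = (if u \<in> S then 0 else c u)" for u
  have d: "\<forall>u\<in>fst F. d u < p" using c p by (simp add: d_def)
  have key: "d u \<noteq> d v \<or> (u \<in> S \<and> v \<in> S \<and> \<psi> v = a \<and> \<psi> u \<noteq> a)" if "(u, v) \<in> snd F" for u v
  proof -
    have r: "(u \<in> S \<and> v \<in> S \<longrightarrow> (\<psi> u, \<psi> v) \<in> snd D) \<and> (u \<in> S \<and> v \<notin> S \<longrightarrow> c v \<noteq> 0) \<and>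
        (u \<notin> S \<and> v \<in> S \<longrightarrow> c u \<noteq> 0) \<and> (u \<notin> S \<and> v \<notin> S \<longrightarrow> c u \<noteq> c v)"
      using bspec[OF R that] by simp
    show ?thesis by (cases "u \<in> S"; cases "v \<in> S") (use r a in \<open>auto simp: d_def\<close>)
  qed
  show ?thesis
  proof (cases "\<exists>x\<in>S. \<psi> x = a")
    case True
    then obtain x where x: "x \<in> S" "\<psi> x = a" by blast
    have eq: "u = x" if "u \<in> S" "\<psi> u = a" for u using S(2) x that by (auto dest: inj_onD)
    have "(u \<noteq> x \<and> v \<noteq> x \<longrightarrow> d u \<noteq> d v) \<and> (u = x \<longrightarrow> d v \<noteq> 0)" if "(u, v) \<in> snd F" for u v
    proof -
      have "d x = 0" using x by (simp add: d_def)
      from key[OF that] show ?thesis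
      proof
        assume "d u \<noteq> d v"
        then show ?thesis using \<open>d x = 0\<close> by metis
      next
        assume uv: "u \<in> S \<and> v \<in> S \<and> \<psi> v = a \<and> \<psi> u \<noteq> a"
        then have "v = x" using eq by simp
        moreover have "u \<noteq> x" using uv x(2) by metis
        ultimately show ?thesis by simp
      qed
    qed
    then show ?thesis unfolding in_centre_def using x S d by blast
  next
    case False
    then have "\<forall>(u, v)\<in>snd F. d u \<noteq> d v" using key by blast
    then show ?thesis using chi_not_colourable[OF chi] d by blast
  qed
qed

text \<open>Vertices of a member of the decomposition family that are isolated or unused by the copy of \<open>H\<close>
  could be replaced by padding vertices.\<close>

lemma dec_family_small:
  assumes H: "wf_graph H" and chi: "chi H = p + 1" and M: "M \<in> dec_family H"
  shows "fst M \<subseteq> \<Union> (snd M)" "card (fst M) \<le> card (fst H)"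
proof -
  have wM: "wf_graph M" and dM: "dec_prop H p M"
    and min: "\<And>M0. wf_graph M0 \<Longrightarrow> fst M0 \<subseteq> fst M \<Longrightarrow> snd M0 \<subseteq> snd M \<Longrightarrow> M0 \<noteq> M \<Longrightarrow> \<not> dec_prop H p M0"
    using M chi by (auto simp: dec_family_def)
  obtain t f where f: "inj_on f (fst H)" "f ` fst H \<subseteq> fst (GM M p t)" "\<forall>e\<in>snd H. f ` e \<in> snd (GM M p t)"
    using dM unfolding dec_prop_def contains_def by blast
  have fH: "finite (fst H)" using H by (simp add: wf_graph_def)
  obtain idx :: "_ \<Rightarrow> nat" where idx: "inj_on idx (fst H)" "idx ` fst H = {..<card (fst H)}"
    using ex_bij_betw_finite_nat[OF fH] by (auto simp: bij_betw_def atLeast0LessThan)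
  define h where "h = card (fst H)"
  \<comment> \<open>The vertices of \<open>M\<close> that are used by the copy and lie on an edge of
    \<open>M\<close>. Minimality will show that these are all.\<close>
  define N where "N = {m \<in> \<Union> (snd M). Inl (Inl m) \<in> f ` fst H}"
  define M0 where "M0 = (N, {e \<in> snd M. e \<subseteq> N})"
  \<comment> \<open>A used vertex outside \<open>N\<close> is isolated in \<open>M\<close>, so its
    edges in the copy lead to the multipartite side only, just as for a padding vertex. It is
    replaced by the fresh padding vertex \<open>t + idx x\<close>.\<close>
  define f' where "f' x = (case f x of Inl (Inl m) \<Rightarrow> if m \<in> N then f x else Inl (Inr (t + idx x)) | _ \<Rightarrow> f x)" for x
  have NM: "N \<subseteq> fst M" using wM by (auto simp: N_def wf_graph_def)
  have wM0: "wf_graph M0"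
    using wM finite_subset[OF NM] unfolding wf_graph_def M0_def by fastforce
  have f'v: "f' x \<in> fst (GM M0 p (t + h))" if x: "x \<in> fst H" for x
  proof -
    have v: "f x \<in> fst (GM M p t)" using f(2) x by blast
    have "idx x < h" using idx x by (auto simp: h_def)
    then show ?thesis using v
      by (cases "f x" rule: sum.exhaust; (cases "projl (f x)")?) (auto simp: f'_def GM_vertices M0_def)
  qed
  have "contains (GM M0 p (t + h)) H" unfolding contains_def
  proof (intro exI[of _ f'] conjI)
    show "inj_on f' (fst H)"
    proof (rule inj_onI)
      fix x y assume xy: "x \<in> fst H" "y \<in> fst H" "f' x = f' y"
      have v: "f x \<in> fst (GM M p t)" "f y \<in> fst (GM M p t)" using f(2) xy by blast+
      have cs: "f' z = f z \<or> f' z = Inl (Inr (t + idx z))" for z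
        by (auto simp: f'_def split: sum.splits)
      have ne: "f z \<noteq> Inl (Inr (t + k))" if "f z \<in> fst (GM M p t)" for z k
        using that by (auto simp: GM_vertices)
      consider "f' x = f x" "f' y = f y" | "f' x = Inl (Inr (t + idx x))" "f' y = Inl (Inr (t + idx y))"
        | "f' x = f x" "f' y = Inl (Inr (t + idx y))" | "f' x = Inl (Inr (t + idx x))" "f' y = f y"
        using cs[of x] cs[of y] by blast
      then show "x = y"
      proof cases
        case 1 then show ?thesis using f(1) xy by (auto dest: inj_onD)
      next
        case 2 then show ?thesis using idx(1) xy by (auto dest: inj_onD)
      next
        case 3 then show ?thesis using xy(3) ne[OF v(1), of "idx y"] by simp
      next
        case 4 then show ?thesis using xy(3) ne[OF v(2), of "idx x"] by simp
      qed
    qed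
    show "f' ` fst H \<subseteq> fst (GM M0 p (t + h))" using f'v by auto
    show "\<forall>e\<in>snd H. f' ` e \<in> snd (GM M0 p (t + h))"
    proof
      fix e assume e: "e \<in> snd H"
      then obtain x y where xy: "e = {x, y}" "x \<in> fst H" "y \<in> fst H" using H unfolding wf_graph_def by blast
      have "f ` e \<in> snd (GM M p t)" using f(3) e by blast
      then have "{f x, f y} \<in> snd (GM M p t)" using xy(1) by simp
      then have "{f' x, f' y} \<in> snd (GM M0 p (t + h))"
      proof (cases rule: GM_edge_cases)
        case (1 a b)
        have "f x \<in> f ` fst H" "f y \<in> f ` fst H" using xy(2,3) by blast+
        then have "a \<in> N" "b \<in> N" using 1 unfolding N_def by auto
        then have "f' x = f x" "f' y = f y" "{a, b} \<in> snd M0" using 1 by (auto simp: f'_def M0_def)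
        then show ?thesis using 1 GM_edgeI(1)[of a b M0 p "t + h"] by simp
      next
        case (2 z w)
        then have "\<exists>z'. f' x = Inl z'" and w: "f' y = Inr w" by (auto simp: f'_def split: sum.splits)
        then obtain z' where "f' x = Inl z'" by blast
        then show ?thesis using w f'v[OF xy(2)] f'v[OF xy(3)] GM_edgeI(2)[of z' M0 p "t + h" w] by simp
      next
        case (3 z w)
        then have "\<exists>z'. f' y = Inl z'" and w: "f' x = Inr w" by (auto simp: f'_def split: sum.splits)
        then obtain z' where "f' y = Inl z'" by blast
        then show ?thesis using w f'v[OF xy(2)] f'v[OF xy(3)] GM_edgeI(2)[of z' M0 p "t + h" w] by (simp add: insert_commute)
      next
        case (4 w w')
        then have "f' x = Inr w" "f' y = Inr w'" by (auto simp: f'_def)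
        then show ?thesis using f'v[OF xy(2)] f'v[OF xy(3)] GM_edgeI(3)[of w M0 p "t + h" w'] 4 by simp
      qed
      then show "f' ` e \<in> snd (GM M0 p (t + h))" using xy(1) by simp
    qed
  qed
  then have "dec_prop H p M0" unfolding dec_prop_def by blast
  then have M0: "M0 = M" using min[OF wM0] NM by (auto simp: M0_def)
  have N: "fst M = N" using arg_cong[OF M0, of fst] by (simp add: M0_def)
  then show "fst M \<subseteq> \<Union> (snd M)" by (auto simp: N_def)
  have "card N = card ((\<lambda>m. Inl (Inl m) :: ('a + nat) + nat \<times> nat) ` N)" by (rule card_image[symmetric]) (auto simp: inj_on_def)
  also have "\<dots> \<le> card (f ` fst H)" using fH by (intro card_mono) (auto simp: N_def)
  also have "\<dots> \<le> card (fst H)" using fH by (rule card_image_le)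
  finally show "card (fst M) \<le> card (fst H)" using N by simp
qed

section \<open>Progressive induction\<close>

lemma finite_graph_values: "finite {f (snd G) | G :: nat graph. wf_graph G \<and> fst G = {..<n} \<and> P G}"
proof (rule finite_subset)
  show "{f (snd G) | G :: nat graph. wf_graph G \<and> fst G = {..<n} \<and> P G} \<subseteq> f ` Pow (Pow {..<n})"
  proof clarify
    fix V and E :: "nat set set"
    assume "wf_graph (V, E)" "fst (V, E) = {..<n}"
    then have "E \<subseteq> Pow {..<n}" by (auto simp: wf_graph_def)
    then show "f (snd (V, E)) \<in> f ` Pow (Pow {..<n})" by auto
  qed
qed simp

lemma card_le_ex_num:
  assumes "wf_graph ({..<n}, E)" "\<And>M. M \<in> L \<Longrightarrow> \<not> contains ({..<n}, E) M"
  shows "card E \<le> ex_num n L"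
  unfolding ex_num_def
proof (rule Max_ge)
  show "finite {card (snd G) | G :: nat graph. wf_graph G \<and> fst G = {..<n} \<and> (\<forall>M\<in>L. \<not> contains G M)}"
    by (rule finite_graph_values)
  show "card E \<in> {card (snd G) | G :: nat graph. wf_graph G \<and> fst G = {..<n} \<and> (\<forall>M\<in>L. \<not> contains G M)}"
    using assms by (intro CollectI exI[of _ "({..<n}, E)"]) auto
qed

lemma finite_D_values: "finite {D_graph G Hd | G :: nat graph. wf_graph G \<and> fst G = {..<n}}"
proof (rule finite_subset)
  show "{D_graph G Hd | G :: nat graph. wf_graph G \<and> fst G = {..<n}} \<subseteq> (\<lambda>E. D_graph ({..<n}, E) Hd) ` Pow (Pow {..<n})"
  proof clarify
    fix V and E :: "nat set set"
    assume "wf_graph (V, E)" "fst (V, E) = {..<n}"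
    then have "E \<subseteq> Pow {..<n}" "V = {..<n}" by (auto simp: wf_graph_def)
    then show "D_graph (V, E) Hd \<in> (\<lambda>E. D_graph ({..<n}, E) Hd) ` Pow (Pow {..<n})" by auto
  qed
qed simp

lemma D_num_ge:
  assumes "wf_graph ({..<n}, E)"
  shows "card (Free {..<n} E Hd) \<le> D_num n Hd"
  unfolding D_num_def D_graph_eq_card_Free[OF assms, symmetric]
  by (rule Max_ge[OF finite_D_values]) (use assms in force)

lemma D_num_le:
  assumes "\<And>E. wf_graph ({..<n}, E) \<Longrightarrow> card (Free {..<n} E Hd) \<le> b"
  shows "D_num n Hd \<le> b"
  unfolding D_num_def
proof (rule Max.boundedI[OF finite_D_values])
  have "wf_graph ({..<n :: nat}, {})" by (simp add: wf_graph_def)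
  then show "{D_graph G Hd | G :: nat graph. wf_graph G \<and> fst G = {..<n}} \<noteq> {}" by force
  fix a assume "a \<in> {D_graph G Hd | G :: nat graph. wf_graph G \<and> fst G = {..<n}}"
  then obtain G :: "nat graph" where G: "wf_graph G" "fst G = {..<n}" "a = D_graph G Hd" by blast
  moreover obtain E where "G = ({..<n}, E)" using G(2) by (cases G) auto
  ultimately have "wf_graph ({..<n}, E)" "a = D_graph ({..<n}, E) Hd" by auto
  then show "a \<le> b" using assms D_graph_eq_card_Free by metis
qed

text \<open>No orientation of an \<open>H\<close>-free graph contains an orientation of
  \<open>H\<close>, so an extremal graph has all its \<open>2 ^ ex\<close> orientations free. That
  \<open>H\<close> has an edge makes the empty graph a competitor, so that the maximum is over a
  nonempty set.\<close>

lemma two_power_ex_num_le_D_num: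
  assumes Hd: "is_orientation H Hd" and ne: "snd H \<noteq> {}"
  shows "2 ^ ex_num n {H} \<le> D_num n Hd"
proof -
  let ?S = "{card (snd G) | G :: nat graph. wf_graph G \<and> fst G = {..<n} \<and> (\<forall>M\<in>{H}. \<not> contains G M)}"
  have w: "wf_graph ({..<n :: nat}, {})" by (simp add: wf_graph_def)
  moreover have "\<not> contains ({..<n :: nat}, {}) H" using ne by (auto simp: contains_def)
  ultimately have "?S \<noteq> {}" by force
  then have "ex_num n {H} \<in> ?S" unfolding ex_num_def by (intro Max_in finite_graph_values)
  then obtain V E where VE: "ex_num n {H} = card E" "wf_graph (V, E)" "V = {..<n}" "\<not> contains (V, E) H"
    by auto
  have "emb V E X Hd \<Longrightarrow> contains (V, E) H" for X
  proof (erule embE)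
    fix f assume f: "inj_on f (fst Hd)" "\<And>u. u \<in> fst Hd \<Longrightarrow> f u \<in> V" "\<And>u v. (u, v) \<in> snd Hd \<Longrightarrow> arc E X (f u) (f v)"
    have H: "fst H = fst Hd" "snd H = {{u, v} | u v. (u, v) \<in> snd Hd}"
    proof -
      have "H = und Hd" using Hd by (simp add: is_orientation_def)
      then show "fst H = fst Hd" "snd H = {{u, v} | u v. (u, v) \<in> snd Hd}" by (simp_all add: und_def)
    qed
    show "contains (V, E) H" unfolding contains_def
    proof (intro exI[of _ f] conjI ballI)
      show "inj_on f (fst H)" "f ` fst H \<subseteq> fst (V, E)" using f H by auto
      fix e assume "e \<in> snd H"
      then obtain u v where "e = {u, v}" "(u, v) \<in> snd Hd" using H by auto
      then show "f ` e \<in> snd (V, E)" using f(3) arc_edge by fastforce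
    qed
  qed
  then have "Free V E Hd = Pow E" using VE(4) by (auto simp: Free_def)
  then have "card (Free {..<n} E Hd) = 2 ^ card E" using wf_graph_finite[OF VE(2)] VE(3) by (simp add: card_Pow)
  then show ?thesis using D_num_ge[of n E Hd] VE by simp
qed

text \<open>Each class is viewed as a graph on all of \<open>{..<n}\<close>, with the vertices
  outside it isolated, so that every class obeys the same bound \<open>ex_num n fam\<close>. This is
  the source of the factor \<open>p\<close>.\<close>

lemma card_edges_good:
  fixes fam :: "'b graph set"
  assumes G: "wf_graph (V, E)" and V: "V \<subseteq> {..<n}" and p: "p > 0" and c: "\<forall>v\<in>V. c v < p"
    and good: "\<forall>i<p. \<forall>M\<in>fam. \<not> (\<exists>f. inj_on f (fst M) \<and> (\<forall>e\<in>snd M. f ` e \<in> inside E {v \<in> V. c v = i}))"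
  shows "card E \<le> turan_num (card V) p + p * ex_num n fam"
proof -
  note fin = wf_graph_finite[OF G]
  let ?I = "\<lambda>i. inside E {v \<in> V. c v = i}"
  have fC: "finite (cross V c)" using wf_graph_finite(2)[OF wf_graph_cross[OF fin(1)]] .
  have "E \<subseteq> cross V c \<union> (\<Union>i<p. ?I i)"
  proof
    fix e assume e: "e \<in> E"
    then obtain a b where ab: "e = {a, b}" "a \<in> V" "b \<in> V" using wf_graph_edge[OF G] by metis
    show "e \<in> cross V c \<union> (\<Union>i<p. ?I i)"
    proof (cases "c a = c b")
      case True
      then have "e \<in> ?I (c a)" using ab e by (auto simp: inside_def)
      then show ?thesis using c ab by blast
    next
      case False
      then show ?thesis using ab by (auto simp: cross_def)
    qed
  qed
  then have "card E \<le> card (cross V c \<union> (\<Union>i<p. ?I i))"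
    using fC fin by (intro card_mono) (auto simp: inside_def)
  also have "\<dots> \<le> card (cross V c) + card (\<Union>i<p. ?I i)" by (rule card_Un_le)
  also have "card (cross V c) \<le> turan_num (card V) p" by (rule card_cross_le_turan) (use fin p c in auto)
  also have "card (\<Union>i<p. ?I i) \<le> (\<Sum>i<p. card (?I i))" by (rule card_UN_le) simp
  also have "\<dots> \<le> (\<Sum>i<p. ex_num n fam)"
  proof (rule sum_mono)
    fix i assume i: "i \<in> {..<p}"
    show "card (?I i) \<le> ex_num n fam"
    proof (rule card_le_ex_num)
      show "wf_graph ({..<n}, ?I i)" using G V unfolding wf_graph_def inside_def by fastforce
      show "\<not> contains ({..<n}, ?I i) M" if "M \<in> fam" for M
        using good i that unfolding contains_def by fastforce
    qed
  qed
  finally show ?thesis by simp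
qed

text \<open>Simonovits' progressive induction: as long as the bound fails for a graph that is not already good,
  deleting at most \<open>K\<close> vertices doubles the excess, which cannot go on for long.\<close>

lemma progressive_bound:
  fixes fam :: "'b graph set" and F :: "'c dgraph"
  assumes p: "p > 0"
    and step: "\<And>V E. wf_graph (V, E) \<Longrightarrow> n0 \<le> card V \<Longrightarrow> 2 ^ turan_num (card V) p < card (Free V E F) \<Longrightarrow> \<not> gains V E F p K \<Longrightarrow>
     \<exists>c. (\<forall>v\<in>V. c v < p) \<and> (\<forall>i<p. \<forall>M\<in>fam. \<not> (\<exists>f. inj_on f (fst M) \<and> (\<forall>e\<in>snd M. f ` e \<in> inside E {v \<in> V. c v = i})))"
    and G: "wf_graph (V, E)" and V: "V \<subseteq> {..<n}"
  shows "card (Free V E F) \<le> 2 ^ (turan_num (card V) p + p * ex_num n fam + (n0\<^sup>2 + n0 - card V div (K + 1)))"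
  using G V
proof (induction "card V" arbitrary: V E rule: less_induct)
  case less
  note G = less.prems(1) and V = less.prems(2)
  note fin = wf_graph_finite[OF G]
  \<comment> \<open>\<open>n\<close> stays fixed while \<open>V\<close> shrinks inside
    \<open>{..<n}\<close>, so this term is the same at every stage. In \<open>?C\<close>,
    \<open>n0 ^ 2\<close> pays for all edges of a graph on fewer than \<open>n0\<close> vertices,
    and \<open>n0\<close> for the quotient that is subtracted.\<close>
  let ?X = "p * ex_num n fam" and ?C = "n0\<^sup>2 + n0" and ?m = "card V"
  let ?goal = "turan_num ?m p + ?X + (?C - ?m div (K + 1))"
  consider "?m < n0" | "card (Free V E F) \<le> 2 ^ turan_num ?m p"
    | "n0 \<le> ?m" "2 ^ turan_num ?m p < card (Free V E F)" "\<not> gains V E F p K" | "gains V E F p K" by linarith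
  then show ?case
  proof cases
    case 1
    have "card E \<le> ?m * ?m" by (rule card_edges_le[OF G])
    also have "\<dots> \<le> n0\<^sup>2" using 1 by (simp add: power2_eq_square mult_le_mono)
    finally have E: "card E \<le> n0\<^sup>2" .
    have "?m div (K + 1) \<le> ?m" by (rule div_le_dividend)
    then have "card E \<le> ?goal" using E 1 by linarith
    then have "(2::nat) ^ card E \<le> 2 ^ ?goal" by (intro power_increasing) auto
    then show ?thesis using card_Free_le[OF fin(2), of V F] by linarith
  next
    case 2
    have "(2::nat) ^ turan_num ?m p \<le> 2 ^ ?goal" by (intro power_increasing) auto
    then show ?thesis using 2 by linarith
  next
    case 3
    then obtain c where "\<forall>v\<in>V. c v < p" "\<forall>i<p. \<forall>M\<in>fam. \<not> (\<exists>f. inj_on f (fst M) \<and> (\<forall>e\<in>snd M. f ` e \<in> inside E {v \<in> V. c v = i}))"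
      using step[OF G] by blast
    then have "card E \<le> turan_num ?m p + ?X" by (rule card_edges_good[OF G V p])
    then have "(2::nat) ^ card E \<le> 2 ^ ?goal" by (intro power_increasing) auto
    then show ?thesis using card_Free_le[OF fin(2), of V F] by linarith
  next
    case 4
    then obtain Z where Z: "Z \<subseteq> V" "Z \<noteq> {}" "card Z \<le> K"
      and g: "2 * card (Free V E F) * 2 ^ turan_num (?m - card Z) p \<le> card (Free (V - Z) (inside E (V - Z)) F) * 2 ^ turan_num ?m p"
      unfolding gains_def by blast
    have fZ: "finite Z" using Z fin finite_subset by blast
    have z: "card Z > 0" "card Z \<le> ?m" using Z fZ fin by (auto simp: card_gt_0_iff card_mono)
    have cVZ: "card (V - Z) = ?m - card Z" using Z fZ by (simp add: card_Diff_subset)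
    let ?e = "?C - (?m - card Z) div (K + 1)"
    have "card (Free (V - Z) (inside E (V - Z)) F) \<le> 2 ^ (turan_num (card (V - Z)) p + ?X + (?C - card (V - Z) div (K + 1)))"
    proof (rule less.hyps)
      show "card (V - Z) < card V" using cVZ z by linarith
      show "wf_graph (V - Z, inside E (V - Z))" by (rule wf_graph_inside[OF G]) auto
    qed (use V in auto)
    then have "2 * card (Free V E F) * 2 ^ turan_num (?m - card Z) p \<le> 2 ^ (turan_num (?m - card Z) p + ?X + ?e) * 2 ^ turan_num ?m p"
      using g unfolding cVZ by (meson le_trans mult_le_mono1)
    also have "\<dots> = 2 ^ (turan_num ?m p + ?X + ?e) * 2 ^ turan_num (?m - card Z) p"
      by (simp add: power_add)
    finally have "2 * card (Free V E F) \<le> 2 ^ (turan_num ?m p + ?X + ?e)" by simp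
    also have "\<dots> \<le> 2 ^ (?goal + 1)"
    proof (rule power_increasing)
      \<comment> \<open>At most \<open>K\<close> vertices are deleted, so the quotient drops by at
        most 1. The factor 2 of the gain compensates exactly this, also when the subtraction is
        truncated at 0.\<close>
      have "?m div (K + 1) \<le> (?m - card Z + (K + 1)) div (K + 1)" using Z(3) by (intro div_le_mono) linarith
      also have "\<dots> = (?m - card Z) div (K + 1) + 1" by (rule div_add_self2) simp
      finally show "turan_num ?m p + ?X + ?e \<le> ?goal + 1" by linarith
    qed simp
    finally show ?thesis by simp
  qed
qed

theorem mainTheorem1:
  fixes H :: "'a graph" and Hd :: "'a dgraph" and p t :: nat
  assumes "wf_graph H"
    and "chi H = p + 1" and "p + 1 \<ge> 3"
    and "t \<ge> 1"
    and "\<exists>M\<in>dec_family H. is_star M t"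
    and "is_orientation H Hd"
    and "\<exists>D\<in>dir_dec_family Hd. is_in_star D t"
    and "\<exists>D\<in>dir_dec_family Hd. is_out_star D t"
  shows "\<exists>N. \<forall>n\<ge>N. 2 ^ ex_num n {H} \<le> D_num n Hd \<and>
           D_num n Hd \<le> 2 ^ (turan_num n p + p * ex_num n (dec_family_prime Hd))"
proof -
  have p: "p > 0" "p \<ge> 2" using assms(3) by auto
  have Hd: "wf_dgraph Hd" and und: "und Hd = H" using assms(6) by (auto simp: is_orientation_def)
  have chi: "chi (und Hd) = p + 1" using assms(2) und by simp
  obtain DI DO where DI: "DI \<in> dir_dec_family Hd" "is_in_star DI t" and DO: "DO \<in> dir_dec_family Hd" "is_out_star DO t"
    using assms(7,8) by blast
  note cfg = dir_dec_config[OF Hd chi p(1)]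
  have o: "out_centre Hd p" by (rule config_out_centre[OF cfg[OF DO(1)] DO(2) chi p(1)])
  have i: "in_centre Hd p" by (rule config_in_centre[OF cfg[OF DI(1)] DI(2) chi p(1)])
  \<comment> \<open>An edgeless graph would be colourable with a single colour.\<close>
  have ne: "snd H \<noteq> {}"
  proof
    assume "snd H = {}"
    then have "snd Hd = {}" using und by (auto simp: und_def)
    then have "\<exists>c. (\<forall>u\<in>fst Hd. c u < p) \<and> (\<forall>(u, v)\<in>snd Hd. c u \<noteq> c v)"
      using p by (intro exI[of _ "\<lambda>_. 0"]) simp
    then show False using chi_not_colourable[OF chi] by blast
  qed
  have fam: "forcing Hd p (card (fst H)) M" if M: "M \<in> dec_family_prime Hd" for M
  proof -
    have dM: "M \<in> dec_family H" and or: "\<And>D. is_orientation M D \<Longrightarrow> D \<in> dir_dec_family Hd"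
      using M und by (auto simp: dec_family_prime_def)
    have wM: "wf_graph M" using dM by (simp add: dec_family_def)
    have "fst M \<noteq> {}"
    proof
      assume e: "fst M = {}"
      then have "snd M = {}" using wM by (auto simp: wf_graph_def)
      then have "is_orientation M ({}, {})" using e by (simp add: is_orientation_def wf_dgraph_def und_def prod_eq_iff)
      then show False using config_nonempty[OF cfg[OF or] chi] by fastforce
    qed
    then show ?thesis using dec_family_small[OF assms(1,2) dM] wM cfg[OF or] by (simp add: forcing_def)
  qed
  show ?thesis
  proof (rule final_structure[OF Hd p(2) assms(4) o i DO(2) cfg[OF DO(1)] DI(2) cfg[OF DI(1)] fam])
    fix K n0
    assume step: "\<And>V E. wf_graph (V, E) \<Longrightarrow> n0 \<le> card V \<Longrightarrow> 2 ^ turan_num (card V) p < card (Free V E Hd) \<Longrightarrow> \<not> gains V E Hd p K \<Longrightarrow>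
     \<exists>c. (\<forall>v\<in>V. c v < p) \<and> (\<forall>i<p. \<forall>M\<in>dec_family_prime Hd. \<not> (\<exists>f. inj_on f (fst M) \<and> (\<forall>e\<in>snd M. f ` e \<in> inside E {v \<in> V. c v = i})))"
  \<comment> \<open>From this order on the truncated difference in the progressive bound is 0, and
    the exact exponent remains.\<close>
  define N where "N = (n0\<^sup>2 + n0) * (K + 1)"
  have "D_num n Hd \<le> 2 ^ (turan_num n p + p * ex_num n (dec_family_prime Hd))" if n: "n \<ge> N" for n
  proof (rule D_num_le)
    fix E :: "nat set set" assume G: "wf_graph ({..<n}, E)"
    have "N div (K + 1) \<le> n div (K + 1)" using n by (rule div_le_mono)
    moreover have "N div (K + 1) = n0\<^sup>2 + n0" unfolding N_def by (rule nonzero_mult_div_cancel_right) simp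
    ultimately have z: "n0\<^sup>2 + n0 - n div (K + 1) = 0" by linarith
    have "card (Free {..<n} E Hd) \<le> 2 ^ (turan_num (card {..<n}) p + p * ex_num n (dec_family_prime Hd) + (n0\<^sup>2 + n0 - card {..<n} div (K + 1)))"
      by (rule progressive_bound[OF p(1) step G subset_refl])
    then show "card (Free {..<n} E Hd) \<le> 2 ^ (turan_num n p + p * ex_num n (dec_family_prime Hd))"
      using z by simp
  qed
  moreover have "2 ^ ex_num n {H} \<le> D_num n Hd" for n
    by (rule two_power_ex_num_le_D_num[OF assms(6) ne])
  ultimately show ?thesis by blast
  qed
qed

end
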